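(* The equivalence $K\colon\mathrm{ShMulti}_{lr}\to\mathrm{SkMon}_{ln}$ between left representable short multicategories and left normal skew monoidal categories (defined in the context) restricts to an equivalence $K^{cl}_{rep}\colon\mathrm{ShMulti}^{cl}_{rep}\to\mathrm{Mon}^{cl}$ between representable closed short multicategories and closed monoidal categories, which fits in a commutative triangle of equivalences $T^{cl}_{rep}=K^{cl}_{rep}\circ U^{cl}_{rep}$, where $U^{cl}_{rep}\colon\mathrm{Multi}^{cl}_{rep}\to\mathrm{ShMulti}^{cl}_{rep}$ is the forgetful functor and $T^{cl}_{rep}\colon\mathrm{Multi}^{cl}_{rep}\to\mathrm{Mon}^{cl}$ is the known equivalence between representable closed multicategories and closed monoidal categories.
   Context: **Short multicategories.** A short multicategory $\mathbb C$ consists of a category $\mathcal C$; for $0\le n\le 4$ a functor $\mathbb C_n(-;-)\colon(\mathcal C^n)^{op}\times\mathcal C\to\mathrm{Set}$ (elements of $\mathbb C_n(a_1,\dots,a_n;b)$ are called $n$-ary maps), with $\mathbb C_1(-;-)=\mathcal C(-,-)$; one writes $q\circ f$ and $f\circ_i p$ for the functorial action of a unary map $q$ on the codomain and of a unary map $p$ on the $i$-th input. Furthermore there are substitution functions $\circ_i\colon\mathbb C_n(\bar b;c)\times\mathbb C_m(\bar a;b_i)\to\mathbb C_{n+m-1}(\bar b_{<i},\bar a,\bar b_{>i};c)$ for $1\le i\le n$ and $(n,m)\in\{(2,2),(3,2),(2,3),(2,0),(3,0)\}$, natural in all $a_k$, all $b_k$ with $k\ne i$, and $c$, and dinatural in $b_i$.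 For $f$ binary, $g$ $n$-ary and $h$ $p$-ary, one requires: (A) $f\circ_i(g\circ_j h)=(f\circ_i g)\circ_{j+i-1}h$ for $1\le i\le 2$, $1\le j\le n$, when $(n,p)\in\{(2,2),(2,0)\}$; (B) $(f\circ_1 g)\circ_{n+1}h=(f\circ_2 h)\circ_1 g$ when $(n,p)\in\{(2,2),(2,0),(0,2),(0,0)\}$. A morphism $F\colon\mathbb C\to\mathbb D$ is a functor $F\colon\mathcal C\to\mathcal D$ with natural families $F_n\colon\mathbb C_n(\bar a;b)\to\mathbb D_n(F\bar a;Fb)$, $0\le n\le4$, $F_1$ being the functor action, commuting with all substitutions $\circ_i$. **Representability and closedness (short).** A short multicategory is left representable if there are binary maps $\theta_{a,b}\colon a,b\to ab$ (for all $a,b$) and a nullary map $u\in\mathbb C_0(\,;i)$ such that $-\circ_1\theta_{a,b}\colon\mathbb C_n(ab,\bar x;d)\to\mathbb C_{n+1}(a,b,\bar x;d)$ is bijective for $n=1,2,3$ and $-\circ_1u\colon\mathbb C_{n+1}(i,\bar x;d)\to\mathbb C_n(\bar x;d)$ is bijective for $n=0,1,2$. It is representable if there are such $\theta_{a,b}$ and $u$ for which all maps $-\circ_j u\colon\mathbb C_n(\bar x,i,\bar y;z)\to\mathbb C_{n-1}(\bar x,\bar y;z)$ and $-\circ_j\theta_{a,b}\colon\mathbb C_n(\bar x,ab,\bar y;z)\to\mathbb C_{n+1}(\bar x,a,b,\bar y;z)$ are bijective, for $1\le n\le3$, $|\bar x|+|\bar y|=n-1$, $j=|\bar x|+1$.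 It is closed if for all $b,c$ there are an object $[b,c]$ and a binary map $e_{b,c}\colon[b,c],b\to c$ such that $e_{b,c}\circ_1-\colon\mathbb C_n(\bar x;[b,c])\to\mathbb C_{n+1}(\bar x,b;c)$ is bijective for $n=0,1,2,3$. $\mathrm{ShMulti}_{lr}$ and $\mathrm{ShMulti}^{cl}_{rep}$ are the full subcategories of short multicategories that are left representable, resp. representable and closed. **Multicategories.** $\mathrm{Multi}^{cl}_{rep}$ is the category of representable closed multicategories (non-symmetric) and multifunctors. Representable: for each list $\bar a$ of length $n\ge0$ there is a multimap $\theta_{\bar a}\colon\bar a\to m\bar a$ such that substitution with $\theta_{\bar a}$ gives bijections $\mathbb C_{k+1}(\bar x,m\bar a,\bar y;b)\to\mathbb C_{k+n}(\bar x,\bar a,\bar y;b)$ for all $\bar x,\bar y,b$ with $|\bar x|+|\bar y|=k$. Closed: for all $b,c$ there are an object $[b,c]$ and a binary map $e_{b,c}\colon[b,c],b\to c$ such that $e_{b,c}\circ_1-\colon\mathbb C_n(\bar x;[b,c])\to\mathbb C_{n+1}(\bar x,b;c)$ is bijective for all $n\ge0$. $U^{cl}_{rep}$ keeps the category of unary maps, the $n$-ary maps for $n\le4$, and the substitutions of $m$-ary maps into $n$-ary maps for $(n,m)\in\{(2,2),(3,2),(2,3),(2,0),(3,0)\}$, and forgets the rest. **Skew monoidal categories.** A (left) skew monoidal category is a category $\mathcal C$ with a functor $(a,b)\mapsto ab$, $\mathcal C\times\mathcal C\to\mathcal C$, an object $i$, and natural families $\alpha_{a,b,c}\colon(ab)c\to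 a(bc)$, $\lambda_a\colon ia\to a$, $\rho_a\colon a\to ai$ (not necessarily invertible) satisfying $\alpha_{a,b,cd}\alpha_{ab,c,d}=(a\,\alpha_{b,c,d})\alpha_{a,bc,d}(\alpha_{a,b,c}\,d)$, $\lambda_{ab}\alpha_{i,a,b}=\lambda_a b$, $\alpha_{a,b,i}\rho_{ab}=a\rho_b$, $(a\lambda_b)\alpha_{a,i,b}(\rho_a b)=1_{ab}$, $\lambda_i\rho_i=1_i$. It is left normal if $\lambda$ is invertible, a monoidal category if $\alpha,\lambda,\rho$ are all invertible, and closed if each functor $-\otimes b\colon a\mapsto ab$ has a right adjoint $[b,-]$. A lax monoidal functor is a functor $F$ with a map $f_0\colon i\to Fi$ and a natural family $f_2\colon FaFb\to F(ab)$ such that $F\alpha\circ f_2\circ(f_2\cdot Fc)=f_2\circ(Fa\cdot f_2)\circ\alpha$, $F\lambda\circ f_2\circ(f_0\cdot Fa)=\lambda$, $f_2\circ(Fa\cdot f_0)\circ\rho=F\rho$. $\mathrm{SkMon}_{ln}$ (resp. $\mathrm{Mon}^{cl}$) is the category of left normal skew monoidal (resp. closed monoidal) categories and lax monoidal functors. **The functors $K$ and $T^{cl}_{rep}$.** For each left representable short multicategory fix a choice of binary maps $\theta_{a,b}\colon a,b\to ab$ (for all $a,b$) and of a nullary map $u\in\mathbb C_0(\,;i)$ such that $-\circ_1\theta_{a,b}\colon\mathbb C_n(ab,\bar x;d)\to\mathbb C_{n+1}(a,b,\bar x;d)$ is bijective for $n=1,2,3$ and $-\circ_1u\colon\mathbb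 C_{n+1}(i,\bar x;d)\to\mathbb C_n(\bar x;d)$ is bijective for $n=0,1,2$. $K\mathbb C$ has underlying category $\mathcal C$, tensor $ab$, unit $i$; for $f\colon a\to b$, $g\colon c\to d$, $fg\colon ac\to bd$ is the unique map with $(fg)\circ\theta_{a,c}=(\theta_{b,d}\circ_1f)\circ_2g$; $\alpha$ is the unique map with $(\alpha\circ\theta_{ab,c})\circ_1\theta_{a,b}=\theta_{a,bc}\circ_2\theta_{b,c}$; $\lambda_a$ is the unique map with $(\lambda_a\circ\theta_{i,a})\circ_1u=1_a$; $\rho_a=\theta_{a,i}\circ_2u$. On a morphism $F$, $KF=(F,f_0,f_2)$ where $f_2$ is the unique map with $f_2\circ\theta_{Fa,Fb}=F_2(\theta_{a,b})$ and $f_0$ the unique map with $f_0\circ u=F_0(u)$. $T^{cl}_{rep}$ is given by the same formulas in a representable closed multicategory (with the same choices of binary and nullary classifiers); it is known to be an equivalence. *)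

theory Defs
  imports "HOL-Library.FuncSet"
begin

text \<open>
  Conventions. Objects and maps live in types \<open>'o\<close> and \<open>'m\<close>. Hom-sets are families of sets indexed
  by their objects and are \<^emph>\<open>not\<close> assumed disjoint, so every operation on maps takes the objects
  involved as arguments: \<open>Cmp C a b c g f\<close> is the composite of \<open>f : a \<rightarrow> b\<close> and \<open>g : b \<rightarrow> c\<close>.
  Functions between carriers that serve as morphisms of structures are required to be
  \<open>extensional\<close>, so that equality of morphisms is equality in HOL.
\<close>

section \<open>Categories\<close>

record ('o, 'm) cat =
  Obj :: "'o set"
  Hom :: "'o \<Rightarrow> 'o \<Rightarrow> 'm set"
  Idm :: "'o \<Rightarrow> 'm"
  Cmp :: "'o \<Rightarrow> 'o \<Rightarrow> 'o \<Rightarrow> 'm \<Rightarrow> 'm \<Rightarrow> 'm"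

locale category =
  fixes C :: "('o, 'm, 'x) cat_scheme"
  assumes idm_hom: "a \<in> Obj C \<Longrightarrow> Idm C a \<in> Hom C a a"
    and cmp_hom: "\<lbrakk>a \<in> Obj C; b \<in> Obj C; c \<in> Obj C; f \<in> Hom C a b; g \<in> Hom C b c\<rbrakk>
      \<Longrightarrow> Cmp C a b c g f \<in> Hom C a c"
    and cmp_id_left: "\<lbrakk>a \<in> Obj C; b \<in> Obj C; f \<in> Hom C a b\<rbrakk> \<Longrightarrow> Cmp C a b b (Idm C b) f = f"
    and cmp_id_right: "\<lbrakk>a \<in> Obj C; b \<in> Obj C; f \<in> Hom C a b\<rbrakk> \<Longrightarrow> Cmp C a a b f (Idm C a) = f"
    and cmp_assoc: "\<lbrakk>a \<in> Obj C; b \<in> Obj C; c \<in> Obj C; d \<in> Obj C;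
        f \<in> Hom C a b; g \<in> Hom C b c; h \<in> Hom C c d\<rbrakk>
      \<Longrightarrow> Cmp C a b d (Cmp C b c d h g) f = Cmp C a c d h (Cmp C a b c g f)"

definition iso_map :: "('o, 'm, 'x) cat_scheme \<Rightarrow> 'o \<Rightarrow> 'o \<Rightarrow> 'm \<Rightarrow> bool" where
  "iso_map C a b f \<longleftrightarrow> f \<in> Hom C a b \<and>
     (\<exists>g \<in> Hom C b a. Cmp C a b a g f = Idm C a \<and> Cmp C b a b f g = Idm C b)"

definition full_sub :: "('o, 'm) cat \<Rightarrow> 'o set \<Rightarrow> ('o, 'm) cat" where
  "full_sub A S = A\<lparr>Obj := Obj A \<inter> S\<rparr>"

definition full_subcategory :: "('o, 'm) cat \<Rightarrow> ('o, 'm) cat \<Rightarrow> bool" where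
  "full_subcategory B A \<longleftrightarrow> Obj B \<subseteq> Obj A
     \<and> (\<forall>a \<in> Obj B. Idm B a = Idm A a)
     \<and> (\<forall>a \<in> Obj B. \<forall>b \<in> Obj B. Hom B a b = Hom A a b)
     \<and> (\<forall>a \<in> Obj B. \<forall>b \<in> Obj B. \<forall>c \<in> Obj B. \<forall>f \<in> Hom B a b. \<forall>g \<in> Hom B b c.
          Cmp B a b c g f = Cmp A a b c g f)"

definition prod_cat :: "('o, 'm, 'x) cat_scheme \<Rightarrow> ('p, 'n, 'y) cat_scheme \<Rightarrow> ('o \<times> 'p, 'm \<times> 'n) cat" where
  "prod_cat A B = \<lparr>
     Obj = Obj A \<times> Obj B,
     Hom = (\<lambda>a b. Hom A (fst a) (fst b) \<times> Hom B (snd a) (snd b)),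
     Idm = (\<lambda>a. (Idm A (fst a), Idm B (snd a))),
     Cmp = (\<lambda>a b c g f. (Cmp A (fst a) (fst b) (fst c) (fst g) (fst f),
                         Cmp B (snd a) (snd b) (snd c) (snd g) (snd f)))\<rparr>"

record ('o, 'm, 'p, 'n) func =
  fOb :: "'o \<Rightarrow> 'p"
  fMap :: "'o \<Rightarrow> 'o \<Rightarrow> 'm \<Rightarrow> 'n"

locale is_functor = A: category A + B: category B
  for A :: "('o, 'm, 'x) cat_scheme" and B :: "('p, 'n, 'y) cat_scheme" +
  fixes F :: "('o, 'm, 'p, 'n, 'z) func_scheme"
  assumes functor_obj: "a \<in> Obj A \<Longrightarrow> fOb F a \<in> Obj B"
    and functor_hom: "\<lbrakk>a \<in> Obj A; b \<in> Obj A; f \<in> Hom A a b\<rbrakk>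
      \<Longrightarrow> fMap F a b f \<in> Hom B (fOb F a) (fOb F b)"
    and functor_id: "a \<in> Obj A \<Longrightarrow> fMap F a a (Idm A a) = Idm B (fOb F a)"
    and functor_cmp: "\<lbrakk>a \<in> Obj A; b \<in> Obj A; c \<in> Obj A; f \<in> Hom A a b; g \<in> Hom A b c\<rbrakk>
      \<Longrightarrow> fMap F a c (Cmp A a b c g f)
        = Cmp B (fOb F a) (fOb F b) (fOb F c) (fMap F b c g) (fMap F a b f)"

definition func_id :: "('o, 'm, 'o, 'm) func" where
  "func_id = \<lparr>fOb = (\<lambda>a. a), fMap = (\<lambda>a b f. f)\<rparr>"

definition func_comp :: "('p, 'n, 'q, 'k) func \<Rightarrow> ('o, 'm, 'p, 'n) func \<Rightarrow> ('o, 'm, 'q, 'k) func" where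
  "func_comp G F = \<lparr>fOb = (\<lambda>a. fOb G (fOb F a)),
     fMap = (\<lambda>a b f. fMap G (fOb F a) (fOb F b) (fMap F a b f))\<rparr>"

definition func_eq :: "('o, 'm) cat \<Rightarrow> ('o, 'm, 'p, 'n) func \<Rightarrow> ('o, 'm, 'p, 'n) func \<Rightarrow> bool" where
  "func_eq A F G \<longleftrightarrow> (\<forall>a \<in> Obj A. fOb F a = fOb G a)
     \<and> (\<forall>a \<in> Obj A. \<forall>b \<in> Obj A. \<forall>f \<in> Hom A a b. fMap F a b f = fMap G a b f)"

definition natural_iso ::
  "('o, 'm) cat \<Rightarrow> ('p, 'n) cat \<Rightarrow> ('o, 'm, 'p, 'n) func \<Rightarrow> ('o, 'm, 'p, 'n) func \<Rightarrow> ('o \<Rightarrow> 'n) \<Rightarrow> bool" where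
  "natural_iso A B F G \<eta> \<longleftrightarrow>
     is_functor A B F \<and> is_functor A B G
     \<and> (\<forall>a \<in> Obj A. iso_map B (fOb F a) (fOb G a) (\<eta> a))
     \<and> (\<forall>a \<in> Obj A. \<forall>b \<in> Obj A. \<forall>f \<in> Hom A a b.
          Cmp B (fOb F a) (fOb F b) (fOb G b) (\<eta> b) (fMap F a b f)
        = Cmp B (fOb F a) (fOb G a) (fOb G b) (fMap G a b f) (\<eta> a))"

definition equivalence :: "('o, 'm) cat \<Rightarrow> ('p, 'n) cat \<Rightarrow> ('o, 'm, 'p, 'n) func \<Rightarrow> bool" where
  "equivalence A B F \<longleftrightarrow> is_functor A B F \<and>
     (\<exists>G \<eta> \<epsilon>. is_functor B A G
        \<and> natural_iso A A func_id (func_comp G F) \<eta>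
        \<and> natural_iso B B (func_comp F G) func_id \<epsilon>)"

definition right_adjoint ::
  "('o, 'm, 'x) cat_scheme \<Rightarrow> ('p, 'n, 'y) cat_scheme \<Rightarrow> ('o, 'm, 'p, 'n) func \<Rightarrow> ('p, 'n, 'o, 'm) func \<Rightarrow> bool"
  where
  "right_adjoint A B F G \<longleftrightarrow> is_functor A B F \<and> is_functor B A G \<and>
     (\<exists>\<phi>. (\<forall>a \<in> Obj A. \<forall>b \<in> Obj B. bij_betw (\<phi> a b) (Hom B (fOb F a) b) (Hom A a (fOb G b)))
       \<and> (\<forall>a \<in> Obj A. \<forall>a' \<in> Obj A. \<forall>b \<in> Obj B. \<forall>b' \<in> Obj B.
            \<forall>p \<in> Hom A a' a. \<forall>q \<in> Hom B b b'. \<forall>f \<in> Hom B (fOb F a) b.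
              \<phi> a' b' (Cmp B (fOb F a') b b' q (Cmp B (fOb F a') (fOb F a) b f (fMap F a' a p)))
            = Cmp A a' (fOb G b) (fOb G b') (fMap G b b' q) (Cmp A a' a (fOb G b) (\<phi> a b f) p)))"


section \<open>Short multicategories\<close>

text \<open>
  The operations \<open>\<circ>\<^sub>i\<close> are indexed by splitting the list of inputs rather than by a number:
  for \<open>f \<in> C(xs @ b # ys; c)\<close> and \<open>g \<in> C(as; b)\<close>, the substitution \<open>f \<circ>\<^sub>i g\<close> with \<open>i = length xs + 1\<close>
  is written \<open>S xs b ys as c f g\<close>, an element of \<open>C(xs @ as @ ys; c)\<close>.
\<close>

type_synonym ('o, 'm) subst = "'o list \<Rightarrow> 'o \<Rightarrow> 'o list \<Rightarrow> 'o list \<Rightarrow> 'o \<Rightarrow> 'm \<Rightarrow> 'm \<Rightarrow> 'm"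

text \<open>
  \<open>Act C as b as' b' ps q f\<close> is the action of the functor \<open>C\<^sub>n(-;-)\<close> on \<open>(ps, q) : (as, b) \<rightarrow> (as', b')\<close>,
  where \<open>ps ! k : as' ! k \<rightarrow> as ! k\<close> and \<open>q : b \<rightarrow> b'\<close>, applied to \<open>f \<in> C(as; b)\<close>.
\<close>

record ('o, 'm) shmulti = "('o, 'm) cat" +
  Mul :: "'o list \<Rightarrow> 'o \<Rightarrow> 'm set"
  Act :: "'o list \<Rightarrow> 'o \<Rightarrow> 'o list \<Rightarrow> 'o \<Rightarrow> 'm list \<Rightarrow> 'm \<Rightarrow> 'm \<Rightarrow> 'm"
  Sub :: "('o, 'm) subst"

text \<open>The category \<open>\<C>\<^sup>n\<close>, with objects and maps given as lists.\<close>

definition Homs :: "('o, 'm, 'x) cat_scheme \<Rightarrow> 'o list \<Rightarrow> 'o list \<Rightarrow> 'm list set" where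
  "Homs C as bs = {ps. length ps = length as \<and> length ps = length bs
                       \<and> (\<forall>k < length ps. ps ! k \<in> Hom C (as ! k) (bs ! k))}"

definition Idms :: "('o, 'm, 'x) cat_scheme \<Rightarrow> 'o list \<Rightarrow> 'm list" where
  "Idms C as = map (Idm C) as"

definition Cmps :: "('o, 'm, 'x) cat_scheme \<Rightarrow> 'o list \<Rightarrow> 'o list \<Rightarrow> 'o list \<Rightarrow> 'm list \<Rightarrow> 'm list \<Rightarrow> 'm list" where
  "Cmps C as bs cs qs ps
     = map (\<lambda>k. Cmp C (as ! k) (bs ! k) (cs ! k) (qs ! k) (ps ! k)) [0..<length ps]"

text \<open>The pairs \<open>(n, m)\<close> for which \<open>m\<close>-ary maps may be substituted into \<open>n\<close>-ary maps.\<close>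

definition sub_arities :: "(nat \<times> nat) set" where
  "sub_arities = {(2,2), (3,2), (2,3), (2,0), (3,0)}"

text \<open>
  The symbol \<open>\<circ>\<^sub>i\<close> in its overloaded use: precomposition \<open>f \<circ>\<^sub>i p\<close> with a unary map \<open>p\<close>,
  postcomposition \<open>q \<circ> f\<close> with a unary map \<open>q\<close>, and substitution otherwise. If both maps are unary,
  this is composition in \<open>\<C>\<close>.
\<close>

definition gsub :: "('o, 'm) shmulti \<Rightarrow> ('o, 'm) subst" where
  "gsub C xs b ys as c f g =
     (if length as = 1
        then Act C (xs @ b # ys) c (xs @ as @ ys) c (Idms C xs @ g # Idms C ys) (Idm C c) f
      else if xs = [] \<and> ys = []
        then Act C as b as c (Idms C as) f g
      else Sub C xs b ys as c f g)"

locale short_multicategory = category C for C :: "('o, 'm) shmulti" +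
  assumes mul_unary: "\<lbrakk>a \<in> Obj C; b \<in> Obj C\<rbrakk> \<Longrightarrow> Mul C [a] b = Hom C a b"
    and act_unary: "\<lbrakk>a \<in> Obj C; b \<in> Obj C; a' \<in> Obj C; b' \<in> Obj C;
        p \<in> Hom C a' a; q \<in> Hom C b b'; f \<in> Hom C a b\<rbrakk>
      \<Longrightarrow> Act C [a] b [a'] b' [p] q f = Cmp C a' b b' q (Cmp C a' a b f p)"
    and act_mul: "\<lbrakk>as \<in> lists (Obj C); as' \<in> lists (Obj C); b \<in> Obj C; b' \<in> Obj C; length as \<le> 4;
        ps \<in> Homs C as' as; q \<in> Hom C b b'; f \<in> Mul C as b\<rbrakk>
      \<Longrightarrow> Act C as b as' b' ps q f \<in> Mul C as' b'"
    and act_id: "\<lbrakk>as \<in> lists (Obj C); b \<in> Obj C; length as \<le> 4; f \<in> Mul C as b\<rbrakk>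
      \<Longrightarrow> Act C as b as b (Idms C as) (Idm C b) f = f"
    and act_cmp: "\<lbrakk>as \<in> lists (Obj C); as' \<in> lists (Obj C); as'' \<in> lists (Obj C);
        b \<in> Obj C; b' \<in> Obj C; b'' \<in> Obj C; length as \<le> 4;
        ps \<in> Homs C as' as; ps' \<in> Homs C as'' as'; q \<in> Hom C b b'; q' \<in> Hom C b' b''; f \<in> Mul C as b\<rbrakk>
      \<Longrightarrow> Act C as b as'' b'' (Cmps C as'' as' as ps ps') (Cmp C b b' b'' q' q) f
        = Act C as' b' as'' b'' ps' q' (Act C as b as' b' ps q f)"
    and sub_mul: "\<lbrakk>(length xs + 1 + length ys, length as) \<in> sub_arities;
        xs \<in> lists (Obj C); b \<in> Obj C; ys \<in> lists (Obj C); as \<in> lists (Obj C); c \<in> Obj C;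
        f \<in> Mul C (xs @ b # ys) c; g \<in> Mul C as b\<rbrakk>
      \<Longrightarrow> Sub C xs b ys as c f g \<in> Mul C (xs @ as @ ys) c"
    and sub_natural: "\<lbrakk>(length xs + 1 + length ys, length as) \<in> sub_arities;
        xs \<in> lists (Obj C); b \<in> Obj C; ys \<in> lists (Obj C); as \<in> lists (Obj C); c \<in> Obj C;
        xs' \<in> lists (Obj C); ys' \<in> lists (Obj C); as' \<in> lists (Obj C); c' \<in> Obj C;
        f \<in> Mul C (xs @ b # ys) c; g \<in> Mul C as b;
        ps \<in> Homs C xs' xs; qs \<in> Homs C ys' ys; rs \<in> Homs C as' as; s \<in> Hom C c c'\<rbrakk>
      \<Longrightarrow> Sub C xs' b ys' as' c'
            (Act C (xs @ b # ys) c (xs' @ b # ys') c' (ps @ Idm C b # qs) s f)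
            (Act C as b as' b rs (Idm C b) g)
        = Act C (xs @ as @ ys) c (xs' @ as' @ ys') c' (ps @ rs @ qs) s (Sub C xs b ys as c f g)"
    and sub_dinatural: "\<lbrakk>(length xs + 1 + length ys, length as) \<in> sub_arities;
        xs \<in> lists (Obj C); b \<in> Obj C; b' \<in> Obj C; ys \<in> lists (Obj C); as \<in> lists (Obj C); c \<in> Obj C;
        f \<in> Mul C (xs @ b' # ys) c; g \<in> Mul C as b; p \<in> Hom C b b'\<rbrakk>
      \<Longrightarrow> Sub C xs b ys as c
            (Act C (xs @ b' # ys) c (xs @ b # ys) c (Idms C xs @ p # Idms C ys) (Idm C c) f) g
        = Sub C xs b' ys as c f (Act C as b as b' (Idms C as) p g)"
    and sub_assoc_A: "\<lbrakk>length xs + 1 + length ys = 2;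
        (length us + 1 + length vs, length as) \<in> {(2,2), (2,0)};
        xs \<in> lists (Obj C); b \<in> Obj C; ys \<in> lists (Obj C); us \<in> lists (Obj C); c \<in> Obj C;
        vs \<in> lists (Obj C); as \<in> lists (Obj C); d \<in> Obj C;
        f \<in> Mul C (xs @ b # ys) d; g \<in> Mul C (us @ c # vs) b; h \<in> Mul C as c\<rbrakk>
      \<Longrightarrow> gsub C xs b ys (us @ as @ vs) d f (gsub C us c vs as b g h)
        = gsub C (xs @ us) c (vs @ ys) as d (gsub C xs b ys (us @ c # vs) d f g) h"
    and sub_assoc_B: "\<lbrakk>(length as, length as') \<in> {(2,2), (2,0), (0,2), (0,0)};
        b \<in> Obj C; c \<in> Obj C; d \<in> Obj C; as \<in> lists (Obj C); as' \<in> lists (Obj C);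
        f \<in> Mul C [b, c] d; g \<in> Mul C as b; h \<in> Mul C as' c\<rbrakk>
      \<Longrightarrow> gsub C as c [] as' d (gsub C [] b [c] as d f g) h
        = gsub C [] b as' as d (gsub C [b] c [] as' d f h) g"

text \<open>
  Morphisms of short multicategories and multifunctors: \<open>morMap F as b\<close> is the function on maps
  \<open>as \<rightarrow> b\<close>. On unary maps it is the action of the underlying functor.
\<close>

record ('o, 'm) mmor =
  morOb :: "'o \<Rightarrow> 'o"
  morMap :: "'o list \<Rightarrow> 'o \<Rightarrow> 'm \<Rightarrow> 'm"

definition mor_unary :: "('o, 'm) mmor \<Rightarrow> ('o, 'm, 'o, 'm) func" where
  "mor_unary F = \<lparr>fOb = morOb F, fMap = (\<lambda>a b. morMap F [a] b)\<rparr>"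

definition morMaps :: "('o, 'm) mmor \<Rightarrow> 'o list \<Rightarrow> 'o list \<Rightarrow> 'm list \<Rightarrow> 'm list" where
  "morMaps F as bs ps = map (\<lambda>k. morMap F [as ! k] (bs ! k) (ps ! k)) [0..<length ps]"

definition shMaps :: "('o, 'm) shmulti \<Rightarrow> 'o list \<Rightarrow> 'o \<Rightarrow> 'm set" where
  "shMaps C as b = (if as \<in> lists (Obj C) \<and> b \<in> Obj C \<and> length as \<le> 4 then Mul C as b else {})"

locale short_morphism = C: short_multicategory C + D: short_multicategory D +
    is_functor C D "mor_unary F"
  for C D :: "('o, 'm) shmulti" and F :: "('o, 'm) mmor" +
  assumes ext_obj: "morOb F \<in> extensional (Obj C)"
    and ext_map: "morMap F as b \<in> extensional (shMaps C as b)"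
    and map_mul: "\<lbrakk>as \<in> lists (Obj C); b \<in> Obj C; length as \<le> 4; f \<in> Mul C as b\<rbrakk>
      \<Longrightarrow> morMap F as b f \<in> Mul D (map (morOb F) as) (morOb F b)"
    and map_natural: "\<lbrakk>as \<in> lists (Obj C); as' \<in> lists (Obj C); b \<in> Obj C; b' \<in> Obj C; length as \<le> 4;
        ps \<in> Homs C as' as; q \<in> Hom C b b'; f \<in> Mul C as b\<rbrakk>
      \<Longrightarrow> morMap F as' b' (Act C as b as' b' ps q f)
        = Act D (map (morOb F) as) (morOb F b) (map (morOb F) as') (morOb F b')
            (morMaps F as' as ps) (morMap F [b] b' q) (morMap F as b f)"
    and map_sub: "\<lbrakk>(length xs + 1 + length ys, length as) \<in> sub_arities;
        xs \<in> lists (Obj C); b \<in> Obj C; ys \<in> lists (Obj C); as \<in> lists (Obj C); c \<in> Obj C;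
        f \<in> Mul C (xs @ b # ys) c; g \<in> Mul C as b\<rbrakk>
      \<Longrightarrow> morMap F (xs @ as @ ys) c (Sub C xs b ys as c f g)
        = Sub D (map (morOb F) xs) (morOb F b) (map (morOb F) ys) (map (morOb F) as) (morOb F c)
            (morMap F (xs @ b # ys) c f) (morMap F as b g)"

text \<open>
  Identities and composites, made extensional with respect to the objects \<open>X\<close> and
  multimaps \<open>M\<close> of the domain.
\<close>

definition mor_id :: "'o set \<Rightarrow> ('o list \<Rightarrow> 'o \<Rightarrow> 'm set) \<Rightarrow> ('o, 'm) mmor" where
  "mor_id X M = \<lparr>morOb = restrict (\<lambda>a. a) X, morMap = (\<lambda>as b. restrict (\<lambda>f. f) (M as b))\<rparr>"

definition mor_comp ::
  "'o set \<Rightarrow> ('o list \<Rightarrow> 'o \<Rightarrow> 'm set) \<Rightarrow> ('o, 'm) mmor \<Rightarrow> ('o, 'm) mmor \<Rightarrow> ('o, 'm) mmor" where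
  "mor_comp X M G F = \<lparr>
     morOb = restrict (\<lambda>a. morOb G (morOb F a)) X,
     morMap = (\<lambda>as b. restrict (\<lambda>f. morMap G (map (morOb F) as) (morOb F b) (morMap F as b f)) (M as b))\<rparr>"

definition ShMulti :: "(('o, 'm) shmulti, ('o, 'm) mmor) cat" where
  "ShMulti = \<lparr>
     Obj = {C. short_multicategory C},
     Hom = (\<lambda>C D. {F. short_morphism C D F}),
     Idm = (\<lambda>C. mor_id (Obj C) (shMaps C)),
     Cmp = (\<lambda>C D E G F. mor_comp (Obj C) (shMaps C) G F)\<rparr>"


section \<open>Representability and closedness of short multicategories\<close>

text \<open>The data of binary maps \<open>\<theta> a b : a, b \<rightarrow> ab\<close> and a nullary map \<open>u : () \<rightarrow> i\<close>.\<close>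

record ('o, 'm) classifiers =
  clOb :: "'o \<Rightarrow> 'o \<Rightarrow> 'o"
  clTheta :: "'o \<Rightarrow> 'o \<Rightarrow> 'm"
  clUnit :: 'o
  clU :: 'm

definition classifier_data :: "('o, 'm) shmulti \<Rightarrow> ('o, 'm) classifiers \<Rightarrow> bool" where
  "classifier_data C t \<longleftrightarrow>
     (\<forall>a \<in> Obj C. \<forall>b \<in> Obj C. clOb t a b \<in> Obj C \<and> clTheta t a b \<in> Mul C [a, b] (clOb t a b))
     \<and> clUnit t \<in> Obj C \<and> clU t \<in> Mul C [] (clUnit t)"

definition left_classifiers :: "('o, 'm) shmulti \<Rightarrow> ('o, 'm) classifiers \<Rightarrow> bool" where
  "left_classifiers C t \<longleftrightarrow> classifier_data C t
     \<and> (\<forall>a \<in> Obj C. \<forall>b \<in> Obj C. \<forall>xs \<in> lists (Obj C). \<forall>d \<in> Obj C. length xs + 1 \<in> {1, 2, 3} \<longrightarrow>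
          bij_betw (\<lambda>f. gsub C [] (clOb t a b) xs [a, b] d f (clTheta t a b))
            (Mul C (clOb t a b # xs) d) (Mul C (a # b # xs) d))
     \<and> (\<forall>xs \<in> lists (Obj C). \<forall>d \<in> Obj C. length xs \<in> {0, 1, 2} \<longrightarrow>
          bij_betw (\<lambda>f. gsub C [] (clUnit t) xs [] d f (clU t))
            (Mul C (clUnit t # xs) d) (Mul C xs d))"

definition left_representable :: "('o, 'm) shmulti \<Rightarrow> bool" where
  "left_representable C \<longleftrightarrow> (\<exists>t. left_classifiers C t)"

definition representable :: "('o, 'm) shmulti \<Rightarrow> bool" where
  "representable C \<longleftrightarrow> (\<exists>t. classifier_data C t
     \<and> (\<forall>xs \<in> lists (Obj C). \<forall>ys \<in> lists (Obj C). \<forall>d \<in> Obj C.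
          length xs + 1 + length ys \<in> {1, 2, 3} \<longrightarrow>
            bij_betw (\<lambda>f. gsub C xs (clUnit t) ys [] d f (clU t))
              (Mul C (xs @ clUnit t # ys) d) (Mul C (xs @ ys) d)
            \<and> (\<forall>a \<in> Obj C. \<forall>b \<in> Obj C.
                bij_betw (\<lambda>f. gsub C xs (clOb t a b) ys [a, b] d f (clTheta t a b))
                  (Mul C (xs @ clOb t a b # ys) d) (Mul C (xs @ a # b # ys) d))))"

definition closed_short :: "('o, 'm) shmulti \<Rightarrow> bool" where
  "closed_short C \<longleftrightarrow> (\<forall>b \<in> Obj C. \<forall>c \<in> Obj C. \<exists>h \<in> Obj C. \<exists>e \<in> Mul C [h, b] c.
     \<forall>xs \<in> lists (Obj C). length xs \<in> {0, 1, 2, 3} \<longrightarrow>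
       bij_betw (\<lambda>f. gsub C [] h [b] xs c e f) (Mul C xs h) (Mul C (xs @ [b]) c))"

definition ShMulti_lr :: "(('o, 'm) shmulti, ('o, 'm) mmor) cat" where
  "ShMulti_lr = full_sub ShMulti {C. left_representable C}"

definition ShMulti_rep_cl :: "(('o, 'm) shmulti, ('o, 'm) mmor) cat" where
  "ShMulti_rep_cl = full_sub ShMulti {C. representable C \<and> closed_short C}"


section \<open>Multicategories\<close>

record ('o, 'm) multi =
  mObj :: "'o set"
  mHom :: "'o list \<Rightarrow> 'o \<Rightarrow> 'm set"
  mIdm :: "'o \<Rightarrow> 'm"
  mSub :: "('o, 'm) subst"

locale multicategory =
  fixes M :: "('o, 'm) multi"
  assumes id_hom: "a \<in> mObj M \<Longrightarrow> mIdm M a \<in> mHom M [a] a"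
    and sub_hom: "\<lbrakk>xs \<in> lists (mObj M); b \<in> mObj M; ys \<in> lists (mObj M); as \<in> lists (mObj M); c \<in> mObj M;
        f \<in> mHom M (xs @ b # ys) c; g \<in> mHom M as b\<rbrakk>
      \<Longrightarrow> mSub M xs b ys as c f g \<in> mHom M (xs @ as @ ys) c"
    and sub_id_right: "\<lbrakk>xs \<in> lists (mObj M); b \<in> mObj M; ys \<in> lists (mObj M); c \<in> mObj M;
        f \<in> mHom M (xs @ b # ys) c\<rbrakk>
      \<Longrightarrow> mSub M xs b ys [b] c f (mIdm M b) = f"
    and sub_id_left: "\<lbrakk>as \<in> lists (mObj M); b \<in> mObj M; g \<in> mHom M as b\<rbrakk>
      \<Longrightarrow> mSub M [] b [] as b (mIdm M b) g = g"
    and sub_assoc_nested: "\<lbrakk>xs \<in> lists (mObj M); b \<in> mObj M; ys \<in> lists (mObj M);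
        us \<in> lists (mObj M); c \<in> mObj M; vs \<in> lists (mObj M); as \<in> lists (mObj M); d \<in> mObj M;
        f \<in> mHom M (xs @ b # ys) d; g \<in> mHom M (us @ c # vs) b; h \<in> mHom M as c\<rbrakk>
      \<Longrightarrow> mSub M xs b ys (us @ as @ vs) d f (mSub M us c vs as b g h)
        = mSub M (xs @ us) c (vs @ ys) as d (mSub M xs b ys (us @ c # vs) d f g) h"
    and sub_assoc_parallel: "\<lbrakk>xs \<in> lists (mObj M); b \<in> mObj M; ys \<in> lists (mObj M); c \<in> mObj M;
        zs \<in> lists (mObj M); as \<in> lists (mObj M); as' \<in> lists (mObj M); d \<in> mObj M;
        f \<in> mHom M (xs @ b # ys @ c # zs) d; g \<in> mHom M as b; h \<in> mHom M as' c\<rbrakk>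
      \<Longrightarrow> mSub M (xs @ as @ ys) c zs as' d (mSub M xs b (ys @ c # zs) as d f g) h
        = mSub M xs b (ys @ as' @ zs) as d (mSub M (xs @ b # ys) c zs as' d f h) g"

definition mMaps :: "('o, 'm) multi \<Rightarrow> 'o list \<Rightarrow> 'o \<Rightarrow> 'm set" where
  "mMaps M as b = (if as \<in> lists (mObj M) \<and> b \<in> mObj M then mHom M as b else {})"

locale multifunctor = M: multicategory M + N: multicategory N for M N :: "('o, 'm) multi" +
  fixes F :: "('o, 'm) mmor"
  assumes ext_obj: "morOb F \<in> extensional (mObj M)"
    and ext_map: "morMap F as b \<in> extensional (mMaps M as b)"
    and map_obj: "a \<in> mObj M \<Longrightarrow> morOb F a \<in> mObj N"
    and map_hom: "\<lbrakk>as \<in> lists (mObj M); b \<in> mObj M; f \<in> mHom M as b\<rbrakk>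
      \<Longrightarrow> morMap F as b f \<in> mHom N (map (morOb F) as) (morOb F b)"
    and map_id: "a \<in> mObj M \<Longrightarrow> morMap F [a] a (mIdm M a) = mIdm N (morOb F a)"
    and map_sub: "\<lbrakk>xs \<in> lists (mObj M); b \<in> mObj M; ys \<in> lists (mObj M); as \<in> lists (mObj M); c \<in> mObj M;
        f \<in> mHom M (xs @ b # ys) c; g \<in> mHom M as b\<rbrakk>
      \<Longrightarrow> morMap F (xs @ as @ ys) c (mSub M xs b ys as c f g)
        = mSub N (map (morOb F) xs) (morOb F b) (map (morOb F) ys) (map (morOb F) as) (morOb F c)
            (morMap F (xs @ b # ys) c f) (morMap F as b g)"

definition Multi :: "(('o, 'm) multi, ('o, 'm) mmor) cat" where
  "Multi = \<lparr>
     Obj = {M. multicategory M},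
     Hom = (\<lambda>M N. {F. multifunctor M N F}),
     Idm = (\<lambda>M. mor_id (mObj M) (mMaps M)),
     Cmp = (\<lambda>M N P G F. mor_comp (mObj M) (mMaps M) G F)\<rparr>"

definition representable_multi :: "('o, 'm) multi \<Rightarrow> bool" where
  "representable_multi M \<longleftrightarrow> (\<forall>as \<in> lists (mObj M). \<exists>m \<in> mObj M. \<exists>\<theta> \<in> mHom M as m.
     \<forall>xs \<in> lists (mObj M). \<forall>ys \<in> lists (mObj M). \<forall>b \<in> mObj M.
       bij_betw (\<lambda>f. mSub M xs m ys as b f \<theta>) (mHom M (xs @ m # ys) b) (mHom M (xs @ as @ ys) b))"

definition closed_multi :: "('o, 'm) multi \<Rightarrow> bool" where
  "closed_multi M \<longleftrightarrow> (\<forall>b \<in> mObj M. \<forall>c \<in> mObj M. \<exists>h \<in> mObj M. \<exists>e \<in> mHom M [h, b] c.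
     \<forall>xs \<in> lists (mObj M).
       bij_betw (\<lambda>f. mSub M [] h [b] xs c e f) (mHom M xs h) (mHom M (xs @ [b]) c))"

definition Multi_rep_cl :: "(('o, 'm) multi, ('o, 'm) mmor) cat" where
  "Multi_rep_cl = full_sub Multi {M. representable_multi M \<and> closed_multi M}"


section \<open>The forgetful functor from multicategories to short multicategories\<close>

definition unary_cat :: "('o, 'm) multi \<Rightarrow> ('o, 'm) cat" where
  "unary_cat M = \<lparr>
     Obj = mObj M,
     Hom = (\<lambda>a b. mHom M [a] b),
     Idm = mIdm M,
     Cmp = (\<lambda>a b c g f. mSub M [] b [] [a] c g f)\<rparr>"

text \<open>
  Substitution of unary maps into all inputs of \<open>f\<close>, from left to right; \<open>xs\<close> is the list of inputs
  already treated, so \<open>f \<in> M(xs @ as; c)\<close>.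
\<close>

fun sub_unaries :: "('o, 'm) multi \<Rightarrow> 'o list \<Rightarrow> 'o list \<Rightarrow> 'o list \<Rightarrow> 'm list \<Rightarrow> 'o \<Rightarrow> 'm \<Rightarrow> 'm" where
  "sub_unaries M xs (a # as) (a' # as') (p # ps) c f
     = sub_unaries M (xs @ [a']) as as' ps c (mSub M xs a as [a'] c f p)"
| "sub_unaries M xs _ _ _ c f = f"

definition U_ob :: "('o, 'm) multi \<Rightarrow> ('o, 'm) shmulti" where
  "U_ob M = \<lparr>
     Obj = mObj M,
     Hom = (\<lambda>a b. mHom M [a] b),
     Idm = mIdm M,
     Cmp = (\<lambda>a b c g f. mSub M [] b [] [a] c g f),
     Mul = (\<lambda>as b. if length as \<le> 4 then mHom M as b else {}),
     Act = (\<lambda>as b as' b' ps q f. if length as \<le> 4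
              then mSub M [] b [] as' b' q (sub_unaries M [] as as' ps b f) else undefined),
     Sub = (\<lambda>xs b ys as c f g. if (length xs + 1 + length ys, length as) \<in> sub_arities
              then mSub M xs b ys as c f g else undefined)\<rparr>"

definition U_mor :: "('o, 'm) mmor \<Rightarrow> ('o, 'm) mmor" where
  "U_mor F = \<lparr>
     morOb = morOb F,
     morMap = (\<lambda>as b. if length as \<le> 4 then morMap F as b else (\<lambda>_. undefined))\<rparr>"

definition U_functor :: "(('o, 'm) multi, ('o, 'm) mmor, ('o, 'm) shmulti, ('o, 'm) mmor) func" where
  "U_functor = \<lparr>fOb = U_ob, fMap = (\<lambda>M N F. U_mor F)\<rparr>"


section \<open>Skew monoidal categories\<close>

text \<open>\<open>tenm C a b c d f g : ac \<rightarrow> bd\<close> is the tensor product of \<open>f : a \<rightarrow> b\<close> and \<open>g : c \<rightarrow> d\<close>.\<close>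

record ('o, 'm) skmon = "('o, 'm) cat" +
  ten :: "'o \<Rightarrow> 'o \<Rightarrow> 'o" (infixl \<open>\<otimes>\<index>\<close> 70)
  tenm :: "'o \<Rightarrow> 'o \<Rightarrow> 'o \<Rightarrow> 'o \<Rightarrow> 'm \<Rightarrow> 'm \<Rightarrow> 'm"
  unt :: 'o (\<open>\<i>\<index>\<close>)
  alp :: "'o \<Rightarrow> 'o \<Rightarrow> 'o \<Rightarrow> 'm"
  lam :: "'o \<Rightarrow> 'm"
  rho :: "'o \<Rightarrow> 'm"

definition tensor_functor :: "('o, 'm) skmon \<Rightarrow> ('o \<times> 'o, 'm \<times> 'm, 'o, 'm) func" where
  "tensor_functor C = \<lparr>
     fOb = (\<lambda>x. ten C (fst x) (snd x)),
     fMap = (\<lambda>x y f. tenm C (fst x) (fst y) (snd x) (snd y) (fst f) (snd f))\<rparr>"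

locale skew_monoidal = category C for C :: "('o, 'm) skmon" (structure) +
  assumes tensor: "is_functor (prod_cat C C) C (tensor_functor C)"
    and unit_obj: "\<i> \<in> Obj C"
    and alp_hom: "\<lbrakk>a \<in> Obj C; b \<in> Obj C; c \<in> Obj C\<rbrakk> \<Longrightarrow> alp C a b c \<in> Hom C (a \<otimes> b \<otimes> c) (a \<otimes> (b \<otimes> c))"
    and lam_hom: "a \<in> Obj C \<Longrightarrow> lam C a \<in> Hom C (\<i> \<otimes> a) a"
    and rho_hom: "a \<in> Obj C \<Longrightarrow> rho C a \<in> Hom C a (a \<otimes> \<i>)"
    and alp_natural: "\<lbrakk>a \<in> Obj C; a' \<in> Obj C; b \<in> Obj C; b' \<in> Obj C; c \<in> Obj C; c' \<in> Obj C;
        f \<in> Hom C a a'; g \<in> Hom C b b'; h \<in> Hom C c c'\<rbrakk>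
      \<Longrightarrow> Cmp C (a \<otimes> b \<otimes> c) (a' \<otimes> b' \<otimes> c') (a' \<otimes> (b' \<otimes> c'))
            (alp C a' b' c') (tenm C (a \<otimes> b) (a' \<otimes> b') c c' (tenm C a a' b b' f g) h)
        = Cmp C (a \<otimes> b \<otimes> c) (a \<otimes> (b \<otimes> c)) (a' \<otimes> (b' \<otimes> c'))
            (tenm C a a' (b \<otimes> c) (b' \<otimes> c') f (tenm C b b' c c' g h)) (alp C a b c)"
    and lam_natural: "\<lbrakk>a \<in> Obj C; a' \<in> Obj C; f \<in> Hom C a a'\<rbrakk>
      \<Longrightarrow> Cmp C (\<i> \<otimes> a) (\<i> \<otimes> a') a' (lam C a') (tenm C \<i> \<i> a a' (Idm C \<i>) f)
        = Cmp C (\<i> \<otimes> a) a a' f (lam C a)"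
    and rho_natural: "\<lbrakk>a \<in> Obj C; a' \<in> Obj C; f \<in> Hom C a a'\<rbrakk>
      \<Longrightarrow> Cmp C a a' (a' \<otimes> \<i>) (rho C a') f
        = Cmp C a (a \<otimes> \<i>) (a' \<otimes> \<i>) (tenm C a a' \<i> \<i> f (Idm C \<i>)) (rho C a)"
    and pentagon: "\<lbrakk>a \<in> Obj C; b \<in> Obj C; c \<in> Obj C; d \<in> Obj C\<rbrakk>
      \<Longrightarrow> Cmp C (a \<otimes> b \<otimes> c \<otimes> d) (a \<otimes> b \<otimes> (c \<otimes> d)) (a \<otimes> (b \<otimes> (c \<otimes> d)))
            (alp C a b (c \<otimes> d)) (alp C (a \<otimes> b) c d)
        = Cmp C (a \<otimes> b \<otimes> c \<otimes> d) (a \<otimes> (b \<otimes> c \<otimes> d)) (a \<otimes> (b \<otimes> (c \<otimes> d)))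
            (tenm C a a (b \<otimes> c \<otimes> d) (b \<otimes> (c \<otimes> d)) (Idm C a) (alp C b c d))
            (Cmp C (a \<otimes> b \<otimes> c \<otimes> d) (a \<otimes> (b \<otimes> c) \<otimes> d) (a \<otimes> (b \<otimes> c \<otimes> d))
              (alp C a (b \<otimes> c) d)
              (tenm C (a \<otimes> b \<otimes> c) (a \<otimes> (b \<otimes> c)) d d (alp C a b c) (Idm C d)))"
    and left_unit: "\<lbrakk>a \<in> Obj C; b \<in> Obj C\<rbrakk>
      \<Longrightarrow> Cmp C (\<i> \<otimes> a \<otimes> b) (\<i> \<otimes> (a \<otimes> b)) (a \<otimes> b) (lam C (a \<otimes> b)) (alp C \<i> a b)
        = tenm C (\<i> \<otimes> a) a b b (lam C a) (Idm C b)"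
    and right_unit: "\<lbrakk>a \<in> Obj C; b \<in> Obj C\<rbrakk>
      \<Longrightarrow> Cmp C (a \<otimes> b) (a \<otimes> b \<otimes> \<i>) (a \<otimes> (b \<otimes> \<i>)) (alp C a b \<i>) (rho C (a \<otimes> b))
        = tenm C a a b (b \<otimes> \<i>) (Idm C a) (rho C b)"
    and middle_unit: "\<lbrakk>a \<in> Obj C; b \<in> Obj C\<rbrakk>
      \<Longrightarrow> Cmp C (a \<otimes> b) (a \<otimes> (\<i> \<otimes> b)) (a \<otimes> b)
            (tenm C a a (\<i> \<otimes> b) b (Idm C a) (lam C b))
            (Cmp C (a \<otimes> b) (a \<otimes> \<i> \<otimes> b) (a \<otimes> (\<i> \<otimes> b))
              (alp C a \<i> b) (tenm C a (a \<otimes> \<i>) b b (rho C a) (Idm C b)))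
        = Idm C (a \<otimes> b)"
    and unit_unit: "Cmp C \<i> (\<i> \<otimes> \<i>) \<i> (lam C \<i>) (rho C \<i>) = Idm C \<i>"

definition left_normal :: "('o, 'm) skmon \<Rightarrow> bool" where
  "left_normal C \<longleftrightarrow> (\<forall>a \<in> Obj C. iso_map C (ten C (unt C) a) a (lam C a))"

definition monoidal :: "('o, 'm) skmon \<Rightarrow> bool" where
  "monoidal C \<longleftrightarrow> skew_monoidal C
     \<and> (\<forall>a \<in> Obj C. \<forall>b \<in> Obj C. \<forall>c \<in> Obj C.
          iso_map C (ten C (ten C a b) c) (ten C a (ten C b c)) (alp C a b c))
     \<and> (\<forall>a \<in> Obj C. iso_map C (ten C (unt C) a) a (lam C a))
     \<and> (\<forall>a \<in> Obj C. iso_map C a (ten C a (unt C)) (rho C a))"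

definition tensor_right :: "('o, 'm) skmon \<Rightarrow> 'o \<Rightarrow> ('o, 'm, 'o, 'm) func" where
  "tensor_right C b = \<lparr>
     fOb = (\<lambda>a. ten C a b),
     fMap = (\<lambda>a a' f. tenm C a a' b b f (Idm C b))\<rparr>"

definition closed_skmon :: "('o, 'm) skmon \<Rightarrow> bool" where
  "closed_skmon C \<longleftrightarrow> (\<forall>b \<in> Obj C. \<exists>G. right_adjoint C C (tensor_right C b) G)"

record ('o, 'm) laxfun = "('o, 'm, 'o, 'm) func" +
  lax0 :: 'm
  lax2 :: "'o \<Rightarrow> 'o \<Rightarrow> 'm"

definition catMaps :: "('o, 'm, 'x) cat_scheme \<Rightarrow> 'o \<Rightarrow> 'o \<Rightarrow> 'm set" where
  "catMaps C a b = (if a \<in> Obj C \<and> b \<in> Obj C then Hom C a b else {})"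

locale lax_monoidal = A: skew_monoidal A + B: skew_monoidal B + is_functor A B F
  for A :: "('o, 'm) skmon" (structure) and B :: "('o, 'm) skmon" (structure)
    and F :: "('o, 'm) laxfun" +
  assumes ext_obj: "fOb F \<in> extensional (Obj A)"
    and ext_map: "fMap F a b \<in> extensional (catMaps A a b)"
    and ext_lax2: "\<not> (a \<in> Obj A \<and> b \<in> Obj A) \<Longrightarrow> lax2 F a b = undefined"
    and lax0_hom: "lax0 F \<in> Hom B \<i>\<^bsub>B\<^esub> (fOb F \<i>)"
    and lax2_hom: "\<lbrakk>a \<in> Obj A; b \<in> Obj A\<rbrakk>
      \<Longrightarrow> lax2 F a b \<in> Hom B (fOb F a \<otimes>\<^bsub>B\<^esub> fOb F b) (fOb F (a \<otimes> b))"
    and lax2_natural: "\<lbrakk>a \<in> Obj A; a' \<in> Obj A; b \<in> Obj A; b' \<in> Obj A; f \<in> Hom A a a'; g \<in> Hom A b b'\<rbrakk>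
      \<Longrightarrow> Cmp B (fOb F a \<otimes>\<^bsub>B\<^esub> fOb F b) (fOb F a' \<otimes>\<^bsub>B\<^esub> fOb F b') (fOb F (a' \<otimes> b'))
            (lax2 F a' b')
            (tenm B (fOb F a) (fOb F a') (fOb F b) (fOb F b') (fMap F a a' f) (fMap F b b' g))
        = Cmp B (fOb F a \<otimes>\<^bsub>B\<^esub> fOb F b) (fOb F (a \<otimes> b)) (fOb F (a' \<otimes> b'))
            (fMap F (a \<otimes> b) (a' \<otimes> b') (tenm A a a' b b' f g)) (lax2 F a b)"
    and lax_assoc: "\<lbrakk>a \<in> Obj A; b \<in> Obj A; c \<in> Obj A\<rbrakk>
      \<Longrightarrow> Cmp B (fOb F a \<otimes>\<^bsub>B\<^esub> fOb F b \<otimes>\<^bsub>B\<^esub> fOb F c) (fOb F (a \<otimes> b \<otimes> c)) (fOb F (a \<otimes> (b \<otimes> c)))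
            (fMap F (a \<otimes> b \<otimes> c) (a \<otimes> (b \<otimes> c)) (alp A a b c))
            (Cmp B (fOb F a \<otimes>\<^bsub>B\<^esub> fOb F b \<otimes>\<^bsub>B\<^esub> fOb F c) (fOb F (a \<otimes> b) \<otimes>\<^bsub>B\<^esub> fOb F c) (fOb F (a \<otimes> b \<otimes> c))
              (lax2 F (a \<otimes> b) c)
              (tenm B (fOb F a \<otimes>\<^bsub>B\<^esub> fOb F b) (fOb F (a \<otimes> b)) (fOb F c) (fOb F c)
                (lax2 F a b) (Idm B (fOb F c))))
        = Cmp B (fOb F a \<otimes>\<^bsub>B\<^esub> fOb F b \<otimes>\<^bsub>B\<^esub> fOb F c) (fOb F a \<otimes>\<^bsub>B\<^esub> fOb F (b \<otimes> c)) (fOb F (a \<otimes> (b \<otimes> c)))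
            (lax2 F a (b \<otimes> c))
            (Cmp B (fOb F a \<otimes>\<^bsub>B\<^esub> fOb F b \<otimes>\<^bsub>B\<^esub> fOb F c) (fOb F a \<otimes>\<^bsub>B\<^esub> (fOb F b \<otimes>\<^bsub>B\<^esub> fOb F c))
                (fOb F a \<otimes>\<^bsub>B\<^esub> fOb F (b \<otimes> c))
              (tenm B (fOb F a) (fOb F a) (fOb F b \<otimes>\<^bsub>B\<^esub> fOb F c) (fOb F (b \<otimes> c))
                (Idm B (fOb F a)) (lax2 F b c))
              (alp B (fOb F a) (fOb F b) (fOb F c)))"
    and lax_left_unit: "a \<in> Obj A
      \<Longrightarrow> Cmp B (\<i>\<^bsub>B\<^esub> \<otimes>\<^bsub>B\<^esub> fOb F a) (fOb F (\<i> \<otimes> a)) (fOb F a)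
            (fMap F (\<i> \<otimes> a) a (lam A a))
            (Cmp B (\<i>\<^bsub>B\<^esub> \<otimes>\<^bsub>B\<^esub> fOb F a) (fOb F \<i> \<otimes>\<^bsub>B\<^esub> fOb F a) (fOb F (\<i> \<otimes> a))
              (lax2 F \<i> a)
              (tenm B \<i>\<^bsub>B\<^esub> (fOb F \<i>) (fOb F a) (fOb F a) (lax0 F) (Idm B (fOb F a))))
        = lam B (fOb F a)"
    and lax_right_unit: "a \<in> Obj A
      \<Longrightarrow> Cmp B (fOb F a) (fOb F a \<otimes>\<^bsub>B\<^esub> fOb F \<i>) (fOb F (a \<otimes> \<i>))
            (lax2 F a \<i>)
            (Cmp B (fOb F a) (fOb F a \<otimes>\<^bsub>B\<^esub> \<i>\<^bsub>B\<^esub>) (fOb F a \<otimes>\<^bsub>B\<^esub> fOb F \<i>)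
              (tenm B (fOb F a) (fOb F a) \<i>\<^bsub>B\<^esub> (fOb F \<i>) (Idm B (fOb F a)) (lax0 F))
              (rho B (fOb F a)))
        = fMap F a (a \<otimes> \<i>) (rho A a)"

definition lax_id :: "('o, 'm) skmon \<Rightarrow> ('o, 'm) laxfun" where
  "lax_id A = \<lparr>
     fOb = restrict (\<lambda>a. a) (Obj A),
     fMap = (\<lambda>a b. restrict (\<lambda>f. f) (catMaps A a b)),
     lax0 = Idm A (unt A),
     lax2 = (\<lambda>a b. if a \<in> Obj A \<and> b \<in> Obj A then Idm A (ten A a b) else undefined)\<rparr>"

definition lax_comp ::
  "('o, 'm) skmon \<Rightarrow> ('o, 'm) skmon \<Rightarrow> ('o, 'm) skmon \<Rightarrow> ('o, 'm) laxfun \<Rightarrow> ('o, 'm) laxfun \<Rightarrow> ('o, 'm) laxfun"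
  where
  "lax_comp A B E G F = \<lparr>
     fOb = restrict (\<lambda>a. fOb G (fOb F a)) (Obj A),
     fMap = (\<lambda>a b. restrict (\<lambda>f. fMap G (fOb F a) (fOb F b) (fMap F a b f)) (catMaps A a b)),
     lax0 = Cmp E (unt E) (fOb G (unt B)) (fOb G (fOb F (unt A)))
              (fMap G (unt B) (fOb F (unt A)) (lax0 F)) (lax0 G),
     lax2 = (\<lambda>a b. if a \<in> Obj A \<and> b \<in> Obj A
       then Cmp E (ten E (fOb G (fOb F a)) (fOb G (fOb F b))) (fOb G (ten B (fOb F a) (fOb F b)))
                  (fOb G (fOb F (ten A a b)))
              (fMap G (ten B (fOb F a) (fOb F b)) (fOb F (ten A a b)) (lax2 F a b))
              (lax2 G (fOb F a) (fOb F b))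
       else undefined)\<rparr>"

definition SkMon :: "(('o, 'm) skmon, ('o, 'm) laxfun) cat" where
  "SkMon = \<lparr>
     Obj = {A. skew_monoidal A},
     Hom = (\<lambda>A B. {F. lax_monoidal A B F}),
     Idm = lax_id,
     Cmp = lax_comp\<rparr>"

definition SkMon_ln :: "(('o, 'm) skmon, ('o, 'm) laxfun) cat" where
  "SkMon_ln = full_sub SkMon {A. left_normal A}"

definition Mon_cl :: "(('o, 'm) skmon, ('o, 'm) laxfun) cat" where
  "Mon_cl = full_sub SkMon {A. monoidal A \<and> closed_skmon A}"


section \<open>The functors \<open>K\<close> and \<open>T\<close>\<close>

text \<open>
  The formulas shared by \<open>K\<close> and \<open>T\<close>. Parameters are the category \<open>X\<close> of unary maps, the substitution
  \<open>S\<close> and the chosen classifiers \<open>t\<close>. The operations are made \<open>undefined\<close> outside the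
  carriers, so that the result depends only on the values of \<open>S\<close> on composable maps.
\<close>

definition skew_tenm :: "('o, 'm) cat \<Rightarrow> ('o, 'm) subst \<Rightarrow> ('o, 'm) classifiers
    \<Rightarrow> 'o \<Rightarrow> 'o \<Rightarrow> 'o \<Rightarrow> 'o \<Rightarrow> 'm \<Rightarrow> 'm \<Rightarrow> 'm" where
  "skew_tenm X S t a b c d f g =
     (if a \<in> Obj X \<and> b \<in> Obj X \<and> c \<in> Obj X \<and> d \<in> Obj X \<and> f \<in> Hom X a b \<and> g \<in> Hom X c d
      then THE h. h \<in> Hom X (clOb t a c) (clOb t b d) \<and>
             S [] (clOb t a c) [] [a, c] (clOb t b d) h (clTheta t a c)
           = S [a] d [] [c] (clOb t b d) (S [] b [d] [a] (clOb t b d) (clTheta t b d) f) g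
      else undefined)"

definition skew_alp :: "('o, 'm) cat \<Rightarrow> ('o, 'm) subst \<Rightarrow> ('o, 'm) classifiers \<Rightarrow> 'o \<Rightarrow> 'o \<Rightarrow> 'o \<Rightarrow> 'm" where
  "skew_alp X S t a b c =
     (if a \<in> Obj X \<and> b \<in> Obj X \<and> c \<in> Obj X
      then let ab = clOb t a b; ab_c = clOb t ab c; bc = clOb t b c; a_bc = clOb t a bc
           in THE h. h \<in> Hom X ab_c a_bc \<and>
                S [] ab [c] [a, b] a_bc (S [] ab_c [] [ab, c] a_bc h (clTheta t ab c)) (clTheta t a b)
              = S [a] bc [] [b, c] a_bc (clTheta t a bc) (clTheta t b c)
      else undefined)"

definition skew_lam :: "('o, 'm) cat \<Rightarrow> ('o, 'm) subst \<Rightarrow> ('o, 'm) classifiers \<Rightarrow> 'o \<Rightarrow> 'm" where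
  "skew_lam X S t a =
     (if a \<in> Obj X
      then let i = clUnit t; ia = clOb t i a
           in THE h. h \<in> Hom X ia a \<and>
                S [] i [a] [] a (S [] ia [] [i, a] a h (clTheta t i a)) (clU t) = Idm X a
      else undefined)"

definition skew_rho :: "('o, 'm) cat \<Rightarrow> ('o, 'm) subst \<Rightarrow> ('o, 'm) classifiers \<Rightarrow> 'o \<Rightarrow> 'm" where
  "skew_rho X S t a =
     (if a \<in> Obj X
      then S [a] (clUnit t) [] [] (clOb t a (clUnit t)) (clTheta t a (clUnit t)) (clU t)
      else undefined)"

definition skew_of :: "('o, 'm) cat \<Rightarrow> ('o, 'm) subst \<Rightarrow> ('o, 'm) classifiers \<Rightarrow> ('o, 'm) skmon" where
  "skew_of X S t = \<lparr>
     Obj = Obj X, Hom = Hom X, Idm = Idm X, Cmp = Cmp X,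
     ten = clOb t,
     tenm = skew_tenm X S t,
     unt = clUnit t,
     alp = skew_alp X S t,
     lam = skew_lam X S t,
     rho = skew_rho X S t\<rparr>"

definition lax_of :: "('o, 'm) cat \<Rightarrow> ('o, 'm) cat \<Rightarrow> ('o, 'm) subst
    \<Rightarrow> ('o, 'm) classifiers \<Rightarrow> ('o, 'm) classifiers \<Rightarrow> ('o, 'm) mmor \<Rightarrow> ('o, 'm) laxfun" where
  "lax_of X Y S t s F = \<lparr>
     fOb = morOb F,
     fMap = (\<lambda>a b. morMap F [a] b),
     lax0 = (let i = clUnit s; Fi = morOb F (clUnit t)
             in THE h. h \<in> Hom Y i Fi \<and> S [] i [] [] Fi h (clU s) = morMap F [] (clUnit t) (clU t)),
     lax2 = (\<lambda>a b.
       if a \<in> Obj X \<and> b \<in> Obj X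
       then let FaFb = clOb s (morOb F a) (morOb F b); Fab = morOb F (clOb t a b)
            in THE h. h \<in> Hom Y FaFb Fab \<and>
                 S [] FaFb [] [morOb F a, morOb F b] Fab h (clTheta s (morOb F a) (morOb F b))
               = morMap F [a, b] (clOb t a b) (clTheta t a b)
       else undefined)\<rparr>"

definition K_functor :: "(('o, 'm) shmulti \<Rightarrow> ('o, 'm) classifiers)
    \<Rightarrow> (('o, 'm) shmulti, ('o, 'm) mmor, ('o, 'm) skmon, ('o, 'm) laxfun) func" where
  "K_functor ch = \<lparr>
     fOb = (\<lambda>C. skew_of (cat.truncate C) (gsub C) (ch C)),
     fMap = (\<lambda>C D F. lax_of (cat.truncate C) (cat.truncate D) (gsub D) (ch C) (ch D) F)\<rparr>"

text \<open>\<open>T\<close> uses in \<open>M\<close> the classifiers chosen for the underlying short multicategory \<open>U M\<close>.\<close>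

definition T_functor :: "(('o, 'm) shmulti \<Rightarrow> ('o, 'm) classifiers)
    \<Rightarrow> (('o, 'm) multi, ('o, 'm) mmor, ('o, 'm) skmon, ('o, 'm) laxfun) func" where
  "T_functor ch = \<lparr>
     fOb = (\<lambda>M. skew_of (unary_cat M) (mSub M) (ch (U_ob M))),
     fMap = (\<lambda>M N F. lax_of (unary_cat M) (unary_cat N) (mSub N) (ch (U_ob M)) (ch (U_ob N)) F)\<rparr>"

end

theory Submission imports Defs begin

text \<open>
  Every functor in question is shown to be fully faithful and essentially surjective. Both properties
  rest on one formula for multimaps in terms of a skew monoidal structure.

  Let \<open>\<theta>\<close> and \<open>u\<close> be the universal maps of a left representable short multicategory. Tensoring \<open>u\<close> with
  the objects of a list \<open>as\<close> one after the other gives a map from \<open>as\<close> to the left bracketed tensor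
  product \<open>\<i> as = (\<i> a\<^sub>1) \<dots> a\<^sub>n\<close>, and left representability, used for one factor at a time, shows that it
  induces bijections \<open>Hom (\<i> as) b \<cong> C(as; b)\<close> (\<open>Phi_surj\<close>, \<open>Phi_inj\<close>). A multimap is thus an arrow out of
  \<open>\<i> as\<close>. In these terms the composite \<open>g \<circ>\<^sub>i h\<close> of \<open>g : us, c, vs \<rightarrow> b\<close> and \<open>h : as \<rightarrow> c\<close> is \<open>g\<close> after the
  arrow obtained from \<open>wh (\<i> us) as h : (\<i> us) as \<rightarrow> (\<i> us) c\<close> by tensoring with \<open>vs\<close> (\<open>Phi_subst\<close>); here
  \<open>wh\<close> is built from \<open>\<rho>\<close>, \<open>\<alpha>\<close> and the tensor product only. A lax monoidal functor is compatible with this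
  formula (\<open>laxs_subst\<close>), so it acts on multimaps and preserves substitution, and a morphism is
  determined by its values on unary maps, on the \<open>\<theta>\<close> and on \<open>u\<close>. Hence \<open>K\<close> is fully faithful
  (\<open>lax_of_surj\<close>, \<open>lax_of_inj\<close>). The argument is carried out for partial multicategories, where
  substitution is restricted to certain arities; these comprise short multicategories and
  multicategories, so that \<open>T\<close> is fully faithful as well.

  Conversely, for every skew monoidal category \<open>A\<close> the sets \<open>A(\<i> as, b)\<close> with this substitution form a
  multicategory, in which \<open>\<lambda>\<^sub>a\<close> is the identity of \<open>a\<close> (\<open>multicategory_multi_of\<close>). If \<open>A\<close> is left normal, its
  short part is left representable and \<open>f \<mapsto> f \<cdot> \<lambda>\<close> is a strict isomorphism from \<open>A\<close> to the skew monoidal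
  category of this short part (\<open>lam_functor_iso\<close>). If \<open>A\<close> is closed monoidal, the multicategory is
  representable and closed (\<open>representable_multi_of\<close>, \<open>closed_multi_of\<close>). So \<open>K\<close>, its restriction and \<open>T\<close> are
  essentially surjective. The restriction of \<open>K\<close> takes values in closed monoidal categories, because in a
  representable short multicategory \<open>\<theta>\<close> and \<open>u\<close> classify also in the second input, which inverts \<open>\<alpha>\<close>
  and \<open>\<rho>\<close>, and the universal maps \<open>[b, c], b \<rightarrow> c\<close> correspond to evaluations (\<open>monoidal_closed_short\<close>).

  Finally \<open>T = K \<circ> U\<close> holds since both sides are given by the same formulas, evaluated at small arities.
  As \<open>T\<close> and \<open>K\<close> are fully faithful, so is \<open>U\<close>. It is essentially surjective because \<open>K\<close> reflects
  isomorphisms and every \<open>K C\<close> is isomorphic to some \<open>K (U M)\<close>.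
\<close>

section \<open>Equivalences of categories\<close>

definition fully_faithful ::
  "('o, 'm) cat \<Rightarrow> ('p, 'n) cat \<Rightarrow> ('o, 'm, 'p, 'n) func \<Rightarrow> bool" where
  "fully_faithful A B F \<longleftrightarrow> (\<forall>a \<in> Obj A. \<forall>b \<in> Obj A.
     bij_betw (fMap F a b) (Hom A a b) (Hom B (fOb F a) (fOb F b)))"

definition essentially_surjective ::
  "('o, 'm) cat \<Rightarrow> ('p, 'n) cat \<Rightarrow> ('o, 'm, 'p, 'n) func \<Rightarrow> bool" where
  "essentially_surjective A B F \<longleftrightarrow> (\<forall>b \<in> Obj B. \<exists>a \<in> Obj A. \<exists>f. iso_map B (fOb F a) b f)"

lemma (in category) cmp_cancel_left:
  assumes "a \<in> Obj C" "b \<in> Obj C" "c \<in> Obj C" "g \<in> Hom C b c" "g' \<in> Hom C c b"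
    "Cmp C b c b g' g = Idm C b" "f \<in> Hom C a b" "f' \<in> Hom C a b"
    "Cmp C a b c g f = Cmp C a b c g f'"
  shows "f = f'"
  by (metis assms cmp_assoc cmp_id_left)

lemma fully_faithful_inj:
  assumes "fully_faithful A B F" "a \<in> Obj A" "b \<in> Obj A" "f \<in> Hom A a b" "g \<in> Hom A a b"
    "fMap F a b f = fMap F a b g"
  shows "f = g"
  using assms unfolding fully_faithful_def by (metis bij_betw_inv_into_left)

lemma fully_faithful_reflects_iso:
  assumes F: "is_functor A B F" and ff: "fully_faithful A B F"
    and ab: "a \<in> Obj A" "b \<in> Obj A" and iso: "iso_map B (fOb F a) (fOb F b) h"
  shows "\<exists>f. iso_map A a b f"
proof -
  interpret is_functor A B F by (rule F)
  have bij: "bij_betw (fMap F a b) (Hom A a b) (Hom B (fOb F a) (fOb F b))"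
    if "a \<in> Obj A" "b \<in> Obj A" for a b
    using ff that by (auto simp: fully_faithful_def)
  obtain k where h: "h \<in> Hom B (fOb F a) (fOb F b)" and k: "k \<in> Hom B (fOb F b) (fOb F a)"
    and kh: "Cmp B (fOb F a) (fOb F b) (fOb F a) k h = Idm B (fOb F a)"
    and hk: "Cmp B (fOb F b) (fOb F a) (fOb F b) h k = Idm B (fOb F b)"
    using iso by (auto simp: iso_map_def)
  obtain f where f: "f \<in> Hom A a b" "fMap F a b f = h"
    using bij[OF ab] h by (metis bij_betw_imp_surj_on imageE)
  obtain g where g: "g \<in> Hom A b a" "fMap F b a g = k"
    using bij[OF ab(2,1)] k by (metis bij_betw_imp_surj_on imageE)
  have "Cmp A a b a g f = Idm A a"
    by (rule fully_faithful_inj[OF ff ab(1) ab(1)]) (use ab f g kh in \<open>auto simp: A.cmp_hom A.idm_hom functor_cmp functor_id\<close>)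
  moreover have "Cmp A b a b f g = Idm A b"
    by (rule fully_faithful_inj[OF ff ab(2) ab(2)]) (use ab f g hk in \<open>auto simp: A.cmp_hom A.idm_hom functor_cmp functor_id\<close>)
  ultimately show ?thesis using f g by (auto simp: iso_map_def)
qed

text \<open>
  The inverse functor sends \<open>b\<close> to a chosen object \<open>g b\<close> with an isomorphism \<open>e b : F (g b) \<rightarrow> b\<close>, and a map to
  the preimage of its conjugate by these isomorphisms. Then \<open>e\<close> is one of the two natural isomorphisms;
  the other one is the preimage under \<open>F\<close> of the inverses of the \<open>e (F a)\<close>.
\<close>

lemma equivalence_if_fully_faithful_essentially_surjective:
  assumes F: "is_functor A B F" and ff: "fully_faithful A B F" and es: "essentially_surjective A B F"
  shows "equivalence A B F"
proof -
  interpret is_functor A B F by (rule F)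
  have bij: "bij_betw (fMap F a b) (Hom A a b) (Hom B (fOb F a) (fOb F b))"
    if "a \<in> Obj A" "b \<in> Obj A" for a b
    using ff that by (auto simp: fully_faithful_def)
  note inj = fully_faithful_inj[OF ff]
  obtain g e where g: "\<And>b. b \<in> Obj B \<Longrightarrow> g b \<in> Obj A"
    and e: "\<And>b. b \<in> Obj B \<Longrightarrow> iso_map B (fOb F (g b)) b (e b)"
    using es unfolding essentially_surjective_def by metis
  obtain e' where eh: "\<And>b. b \<in> Obj B \<Longrightarrow> e b \<in> Hom B (fOb F (g b)) b"
    and e'h: "\<And>b. b \<in> Obj B \<Longrightarrow> e' b \<in> Hom B b (fOb F (g b))"
    and e'e: "\<And>b. b \<in> Obj B \<Longrightarrow> Cmp B (fOb F (g b)) b (fOb F (g b)) (e' b) (e b) = Idm B (fOb F (g b))"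
    and ee': "\<And>b. b \<in> Obj B \<Longrightarrow> Cmp B b (fOb F (g b)) b (e b) (e' b) = Idm B b"
    using e unfolding iso_map_def by metis
  define L where "L a b = inv_into (Hom A a b) (fMap F a b)" for a b
  have L: "L a b h \<in> Hom A a b" "fMap F a b (L a b h) = h"
    if "a \<in> Obj A" "b \<in> Obj A" "h \<in> Hom B (fOb F a) (fOb F b)" for a b h
    using bij[OF that(1,2)] that(3) unfolding L_def
    by (auto simp: bij_betw_inv_into_right intro: bij_betw_apply[OF bij_betw_inv_into])
  define conj where "conj b c f = Cmp B (fOb F (g b)) c (fOb F (g c)) (e' c)
      (Cmp B (fOb F (g b)) b c f (e b))" for b c f
  have conj: "conj b c f \<in> Hom B (fOb F (g b)) (fOb F (g c))"
    if "b \<in> Obj B" "c \<in> Obj B" "f \<in> Hom B b c" for b c f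
    using that unfolding conj_def by (auto intro!: B.cmp_hom functor_obj g eh e'h)
  define G where "G = \<lparr>fOb = g, fMap = (\<lambda>b c f. L (g b) (g c) (conj b c f))\<rparr>"
  have Ge: "Cmp B (fOb F (g b)) (fOb F (g c)) c (e c) (conj b c f) = Cmp B (fOb F (g b)) b c f (e b)"
    if "b \<in> Obj B" "c \<in> Obj B" "f \<in> Hom B b c" for b c f
    using that unfolding conj_def
    by (simp add: B.cmp_assoc[symmetric] B.cmp_id_left ee' functor_obj g eh e'h B.cmp_hom)
  have e_cancel: "h = h'" if "a \<in> Obj B" "c \<in> Obj B" "h \<in> Hom B a (fOb F (g c))" "h' \<in> Hom B a (fOb F (g c))"
    "Cmp B a (fOb F (g c)) c (e c) h = Cmp B a (fOb F (g c)) c (e c) h'" for a c h h'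
    by (rule B.cmp_cancel_left[OF _ _ _ eh e'h e'e]) (use that g functor_obj in auto)
  have G: "is_functor B A G"
  proof
    fix a assume a: "a \<in> Obj B"
    have "conj a a (Idm B a) = Idm B (fOb F (g a))"
      using a by (simp add: conj_def B.cmp_id_left e'e eh functor_obj g)
    then show "fMap G a a (Idm B a) = Idm A (fOb G a)"
      using a unfolding G_def
      by (auto intro!: inj[of "g a" "g a"] simp: g L B.idm_hom A.idm_hom functor_id functor_obj)
  next
    fix a b c f h assume *: "a \<in> Obj B" "b \<in> Obj B" "c \<in> Obj B" "f \<in> Hom B a b" "h \<in> Hom B b c"
    have "conj a c (Cmp B a b c h f) = Cmp B (fOb F (g a)) (fOb F (g b)) (fOb F (g c)) (conj b c h) (conj a b f)"
    proof (rule e_cancel)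
      show "Cmp B (fOb F (g a)) (fOb F (g c)) c (e c) (conj a c (Cmp B a b c h f)) =
        Cmp B (fOb F (g a)) (fOb F (g c)) c (e c) (Cmp B (fOb F (g a)) (fOb F (g b)) (fOb F (g c)) (conj b c h) (conj a b f))"
        using * by (simp add: Ge B.cmp_assoc[symmetric] B.cmp_hom functor_obj g eh conj)
          (simp add: Ge B.cmp_assoc B.cmp_hom functor_obj g eh conj)
    qed (use * in \<open>auto intro!: conj B.cmp_hom functor_obj g\<close>)
    then show "fMap G a c (Cmp B a b c h f) = Cmp A (fOb G a) (fOb G b) (fOb G c) (fMap G b c h) (fMap G a b f)"
      using * unfolding G_def
      by (auto intro!: inj[of "g a" "g c"] simp: g L conj A.cmp_hom functor_cmp B.cmp_hom functor_obj)
  qed (auto simp: G_def g L conj)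
  interpret G: is_functor B A G by (rule G)
  define \<eta> where "\<eta> a = L a (g (fOb F a)) (e' (fOb F a))" for a
  define \<eta>' where "\<eta>' a = L (g (fOb F a)) a (e (fOb F a))" for a
  have \<eta>: "\<eta> a \<in> Hom A a (g (fOb F a))" "fMap F a (g (fOb F a)) (\<eta> a) = e' (fOb F a)"
     "\<eta>' a \<in> Hom A (g (fOb F a)) a" "fMap F (g (fOb F a)) a (\<eta>' a) = e (fOb F a)" if "a \<in> Obj A" for a
    using that unfolding \<eta>_def \<eta>'_def by (auto intro!: L functor_obj g e'h eh)
  have GF: "is_functor A A (func_comp G F)"
    by unfold_locales (auto simp: func_comp_def functor_obj G.functor_obj functor_hom G.functor_hom functor_id
        G.functor_id functor_cmp G.functor_cmp)
  have FG: "is_functor B B (func_comp F G)"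
    by unfold_locales (auto simp: func_comp_def functor_obj G.functor_obj functor_hom G.functor_hom functor_id
        G.functor_id functor_cmp G.functor_cmp)
  have IA: "is_functor A A func_id" by unfold_locales (auto simp: func_id_def)
  have IB: "is_functor B B func_id" by unfold_locales (auto simp: func_id_def)
  have "natural_iso A A func_id (func_comp G F) \<eta>"
    unfolding natural_iso_def
  proof (intro conjI ballI IA GF)
    fix a assume a: "a \<in> Obj A"
    have "Cmp A a (g (fOb F a)) a (\<eta>' a) (\<eta> a) = Idm A a"
      by (rule inj[OF a a]) (use a in \<open>auto simp: \<eta> g functor_obj A.cmp_hom A.idm_hom functor_cmp functor_id ee'\<close>)
    moreover have "Cmp A (g (fOb F a)) a (g (fOb F a)) (\<eta> a) (\<eta>' a) = Idm A (g (fOb F a))"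
      by (rule inj[OF g[OF functor_obj[OF a]] g[OF functor_obj[OF a]]]) (use a in \<open>auto simp: \<eta> g functor_obj A.cmp_hom A.idm_hom functor_cmp functor_id e'e\<close>)
    ultimately show "iso_map A (fOb func_id a) (fOb (func_comp G F) a) (\<eta> a)"
      using \<eta>[OF a] by (auto simp: iso_map_def func_id_def func_comp_def G_def)
  next
    fix a b f assume *: "a \<in> Obj A" "b \<in> Obj A" "f \<in> Hom A a b"
    have "Cmp A a b (g (fOb F b)) (\<eta> b) f
        = Cmp A a (g (fOb F a)) (g (fOb F b)) (L (g (fOb F a)) (g (fOb F b)) (conj (fOb F a) (fOb F b) (fMap F a b f))) (\<eta> a)"
      by (rule inj[OF *(1) g[OF functor_obj[OF *(2)]]]) (use * in \<open>auto simp: \<eta> g functor_obj functor_hom L conj A.cmp_hom functor_cmp conj_def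
           B.cmp_assoc B.cmp_hom eh e'h ee' B.cmp_id_right\<close>)
    then show "Cmp A (fOb func_id a) (fOb func_id b) (fOb (func_comp G F) b) (\<eta> b) (fMap func_id a b f) =
      Cmp A (fOb func_id a) (fOb (func_comp G F) a) (fOb (func_comp G F) b) (fMap (func_comp G F) a b f) (\<eta> a)"
      by (simp add: func_id_def func_comp_def G_def)
  qed
  moreover have "natural_iso B B (func_comp F G) func_id e"
    unfolding natural_iso_def
  proof (intro conjI ballI IB FG)
    fix a b f assume *: "a \<in> Obj B" "b \<in> Obj B" "f \<in> Hom B a b"
    then show "Cmp B (fOb (func_comp F G) a) (fOb (func_comp F G) b) (fOb func_id b) (e b) (fMap (func_comp F G) a b f) =
      Cmp B (fOb (func_comp F G) a) (fOb func_id a) (fOb func_id b) (fMap func_id a b f) (e a)"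
      by (simp add: func_id_def func_comp_def G_def L g conj Ge)
  qed (use e in \<open>auto simp: func_id_def func_comp_def G_def\<close>)
  ultimately show ?thesis using F G by (auto simp: equivalence_def)
qed

lemma category_full_sub: "category A \<Longrightarrow> category (full_sub A S)"
  unfolding full_sub_def category_def by simp

lemma is_functor_full_sub:
  assumes "is_functor A B F" and "\<And>a. a \<in> Obj A \<Longrightarrow> a \<in> S \<Longrightarrow> fOb F a \<in> T"
  shows "is_functor (full_sub A S) (full_sub B T) F"
proof -
  interpret is_functor A B F by (rule assms(1))
  interpret A': category "full_sub A S" by (rule category_full_sub) unfold_locales
  interpret B': category "full_sub B T" by (rule category_full_sub) unfold_locales
  show ?thesis
    by unfold_locales (use assms(2) in \<open>auto simp: full_sub_def functor_obj functor_hom functor_id functor_cmp\<close>)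
qed

lemma full_sub_sub: "R \<subseteq> S \<Longrightarrow> full_sub (full_sub A S) R = full_sub A R"
  by (simp add: full_sub_def Int_absorb1 Int_assoc)

lemma full_sub_simps: "Obj (full_sub A S) = Obj A \<inter> S" "Hom (full_sub A S) = Hom A"
  "Idm (full_sub A S) = Idm A" "Cmp (full_sub A S) = Cmp A"
  by (simp_all add: full_sub_def)

lemma full_subcategory_full_sub: "R \<subseteq> S \<Longrightarrow> full_subcategory (full_sub A R) (full_sub A S)"
  by (auto simp: full_subcategory_def full_sub_simps)

lemma iso_map_full_sub: "iso_map (full_sub A S) a b f \<longleftrightarrow> iso_map A a b f"
  by (simp add: iso_map_def full_sub_simps)

lemma fully_faithful_full_sub:
  "fully_faithful A B F \<Longrightarrow> fully_faithful (full_sub A S) (full_sub B T) F"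
  by (simp add: fully_faithful_def full_sub_simps)

lemma is_functor_comp:
  assumes "is_functor A B F" "is_functor B C G" shows "is_functor A C (func_comp G F)"
proof -
  interpret F: is_functor A B F by fact
  interpret G: is_functor B C G by fact
  show ?thesis
    by unfold_locales (simp_all add: func_comp_def F.functor_obj G.functor_obj F.functor_hom G.functor_hom
      F.functor_id G.functor_id F.functor_cmp G.functor_cmp)
qed

lemma is_functor_func_eq:
  assumes "is_functor A B G" "func_eq A F G" shows "is_functor A B F"
proof -
  interpret G: is_functor A B G by fact
  show ?thesis
    using assms(2)
    by unfold_locales (simp_all add: func_eq_def G.functor_obj G.functor_hom G.functor_id G.functor_cmp
      G.A.idm_hom G.A.cmp_hom)
qed

lemma fully_faithful_cancel:
  assumes eq: "func_eq A T (func_comp K U)" and T: "fully_faithful A C T" and K: "fully_faithful B C K"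
    and U: "is_functor A B U"
  shows "fully_faithful A B U"
  unfolding fully_faithful_def
proof (intro ballI bij_betw_imageI)
  interpret U: is_functor A B U by (rule U)
  fix a b assume o: "a \<in> Obj A" "b \<in> Obj A"
  have e: "fMap T a b f = fMap K (fOb U a) (fOb U b) (fMap U a b f)" if "f \<in> Hom A a b" for f
    using eq o that by (simp add: func_eq_def func_comp_def)
  have e': "fOb T a = fOb K (fOb U a)" "fOb T b = fOb K (fOb U b)"
    using eq o by (simp_all add: func_eq_def func_comp_def)
  show "inj_on (fMap U a b) (Hom A a b)"
    using fully_faithful_inj[OF T o] e by (intro inj_onI) metis
  show "fMap U a b ` Hom A a b = Hom B (fOb U a) (fOb U b)"
  proof (intro equalityI subsetI)
    show "g \<in> Hom B (fOb U a) (fOb U b)" if "g \<in> fMap U a b ` Hom A a b" for g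
      using that o by (auto simp: U.functor_hom)
    fix g assume g: "g \<in> Hom B (fOb U a) (fOb U b)"
    note uo = U.functor_obj[OF o(1)] U.functor_obj[OF o(2)]
    have "fMap K (fOb U a) (fOb U b) g \<in> Hom C (fOb T a) (fOb T b)"
      unfolding e' using K uo g unfolding fully_faithful_def by (metis bij_betw_apply)
    then obtain f where f: "f \<in> Hom A a b" "fMap T a b f = fMap K (fOb U a) (fOb U b) g"
      using T o unfolding fully_faithful_def by (metis bij_betw_imp_surj_on imageE)
    then have "fMap U a b f = g"
      using fully_faithful_inj[OF K uo] e[OF f(1)] U.functor_hom[OF o f(1)] g by metis
    then show "g \<in> fMap U a b ` Hom A a b" using f(1) by blast
  qed
qed

section \<open>Arrows of skew monoidal categories\<close>

text \<open>
  Hom-sets need not be disjoint, so operations on raw maps take the objects involved as arguments. On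
  triples of domain, raw map and codomain they become operations in the usual sense, for which the laws
  can be used as rewrite rules. The projections are polymorphic because they also serve multimaps, whose
  domain is a list.
\<close>

type_synonym ('o, 'm) arrow = "'o \<times> 'm \<times> 'o"

abbreviation src :: "'a \<times> 'b \<times> 'c \<Rightarrow> 'a" where "src \<equiv> fst"
abbreviation raw :: "'a \<times> 'b \<times> 'c \<Rightarrow> 'b" where "raw f \<equiv> fst (snd f)"
abbreviation trg :: "'a \<times> 'b \<times> 'c \<Rightarrow> 'c" where "trg f \<equiv> snd (snd f)"

definition arr :: "('o, 'm, 'x) cat_scheme \<Rightarrow> ('o, 'm) arrow set" where
  "arr C = {f. src f \<in> Obj C \<and> trg f \<in> Obj C \<and> raw f \<in> Hom C (src f) (trg f)}"

definition ida :: "('o, 'm, 'x) cat_scheme \<Rightarrow> 'o \<Rightarrow> ('o, 'm) arrow" (\<open>\<one>\<index>\<close>) where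
  "ida C a = (a, Idm C a, a)"

definition cmpa :: "('o, 'm, 'x) cat_scheme \<Rightarrow> ('o, 'm) arrow \<Rightarrow> ('o, 'm) arrow \<Rightarrow> ('o, 'm) arrow"
    (infixr \<open>\<cdot>\<index>\<close> 65) where
  "cmpa C g f = (src f, Cmp C (src f) (trg f) (trg g) (raw g) (raw f), trg g)"

definition tena :: "('o, 'm) skmon \<Rightarrow> ('o, 'm) arrow \<Rightarrow> ('o, 'm) arrow \<Rightarrow> ('o, 'm) arrow"
    (infixl \<open>\<boxtimes>\<index>\<close> 75) where
  "tena C f g = (ten C (src f) (src g), tenm C (src f) (trg f) (src g) (trg g) (raw f) (raw g),
     ten C (trg f) (trg g))"

definition alpa :: "('o, 'm) skmon \<Rightarrow> 'o \<Rightarrow> 'o \<Rightarrow> 'o \<Rightarrow> ('o, 'm) arrow" (\<open>\<a>\<index>\<close>) where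
  "alpa C a b c = (ten C (ten C a b) c, alp C a b c, ten C a (ten C b c))"

definition lama :: "('o, 'm) skmon \<Rightarrow> 'o \<Rightarrow> ('o, 'm) arrow" (\<open>\<l>\<index>\<close>) where
  "lama C a = (ten C (unt C) a, lam C a, a)"

definition rhoa :: "('o, 'm) skmon \<Rightarrow> 'o \<Rightarrow> ('o, 'm) arrow" (\<open>\<r>\<index>\<close>) where
  "rhoa C a = (a, rho C a, ten C a (unt C))"

lemma src_trg [simp]:
  "src (ida C a) = a" "trg (ida C a) = a"
  "src (cmpa C g f) = src f" "trg (cmpa C g f) = trg g"
  "src (tena D f g) = ten D (src f) (src g)" "trg (tena D f g) = ten D (trg f) (trg g)"
  "src (alpa D a b c) = ten D (ten D a b) c" "trg (alpa D a b c) = ten D a (ten D b c)"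
  "src (lama D a) = ten D (unt D) a" "trg (lama D a) = a"
  "src (rhoa D a) = a" "trg (rhoa D a) = ten D a (unt D)"
  by (simp_all add: ida_def cmpa_def tena_def alpa_def lama_def rhoa_def)

lemma arr_obj: "f \<in> arr C \<Longrightarrow> src f \<in> Obj C" "f \<in> arr C \<Longrightarrow> trg f \<in> Obj C"
  by (auto simp: arr_def)

context category begin

lemma ida_arr [simp]: "a \<in> Obj C \<Longrightarrow> ida C a \<in> arr C"
  by (simp add: arr_def ida_def idm_hom)

lemma cmpa_arr [simp]: "f \<in> arr C \<Longrightarrow> g \<in> arr C \<Longrightarrow> src g = trg f \<Longrightarrow> cmpa C g f \<in> arr C"
  by (auto simp: arr_def cmpa_def cmp_hom)

lemma cmpa_id [simp]:
  "f \<in> arr C \<Longrightarrow> trg f = a \<Longrightarrow> cmpa C (ida C a) f = f"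
  "f \<in> arr C \<Longrightarrow> src f = a \<Longrightarrow> cmpa C f (ida C a) = f"
  by (auto simp: arr_def cmpa_def ida_def cmp_id_left cmp_id_right)

lemma cmpa_assoc [simp]:
  "f \<in> arr C \<Longrightarrow> g \<in> arr C \<Longrightarrow> h \<in> arr C \<Longrightarrow> src g = trg f \<Longrightarrow> src h = trg g
    \<Longrightarrow> cmpa C (cmpa C h g) f = cmpa C h (cmpa C g f)"
  by (auto simp: arr_def cmpa_def cmp_assoc)

end

text \<open>Below, skew monoidal categories are constructed and used only through the axioms in this form.\<close>

lemma skew_monoidalI:
  fixes C :: "('o, 'm) skmon" (structure)
  assumes C: "category C" and i: "\<i> \<in> Obj C"
    and ten: "\<And>a b. a \<in> Obj C \<Longrightarrow> b \<in> Obj C \<Longrightarrow> a \<otimes> b \<in> Obj C"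
    and tena: "\<And>f g. f \<in> arr C \<Longrightarrow> g \<in> arr C \<Longrightarrow> f \<boxtimes> g \<in> arr C"
    and tid: "\<And>a b. a \<in> Obj C \<Longrightarrow> b \<in> Obj C \<Longrightarrow> ida C a \<boxtimes> ida C b = ida C (a \<otimes> b)"
    and tcmp: "\<And>f g f' g'. f \<in> arr C \<Longrightarrow> g \<in> arr C \<Longrightarrow> f' \<in> arr C \<Longrightarrow> g' \<in> arr C \<Longrightarrow> src f' = trg f
        \<Longrightarrow> src g' = trg g \<Longrightarrow> (f' \<cdot> f) \<boxtimes> (g' \<cdot> g) = (f' \<boxtimes> g') \<cdot> (f \<boxtimes> g)"
    and al: "\<And>a b c. a \<in> Obj C \<Longrightarrow> b \<in> Obj C \<Longrightarrow> c \<in> Obj C \<Longrightarrow> alpa C a b c \<in> arr C"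
    and la: "\<And>a. a \<in> Obj C \<Longrightarrow> lama C a \<in> arr C"
    and ro: "\<And>a. a \<in> Obj C \<Longrightarrow> rhoa C a \<in> arr C"
    and aln: "\<And>f g h. f \<in> arr C \<Longrightarrow> g \<in> arr C \<Longrightarrow> h \<in> arr C \<Longrightarrow>
        alpa C (trg f) (trg g) (trg h) \<cdot> (f \<boxtimes> g \<boxtimes> h) = (f \<boxtimes> (g \<boxtimes> h)) \<cdot> alpa C (src f) (src g) (src h)"
    and lan: "\<And>f. f \<in> arr C \<Longrightarrow> lama C (trg f) \<cdot> (ida C \<i> \<boxtimes> f) = f \<cdot> lama C (src f)"
    and ron: "\<And>f. f \<in> arr C \<Longrightarrow> rhoa C (trg f) \<cdot> f = (f \<boxtimes> ida C \<i>) \<cdot> rhoa C (src f)"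
    and pent: "\<And>a b c d. a \<in> Obj C \<Longrightarrow> b \<in> Obj C \<Longrightarrow> c \<in> Obj C \<Longrightarrow> d \<in> Obj C \<Longrightarrow>
        alpa C a b (c \<otimes> d) \<cdot> alpa C (a \<otimes> b) c d
      = (ida C a \<boxtimes> alpa C b c d) \<cdot> alpa C a (b \<otimes> c) d \<cdot> (alpa C a b c \<boxtimes> ida C d)"
    and lunit: "\<And>a b. a \<in> Obj C \<Longrightarrow> b \<in> Obj C \<Longrightarrow>
        lama C (a \<otimes> b) \<cdot> alpa C \<i> a b = lama C a \<boxtimes> ida C b"
    and runit: "\<And>a b. a \<in> Obj C \<Longrightarrow> b \<in> Obj C \<Longrightarrow>
        alpa C a b \<i> \<cdot> rhoa C (a \<otimes> b) = ida C a \<boxtimes> rhoa C b"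
    and munit: "\<And>a b. a \<in> Obj C \<Longrightarrow> b \<in> Obj C \<Longrightarrow>
        (ida C a \<boxtimes> lama C b) \<cdot> alpa C a \<i> b \<cdot> (rhoa C a \<boxtimes> ida C b) = ida C (a \<otimes> b)"
    and uunit: "lama C \<i> \<cdot> rhoa C \<i> = ida C \<i>"
  shows "skew_monoidal C"
proof -
  interpret category C by (rule C)
  note defs = arr_def ida_def cmpa_def tena_def alpa_def lama_def rhoa_def
  have prod: "category (prod_cat C C)"
    by unfold_locales (auto simp: prod_cat_def idm_hom cmp_hom cmp_id_left cmp_id_right cmp_assoc)
  interpret P: category "prod_cat C C" by (rule prod)
  have tens: "is_functor (prod_cat C C) C (tensor_functor C)"
  proof
    fix x y f assume "x \<in> Obj (prod_cat C C)" "y \<in> Obj (prod_cat C C)" "f \<in> Hom (prod_cat C C) x y"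
    then show "fMap (tensor_functor C) x y f \<in> Hom C (fOb (tensor_functor C) x) (fOb (tensor_functor C) y)"
      using tena[of "(fst x, fst f, fst y)" "(snd x, snd f, snd y)"]
      by (auto simp: prod_cat_def tensor_functor_def defs)
  next
    fix x assume "x \<in> Obj (prod_cat C C)"
    then show "fMap (tensor_functor C) x x (Idm (prod_cat C C) x) = Idm C (fOb (tensor_functor C) x)"
      using tid[of "fst x" "snd x"] by (auto simp: prod_cat_def tensor_functor_def defs)
  next
    fix x y z f g assume "x \<in> Obj (prod_cat C C)" "y \<in> Obj (prod_cat C C)" "z \<in> Obj (prod_cat C C)"
      "f \<in> Hom (prod_cat C C) x y" "g \<in> Hom (prod_cat C C) y z"
    then show "fMap (tensor_functor C) x z (Cmp (prod_cat C C) x y z g f)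
       = Cmp C (fOb (tensor_functor C) x) (fOb (tensor_functor C) y) (fOb (tensor_functor C) z)
        (fMap (tensor_functor C) y z g) (fMap (tensor_functor C) x y f)"
      using tcmp[of "(fst x, fst f, fst y)" "(snd x, snd f, snd y)" "(fst y, fst g, fst z)" "(snd y, snd g, snd z)"]
      by (auto simp: prod_cat_def tensor_functor_def defs)
  qed (auto simp: prod_cat_def tensor_functor_def ten)
  show ?thesis
  proof (rule skew_monoidal.intro, rule C, rule skew_monoidal_axioms.intro)
    fix a a' b b' c c' f g h
    assume "a \<in> Obj C" "a' \<in> Obj C" "b \<in> Obj C" "b' \<in> Obj C" "c \<in> Obj C" "c' \<in> Obj C"
      "f \<in> Hom C a a'" "g \<in> Hom C b b'" "h \<in> Hom C c c'"
    then show "Cmp C (a \<otimes> b \<otimes> c) (a' \<otimes> b' \<otimes> c') (a' \<otimes> (b' \<otimes> c'))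
            (alp C a' b' c') (tenm C (a \<otimes> b) (a' \<otimes> b') c c' (tenm C a a' b b' f g) h)
        = Cmp C (a \<otimes> b \<otimes> c) (a \<otimes> (b \<otimes> c)) (a' \<otimes> (b' \<otimes> c'))
            (tenm C a a' (b \<otimes> c) (b' \<otimes> c') f (tenm C b b' c c' g h)) (alp C a b c)"
      using aln[of "(a, f, a')" "(b, g, b')" "(c, h, c')"] by (simp add: defs)
  next
    fix a a' f assume "a \<in> Obj C" "a' \<in> Obj C" "f \<in> Hom C a a'"
    then show "Cmp C (\<i> \<otimes> a) (\<i> \<otimes> a') a' (lam C a') (tenm C \<i> \<i> a a' (Idm C \<i>) f)
        = Cmp C (\<i> \<otimes> a) a a' f (lam C a)"
      and "Cmp C a a' (a' \<otimes> \<i>) (rho C a') f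
        = Cmp C a (a \<otimes> \<i>) (a' \<otimes> \<i>) (tenm C a a' \<i> \<i> f (Idm C \<i>)) (rho C a)"
      using lan[of "(a, f, a')"] ron[of "(a, f, a')"] by (simp_all add: defs)
  qed (use tens i ten al la ro pent lunit runit munit uunit in \<open>auto simp: defs\<close>)
qed

context skew_monoidal begin

lemma ten_obj [simp]: "a \<in> Obj C \<Longrightarrow> b \<in> Obj C \<Longrightarrow> a \<otimes> b \<in> Obj C"
  using is_functor.functor_obj[OF tensor, of "(a, b)"] by (simp add: prod_cat_def tensor_functor_def)

lemma unit_obj' [simp]: "\<i> \<in> Obj C" by (rule unit_obj)

lemma tena_arr [simp]: "f \<in> arr C \<Longrightarrow> g \<in> arr C \<Longrightarrow> f \<boxtimes> g \<in> arr C"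
  using is_functor.functor_hom[OF tensor, of "(src f, src g)" "(trg f, trg g)" "(raw f, raw g)"]
  by (auto simp: arr_def tena_def prod_cat_def tensor_functor_def)

lemma tena_id [simp]: "a \<in> Obj C \<Longrightarrow> b \<in> Obj C \<Longrightarrow> ida C a \<boxtimes> ida C b = ida C (a \<otimes> b)"
  using is_functor.functor_id[OF tensor, of "(a, b)"]
  by (auto simp: ida_def tena_def prod_cat_def tensor_functor_def)

lemma tena_cmp:
  "f \<in> arr C \<Longrightarrow> g \<in> arr C \<Longrightarrow> f' \<in> arr C \<Longrightarrow> g' \<in> arr C \<Longrightarrow> src f' = trg f \<Longrightarrow> src g' = trg g
    \<Longrightarrow> (f' \<cdot> f) \<boxtimes> (g' \<cdot> g) = (f' \<boxtimes> g') \<cdot> (f \<boxtimes> g)"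
  using is_functor.functor_cmp[OF tensor, of "(src f, src g)" "(trg f, trg g)" "(trg f', trg g')"
      "(raw f, raw g)" "(raw f', raw g')"]
  by (auto simp: arr_def tena_def cmpa_def prod_cat_def tensor_functor_def)

lemma struct_arr [simp]:
  "a \<in> Obj C \<Longrightarrow> b \<in> Obj C \<Longrightarrow> c \<in> Obj C \<Longrightarrow> alpa C a b c \<in> arr C"
  "a \<in> Obj C \<Longrightarrow> lama C a \<in> arr C" "a \<in> Obj C \<Longrightarrow> rhoa C a \<in> arr C"
  by (auto simp: arr_def alpa_def lama_def rhoa_def alp_hom lam_hom rho_hom)

lemma alpa_natural:
  "f \<in> arr C \<Longrightarrow> g \<in> arr C \<Longrightarrow> h \<in> arr C \<Longrightarrow>
    alpa C (trg f) (trg g) (trg h) \<cdot> (f \<boxtimes> g \<boxtimes> h) = (f \<boxtimes> (g \<boxtimes> h)) \<cdot> alpa C (src f) (src g) (src h)"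
  by (auto simp: arr_def alpa_def cmpa_def tena_def alp_natural)

lemma lama_natural: "f \<in> arr C \<Longrightarrow> lama C (trg f) \<cdot> (ida C \<i> \<boxtimes> f) = f \<cdot> lama C (src f)"
  by (auto simp: arr_def lama_def cmpa_def tena_def ida_def lam_natural)

lemma rhoa_natural: "f \<in> arr C \<Longrightarrow> rhoa C (trg f) \<cdot> f = (f \<boxtimes> ida C \<i>) \<cdot> rhoa C (src f)"
  by (auto simp: arr_def rhoa_def cmpa_def tena_def ida_def rho_natural)

lemma pentagona:
  "a \<in> Obj C \<Longrightarrow> b \<in> Obj C \<Longrightarrow> c \<in> Obj C \<Longrightarrow> d \<in> Obj C \<Longrightarrow>
    alpa C a b (c \<otimes> d) \<cdot> alpa C (a \<otimes> b) c d
    = (ida C a \<boxtimes> alpa C b c d) \<cdot> alpa C a (b \<otimes> c) d \<cdot> (alpa C a b c \<boxtimes> ida C d)"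
  by (simp add: alpa_def cmpa_def tena_def ida_def pentagon)

lemma left_unita: "a \<in> Obj C \<Longrightarrow> b \<in> Obj C \<Longrightarrow> lama C (a \<otimes> b) \<cdot> alpa C \<i> a b = lama C a \<boxtimes> ida C b"
  by (simp add: alpa_def cmpa_def tena_def ida_def lama_def left_unit)

lemma right_unita: "a \<in> Obj C \<Longrightarrow> b \<in> Obj C \<Longrightarrow> alpa C a b \<i> \<cdot> rhoa C (a \<otimes> b) = ida C a \<boxtimes> rhoa C b"
  by (simp add: alpa_def cmpa_def tena_def ida_def rhoa_def right_unit)

lemma middle_unita: "a \<in> Obj C \<Longrightarrow> b \<in> Obj C \<Longrightarrow>
    (ida C a \<boxtimes> lama C b) \<cdot> alpa C a \<i> b \<cdot> (rhoa C a \<boxtimes> ida C b) = ida C (a \<otimes> b)"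
  by (simp add: alpa_def cmpa_def tena_def ida_def lama_def rhoa_def middle_unit)

lemma unit_unita: "lama C \<i> \<cdot> rhoa C \<i> = ida C \<i>"
  by (simp add: cmpa_def ida_def lama_def rhoa_def unit_unit)

declare arr_obj [simp]

lemma tena_cmp_id:
  "f \<in> arr C \<Longrightarrow> f' \<in> arr C \<Longrightarrow> a \<in> Obj C \<Longrightarrow> src f' = trg f
    \<Longrightarrow> (f' \<cdot> f) \<boxtimes> ida C a = (f' \<boxtimes> ida C a) \<cdot> (f \<boxtimes> ida C a)"
  using tena_cmp[of f "ida C a" f' "ida C a"] by simp

lemma tena_id_cmp:
  "f \<in> arr C \<Longrightarrow> f' \<in> arr C \<Longrightarrow> a \<in> Obj C \<Longrightarrow> src f' = trg f
    \<Longrightarrow> ida C a \<boxtimes> (f' \<cdot> f) = (ida C a \<boxtimes> f') \<cdot> (ida C a \<boxtimes> f)"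
  using tena_cmp[of "ida C a" f "ida C a" f'] by simp

lemma interchange:
  "f \<in> arr C \<Longrightarrow> g \<in> arr C
    \<Longrightarrow> (f \<boxtimes> ida C (trg g)) \<cdot> (ida C (src f) \<boxtimes> g) = f \<boxtimes> g"
  "f \<in> arr C \<Longrightarrow> g \<in> arr C
    \<Longrightarrow> (ida C (trg f) \<boxtimes> g) \<cdot> (f \<boxtimes> ida C (src g)) = f \<boxtimes> g"
  using tena_cmp[of "ida C (src f)" g f "ida C (trg g)"] tena_cmp[of f "ida C (src g)" "ida C (trg f)" g]
  by simp_all

text \<open>Every law \<open>p \<cdot> q = r\<close> is also needed in the form \<open>p \<cdot> (q \<cdot> k) = r \<cdot> k\<close>.\<close>

lemma cmpa_reassoc:
  "p \<cdot> q = r \<Longrightarrow> k \<in> arr C \<Longrightarrow> q \<in> arr C \<Longrightarrow> p \<in> arr C \<Longrightarrow> src q = trg k \<Longrightarrow> src p = trg q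
    \<Longrightarrow> p \<cdot> q \<cdot> k = r \<cdot> k"
  by (metis cmpa_assoc)

end

section \<open>Iterated tensor products and whiskering\<close>

context skew_monoidal begin

abbreviation tens :: "'o \<Rightarrow> 'o list \<Rightarrow> 'o" where "tens \<equiv> foldl (ten C)"

lemma tens_obj [simp]: "x \<in> Obj C \<Longrightarrow> as \<in> lists (Obj C) \<Longrightarrow> tens x as \<in> Obj C"
  by (induction as arbitrary: x) auto

primrec act :: "('o, 'm) arrow \<Rightarrow> 'o list \<Rightarrow> ('o, 'm) arrow" where
  "act f [] = f"
| "act f (a # as) = act (f \<boxtimes> ida C a) as"

text \<open>
  For \<open>f : w \<rightarrow> x \<otimes> y\<close> the arrow \<open>bet x y f as : w as \<rightarrow> x \<otimes> (y as)\<close> shifts the brackets around the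
  factors \<open>as\<close> to the right.
\<close>

primrec bet :: "'o \<Rightarrow> 'o \<Rightarrow> ('o, 'm) arrow \<Rightarrow> 'o list \<Rightarrow> ('o, 'm) arrow" where
  "bet x y f [] = f"
| "bet x y f (a # as) = bet x (y \<otimes> a) (alpa C x y a \<cdot> (f \<boxtimes> ida C a)) as"

lemma act_append: "act f (as @ bs) = act (act f as) bs"
  by (induction as arbitrary: f) auto

lemma act_src_trg [simp]: "src (act f as) = tens (src f) as" "trg (act f as) = tens (trg f) as"
  by (induction as arbitrary: f) auto

lemma act_arr [simp]: "f \<in> arr C \<Longrightarrow> as \<in> lists (Obj C) \<Longrightarrow> act f as \<in> arr C"
  by (induction as arbitrary: f) auto

lemma act_id [simp]: "a \<in> Obj C \<Longrightarrow> as \<in> lists (Obj C) \<Longrightarrow> act (ida C a) as = ida C (tens a as)"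
  by (induction as arbitrary: a) auto

lemma act_cmp:
  "f \<in> arr C \<Longrightarrow> g \<in> arr C \<Longrightarrow> src g = trg f \<Longrightarrow> as \<in> lists (Obj C)
    \<Longrightarrow> act (g \<cdot> f) as = act g as \<cdot> act f as"
  by (induction as arbitrary: f g) (auto simp: tena_cmp_id)

lemma bet_append: "bet x y f (as @ bs) = bet x (tens y as) (bet x y f as) bs"
  by (induction as arbitrary: f y) auto

lemma bet_src [simp]: "src (bet x y f as) = tens (src f) as"
  by (induction as arbitrary: f y) auto

lemma bet_trg [simp]: "trg f = x \<otimes> y \<Longrightarrow> trg (bet x y f as) = x \<otimes> tens y as"
  by (induction as arbitrary: f y) auto

lemma bet_arr [simp]:
  "f \<in> arr C \<Longrightarrow> trg f = x \<otimes> y \<Longrightarrow> x \<in> Obj C \<Longrightarrow> y \<in> Obj C \<Longrightarrow> as \<in> lists (Obj C) \<Longrightarrow> bet x y f as \<in> arr C"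
  by (induction as arbitrary: f y) auto

lemma bet_pre:
  assumes "f \<in> arr C" "g \<in> arr C" "src f = trg g" "trg f = x \<otimes> y" "x \<in> Obj C" "y \<in> Obj C" "as \<in> lists (Obj C)"
  shows "bet x y (f \<cdot> g) as = bet x y f as \<cdot> act g as"
  using assms
proof (induction as arbitrary: f g y)
  case (Cons a as)
  have "alpa C x y a \<cdot> ((f \<cdot> g) \<boxtimes> ida C a) = (alpa C x y a \<cdot> (f \<boxtimes> ida C a)) \<cdot> (g \<boxtimes> ida C a)"
    using Cons.prems by (simp add: tena_cmp_id)
  then show ?case using Cons.prems by (simp del: cmpa_assoc add: Cons.IH)
qed auto

lemma bet_post:
  assumes "f \<in> arr C" "p \<in> arr C" "q \<in> arr C" "trg f = src p \<otimes> src q" "as \<in> lists (Obj C)"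
  shows "bet (trg p) (trg q) ((p \<boxtimes> q) \<cdot> f) as = (p \<boxtimes> act q as) \<cdot> bet (src p) (src q) f as"
  using assms
proof (induction as arbitrary: f q)
  case (Cons a as)
  have "alpa C (trg p) (trg q) a \<cdot> ((p \<boxtimes> q) \<cdot> f) \<boxtimes> ida C a
      = alpa C (trg p) (trg q) a \<cdot> (p \<boxtimes> q \<boxtimes> ida C a) \<cdot> (f \<boxtimes> ida C a)"
    using Cons.prems by (simp add: tena_cmp_id)
  also have "\<dots> = (p \<boxtimes> (q \<boxtimes> ida C a)) \<cdot> alpa C (src p) (src q) a \<cdot> (f \<boxtimes> ida C a)"
    using Cons.prems alpa_natural[of p q "ida C a"] by (subst cmpa_reassoc) auto
  finally show ?case using Cons.prems
    Cons.IH[of "alpa C (src p) (src q) a \<cdot> (f \<boxtimes> ida C a)" "q \<boxtimes> ida C a"] by simp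
qed auto

text \<open>The pentagon law, iterated over the factors \<open>as\<close>.\<close>

lemma bet_alpa:
  assumes "f \<in> arr C" "trg f = x \<otimes> y \<otimes> z" "x \<in> Obj C" "y \<in> Obj C" "z \<in> Obj C" "as \<in> lists (Obj C)"
  shows "alpa C x y (tens z as) \<cdot> bet (x \<otimes> y) z f as
    = (ida C x \<boxtimes> bet y z (ida C (y \<otimes> z)) as) \<cdot> bet x (y \<otimes> z) (alpa C x y z \<cdot> f) as"
  using assms(6)
proof (induction as rule: rev_induct)
  case (snoc a as)
  let ?u = "tens z as"
  let ?b = "bet y z (ida C (y \<otimes> z)) as"
  let ?c = "bet x (y \<otimes> z) (alpa C x y z \<cdot> f) as"
  let ?d = "bet (x \<otimes> y) z f as"
  have a: "a \<in> Obj C" "as \<in> lists (Obj C)" using snoc.prems by auto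
  note o = a assms
  have "alpa C x y (?u \<otimes> a) \<cdot> alpa C (x \<otimes> y) ?u a \<cdot> (?d \<boxtimes> ida C a)
     = (ida C x \<boxtimes> alpa C y ?u a) \<cdot> alpa C x (y \<otimes> ?u) a \<cdot> (alpa C x y ?u \<boxtimes> ida C a) \<cdot> (?d \<boxtimes> ida C a)"
    using o cmpa_reassoc[OF pentagona[of x y ?u a], of "?d \<boxtimes> ida C a"] by simp
  also have "(alpa C x y ?u \<boxtimes> ida C a) \<cdot> (?d \<boxtimes> ida C a) = (alpa C x y ?u \<cdot> ?d) \<boxtimes> ida C a"
    using o by (simp add: tena_cmp_id)
  also have "\<dots> = (ida C x \<boxtimes> ?b \<boxtimes> ida C a) \<cdot> (?c \<boxtimes> ida C a)"
    using o snoc.IH by (simp add: tena_cmp_id)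
  also have "alpa C x (y \<otimes> ?u) a \<cdot> (ida C x \<boxtimes> ?b \<boxtimes> ida C a) \<cdot> (?c \<boxtimes> ida C a)
      = (ida C x \<boxtimes> (?b \<boxtimes> ida C a)) \<cdot> alpa C x (tens (y \<otimes> z) as) a \<cdot> (?c \<boxtimes> ida C a)"
    using o cmpa_reassoc[OF alpa_natural[of "ida C x" ?b "ida C a"], of "?c \<boxtimes> ida C a"] by simp
  finally show ?case using o by (simp add: bet_append tena_id_cmp)
qed (use assms in auto)

text \<open>The left unit law, iterated over the factors \<open>as\<close>.\<close>

lemma lama_bet:
  assumes "f \<in> arr C" "trg f = \<i> \<otimes> y" "y \<in> Obj C" "as \<in> lists (Obj C)"
  shows "lama C (tens y as) \<cdot> bet \<i> y f as = act (lama C y \<cdot> f) as"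
  using assms(4)
proof (induction as rule: rev_induct)
  case (snoc a as)
  then have a: "a \<in> Obj C" "as \<in> lists (Obj C)" by auto
  let ?u = "tens y as"
  have "lama C (?u \<otimes> a) \<cdot> alpa C \<i> ?u a \<cdot> (bet \<i> y f as \<boxtimes> ida C a)
     = (lama C ?u \<boxtimes> ida C a) \<cdot> (bet \<i> y f as \<boxtimes> ida C a)"
    using a assms cmpa_reassoc[OF left_unita[of ?u a], of "bet \<i> y f as \<boxtimes> ida C a"] by simp
  also have "\<dots> = act (lama C y \<cdot> f) as \<boxtimes> ida C a"
    using a assms snoc.IH by (simp flip: tena_cmp_id)
  finally show ?case using a assms by (simp add: bet_append act_append)
qed auto

lemma lama_bet_unit: "as \<in> lists (Obj C) \<Longrightarrow> lama C (tens \<i> as) \<cdot> bet \<i> \<i> (rhoa C \<i>) as = ida C (tens \<i> as)"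
  using lama_bet[of "rhoa C \<i>" \<i> as] by (simp add: unit_unita)

text \<open>
  A multimap \<open>g : as \<rightarrow> b\<close> is given by an arrow \<open>i as \<rightarrow> b\<close>. It induces for every object \<open>x\<close> an arrow
  \<open>wh x as g : x as \<rightarrow> x \<otimes> b\<close>, which places the multimap to the right of \<open>x\<close>.
\<close>

definition wh :: "'o \<Rightarrow> 'o list \<Rightarrow> ('o, 'm) arrow \<Rightarrow> ('o, 'm) arrow" where
  "wh x as g = (ida C x \<boxtimes> g) \<cdot> bet x \<i> (rhoa C x) as"

lemma wh_src_trg [simp]: "src (wh x as g) = tens x as" "trg (wh x as g) = x \<otimes> trg g"
  by (simp_all add: wh_def)

lemma wh_arr [simp]:
  "g \<in> arr C \<Longrightarrow> src g = tens \<i> as \<Longrightarrow> x \<in> Obj C \<Longrightarrow> as \<in> lists (Obj C) \<Longrightarrow> wh x as g \<in> arr C"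
  by (simp add: wh_def)

text \<open>This will be the left identity law of \<open>multi_of\<close>, in which \<open>\<lambda>\<close> serves as the identity.\<close>

lemma wh_unit:
  "g \<in> arr C \<Longrightarrow> src g = tens \<i> as \<Longrightarrow> as \<in> lists (Obj C) \<Longrightarrow> lama C (trg g) \<cdot> wh \<i> as g = g"
  unfolding wh_def
  by (subst cmpa_reassoc[OF lama_natural]) (auto simp: lama_bet_unit)

text \<open>This will be the right identity law of \<open>multi_of\<close>; it is the middle unit law in disguise.\<close>

lemma wh_lama: "x \<in> Obj C \<Longrightarrow> a \<in> Obj C \<Longrightarrow> wh x [a] (lama C a) = ida C (x \<otimes> a)"
  by (simp add: wh_def middle_unita)

text \<open>
  Maps to the left of a whiskered multimap can be moved past it. This will be the associativity law for
  parallel substitutions in \<open>multi_of\<close>.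
\<close>

lemma wh_natural:
  assumes "p \<in> arr C" "g \<in> arr C" "src g = tens \<i> as" "as \<in> lists (Obj C)"
  shows "wh (trg p) as g \<cdot> act p as = (p \<boxtimes> ida C (trg g)) \<cdot> wh (src p) as g"
proof -
  have "bet (trg p) \<i> (rhoa C (trg p)) as \<cdot> act p as = bet (trg p) \<i> ((p \<boxtimes> ida C \<i>) \<cdot> rhoa C (src p)) as"
    using assms by (simp add: rhoa_natural flip: bet_pre)
  also have "\<dots> = (p \<boxtimes> ida C (tens \<i> as)) \<cdot> bet (src p) \<i> (rhoa C (src p)) as"
    using bet_post[of "rhoa C (src p)" p "ida C \<i>" as] assms by simp
  finally have *: "bet (trg p) \<i> (rhoa C (trg p)) as \<cdot> act p as
      = (p \<boxtimes> ida C (tens \<i> as)) \<cdot> bet (src p) \<i> (rhoa C (src p)) as" .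
  show ?thesis
    using assms cmpa_reassoc[OF interchange(2)[of p g], of "bet (src p) \<i> (rhoa C (src p)) as"]
      cmpa_reassoc[OF interchange(1)[of p g], of "bet (src p) \<i> (rhoa C (src p)) as"]
    by (simp add: wh_def *)
qed

lemma wh_alpa:
  assumes "g \<in> arr C" "src g = tens \<i> as" "as \<in> lists (Obj C)" "x \<in> Obj C" "y \<in> Obj C"
  shows "alpa C x y (trg g) \<cdot> wh (x \<otimes> y) as g = (ida C x \<boxtimes> wh y as g) \<cdot> bet x y (ida C (x \<otimes> y)) as"
proof -
  let ?b = "bet y \<i> (ida C (y \<otimes> \<i>)) as"
  have "alpa C x y (trg g) \<cdot> wh (x \<otimes> y) as g
      = (ida C x \<boxtimes> (ida C y \<boxtimes> g)) \<cdot> alpa C x y (tens \<i> as) \<cdot> bet (x \<otimes> y) \<i> (rhoa C (x \<otimes> y)) as"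
    using assms cmpa_reassoc[OF alpa_natural[of "ida C x" "ida C y" g], of "bet (x \<otimes> y) \<i> (rhoa C (x \<otimes> y)) as"]
    by (simp add: wh_def)
  also have "alpa C x y (tens \<i> as) \<cdot> bet (x \<otimes> y) \<i> (rhoa C (x \<otimes> y)) as
      = (ida C x \<boxtimes> ?b) \<cdot> bet x (y \<otimes> \<i>) (ida C x \<boxtimes> rhoa C y) as"
    using assms by (simp add: bet_alpa right_unita)
  also have "bet x (y \<otimes> \<i>) (ida C x \<boxtimes> rhoa C y) as = (ida C x \<boxtimes> act (rhoa C y) as) \<cdot> bet x y (ida C (x \<otimes> y)) as"
    using assms bet_post[of "ida C (x \<otimes> y)" "ida C x" "rhoa C y" as] by simp
  also have "(ida C x \<boxtimes> (ida C y \<boxtimes> g)) \<cdot> (ida C x \<boxtimes> ?b) \<cdot> (ida C x \<boxtimes> act (rhoa C y) as) \<cdot> bet x y (ida C (x \<otimes> y)) as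
    = (ida C x \<boxtimes> ((ida C y \<boxtimes> g) \<cdot> ?b \<cdot> act (rhoa C y) as)) \<cdot> bet x y (ida C (x \<otimes> y)) as"
    using assms by (simp add: tena_id_cmp)
  also have "?b \<cdot> act (rhoa C y) as = bet y \<i> (rhoa C y) as"
    using assms by (simp flip: bet_pre)
  finally show ?thesis by (simp add: wh_def)
qed

text \<open>
  Whiskering commutes with the substitution of \<open>h : as \<rightarrow> c\<close> into \<open>g : us, c, vs \<rightarrow> b\<close>, which will be the
  associativity law for nested substitutions in \<open>multi_of\<close>. The shift of brackets around \<open>us, as, vs\<close> is
  decomposed by \<open>wh_alpa\<close>, that is, by the pentagon law.
\<close>

lemma wh_subst:
  assumes "g \<in> arr C" "h \<in> arr C" "src g = tens \<i> (us @ c # vs)" "src h = tens \<i> as" "trg h = c"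
    "us \<in> lists (Obj C)" "vs \<in> lists (Obj C)" "as \<in> lists (Obj C)" "x \<in> Obj C"
  shows "wh x (us @ as @ vs) (g \<cdot> act (wh (tens \<i> us) as h) vs)
     = wh x (us @ c # vs) g \<cdot> act (wh (tens x us) as h) vs"
proof -
  let ?y = "tens \<i> us" and ?B = "bet x \<i> (rhoa C x) us"
  let ?q = "wh ?y as h"
  have c: "c \<in> Obj C" using assms by auto
  note o = assms c
  have B: "?B \<in> arr C" "src ?B = tens x us" "trg ?B = x \<otimes> ?y" using o by auto
  have "(ida C x \<boxtimes> ?q) \<cdot> bet x ?y ?B as = (ida C x \<boxtimes> ?q) \<cdot> bet x ?y (ida C (x \<otimes> ?y)) as \<cdot> act ?B as"
    using o B bet_pre[of "ida C (x \<otimes> ?y)" ?B x ?y as] by simp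
  also have "\<dots> = alpa C x ?y c \<cdot> wh (x \<otimes> ?y) as h \<cdot> act ?B as"
    using o B cmpa_reassoc[OF wh_alpa[of h as x ?y, symmetric], of "act ?B as"] by simp
  also have "\<dots> = alpa C x ?y c \<cdot> (?B \<boxtimes> ida C c) \<cdot> wh (tens x us) as h"
    using o B wh_natural[of ?B h as] by simp
  also have "\<dots> = bet x \<i> (rhoa C x) (us @ [c]) \<cdot> wh (tens x us) as h"
    using o B by (simp add: bet_append)
  finally have *: "(ida C x \<boxtimes> ?q) \<cdot> bet x ?y ?B as = bet x \<i> (rhoa C x) (us @ [c]) \<cdot> wh (tens x us) as h" .
  have "wh x (us @ as @ vs) (g \<cdot> act ?q vs)
     = (ida C x \<boxtimes> g) \<cdot> (ida C x \<boxtimes> act ?q vs) \<cdot> bet x (tens ?y as) (bet x ?y ?B as) vs"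
    using o by (simp add: wh_def bet_append tena_id_cmp)
  also have "(ida C x \<boxtimes> act ?q vs) \<cdot> bet x (tens ?y as) (bet x ?y ?B as) vs
      = bet x (?y \<otimes> c) ((ida C x \<boxtimes> ?q) \<cdot> bet x ?y ?B as) vs"
    using o B bet_post[of "bet x ?y ?B as" "ida C x" ?q vs] by simp
  also have "\<dots> = bet x \<i> (rhoa C x) (us @ c # vs) \<cdot> act (wh (tens x us) as h) vs"
    unfolding * using o bet_pre[of "bet x \<i> (rhoa C x) (us @ [c])" "wh (tens x us) as h" x "?y \<otimes> c" vs]
      bet_append[of x \<i> "rhoa C x" "us @ [c]" vs] by simp
  finally show ?thesis using o by (simp add: wh_def)
qed

end

section \<open>Lax monoidal functors\<close>

definition mapa :: "('o, 'm, 'p, 'n, 'z) func_scheme \<Rightarrow> ('o, 'm) arrow \<Rightarrow> ('p, 'n) arrow" where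
  "mapa F f = (fOb F (src f), fMap F (src f) (trg f) (raw f), fOb F (trg f))"

definition lax0a :: "('o, 'm) skmon \<Rightarrow> ('o, 'm) skmon \<Rightarrow> ('o, 'm) laxfun \<Rightarrow> ('o, 'm) arrow" where
  "lax0a A B F = (unt B, lax0 F, fOb F (unt A))"

definition lax2a :: "('o, 'm) skmon \<Rightarrow> ('o, 'm) skmon \<Rightarrow> ('o, 'm) laxfun \<Rightarrow> 'o \<Rightarrow> 'o \<Rightarrow> ('o, 'm) arrow" where
  "lax2a A B F a b = (ten B (fOb F a) (fOb F b), lax2 F a b, fOb F (ten A a b))"

lemma lax_src_trg [simp]:
  "src (mapa F f) = fOb F (src f)" "trg (mapa F f) = fOb F (trg f)"
  "src (lax0a A B G) = unt B" "trg (lax0a A B G) = fOb G (unt A)"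
  "src (lax2a A B G a b) = ten B (fOb G a) (fOb G b)" "trg (lax2a A B G a b) = fOb G (ten A a b)"
  by (simp_all add: mapa_def lax0a_def lax2a_def)

context is_functor begin

lemma mapa_arr [simp]: "f \<in> arr A \<Longrightarrow> mapa F f \<in> arr B"
  using functor_obj[of "src f"] functor_obj[of "trg f"] functor_hom[of "src f" "trg f" "raw f"]
  by (simp del: arr_obj add: arr_def mapa_def)

lemma mapa_id [simp]: "a \<in> Obj A \<Longrightarrow> mapa F (ida A a) = ida B (fOb F a)"
  by (simp add: mapa_def ida_def functor_id)

lemma mapa_cmp:
  "f \<in> arr A \<Longrightarrow> g \<in> arr A \<Longrightarrow> src g = trg f \<Longrightarrow> mapa F (cmpa A g f) = cmpa B (mapa F g) (mapa F f)"
  by (auto simp del: arr_obj simp add: arr_def mapa_def cmpa_def functor_cmp)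

end

lemma lax_monoidalI:
  assumes A: "skew_monoidal A" and B: "skew_monoidal B" and F: "is_functor A B F"
    and ext: "fOb F \<in> extensional (Obj A)" "\<And>a b. fMap F a b \<in> extensional (catMaps A a b)"
      "\<And>a b. \<not> (a \<in> Obj A \<and> b \<in> Obj A) \<Longrightarrow> lax2 F a b = undefined"
    and l0: "lax0a A B F \<in> arr B"
    and l2: "\<And>a b. a \<in> Obj A \<Longrightarrow> b \<in> Obj A \<Longrightarrow> lax2a A B F a b \<in> arr B"
    and nat: "\<And>f g. f \<in> arr A \<Longrightarrow> g \<in> arr A \<Longrightarrow>
      lax2a A B F (trg f) (trg g) \<cdot>\<^bsub>B\<^esub> (mapa F f \<boxtimes>\<^bsub>B\<^esub> mapa F g)
      = mapa F (f \<boxtimes>\<^bsub>A\<^esub> g) \<cdot>\<^bsub>B\<^esub> lax2a A B F (src f) (src g)"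
    and assoc: "\<And>a b c. a \<in> Obj A \<Longrightarrow> b \<in> Obj A \<Longrightarrow> c \<in> Obj A \<Longrightarrow>
      mapa F (alpa A a b c) \<cdot>\<^bsub>B\<^esub> lax2a A B F (ten A a b) c \<cdot>\<^bsub>B\<^esub> (lax2a A B F a b \<boxtimes>\<^bsub>B\<^esub> ida B (fOb F c))
      = lax2a A B F a (ten A b c) \<cdot>\<^bsub>B\<^esub> (ida B (fOb F a) \<boxtimes>\<^bsub>B\<^esub> lax2a A B F b c)
          \<cdot>\<^bsub>B\<^esub> alpa B (fOb F a) (fOb F b) (fOb F c)"
    and lunit: "\<And>a. a \<in> Obj A \<Longrightarrow>
      mapa F (lama A a) \<cdot>\<^bsub>B\<^esub> lax2a A B F (unt A) a \<cdot>\<^bsub>B\<^esub> (lax0a A B F \<boxtimes>\<^bsub>B\<^esub> ida B (fOb F a)) = lama B (fOb F a)"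
    and runit: "\<And>a. a \<in> Obj A \<Longrightarrow>
      lax2a A B F a (unt A) \<cdot>\<^bsub>B\<^esub> (ida B (fOb F a) \<boxtimes>\<^bsub>B\<^esub> lax0a A B F) \<cdot>\<^bsub>B\<^esub> rhoa B (fOb F a) = mapa F (rhoa A a)"
  shows "lax_monoidal A B F"
proof -
  interpret A: skew_monoidal A by (rule A)
  interpret B: skew_monoidal B by (rule B)
  interpret is_functor A B F by (rule F)
  note defs = ida_def cmpa_def tena_def alpa_def lama_def rhoa_def mapa_def lax0a_def lax2a_def
  show ?thesis
  proof
    fix a a' b b' f g
    assume "a \<in> Obj A" "a' \<in> Obj A" "b \<in> Obj A" "b' \<in> Obj A" "f \<in> Hom A a a'" "g \<in> Hom A b b'"
    then show "Cmp B (ten B (fOb F a) (fOb F b)) (ten B (fOb F a') (fOb F b')) (fOb F (ten A a' b'))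
            (lax2 F a' b')
            (tenm B (fOb F a) (fOb F a') (fOb F b) (fOb F b') (fMap F a a' f) (fMap F b b' g))
        = Cmp B (ten B (fOb F a) (fOb F b)) (fOb F (ten A a b)) (fOb F (ten A a' b'))
            (fMap F (ten A a b) (ten A a' b') (tenm A a a' b b' f g)) (lax2 F a b)"
      using nat[of "(a, f, a')" "(b, g, b')"] by (simp del: arr_obj add: defs arr_def)
  qed (use ext l0 l2 assoc lunit runit in \<open>simp_all del: arr_obj add: arr_def defs\<close>)
qed

context lax_monoidal begin

lemma lax_arr [simp]: "lax0a A B F \<in> arr B"
  "a \<in> Obj A \<Longrightarrow> b \<in> Obj A \<Longrightarrow> lax2a A B F a b \<in> arr B"
  using lax0_hom lax2_hom[of a b]
  by (simp_all del: arr_obj add: arr_def lax0a_def lax2a_def functor_obj A.unit_obj)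

lemma functor_obj' [simp]: "a \<in> Obj A \<Longrightarrow> fOb F a \<in> Obj B"
  by (rule functor_obj)

lemma laxa_natural:
  "f \<in> arr A \<Longrightarrow> g \<in> arr A \<Longrightarrow> lax2a A B F (trg f) (trg g) \<cdot>\<^bsub>B\<^esub> (mapa F f \<boxtimes>\<^bsub>B\<^esub> mapa F g)
      = mapa F (f \<boxtimes> g) \<cdot>\<^bsub>B\<^esub> lax2a A B F (src f) (src g)"
  using lax2_natural[of "src f" "trg f" "src g" "trg g" "raw f" "raw g"]
  by (simp del: arr_obj add: arr_def mapa_def tena_def lax2a_def cmpa_def)

lemma laxa_assoc: "a \<in> Obj A \<Longrightarrow> b \<in> Obj A \<Longrightarrow> c \<in> Obj A \<Longrightarrow>
      mapa F (alpa A a b c) \<cdot>\<^bsub>B\<^esub> lax2a A B F (a \<otimes> b) c \<cdot>\<^bsub>B\<^esub> (lax2a A B F a b \<boxtimes>\<^bsub>B\<^esub> ida B (fOb F c))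
      = lax2a A B F a (b \<otimes> c) \<cdot>\<^bsub>B\<^esub> (ida B (fOb F a) \<boxtimes>\<^bsub>B\<^esub> lax2a A B F b c)
          \<cdot>\<^bsub>B\<^esub> alpa B (fOb F a) (fOb F b) (fOb F c)"
  using lax_assoc by (simp add: mapa_def tena_def lax2a_def cmpa_def ida_def alpa_def)

lemma laxa_left_unit: "a \<in> Obj A \<Longrightarrow>
      mapa F (lama A a) \<cdot>\<^bsub>B\<^esub> lax2a A B F \<i> a \<cdot>\<^bsub>B\<^esub> (lax0a A B F \<boxtimes>\<^bsub>B\<^esub> ida B (fOb F a)) = lama B (fOb F a)"
  using lax_left_unit by (simp add: mapa_def tena_def lax0a_def lax2a_def cmpa_def ida_def lama_def)

lemma laxa_right_unit: "a \<in> Obj A \<Longrightarrow>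
      lax2a A B F a \<i> \<cdot>\<^bsub>B\<^esub> (ida B (fOb F a) \<boxtimes>\<^bsub>B\<^esub> lax0a A B F) \<cdot>\<^bsub>B\<^esub> rhoa B (fOb F a) = mapa F (rhoa A a)"
  using lax_right_unit by (simp add: mapa_def tena_def lax0a_def lax2a_def cmpa_def ida_def rhoa_def)

lemma mapa_reassoc:
  "p \<in> arr A \<Longrightarrow> q \<in> arr A \<Longrightarrow> src p = trg q \<Longrightarrow> k \<in> arr B \<Longrightarrow> trg k = fOb F (src q) \<Longrightarrow>
    mapa F p \<cdot>\<^bsub>B\<^esub> mapa F q \<cdot>\<^bsub>B\<^esub> k = mapa F (p \<cdot> q) \<cdot>\<^bsub>B\<^esub> k"
  by (simp add: mapa_cmp)

end

lemma is_functor_lax_comp: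
  assumes "lax_monoidal A B F" "lax_monoidal B E G"
  shows "is_functor A E (lax_comp A B E G F)"
proof -
  interpret F: lax_monoidal A B F by fact
  interpret G: lax_monoidal B E G by fact
  show ?thesis
    by unfold_locales (auto simp: lax_comp_def catMaps_def F.functor_hom G.functor_hom F.functor_id
        G.functor_id F.functor_cmp G.functor_cmp F.A.cmp_hom F.A.idm_hom)
qed

lemma lax_monoidal_comp:
  assumes "lax_monoidal A B F" "lax_monoidal B E G"
  shows "lax_monoidal A E (lax_comp A B E G F)"
proof -
  interpret F: lax_monoidal A B F by fact
  interpret G: lax_monoidal B E G by fact
  let ?H = "lax_comp A B E G F"
  have ob: "fOb ?H a = fOb G (fOb F a)" if "a \<in> Obj A" for a
    using that by (simp add: lax_comp_def)
  have map: "mapa ?H f = mapa G (mapa F f)" if "f \<in> arr A" for f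
    using that by (simp del: arr_obj add: arr_def mapa_def lax_comp_def catMaps_def)
  have l0: "lax0a A E ?H = mapa G (lax0a A B F) \<cdot>\<^bsub>E\<^esub> lax0a B E G"
    by (simp add: lax0a_def mapa_def cmpa_def lax_comp_def)
  have l2: "lax2a A E ?H a b = mapa G (lax2a A B F a b) \<cdot>\<^bsub>E\<^esub> lax2a B E G (fOb F a) (fOb F b)"
    if "a \<in> Obj A" "b \<in> Obj A" for a b
    using that by (simp add: lax2a_def mapa_def cmpa_def lax_comp_def)
  show ?thesis
  proof (rule lax_monoidalI[OF F.A.skew_monoidal_axioms G.B.skew_monoidal_axioms is_functor_lax_comp[OF assms]])
    fix f g assume fg: "f \<in> arr A" "g \<in> arr A"
    have "mapa G (lax2a A B F (trg f) (trg g)) \<cdot>\<^bsub>E\<^esub> lax2a B E G (fOb F (trg f)) (fOb F (trg g))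
        \<cdot>\<^bsub>E\<^esub> mapa G (mapa F f) \<boxtimes>\<^bsub>E\<^esub> mapa G (mapa F g)
      = mapa G (lax2a A B F (trg f) (trg g)) \<cdot>\<^bsub>E\<^esub> mapa G (mapa F f \<boxtimes>\<^bsub>B\<^esub> mapa F g)
        \<cdot>\<^bsub>E\<^esub> lax2a B E G (fOb F (src f)) (fOb F (src g))"
      using fg G.laxa_natural[of "mapa F f" "mapa F g"] by simp
    also have "\<dots> = mapa G (mapa F (f \<boxtimes>\<^bsub>A\<^esub> g)) \<cdot>\<^bsub>E\<^esub> mapa G (lax2a A B F (src f) (src g))
        \<cdot>\<^bsub>E\<^esub> lax2a B E G (fOb F (src f)) (fOb F (src g))"
      using fg by (simp add: G.mapa_reassoc F.laxa_natural)
    finally show "lax2a A E ?H (trg f) (trg g) \<cdot>\<^bsub>E\<^esub> (mapa ?H f \<boxtimes>\<^bsub>E\<^esub> mapa ?H g)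
      = mapa ?H (f \<boxtimes>\<^bsub>A\<^esub> g) \<cdot>\<^bsub>E\<^esub> lax2a A E ?H (src f) (src g)"
      using fg by (simp add: map l2 ob)
  next
    fix a b c assume o: "a \<in> Obj A" "b \<in> Obj A" "c \<in> Obj A"
    let ?g2 = "lax2a B E G" and ?f2 = "lax2a A B F"
    let ?a = "fOb F a" and ?b = "fOb F b" and ?c = "fOb F c"
    let ?Ga = "fOb G ?a" and ?Gb = "fOb G ?b" and ?Gc = "fOb G ?c"
    have "mapa G (mapa F (alpa A a b c)) \<cdot>\<^bsub>E\<^esub> mapa G (?f2 (ten A a b) c) \<cdot>\<^bsub>E\<^esub> ?g2 (fOb F (ten A a b)) ?c
        \<cdot>\<^bsub>E\<^esub> (mapa G (?f2 a b) \<boxtimes>\<^bsub>E\<^esub> ida E ?Gc) \<cdot>\<^bsub>E\<^esub> (?g2 ?a ?b \<boxtimes>\<^bsub>E\<^esub> ida E ?Gc)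
      = mapa G (mapa F (alpa A a b c)) \<cdot>\<^bsub>E\<^esub> mapa G (?f2 (ten A a b) c) \<cdot>\<^bsub>E\<^esub> mapa G (?f2 a b \<boxtimes>\<^bsub>B\<^esub> ida B ?c)
        \<cdot>\<^bsub>E\<^esub> ?g2 (ten B ?a ?b) ?c \<cdot>\<^bsub>E\<^esub> (?g2 ?a ?b \<boxtimes>\<^bsub>E\<^esub> ida E ?Gc)"
      using o G.B.cmpa_reassoc[OF G.laxa_natural[of "?f2 a b" "ida B ?c"], of "?g2 ?a ?b \<boxtimes>\<^bsub>E\<^esub> ida E ?Gc"]
      by simp
    also have "\<dots> = mapa G (?f2 a (ten A b c)) \<cdot>\<^bsub>E\<^esub> mapa G (ida B ?a \<boxtimes>\<^bsub>B\<^esub> ?f2 b c)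
        \<cdot>\<^bsub>E\<^esub> mapa G (alpa B ?a ?b ?c) \<cdot>\<^bsub>E\<^esub> ?g2 (ten B ?a ?b) ?c \<cdot>\<^bsub>E\<^esub> (?g2 ?a ?b \<boxtimes>\<^bsub>E\<^esub> ida E ?Gc)"
      using o by (simp add: G.mapa_reassoc F.laxa_assoc)
    also have "\<dots> = mapa G (?f2 a (ten A b c)) \<cdot>\<^bsub>E\<^esub> mapa G (ida B ?a \<boxtimes>\<^bsub>B\<^esub> ?f2 b c)
        \<cdot>\<^bsub>E\<^esub> ?g2 ?a (ten B ?b ?c) \<cdot>\<^bsub>E\<^esub> (ida E ?Ga \<boxtimes>\<^bsub>E\<^esub> ?g2 ?b ?c) \<cdot>\<^bsub>E\<^esub> alpa E ?Ga ?Gb ?Gc"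
      using o by (simp add: G.laxa_assoc)
    also have "\<dots> = mapa G (?f2 a (ten A b c)) \<cdot>\<^bsub>E\<^esub> ?g2 ?a (fOb F (ten A b c))
        \<cdot>\<^bsub>E\<^esub> (ida E ?Ga \<boxtimes>\<^bsub>E\<^esub> mapa G (?f2 b c)) \<cdot>\<^bsub>E\<^esub> (ida E ?Ga \<boxtimes>\<^bsub>E\<^esub> ?g2 ?b ?c) \<cdot>\<^bsub>E\<^esub> alpa E ?Ga ?Gb ?Gc"
      using o G.B.cmpa_reassoc[OF G.laxa_natural[of "ida B ?a" "?f2 b c"],
          of "(ida E ?Ga \<boxtimes>\<^bsub>E\<^esub> ?g2 ?b ?c) \<cdot>\<^bsub>E\<^esub> alpa E ?Ga ?Gb ?Gc"]
      by simp
    finally show "mapa ?H (alpa A a b c) \<cdot>\<^bsub>E\<^esub> lax2a A E ?H (ten A a b) c \<cdot>\<^bsub>E\<^esub> (lax2a A E ?H a b \<boxtimes>\<^bsub>E\<^esub> ida E (fOb ?H c))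
      = lax2a A E ?H a (ten A b c) \<cdot>\<^bsub>E\<^esub> (ida E (fOb ?H a) \<boxtimes>\<^bsub>E\<^esub> lax2a A E ?H b c)
          \<cdot>\<^bsub>E\<^esub> alpa E (fOb ?H a) (fOb ?H b) (fOb ?H c)"
      using o by (simp add: map l2 ob G.B.tena_cmp_id G.B.tena_id_cmp)
  next
    fix a assume o: "a \<in> Obj A"
    let ?g2 = "lax2a B E G" and ?f2 = "lax2a A B F" and ?g0 = "lax0a B E G" and ?f0 = "lax0a A B F"
    let ?a = "fOb F a" let ?Ga = "fOb G ?a" let ?i = "fOb F (unt A)"
    have "mapa G (mapa F (lama A a)) \<cdot>\<^bsub>E\<^esub> mapa G (?f2 (unt A) a) \<cdot>\<^bsub>E\<^esub> ?g2 ?i ?a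
        \<cdot>\<^bsub>E\<^esub> (mapa G ?f0 \<boxtimes>\<^bsub>E\<^esub> ida E ?Ga) \<cdot>\<^bsub>E\<^esub> (?g0 \<boxtimes>\<^bsub>E\<^esub> ida E ?Ga)
      = mapa G (mapa F (lama A a)) \<cdot>\<^bsub>E\<^esub> mapa G (?f2 (unt A) a) \<cdot>\<^bsub>E\<^esub> mapa G (?f0 \<boxtimes>\<^bsub>B\<^esub> ida B ?a)
        \<cdot>\<^bsub>E\<^esub> ?g2 (unt B) ?a \<cdot>\<^bsub>E\<^esub> (?g0 \<boxtimes>\<^bsub>E\<^esub> ida E ?Ga)"
      using o G.B.cmpa_reassoc[OF G.laxa_natural[of ?f0 "ida B ?a"], of "?g0 \<boxtimes>\<^bsub>E\<^esub> ida E ?Ga"]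
      by simp
    also have "\<dots> = lama E ?Ga"
      using o by (simp add: G.mapa_reassoc F.laxa_left_unit G.laxa_left_unit)
    finally show "mapa ?H (lama A a) \<cdot>\<^bsub>E\<^esub> lax2a A E ?H (unt A) a \<cdot>\<^bsub>E\<^esub> (lax0a A E ?H \<boxtimes>\<^bsub>E\<^esub> ida E (fOb ?H a))
      = lama E (fOb ?H a)"
      using o by (simp add: map l2 l0 ob G.B.tena_cmp_id)
    have "mapa G (?f2 a (unt A)) \<cdot>\<^bsub>E\<^esub> ?g2 ?a ?i \<cdot>\<^bsub>E\<^esub> (ida E ?Ga \<boxtimes>\<^bsub>E\<^esub> mapa G ?f0)
        \<cdot>\<^bsub>E\<^esub> (ida E ?Ga \<boxtimes>\<^bsub>E\<^esub> ?g0) \<cdot>\<^bsub>E\<^esub> rhoa E ?Ga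
      = mapa G (?f2 a (unt A)) \<cdot>\<^bsub>E\<^esub> mapa G (ida B ?a \<boxtimes>\<^bsub>B\<^esub> ?f0) \<cdot>\<^bsub>E\<^esub> ?g2 ?a (unt B)
        \<cdot>\<^bsub>E\<^esub> (ida E ?Ga \<boxtimes>\<^bsub>E\<^esub> ?g0) \<cdot>\<^bsub>E\<^esub> rhoa E ?Ga"
      using o G.B.cmpa_reassoc[OF G.laxa_natural[of "ida B ?a" ?f0], of "(ida E ?Ga \<boxtimes>\<^bsub>E\<^esub> ?g0) \<cdot>\<^bsub>E\<^esub> rhoa E ?Ga"]
      by simp
    also have "\<dots> = mapa G (mapa F (rhoa A a))"
      using o by (simp add: G.laxa_right_unit F.laxa_right_unit flip: G.mapa_cmp)
    finally show "lax2a A E ?H a (unt A) \<cdot>\<^bsub>E\<^esub> (ida E (fOb ?H a) \<boxtimes>\<^bsub>E\<^esub> lax0a A E ?H) \<cdot>\<^bsub>E\<^esub> rhoa E (fOb ?H a)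
      = mapa ?H (rhoa A a)"
      using o by (simp add: map l2 l0 ob G.B.tena_id_cmp)
  next
    show "lax0a A E ?H \<in> arr E" by (simp add: l0)
    show "lax2a A E ?H a b \<in> arr E" if "a \<in> Obj A" "b \<in> Obj A" for a b using that by (simp add: l2)
  qed (auto simp: lax_comp_def)
qed

lemma lax_monoidal_id:
  assumes "skew_monoidal A"
  shows "lax_monoidal A A (lax_id A)"
proof -
  interpret skew_monoidal A by fact
  have F: "is_functor A A (lax_id A)"
    by unfold_locales (auto simp: lax_id_def catMaps_def idm_hom cmp_hom)
  have map: "mapa (lax_id A) f = f" if "f \<in> arr A" for f
    using that by (simp del: arr_obj add: arr_def mapa_def lax_id_def catMaps_def)
  have ob: "fOb (lax_id A) a = a" if "a \<in> Obj A" for a using that by (simp add: lax_id_def)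
  have l0: "lax0a A A (lax_id A) = ida A (unt A)"
    by (simp add: lax0a_def ida_def lax_id_def)
  have l2: "lax2a A A (lax_id A) a b = ida A (ten A a b)" if "a \<in> Obj A" "b \<in> Obj A" for a b
    using that by (simp add: lax2a_def ida_def lax_id_def)
  show ?thesis
    by (rule lax_monoidalI[OF assms assms F]) (auto simp: l0 l2 map ob, auto simp: lax_id_def)
qed

lemma laxfun_eqI:
  assumes "fOb F = fOb G" "\<And>a b f. fMap F a b f = fMap G a b f" "lax0 F = lax0 G"
    "\<And>a b. lax2 F a b = lax2 G a b"
  shows "F = (G :: ('o, 'm) laxfun)"
  by (rule laxfun.equality) (use assms in \<open>auto intro!: ext\<close>)

lemma category_SkMon: "category SkMon"
proof
  fix A B and F :: "('o, 'm) laxfun" assume "A \<in> Obj SkMon" "B \<in> Obj SkMon" "F \<in> Hom SkMon A B"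
  then interpret lax_monoidal A B F by (simp add: SkMon_def)
  have u: "fMap F a b f = undefined" if "\<not> (a \<in> Obj A \<and> b \<in> Obj A \<and> f \<in> Hom A a b)" for a b f
    using that ext_map[of a b] by (auto simp: extensional_def catMaps_def)
  have o: "fOb F a = undefined" if "a \<notin> Obj A" for a
    using that ext_obj by (auto simp: extensional_def)
  have "fMap (lax_comp A B B (lax_id B) F) a b f = fMap F a b f" for a b f
    by (cases "a \<in> Obj A \<and> b \<in> Obj A \<and> f \<in> Hom A a b")
      (auto simp: lax_comp_def lax_id_def catMaps_def restrict_def u functor_obj functor_hom)
  moreover have "fOb (lax_comp A B B (lax_id B) F) = fOb F"
    by (rule ext) (simp add: lax_comp_def lax_id_def restrict_def o functor_obj)
  moreover have "lax0 (lax_comp A B B (lax_id B) F) = lax0 F"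
    using lax0_hom by (simp add: lax_comp_def lax_id_def catMaps_def functor_obj A.unit_obj B.unit_obj B.cmp_id_right)
  moreover have "lax2 (lax_comp A B B (lax_id B) F) a b = lax2 F a b" for a b
    using lax2_hom[of a b]
    by (simp add: lax_comp_def lax_id_def catMaps_def functor_obj B.cmp_id_right ext_lax2)
  ultimately show "Cmp SkMon A B B (Idm SkMon B) F = F"
    unfolding SkMon_def by (auto intro!: laxfun_eqI)
  have "fMap (lax_comp A A B F (lax_id A)) a b f = fMap F a b f" for a b f
    by (cases "a \<in> Obj A \<and> b \<in> Obj A \<and> f \<in> Hom A a b")
      (auto simp: lax_comp_def lax_id_def catMaps_def restrict_def u)
  moreover have "fOb (lax_comp A A B F (lax_id A)) = fOb F"
    by (rule ext) (simp add: lax_comp_def lax_id_def restrict_def o)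
  moreover have "lax0 (lax_comp A A B F (lax_id A)) = lax0 F"
    using lax0_hom by (simp add: lax_comp_def lax_id_def functor_id A.unit_obj B.unit_obj B.cmp_id_left functor_obj)
  moreover have "lax2 (lax_comp A A B F (lax_id A)) a b = lax2 F a b" for a b
    using lax2_hom[of a b]
    by (simp add: lax_comp_def lax_id_def functor_id functor_obj B.cmp_id_left ext_lax2)
  ultimately show "Cmp SkMon A A B F (Idm SkMon A) = F"
    unfolding SkMon_def by (auto intro!: laxfun_eqI)
next
  fix A B E D and F G H :: "('o, 'm) laxfun" 
  assume *: "A \<in> Obj SkMon" "B \<in> Obj SkMon" "E \<in> Obj SkMon" "D \<in> Obj SkMon"
    "F \<in> Hom SkMon A B" "G \<in> Hom SkMon B E" "H \<in> Hom SkMon E D"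
  interpret F: lax_monoidal A B F using * by (simp add: SkMon_def)
  interpret G: lax_monoidal B E G using * by (simp add: SkMon_def)
  interpret H: lax_monoidal E D H using * by (simp add: SkMon_def)
  let ?L = "lax_comp A B D (lax_comp B E D H G) F" and ?R = "lax_comp A E D H (lax_comp A B E G F)"
  have "fMap ?L a b f = fMap ?R a b f" for a b f
    by (cases "a \<in> Obj A \<and> b \<in> Obj A \<and> f \<in> Hom A a b")
      (auto simp: lax_comp_def catMaps_def restrict_def F.functor_hom)
  moreover have "fOb ?L = fOb ?R"
    by (rule ext) (simp add: lax_comp_def restrict_def)
  moreover have "lax0 ?L = lax0 ?R"
    using F.lax0_hom G.lax0_hom H.lax0_hom
    by (simp add: lax_comp_def catMaps_def G.functor_hom G.functor_cmp H.functor_hom H.functor_cmp H.B.cmp_assoc)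
  moreover have "lax2 ?L a b = lax2 ?R a b" for a b
    using F.lax2_hom[of a b] G.lax2_hom[of "fOb F a" "fOb F b"] H.lax2_hom[of "fOb G (fOb F a)" "fOb G (fOb F b)"]
    by (auto simp add: lax_comp_def catMaps_def G.functor_hom G.functor_cmp H.functor_hom H.functor_cmp H.B.cmp_assoc)
  ultimately show "Cmp SkMon A B D (Cmp SkMon B E D H G) F = Cmp SkMon A E D H (Cmp SkMon A B E G F)"
    unfolding SkMon_def by (auto intro!: laxfun_eqI)
qed (auto simp: SkMon_def intro: lax_monoidal_id lax_monoidal_comp)

section \<open>The multicategory of a skew monoidal category\<close>

context skew_monoidal begin

text \<open>
  Starting the tensor product with \<open>\<i>\<close> turns nullary multimaps into arrows out of \<open>\<i>\<close>, at the price that the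
  identity of \<open>a\<close> has to be an arrow \<open>\<i> \<otimes> a \<rightarrow> a\<close>.
\<close>

definition multi_of :: "('o, 'm) multi" where
  "multi_of = \<lparr>
     mObj = Obj C,
     mHom = (\<lambda>as b. Hom C (tens \<i> as) b),
     mIdm = lam C,
     mSub = (\<lambda>xs b ys as c f g.
       raw ((tens \<i> (xs @ b # ys), f, c) \<cdot> act (wh (tens \<i> xs) as (tens \<i> as, g, b)) ys))\<rparr>"

lemma multi_of_simps [simp]: "mObj multi_of = Obj C" "mHom multi_of as b = Hom C (tens \<i> as) b"
  "mIdm multi_of = lam C"
  by (simp_all add: multi_of_def)

lemma multi_of_sub:
  assumes "xs \<in> lists (Obj C)" "b \<in> Obj C" "ys \<in> lists (Obj C)" "as \<in> lists (Obj C)" "c \<in> Obj C"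
    "f \<in> Hom C (tens \<i> (xs @ b # ys)) c" "g \<in> Hom C (tens \<i> as) b"
  shows "(tens \<i> (xs @ as @ ys), mSub multi_of xs b ys as c f g, c)
    = (tens \<i> (xs @ b # ys), f, c) \<cdot> act (wh (tens \<i> xs) as (tens \<i> as, g, b)) ys"
  by (rule prod_eqI, simp, rule prod_eqI) (simp_all add: multi_of_def)

lemma triple_arr: "a \<in> Obj C \<Longrightarrow> b \<in> Obj C \<Longrightarrow> f \<in> Hom C a b \<Longrightarrow> (a, f, b) \<in> arr C"
  by (simp add: arr_def del: arr_obj)

lemma triple_hom: "(a, f, b) \<in> arr C \<Longrightarrow> f \<in> Hom C a b"
  by (simp add: arr_def del: arr_obj)

lemma multi_of_sub_hom:
  assumes "xs \<in> lists (Obj C)" "b \<in> Obj C" "ys \<in> lists (Obj C)" "as \<in> lists (Obj C)" "c \<in> Obj C"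
    "f \<in> Hom C (tens \<i> (xs @ b # ys)) c" "g \<in> Hom C (tens \<i> as) b"
  shows "mSub multi_of xs b ys as c f g \<in> Hom C (tens \<i> (xs @ as @ ys)) c"
proof (rule triple_hom)
  have f: "(tens \<i> (xs @ b # ys), f, c) \<in> arr C" and g: "(tens \<i> as, g, b) \<in> arr C"
    using assms by (simp_all add: triple_arr)
  show "(tens \<i> (xs @ as @ ys), mSub multi_of xs b ys as c f g, c) \<in> arr C"
    unfolding multi_of_sub[OF assms] using assms f g by simp
qed

lemma multicategory_multi_of: "multicategory multi_of"
proof
  fix a assume "a \<in> mObj multi_of" then show "mIdm multi_of a \<in> mHom multi_of [a] a"
    by (simp add: lam_hom)
next
  fix xs b ys as c f g
  assume "xs \<in> lists (mObj multi_of)" "b \<in> mObj multi_of" "ys \<in> lists (mObj multi_of)"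
    "as \<in> lists (mObj multi_of)" "c \<in> mObj multi_of"
    "f \<in> mHom multi_of (xs @ b # ys) c" "g \<in> mHom multi_of as b"
  then show "mSub multi_of xs b ys as c f g \<in> mHom multi_of (xs @ as @ ys) c"
    using multi_of_sub_hom by simp
next
  fix xs b ys c f
  assume "xs \<in> lists (mObj multi_of)" "b \<in> mObj multi_of" "ys \<in> lists (mObj multi_of)"
    "c \<in> mObj multi_of" "f \<in> mHom multi_of (xs @ b # ys) c"
  then have o: "xs \<in> lists (Obj C)" "b \<in> Obj C" "ys \<in> lists (Obj C)" "c \<in> Obj C"
     "f \<in> Hom C (tens \<i> (xs @ b # ys)) c" by simp_all
  have f: "(tens \<i> (xs @ b # ys), f, c) \<in> arr C" using o by (simp_all add: triple_arr)
  have "(tens \<i> [b], lam C b, b) = lama C b" by (simp add: lama_def)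
  then have "(tens \<i> (xs @ [b] @ ys), mSub multi_of xs b ys [b] c f (lam C b), c) = (tens \<i> (xs @ b # ys), f, c)"
    using o f by (subst multi_of_sub) (simp_all add: lam_hom wh_lama)
  then show "mSub multi_of xs b ys [b] c f (mIdm multi_of b) = f" by simp
next
  fix as b g assume "as \<in> lists (mObj multi_of)" "b \<in> mObj multi_of" "g \<in> mHom multi_of as b"
  then have o: "as \<in> lists (Obj C)" "b \<in> Obj C" "g \<in> Hom C (tens \<i> as) b" by simp_all
  have g: "(tens \<i> as, g, b) \<in> arr C" using o by (simp_all add: triple_arr)
  have "(tens \<i> ([] @ [b]), lam C b, b) = lama C b" by (simp add: lama_def)
  then have "(tens \<i> ([] @ as @ []), mSub multi_of [] b [] as b (lam C b) g, b) = (tens \<i> as, g, b)"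
    using o g wh_unit[OF g] by (subst multi_of_sub) (simp_all add: lam_hom)
  then show "mSub multi_of [] b [] as b (mIdm multi_of b) g = g" by simp
next
  fix xs b ys us c vs as d f g h
  assume "xs \<in> lists (mObj multi_of)" "b \<in> mObj multi_of" "ys \<in> lists (mObj multi_of)"
        "us \<in> lists (mObj multi_of)" "c \<in> mObj multi_of" "vs \<in> lists (mObj multi_of)"
        "as \<in> lists (mObj multi_of)" "d \<in> mObj multi_of"
        "f \<in> mHom multi_of (xs @ b # ys) d" "g \<in> mHom multi_of (us @ c # vs) b" "h \<in> mHom multi_of as c"
  then have o: "xs \<in> lists (Obj C)" "b \<in> Obj C" "ys \<in> lists (Obj C)" "us \<in> lists (Obj C)" "c \<in> Obj C"
     "vs \<in> lists (Obj C)" "as \<in> lists (Obj C)" "d \<in> Obj C" 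
     and fgh: "f \<in> Hom C (tens \<i> (xs @ b # ys)) d" "g \<in> Hom C (tens \<i> (us @ c # vs)) b" "h \<in> Hom C (tens \<i> as) c"
    by simp_all
  define F G H where "F = (tens \<i> (xs @ b # ys), f, d)" "G = (tens \<i> (us @ c # vs), g, b)" "H = (tens \<i> as, h, c)"
  have arrs: "F \<in> arr C" "G \<in> arr C" "H \<in> arr C" "src F = tens \<i> (xs @ b # ys)"
    "src G = tens \<i> (us @ c # vs)" "src H = tens \<i> as" "trg G = b" "trg H = c"
    unfolding F_G_H_def using o fgh by (simp_all add: triple_arr)
  have "(tens \<i> (xs @ (us @ as @ vs) @ ys), mSub multi_of xs b ys (us @ as @ vs) d f (mSub multi_of us c vs as b g h), d)
     = F \<cdot> act (wh (tens \<i> xs) (us @ as @ vs) (G \<cdot> act (wh (tens \<i> us) as H) vs)) ys"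
    unfolding F_G_H_def using o fgh by (simp only: multi_of_sub multi_of_sub_hom append_in_lists_conv lists.Cons)
  also have "\<dots> = F \<cdot> act (wh (tens \<i> xs) (us @ c # vs) G) ys \<cdot> act (wh (tens \<i> (xs @ us)) as H) (vs @ ys)"
  proof -
    have "wh (tens \<i> xs) (us @ c # vs) G \<in> arr C" "wh (tens \<i> (xs @ us)) as H \<in> arr C"
      using o arrs by (auto intro!: wh_arr simp del: foldl_append)
    then have "act (wh (tens \<i> xs) (us @ c # vs) G \<cdot> act (wh (tens \<i> (xs @ us)) as H) vs) ys
       = act (wh (tens \<i> xs) (us @ c # vs) G) ys \<cdot> act (wh (tens \<i> (xs @ us)) as H) (vs @ ys)"
      unfolding act_append using o arrs by (intro act_cmp act_arr) simp_all
    moreover have "wh (tens \<i> xs) (us @ as @ vs) (G \<cdot> act (wh (tens \<i> us) as H) vs)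
       = wh (tens \<i> xs) (us @ c # vs) G \<cdot> act (wh (tens \<i> (xs @ us)) as H) vs"
      using o arrs by (subst wh_subst[where c = c]) simp_all
    ultimately show ?thesis by simp
  qed
  also have "\<dots> = (F \<cdot> act (wh (tens \<i> xs) (us @ c # vs) G) ys) \<cdot> act (wh (tens \<i> (xs @ us)) as H) (vs @ ys)"
    using o arrs by simp
  also have "\<dots> = (tens \<i> ((xs @ us) @ as @ vs @ ys),
      mSub multi_of (xs @ us) c (vs @ ys) as d (mSub multi_of xs b ys (us @ c # vs) d f g) h, d)"
    unfolding F_G_H_def using o fgh multi_of_sub_hom[of xs b ys "us @ c # vs" d f g] multi_of_sub[of xs b ys "us @ c # vs" d f g]
    by (subst multi_of_sub) auto
  finally show "mSub multi_of xs b ys (us @ as @ vs) d f (mSub multi_of us c vs as b g h)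
        = mSub multi_of (xs @ us) c (vs @ ys) as d (mSub multi_of xs b ys (us @ c # vs) d f g) h" by simp
next
  fix xs b ys c zs as as' d f g h
  assume "xs \<in> lists (mObj multi_of)" "b \<in> mObj multi_of" "ys \<in> lists (mObj multi_of)" "c \<in> mObj multi_of"
        "zs \<in> lists (mObj multi_of)" "as \<in> lists (mObj multi_of)" "as' \<in> lists (mObj multi_of)" "d \<in> mObj multi_of"
        "f \<in> mHom multi_of (xs @ b # ys @ c # zs) d" "g \<in> mHom multi_of as b" "h \<in> mHom multi_of as' c"
  then have o: "xs \<in> lists (Obj C)" "b \<in> Obj C" "ys \<in> lists (Obj C)" "c \<in> Obj C" "zs \<in> lists (Obj C)"
     "as \<in> lists (Obj C)" "as' \<in> lists (Obj C)" "d \<in> Obj C" 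
     and fgh: "f \<in> Hom C (tens \<i> (xs @ b # ys @ c # zs)) d" "g \<in> Hom C (tens \<i> as) b" "h \<in> Hom C (tens \<i> as') c"
    by simp_all
  define F G H where "F = (tens \<i> (xs @ b # ys @ c # zs), f, d)" "G = (tens \<i> as, g, b)" "H = (tens \<i> as', h, c)"
  have arrs: "F \<in> arr C" "G \<in> arr C" "H \<in> arr C" "src F = tens \<i> (xs @ b # ys @ c # zs)"
    "src G = tens \<i> as" "src H = tens \<i> as'" "trg G = b" "trg H = c"
    unfolding F_G_H_def using o fgh by (simp_all add: triple_arr)
  let ?g = "wh (tens \<i> xs) as G"
  have "(tens \<i> ((xs @ as @ ys) @ as' @ zs), mSub multi_of (xs @ as @ ys) c zs as' d (mSub multi_of xs b (ys @ c # zs) as d f g) h, d)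
     = (F \<cdot> act ?g (ys @ c # zs)) \<cdot> act (wh (tens \<i> (xs @ as @ ys)) as' H) zs"
    unfolding F_G_H_def using o fgh multi_of_sub_hom[of xs b "ys @ c # zs" as d f g] multi_of_sub[of xs b "ys @ c # zs" as d f g]
    by (subst multi_of_sub) auto
  also have "\<dots> = F \<cdot> act ((act ?g ys \<boxtimes> ida C c) \<cdot> wh (tens \<i> (xs @ as @ ys)) as' H) zs"
    using o arrs by (simp add: act_append act_cmp)
  also have "(act ?g ys \<boxtimes> ida C c) \<cdot> wh (tens \<i> (xs @ as @ ys)) as' H
     = wh (tens \<i> (xs @ b # ys)) as' H \<cdot> act ?g (ys @ as')"
    using o arrs wh_natural[of "act ?g ys" H as'] by (simp add: act_append)
  also have "F \<cdot> act (wh (tens \<i> (xs @ b # ys)) as' H \<cdot> act ?g (ys @ as')) zs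
     = (F \<cdot> act (wh (tens \<i> (xs @ b # ys)) as' H) zs) \<cdot> act ?g (ys @ as' @ zs)"
    using o arrs by (simp add: act_cmp act_append)
  also have "\<dots> = (tens \<i> (xs @ as @ ys @ as' @ zs),
      mSub multi_of xs b (ys @ as' @ zs) as d (mSub multi_of (xs @ b # ys) c zs as' d f h) g, d)"
    unfolding F_G_H_def using o fgh multi_of_sub_hom[of "xs @ b # ys" c zs as' d f h] multi_of_sub[of "xs @ b # ys" c zs as' d f h]
    by (subst multi_of_sub) auto
  finally show "mSub multi_of (xs @ as @ ys) c zs as' d (mSub multi_of xs b (ys @ c # zs) as d f g) h
        = mSub multi_of xs b (ys @ as' @ zs) as d (mSub multi_of (xs @ b # ys) c zs as' d f h) g" by simp
qed

end

section \<open>Lax monoidal functors and iterated tensor products\<close>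

context lax_monoidal begin

text \<open>For \<open>f : w \<rightarrow> Fx\<close> the canonical arrow \<open>laxs f x as : w (F as) \<rightarrow> F(x as)\<close>.\<close>

primrec laxs :: "('o, 'm) arrow \<Rightarrow> 'o \<Rightarrow> 'o list \<Rightarrow> ('o, 'm) arrow" where
  "laxs f x [] = f"
| "laxs f x (a # as) = laxs (lax2a A B F x a \<cdot>\<^bsub>B\<^esub> (f \<boxtimes>\<^bsub>B\<^esub> ida B (fOb F a))) (x \<otimes> a) as"

lemma laxs_append: "laxs f x (as @ bs) = laxs (laxs f x as) (A.tens x as) bs"
  by (induction as arbitrary: f x) auto

lemma laxs_src [simp]: "src (laxs f x as) = B.tens (src f) (map (fOb F) as)"
  by (induction as arbitrary: f x) auto

lemma laxs_trg [simp]: "trg f = fOb F x \<Longrightarrow> trg (laxs f x as) = fOb F (A.tens x as)"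
  by (induction as arbitrary: f x) auto

lemma map_objs [simp]: "as \<in> lists (Obj A) \<Longrightarrow> map (fOb F) as \<in> lists (Obj B)"
  by (induction as) auto

lemma laxs_arr [simp]:
  "f \<in> arr B \<Longrightarrow> trg f = fOb F x \<Longrightarrow> x \<in> Obj A \<Longrightarrow> as \<in> lists (Obj A) \<Longrightarrow> laxs f x as \<in> arr B"
  by (induction as arbitrary: f x) auto

lemma laxs_pre:
  assumes "f \<in> arr B" "g \<in> arr B" "src f = trg g" "trg f = fOb F x" "x \<in> Obj A" "as \<in> lists (Obj A)"
  shows "laxs (f \<cdot>\<^bsub>B\<^esub> g) x as = laxs f x as \<cdot>\<^bsub>B\<^esub> B.act g (map (fOb F) as)"
  using assms
proof (induction as arbitrary: f g x)
  case (Cons a as)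
  have "lax2a A B F x a \<cdot>\<^bsub>B\<^esub> ((f \<cdot>\<^bsub>B\<^esub> g) \<boxtimes>\<^bsub>B\<^esub> ida B (fOb F a))
      = (lax2a A B F x a \<cdot>\<^bsub>B\<^esub> (f \<boxtimes>\<^bsub>B\<^esub> ida B (fOb F a))) \<cdot>\<^bsub>B\<^esub> (g \<boxtimes>\<^bsub>B\<^esub> ida B (fOb F a))"
    using Cons.prems by (simp add: B.tena_cmp_id)
  then show ?case using Cons.prems by (simp del: B.cmpa_assoc add: Cons.IH)
qed auto

lemma laxs_post:
  assumes "f \<in> arr B" "p \<in> arr A" "trg f = fOb F (src p)" "as \<in> lists (Obj A)"
  shows "laxs (mapa F p \<cdot>\<^bsub>B\<^esub> f) (trg p) as = mapa F (A.act p as) \<cdot>\<^bsub>B\<^esub> laxs f (src p) as"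
  using assms
proof (induction as arbitrary: f p)
  case (Cons a as)
  let ?f = "f \<boxtimes>\<^bsub>B\<^esub> ida B (fOb F a)"
  have "lax2a A B F (trg p) a \<cdot>\<^bsub>B\<^esub> ((mapa F p \<cdot>\<^bsub>B\<^esub> f) \<boxtimes>\<^bsub>B\<^esub> ida B (fOb F a))
      = mapa F (p \<boxtimes> ida A a) \<cdot>\<^bsub>B\<^esub> lax2a A B F (src p) a \<cdot>\<^bsub>B\<^esub> ?f"
    using Cons.prems B.cmpa_reassoc[OF laxa_natural[of p "ida A a"], of ?f] by (simp add: B.tena_cmp_id)
  then show ?case
    using Cons.prems Cons.IH[of "lax2a A B F (src p) a \<cdot>\<^bsub>B\<^esub> ?f" "p \<boxtimes> ida A a"] by simp
qed auto

text \<open>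
  A lax monoidal functor is compatible with the shift of brackets. The induction adds one factor at a time
  by the associativity law and starts with the right unit law.
\<close>

lemma laxs_bet:
  assumes "x \<in> Obj A" "as \<in> lists (Obj A)"
  shows "mapa F (A.bet x \<i> (rhoa A x) as) \<cdot>\<^bsub>B\<^esub> laxs (ida B (fOb F x)) x as
     = lax2a A B F x (A.tens \<i> as) \<cdot>\<^bsub>B\<^esub> (ida B (fOb F x) \<boxtimes>\<^bsub>B\<^esub> laxs (lax0a A B F) \<i> as)
        \<cdot>\<^bsub>B\<^esub> B.bet (fOb F x) \<i>\<^bsub>B\<^esub> (rhoa B (fOb F x)) (map (fOb F) as)"
  using assms(2)
proof (induction as rule: rev_induct)
  case Nil
  then show ?case using assms laxa_right_unit[of x] by simp
next
  case (snoc a as)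
  then have a: "a \<in> Obj A" "as \<in> lists (Obj A)" by auto
  note o = a assms(1)
  let ?x = "fOb F x" and ?a = "fOb F a" and ?i = "A.tens \<i> as"
  let ?b = "A.bet x \<i> (rhoa A x) as" and ?H = "laxs (ida B ?x) x as"
  let ?K = "laxs (lax0a A B F) \<i> as" and ?B = "B.bet ?x \<i>\<^bsub>B\<^esub> (rhoa B ?x) (map (fOb F) as)"
  have "mapa F (alpa A x ?i a \<cdot> ?b \<boxtimes> ida A a) \<cdot>\<^bsub>B\<^esub> lax2a A B F (A.tens x as) a \<cdot>\<^bsub>B\<^esub> ?H \<boxtimes>\<^bsub>B\<^esub> ida B ?a
     = mapa F (alpa A x ?i a) \<cdot>\<^bsub>B\<^esub> lax2a A B F (x \<otimes> ?i) a \<cdot>\<^bsub>B\<^esub> (mapa F ?b \<boxtimes>\<^bsub>B\<^esub> ida B ?a) \<cdot>\<^bsub>B\<^esub> (?H \<boxtimes>\<^bsub>B\<^esub> ida B ?a)"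
    using o B.cmpa_reassoc[OF laxa_natural[of ?b "ida A a"], of "?H \<boxtimes>\<^bsub>B\<^esub> ida B ?a"] by (simp add: mapa_cmp)
  also have "(mapa F ?b \<boxtimes>\<^bsub>B\<^esub> ida B ?a) \<cdot>\<^bsub>B\<^esub> (?H \<boxtimes>\<^bsub>B\<^esub> ida B ?a)
     = (lax2a A B F x ?i \<boxtimes>\<^bsub>B\<^esub> ida B ?a) \<cdot>\<^bsub>B\<^esub> (ida B ?x \<boxtimes>\<^bsub>B\<^esub> ?K \<boxtimes>\<^bsub>B\<^esub> ida B ?a) \<cdot>\<^bsub>B\<^esub> (?B \<boxtimes>\<^bsub>B\<^esub> ida B ?a)"
    using o snoc.IH by (simp flip: B.tena_cmp_id)
  also have "mapa F (alpa A x ?i a) \<cdot>\<^bsub>B\<^esub> lax2a A B F (x \<otimes> ?i) a \<cdot>\<^bsub>B\<^esub> (lax2a A B F x ?i \<boxtimes>\<^bsub>B\<^esub> ida B ?a)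
       \<cdot>\<^bsub>B\<^esub> (ida B ?x \<boxtimes>\<^bsub>B\<^esub> ?K \<boxtimes>\<^bsub>B\<^esub> ida B ?a) \<cdot>\<^bsub>B\<^esub> (?B \<boxtimes>\<^bsub>B\<^esub> ida B ?a)
     = lax2a A B F x (?i \<otimes> a) \<cdot>\<^bsub>B\<^esub> (ida B ?x \<boxtimes>\<^bsub>B\<^esub> lax2a A B F ?i a) \<cdot>\<^bsub>B\<^esub> alpa B ?x (fOb F ?i) ?a
       \<cdot>\<^bsub>B\<^esub> (ida B ?x \<boxtimes>\<^bsub>B\<^esub> ?K \<boxtimes>\<^bsub>B\<^esub> ida B ?a) \<cdot>\<^bsub>B\<^esub> (?B \<boxtimes>\<^bsub>B\<^esub> ida B ?a)"
    using o B.cmpa_reassoc[OF laxa_assoc[of x ?i a], of "(ida B ?x \<boxtimes>\<^bsub>B\<^esub> ?K \<boxtimes>\<^bsub>B\<^esub> ida B ?a) \<cdot>\<^bsub>B\<^esub> (?B \<boxtimes>\<^bsub>B\<^esub> ida B ?a)"]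
    by simp
  also have "alpa B ?x (fOb F ?i) ?a \<cdot>\<^bsub>B\<^esub> (ida B ?x \<boxtimes>\<^bsub>B\<^esub> ?K \<boxtimes>\<^bsub>B\<^esub> ida B ?a) \<cdot>\<^bsub>B\<^esub> (?B \<boxtimes>\<^bsub>B\<^esub> ida B ?a)
     = (ida B ?x \<boxtimes>\<^bsub>B\<^esub> (?K \<boxtimes>\<^bsub>B\<^esub> ida B ?a)) \<cdot>\<^bsub>B\<^esub> alpa B ?x (B.tens \<i>\<^bsub>B\<^esub> (map (fOb F) as)) ?a \<cdot>\<^bsub>B\<^esub> (?B \<boxtimes>\<^bsub>B\<^esub> ida B ?a)"
    using o B.cmpa_reassoc[OF B.alpa_natural[of "ida B ?x" ?K "ida B ?a"], of "?B \<boxtimes>\<^bsub>B\<^esub> ida B ?a"] by simp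
  finally show ?case using o by (simp add: A.bet_append B.bet_append laxs_append B.tena_id_cmp)
qed

text \<open>The same compatibility for whiskered multimaps, from naturality in \<open>h\<close>.\<close>

lemma laxs_wh:
  assumes "h \<in> arr A" "src h = A.tens \<i> as" "x \<in> Obj A" "as \<in> lists (Obj A)"
  shows "mapa F (A.wh x as h) \<cdot>\<^bsub>B\<^esub> laxs (ida B (fOb F x)) x as
    = lax2a A B F x (trg h) \<cdot>\<^bsub>B\<^esub> B.wh (fOb F x) (map (fOb F) as) (mapa F h \<cdot>\<^bsub>B\<^esub> laxs (lax0a A B F) \<i> as)"
proof -
  let ?K = "laxs (lax0a A B F) \<i> as" and ?B = "B.bet (fOb F x) \<i>\<^bsub>B\<^esub> (rhoa B (fOb F x)) (map (fOb F) as)"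
  have "mapa F (A.wh x as h) \<cdot>\<^bsub>B\<^esub> laxs (ida B (fOb F x)) x as
     = mapa F (ida A x \<boxtimes> h) \<cdot>\<^bsub>B\<^esub> lax2a A B F x (A.tens \<i> as) \<cdot>\<^bsub>B\<^esub> (ida B (fOb F x) \<boxtimes>\<^bsub>B\<^esub> ?K) \<cdot>\<^bsub>B\<^esub> ?B"
    using assms by (simp add: A.wh_def mapa_cmp laxs_bet)
  also have "\<dots> = lax2a A B F x (trg h) \<cdot>\<^bsub>B\<^esub> (ida B (fOb F x) \<boxtimes>\<^bsub>B\<^esub> mapa F h) \<cdot>\<^bsub>B\<^esub> (ida B (fOb F x) \<boxtimes>\<^bsub>B\<^esub> ?K) \<cdot>\<^bsub>B\<^esub> ?B"
    using assms B.cmpa_reassoc[OF laxa_natural[of "ida A x" h], of "(ida B (fOb F x) \<boxtimes>\<^bsub>B\<^esub> ?K) \<cdot>\<^bsub>B\<^esub> ?B"] by simp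
  finally show ?thesis using assms by (simp add: B.wh_def B.tena_id_cmp)
qed

text \<open>
  On multimaps the functor acts by \<open>g \<mapsto> F g \<cdot> laxs\<close>. By this identity the action preserves the substitution
  of \<open>multi_of\<close>.
\<close>

lemma laxs_subst:
  assumes "g \<in> arr A" "h \<in> arr A" "src g = A.tens \<i> (us @ c # vs)" "src h = A.tens \<i> as" "trg h = c"
    "us \<in> lists (Obj A)" "vs \<in> lists (Obj A)" "as \<in> lists (Obj A)"
  shows "mapa F (g \<cdot> A.act (A.wh (A.tens \<i> us) as h) vs) \<cdot>\<^bsub>B\<^esub> laxs (lax0a A B F) \<i> (us @ as @ vs)
    = (mapa F g \<cdot>\<^bsub>B\<^esub> laxs (lax0a A B F) \<i> (us @ c # vs))
        \<cdot>\<^bsub>B\<^esub> B.act (B.wh (B.tens \<i>\<^bsub>B\<^esub> (map (fOb F) us)) (map (fOb F) as)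
              (mapa F h \<cdot>\<^bsub>B\<^esub> laxs (lax0a A B F) \<i> as)) (map (fOb F) vs)"
proof -
  let ?x = "A.tens \<i> us" let ?q = "A.wh ?x as h" let ?X = "laxs (lax0a A B F) \<i> us"
  let ?h = "mapa F h \<cdot>\<^bsub>B\<^esub> laxs (lax0a A B F) \<i> as" let ?as = "map (fOb F) as"
  let ?W = "B.wh (B.tens \<i>\<^bsub>B\<^esub> (map (fOb F) us)) ?as ?h"
  have c: "c \<in> Obj A" using assms by auto
  note o = assms c
  have "mapa F ?q \<cdot>\<^bsub>B\<^esub> laxs ?X ?x as = mapa F ?q \<cdot>\<^bsub>B\<^esub> laxs (ida B (fOb F ?x)) ?x as \<cdot>\<^bsub>B\<^esub> B.act ?X ?as"
    using o laxs_pre[of "ida B (fOb F ?x)" ?X ?x as] by simp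
  also have "\<dots> = lax2a A B F ?x c \<cdot>\<^bsub>B\<^esub> B.wh (fOb F ?x) ?as ?h \<cdot>\<^bsub>B\<^esub> B.act ?X ?as"
    using o B.cmpa_reassoc[OF laxs_wh[of h as ?x], of "B.act ?X ?as"] by simp
  also have "\<dots> = (lax2a A B F ?x c \<cdot>\<^bsub>B\<^esub> (?X \<boxtimes>\<^bsub>B\<^esub> ida B (fOb F c))) \<cdot>\<^bsub>B\<^esub> ?W"
    using o B.wh_natural[of ?X ?h ?as] by simp
  finally have *: "mapa F ?q \<cdot>\<^bsub>B\<^esub> laxs ?X ?x as = laxs (lax0a A B F) \<i> (us @ [c]) \<cdot>\<^bsub>B\<^esub> ?W"
    by (simp add: laxs_append)
  have "mapa F (A.act ?q vs) \<cdot>\<^bsub>B\<^esub> laxs (laxs ?X ?x as) (A.tens ?x as) vs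
      = laxs (mapa F ?q \<cdot>\<^bsub>B\<^esub> laxs ?X ?x as) (?x \<otimes> c) vs"
    using o laxs_post[of "laxs ?X ?x as" ?q vs] by simp
  also have "\<dots> = laxs (laxs (lax0a A B F) \<i> (us @ [c])) (?x \<otimes> c) vs \<cdot>\<^bsub>B\<^esub> B.act ?W (map (fOb F) vs)"
    unfolding * using o laxs_pre[of "laxs (lax0a A B F) \<i> (us @ [c])" ?W "?x \<otimes> c" vs] by simp
  also have "laxs (laxs (lax0a A B F) \<i> (us @ [c])) (?x \<otimes> c) vs = laxs (lax0a A B F) \<i> (us @ c # vs)"
    using laxs_append[of "lax0a A B F" \<i> "us @ [c]" vs] by simp
  finally have **: "mapa F (A.act ?q vs) \<cdot>\<^bsub>B\<^esub> laxs (laxs ?X ?x as) (A.tens ?x as) vs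
    = laxs (lax0a A B F) \<i> (us @ c # vs) \<cdot>\<^bsub>B\<^esub> B.act ?W (map (fOb F) vs)" .
  show ?thesis using o ** by (simp add: mapa_cmp laxs_append)
qed

end

section \<open>Multicategories with restricted substitution\<close>

definition short_ok :: "nat \<Rightarrow> nat \<Rightarrow> bool" where
  "short_ok n m \<longleftrightarrow> (n, m) \<in> sub_arities \<or> (n = 1 \<and> m \<le> 4) \<or> (m = 1 \<and> 1 \<le> n \<and> n \<le> 4)"

lemmas short_ok_simp = short_ok_def sub_arities_def

lemma short_ok_bounds: "short_ok n m \<Longrightarrow> 1 \<le> n \<and> n \<le> 4 \<and> m \<le> 4 \<and> n + m \<le> 5"
  by (auto simp: short_ok_simp)

lemma short_ok_sub: "short_ok n m \<Longrightarrow> n \<noteq> 1 \<Longrightarrow> m \<noteq> 1 \<Longrightarrow> (n, m) \<in> sub_arities"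
  by (auto simp: short_ok_def)

text \<open>
  If no map is unary, the conditions on the arities for nested and for parallel substitution are those
  of the two associativity axioms of a short multicategory.
\<close>

lemma short_ok_nested:
  assumes "short_ok n m" "short_ok m p" "short_ok (n + m - 1) p" "n \<noteq> 1" "m \<noteq> 1" "p \<noteq> 1"
  shows "n = 2 \<and> (m, p) \<in> {(2, 2), (2, 0)}"
proof -
  have "(n, m) \<in> {(2,2), (3,2), (2,3), (2,0), (3,0)}" "(m, p) \<in> {(2,2), (3,2), (2,3), (2,0), (3,0)}"
    using assms short_ok_sub by (auto simp: sub_arities_def)
  then show ?thesis using assms(3) by (elim insertE) (auto simp: short_ok_simp)
qed

lemma short_ok_parallel:
  assumes "short_ok 2 m" "short_ok 2 p" "short_ok (m + 1) p" "short_ok (p + 1) m" "m \<noteq> 1" "p \<noteq> 1"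
  shows "(m, p) \<in> {(2, 2), (2, 0), (0, 2), (0, 0)}"
proof -
  have "m \<in> {0, 2, 3}" "p \<in> {0, 2, 3}"
    using assms(1,2,5,6) by (auto simp: short_ok_simp)
  then show ?thesis using assms(3,4) by (elim insertE) (auto simp: short_ok_simp)
qed

text \<open>
  A common generalization of multicategories and short multicategories: \<open>ok n m\<close> states that \<open>m\<close>-ary maps
  may be substituted into \<open>n\<close>-ary ones, and a law is required when all substitutions in it are allowed.
  The law for parallel substitutions is restricted further, to the cases in which one of the inserted
  maps is unary or the outer map is binary: for the latter it is \<open>sub_assoc_B\<close> in a short multicategory,
  and for the former it is naturality.
\<close>

locale partial_multicategory =
  fixes X :: "('o, 'm) cat" and MM :: "'o list \<Rightarrow> 'o \<Rightarrow> 'm set" and S :: "('o, 'm) subst"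
    and ok :: "nat \<Rightarrow> nat \<Rightarrow> bool"
  assumes ok_cases: "ok = (\<lambda>n m. True) \<or> ok = short_ok"
    and hom_unary: "\<lbrakk>a \<in> Obj X; b \<in> Obj X\<rbrakk> \<Longrightarrow> Hom X a b = MM [a] b"
    and cmp_unary: "\<lbrakk>a \<in> Obj X; b \<in> Obj X; c \<in> Obj X; f \<in> MM [a] b; g \<in> MM [b] c\<rbrakk>
      \<Longrightarrow> Cmp X a b c g f = S [] b [] [a] c g f"
    and idm_unary: "a \<in> Obj X \<Longrightarrow> Idm X a \<in> MM [a] a"
    and sub_hom: "\<lbrakk>ok (length xs + 1 + length ys) (length as);
        xs \<in> lists (Obj X); b \<in> Obj X; ys \<in> lists (Obj X); as \<in> lists (Obj X); c \<in> Obj X;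
        f \<in> MM (xs @ b # ys) c; g \<in> MM as b\<rbrakk> \<Longrightarrow> S xs b ys as c f g \<in> MM (xs @ as @ ys) c"
    and sub_id_right: "\<lbrakk>ok (length xs + 1 + length ys) 1;
        xs \<in> lists (Obj X); b \<in> Obj X; ys \<in> lists (Obj X); c \<in> Obj X; f \<in> MM (xs @ b # ys) c\<rbrakk>
      \<Longrightarrow> S xs b ys [b] c f (Idm X b) = f"
    and sub_id_left: "\<lbrakk>ok 1 (length as); as \<in> lists (Obj X); b \<in> Obj X; g \<in> MM as b\<rbrakk>
      \<Longrightarrow> S [] b [] as b (Idm X b) g = g"
    and sub_assoc_nested: "\<lbrakk>
        ok (length xs + 1 + length ys) (length us + 1 + length vs);
        ok (length us + 1 + length vs) (length as);
        ok (length xs + 1 + length ys) (length us + length as + length vs);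
        ok (length xs + length us + 1 + length vs + length ys) (length as);
        xs \<in> lists (Obj X); b \<in> Obj X; ys \<in> lists (Obj X);
        us \<in> lists (Obj X); c \<in> Obj X; vs \<in> lists (Obj X); as \<in> lists (Obj X); d \<in> Obj X;
        f \<in> MM (xs @ b # ys) d; g \<in> MM (us @ c # vs) b; h \<in> MM as c\<rbrakk>
      \<Longrightarrow> S xs b ys (us @ as @ vs) d f (S us c vs as b g h)
        = S (xs @ us) c (vs @ ys) as d (S xs b ys (us @ c # vs) d f g) h"
    and sub_assoc_parallel: "\<lbrakk>
        ok (length xs + 2 + length ys + length zs) (length as);
        ok (length xs + 2 + length ys + length zs) (length as');
        ok (length xs + length as + length ys + 1 + length zs) (length as');
        ok (length xs + 1 + length ys + length as' + length zs) (length as);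
        length as = 1 \<or> length as' = 1 \<or> (xs = [] \<and> ys = [] \<and> zs = []);
        xs \<in> lists (Obj X); b \<in> Obj X; ys \<in> lists (Obj X); c \<in> Obj X;
        zs \<in> lists (Obj X); as \<in> lists (Obj X); as' \<in> lists (Obj X); d \<in> Obj X;
        f \<in> MM (xs @ b # ys @ c # zs) d; g \<in> MM as b; h \<in> MM as' c\<rbrakk>
      \<Longrightarrow> S (xs @ as @ ys) c zs as' d (S xs b (ys @ c # zs) as d f g) h
        = S xs b (ys @ as' @ zs) as d (S (xs @ b # ys) c zs as' d f h) g"

lemma partial_multicategory_multi:
  assumes "multicategory M"
  shows "partial_multicategory (unary_cat M) (mHom M) (mSub M) (\<lambda>n m. True)"
proof -
  interpret multicategory M by fact
  show ?thesis
    by unfold_locales (auto simp: unary_cat_def id_hom sub_hom sub_id_right sub_id_left sub_assoc_nested sub_assoc_parallel)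
qed

subsection \<open>Short multicategories\<close>

lemma Homs_simps [simp]:
  "ps \<in> Homs C [] bs \<longleftrightarrow> ps = [] \<and> bs = []"
  "ps \<in> Homs C as [] \<longleftrightarrow> ps = [] \<and> as = []"
  "p # ps \<in> Homs C (a # as) (b # bs) \<longleftrightarrow> p \<in> Hom C a b \<and> ps \<in> Homs C as bs"
  by (auto simp: Homs_def nth_Cons split: nat.splits)

lemma Homs_append [simp]:
  "ps \<in> Homs C as as' \<Longrightarrow> qs \<in> Homs C bs bs' \<Longrightarrow> ps @ qs \<in> Homs C (as @ bs) (as' @ bs')"
  by (auto simp: Homs_def nth_append)

lemma Homs_length: "ps \<in> Homs C as as' \<Longrightarrow> length ps = length as \<and> length as' = length as"
  by (auto simp: Homs_def)

lemma Idms_simps [simp]: "Idms C [] = []" "Idms C (a # as) = Idm C a # Idms C as"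
  "Idms C (as @ bs) = Idms C as @ Idms C bs" "length (Idms C as) = length as"
  by (auto simp: Idms_def)

lemma Cmps_simps [simp]: "Cmps C as bs cs qs [] = []"
  "Cmps C (a # as) (b # bs) (c # cs) (q # qs) (p # ps) = Cmp C a b c q p # Cmps C as bs cs qs ps"
  by (auto simp: Cmps_def simp del: upt_Suc simp add: upt_conv_Cons map_Suc_upt[symmetric])

lemma Cmps_append:
  "length as = length ps \<Longrightarrow> length bs = length ps \<Longrightarrow> length cs = length ps \<Longrightarrow> length qs = length ps \<Longrightarrow>
   Cmps C (as @ as') (bs @ bs') (cs @ cs') (qs @ qs') (ps @ ps') = Cmps C as bs cs qs ps @ Cmps C as' bs' cs' qs' ps'"
proof (induction ps arbitrary: as bs cs qs)
  case (Cons p ps)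
  then show ?case by (cases as; cases bs; cases cs; cases qs) auto
qed auto

context short_multicategory begin

lemma Idms_Homs [simp]: "as \<in> lists (Obj C) \<Longrightarrow> Idms C as \<in> Homs C as as"
  by (induction as) (auto simp: idm_hom)

lemma Cmps_Idms:
  assumes "ps \<in> Homs C as bs" "as \<in> lists (Obj C)" "bs \<in> lists (Obj C)"
  shows "Cmps C as bs bs (Idms C bs) ps = ps" "Cmps C as as bs ps (Idms C as) = ps"
proof -
  have "length as = length ps" "length bs = length ps" using assms by (auto simp: Homs_def)
  from this assms have "Cmps C as bs bs (Idms C bs) ps = ps \<and> Cmps C as as bs ps (Idms C as) = ps"
  proof (induction ps arbitrary: as bs)
    case (Cons p ps)
    then show ?case by (cases as; cases bs) (auto simp: cmp_id_left cmp_id_right)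
  qed auto
  then show "Cmps C as bs bs (Idms C bs) ps = ps" "Cmps C as as bs ps (Idms C as) = ps" by auto
qed

lemma Cmps_Idms_Idms [simp]: "as \<in> lists (Obj C) \<Longrightarrow> Cmps C as as as (Idms C as) (Idms C as) = Idms C as"
  using Cmps_Idms by simp

definition pre :: "'o list \<Rightarrow> 'o \<Rightarrow> 'o list \<Rightarrow> 'o \<Rightarrow> 'o \<Rightarrow> 'm \<Rightarrow> 'm \<Rightarrow> 'm" where
  "pre xs b ys a c f p = Act C (xs @ b # ys) c (xs @ a # ys) c (Idms C xs @ p # Idms C ys) (Idm C c) f"

definition post :: "'o list \<Rightarrow> 'o \<Rightarrow> 'o \<Rightarrow> 'm \<Rightarrow> 'm \<Rightarrow> 'm" where
  "post as b c q f = Act C as b as c (Idms C as) q f"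

lemma pre_mul:
  assumes "xs \<in> lists (Obj C)" "ys \<in> lists (Obj C)" "a \<in> Obj C" "b \<in> Obj C" "c \<in> Obj C"
    "length xs + length ys \<le> 3" "f \<in> Mul C (xs @ b # ys) c" "p \<in> Hom C a b"
  shows "pre xs b ys a c f p \<in> Mul C (xs @ a # ys) c"
  unfolding pre_def by (rule act_mul) (use assms in \<open>auto simp: idm_hom\<close>)

lemma post_mul:
  assumes "as \<in> lists (Obj C)" "b \<in> Obj C" "c \<in> Obj C" "length as \<le> 4" "f \<in> Mul C as b" "q \<in> Hom C b c"
  shows "post as b c q f \<in> Mul C as c"
  unfolding post_def by (rule act_mul) (use assms in auto)

lemma gsub_pre: "gsub C xs b ys [a] c f p = pre xs b ys a c f p"
  by (simp add: gsub_def pre_def)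

lemma pre_unary:
  assumes "a \<in> Obj C" "b \<in> Obj C" "c \<in> Obj C" "f \<in> Hom C b c" "p \<in> Hom C a b"
  shows "pre [] b [] a c f p = Cmp C a b c f p"
  unfolding pre_def using assms by (simp add: act_unary cmp_hom cmp_id_left idm_hom)

lemma post_unary:
  assumes "a \<in> Obj C" "b \<in> Obj C" "c \<in> Obj C" "f \<in> Hom C b c" "p \<in> Hom C a b"
  shows "post [a] b c f p = Cmp C a b c f p"
  unfolding post_def using assms by (simp add: act_unary cmp_hom cmp_id_right idm_hom)

lemma gsub_post:
  assumes "b \<in> Obj C" "c \<in> Obj C" "as \<in> lists (Obj C)" "f \<in> Hom C b c" "g \<in> Mul C as b"
  shows "gsub C [] b [] as c f g = post as b c f g"
proof (cases "length as = 1")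
  case True
  then obtain a where "as = [a]" by (cases as) auto
  then show ?thesis using assms by (simp add: gsub_pre pre_unary post_unary mul_unary)
qed (auto simp: gsub_def post_def)

lemma gsub_sub: "length as \<noteq> 1 \<Longrightarrow> xs \<noteq> [] \<or> ys \<noteq> [] \<Longrightarrow> gsub C xs b ys as c f g = Sub C xs b ys as c f g"
  by (auto simp: gsub_def)

lemma gsub_mul:
  assumes "short_ok (length xs + 1 + length ys) (length as)"
    "xs \<in> lists (Obj C)" "b \<in> Obj C" "ys \<in> lists (Obj C)" "as \<in> lists (Obj C)" "c \<in> Obj C"
    "f \<in> Mul C (xs @ b # ys) c" "g \<in> Mul C as b"
  shows "gsub C xs b ys as c f g \<in> Mul C (xs @ as @ ys) c"
proof -
  consider a where "as = [a]" | "length as \<noteq> 1" "xs = []" "ys = []" | "length as \<noteq> 1" "xs \<noteq> [] \<or> ys \<noteq> []"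
    by (cases as) auto
  then show ?thesis
  proof cases
    case 1
    have "length xs + length ys \<le> 3" using assms(1) 1 by (auto dest: short_ok_bounds)
    then show ?thesis using 1 assms by (auto simp: gsub_pre mul_unary intro!: pre_mul)
  next
    case 2
    have "length as \<le> 4" using assms(1) 2 by (auto simp: short_ok_simp)
    then show ?thesis using 2 assms by (auto simp: gsub_post mul_unary intro!: post_mul)
  next
    case 3
    have "(length xs + 1 + length ys, length as) \<in> sub_arities" using assms(1) 3 by (intro short_ok_sub) auto
    then show ?thesis using 3 assms by (auto simp: gsub_sub intro!: sub_mul)
  qed
qed

lemma act_id_eq: "as \<in> lists (Obj C) \<Longrightarrow> b \<in> Obj C \<Longrightarrow> length as \<le> 4 \<Longrightarrow> f \<in> Mul C as b \<Longrightarrow> ids = Idms C as \<Longrightarrow>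
   Act C as b as b ids (Idm C b) f = f"
  using act_id by simp

lemma pre_pre_nested:
  assumes "xs \<in> lists (Obj C)" "ys \<in> lists (Obj C)" "a \<in> Obj C" "b \<in> Obj C" "c \<in> Obj C" "d \<in> Obj C"
    "length xs + length ys \<le> 3" "f \<in> Mul C (xs @ b # ys) d" "g \<in> Hom C c b" "h \<in> Hom C a c"
  shows "pre xs b ys a d f (Cmp C a c b g h) = pre xs c ys a d (pre xs b ys c d f g) h"
  unfolding pre_def using assms
  by (subst act_cmp[symmetric]) (auto simp: idm_hom Cmps_append cmp_id_left)

lemma post_post:
  assumes "as \<in> lists (Obj C)" "c \<in> Obj C" "b \<in> Obj C" "d \<in> Obj C"
    "length as \<le> 4" "f \<in> Hom C b d" "g \<in> Hom C c b" "h \<in> Mul C as c"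
  shows "post as b d f (post as c b g h) = post as c d (Cmp C c b d f g) h"
  unfolding post_def using assms by (subst act_cmp[symmetric]) auto

lemma post_pre:
  assumes "xs \<in> lists (Obj C)" "ys \<in> lists (Obj C)" "a \<in> Obj C" "b \<in> Obj C" "c \<in> Obj C" "d \<in> Obj C"
    "length xs + length ys \<le> 3" "f \<in> Hom C b d" "g \<in> Mul C (xs @ c # ys) b" "h \<in> Hom C a c"
  shows "post (xs @ a # ys) b d f (pre xs c ys a b g h) = pre xs c ys a d (post (xs @ c # ys) b d f g) h"
  unfolding post_def pre_def using assms
  by (subst (1 2) act_cmp[symmetric]) (auto simp: idm_hom Cmps_append cmp_id_left cmp_id_right)

text \<open>
  If one of the three maps is unary, this is functoriality, naturality or dinaturality; otherwise the
  arities are those of \<open>sub_assoc_A\<close>.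
\<close>

lemma partial_nested:
  assumes oks: "short_ok (length xs + 1 + length ys) (length us + 1 + length vs)"
    "short_ok (length us + 1 + length vs) (length as)"
    "short_ok (length xs + 1 + length ys) (length us + length as + length vs)"
    "short_ok (length xs + length us + 1 + length vs + length ys) (length as)"
    and o: "xs \<in> lists (Obj C)" "b \<in> Obj C" "ys \<in> lists (Obj C)"
    "us \<in> lists (Obj C)" "c \<in> Obj C" "vs \<in> lists (Obj C)" "as \<in> lists (Obj C)" "d \<in> Obj C"
    and m: "f \<in> Mul C (xs @ b # ys) d" "g \<in> Mul C (us @ c # vs) b" "h \<in> Mul C as c"
  shows "gsub C xs b ys (us @ as @ vs) d f (gsub C us c vs as b g h)
        = gsub C (xs @ us) c (vs @ ys) as d (gsub C xs b ys (us @ c # vs) d f g) h"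
proof -
  let ?n = "length xs + 1 + length ys" and ?m = "length us + 1 + length vs" and ?p = "length as"
  have n1: "?n = 1 \<longleftrightarrow> xs = [] \<and> ys = []" and m1: "?m = 1 \<longleftrightarrow> us = [] \<and> vs = []" by auto
  have len: "length xs + length ys \<le> 3" "length us + length vs \<le> 3" "length as \<le> 4"
    "length xs + length us + length vs + length ys \<le> 3"
    using oks[THEN short_ok_bounds] by auto
  have inner: "gsub C us c vs as b g h \<in> Mul C (us @ as @ vs) b"
    using oks(2) o m by (intro gsub_mul) auto
  consider a where "as = [a]" "?n = 1" | a where "as = [a]" "?m = 1" | a where "as = [a]" "?n \<noteq> 1" "?m \<noteq> 1"
    | "?p \<noteq> 1" "?n = 1" "?m = 1" | "?p \<noteq> 1" "?n = 1" "?m \<noteq> 1" | "?p \<noteq> 1" "?n \<noteq> 1" "?m = 1"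
    | "?p \<noteq> 1" "?n \<noteq> 1" "?m \<noteq> 1"
  proof (cases "?p = 1")
    case True
    then obtain a where "as = [a]" by (cases as) auto
    then show ?thesis using that by blast
  qed (use that in blast)
  then show ?thesis
  proof cases
    case 1
    then have e: "xs = []" "ys = []" using n1 by auto
    then show ?thesis using 1 o m len inner
      by (simp add: gsub_post gsub_pre mul_unary post_pre)
  next
    case 2
    then have e: "us = []" "vs = []" using m1 by auto
    then show ?thesis using 2 o m len pre_pre_nested[of xs ys a b c d f g h]
      by (simp add: gsub_pre mul_unary pre_unary)
  next
    case 3
    have s: "(?n, length (us @ c # vs)) \<in> sub_arities" using short_ok_sub[OF oks(1)] 3 by simp
    have "Sub C xs b ys (us @ [a] @ vs) d f (pre us c vs a b g h)
      = Sub C xs b ys (us @ [a] @ vs) d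
          (Act C (xs @ b # ys) d (xs @ b # ys) d (Idms C xs @ Idm C b # Idms C ys) (Idm C d) f)
          (Act C (us @ c # vs) b (us @ [a] @ vs) b (Idms C us @ h # Idms C vs) (Idm C b) g)"
      using o m 3 len by (simp add: pre_def act_id_eq)
    also have "\<dots> = pre (xs @ us) c (vs @ ys) a d (Sub C xs b ys (us @ c # vs) d f g) h"
      using o m 3 len s by (subst sub_natural) (auto simp: pre_def idm_hom mul_unary)
    finally show ?thesis using 3 n1 by (auto simp: gsub_pre gsub_sub)
  next
    case 4
    then have e: "xs = []" "ys = []" "us = []" "vs = []" using n1 m1 by auto
    then show ?thesis using 4 o m len inner
      by (simp add: gsub_post gsub_pre mul_unary post_post pre_unary cmp_hom)
  next
    case 5
    then have e: "xs = []" "ys = []" using n1 by auto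
    have s: "(?m, ?p) \<in> sub_arities" using short_ok_sub[OF oks(2)] 5 by simp
    have "post (us @ as @ vs) b d f (Sub C us c vs as b g h)
      = Sub C us c vs as d (post (us @ c # vs) b d f g) (Act C as c as c (Idms C as) (Idm C c) h)"
      using o m 5 len s e unfolding post_def by (subst (2) Idms_simps(3), subst Idms_simps(2), subst sub_natural) (auto simp: mul_unary)
    also have "\<dots> = Sub C us c vs as d (post (us @ c # vs) b d f g) h"
      using o m len by (simp add: act_id_eq)
    finally show ?thesis using 5 e o m m1 inner by (auto simp: gsub_post gsub_sub mul_unary)
  next
    case 6
    then have e: "us = []" "vs = []" using m1 by auto
    have s: "(?n, ?p) \<in> sub_arities" using short_ok_sub[OF oks(4)] 6 e by simp
    have "Sub C xs c ys as d (pre xs b ys c d f g) h = Sub C xs b ys as d f (post as c b g h)"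
      unfolding pre_def post_def by (rule sub_dinatural) (use o m s e mul_unary in auto)
    then show ?thesis using 6 e o m n1 by (auto simp: gsub_post gsub_sub gsub_pre mul_unary)
  next
    case 7
    have "?n = 2 \<and> (?m, ?p) \<in> {(2, 2), (2, 0)}"
      using short_ok_nested[of ?n ?m ?p] 7 oks by (simp add: algebra_simps)
    then show ?thesis using o m by (intro sub_assoc_A) auto
  qed
qed

text \<open>
  If one of the inserted maps is unary, this is functoriality or naturality; otherwise the arities are
  those of \<open>sub_assoc_B\<close>.
\<close>

lemma partial_parallel:
  assumes oks: "short_ok (length xs + 2 + length ys + length zs) (length as)"
        "short_ok (length xs + 2 + length ys + length zs) (length as')"
        "short_ok (length xs + length as + length ys + 1 + length zs) (length as')"
        "short_ok (length xs + 1 + length ys + length as' + length zs) (length as)"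
        "length as = 1 \<or> length as' = 1 \<or> (xs = [] \<and> ys = [] \<and> zs = [])"
    and o: "xs \<in> lists (Obj C)" "b \<in> Obj C" "ys \<in> lists (Obj C)" "c \<in> Obj C"
        "zs \<in> lists (Obj C)" "as \<in> lists (Obj C)" "as' \<in> lists (Obj C)" "d \<in> Obj C"
    and m: "f \<in> Mul C (xs @ b # ys @ c # zs) d" "g \<in> Mul C as b" "h \<in> Mul C as' c"
  shows "gsub C (xs @ as @ ys) c zs as' d (gsub C xs b (ys @ c # zs) as d f g) h
        = gsub C xs b (ys @ as' @ zs) as d (gsub C (xs @ b # ys) c zs as' d f h) g"
proof -
  have len: "length xs + length ys + length zs \<le> 2" "length as \<le> 4" "length as' \<le> 4"
    using oks(1-4)[THEN short_ok_bounds] by auto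
  consider a a' where "as = [a]" "as' = [a']" | a where "as = [a]" "length as' \<noteq> 1"
    | a' where "length as \<noteq> 1" "as' = [a']" | "length as \<noteq> 1" "length as' \<noteq> 1"
    by (cases as; cases as') (auto simp: length_Suc_conv)
  then show ?thesis
  proof cases
    case 1
    then have gh: "g \<in> Hom C a b" "h \<in> Hom C a' c" "a \<in> Obj C" "a' \<in> Obj C" using o m by (auto simp: mul_unary)
    let ?A = "Act C (xs @ b # ys @ c # zs) d (xs @ a # ys @ a' # zs) d (Idms C xs @ g # Idms C ys @ h # Idms C zs) (Idm C d) f"
    have "pre (xs @ a # ys) c zs a' d (pre xs b (ys @ c # zs) a d f g) h = ?A"
      using o m gh len unfolding pre_def append.assoc append.simps
      by (subst act_cmp[symmetric]) (auto simp: idm_hom Cmps_append cmp_id_left cmp_id_right)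
    moreover have "pre xs b (ys @ a' # zs) a d (pre (xs @ b # ys) c zs a' d f h) g = ?A"
      using o m gh len unfolding pre_def append.assoc append.simps
      by (subst act_cmp[symmetric]) (auto simp: idm_hom Cmps_append cmp_id_left cmp_id_right)
    ultimately show ?thesis using 1 by (simp add: gsub_pre)
  next
    case 2
    then have g: "g \<in> Hom C a b" "a \<in> Obj C" using o m by (auto simp: mul_unary)
    have s: "(length (xs @ b # ys) + 1 + length zs, length as') \<in> sub_arities"
      using short_ok_sub[OF oks(2)] 2 by simp
    have "Sub C (xs @ a # ys) c zs as' d (pre xs b (ys @ c # zs) a d f g) h
       = Sub C (xs @ a # ys) c zs as' d
          (Act C ((xs @ b # ys) @ c # zs) d ((xs @ a # ys) @ c # zs) d ((Idms C xs @ g # Idms C ys) @ Idm C c # Idms C zs) (Idm C d) f)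
          (Act C as' c as' c (Idms C as') (Idm C c) h)"
      using o m g len by (simp add: pre_def act_id)
    also have "\<dots> = pre xs b (ys @ as' @ zs) a d (Sub C (xs @ b # ys) c zs as' d f h) g"
      using o m g len s by (subst sub_natural) (auto simp: pre_def idm_hom)
    finally show ?thesis using 2 by (simp add: gsub_pre gsub_sub)
  next
    case 3
    then have h: "h \<in> Hom C a' c" "a' \<in> Obj C" using o m by (auto simp: mul_unary)
    have s: "(length xs + 1 + length (ys @ c # zs), length as) \<in> sub_arities"
      using short_ok_sub[OF oks(1)] 3 by (simp add: add.assoc)
    have "Sub C xs b (ys @ a' # zs) as d (pre (xs @ b # ys) c zs a' d f h) g
       = Sub C xs b (ys @ a' # zs) as d
          (Act C (xs @ b # (ys @ c # zs)) d (xs @ b # (ys @ a' # zs)) d (Idms C xs @ Idm C b # (Idms C ys @ h # Idms C zs)) (Idm C d) f)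
          (Act C as b as b (Idms C as) (Idm C b) g)"
      using o m h len by (simp add: pre_def act_id)
    also have "\<dots> = pre (xs @ as @ ys) c zs a' d (Sub C xs b (ys @ c # zs) as d f g) h"
      using o m h len s by (subst sub_natural) (auto simp: pre_def idm_hom)
    finally show ?thesis using 3 by (simp add: gsub_pre gsub_sub)
  next
    case 4
    then have e: "xs = []" "ys = []" "zs = []" using oks(5) by auto
    then have "(length as, length as') \<in> {(2, 2), (2, 0), (0, 2), (0, 0)}"
      using 4 oks short_ok_parallel[of "length as" "length as'"] by (simp add: algebra_simps numeral_2_eq_2)
    then show ?thesis using sub_assoc_B[of as as' b c d f g h] o m e by simp
  qed
qed

lemma partial_multicategory_short:
  "partial_multicategory (cat.truncate C) (Mul C) (gsub C) short_ok"
proof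
  fix xs b ys c f
  assume *: "short_ok (length xs + 1 + length ys) 1" "xs \<in> lists (Obj (cat.truncate C))" "b \<in> Obj (cat.truncate C)"
    "ys \<in> lists (Obj (cat.truncate C))" "c \<in> Obj (cat.truncate C)" "f \<in> Mul C (xs @ b # ys) c"
  then have "length xs + length ys \<le> 3" by (auto simp: short_ok_simp)
  then show "gsub C xs b ys [b] c f (Idm (cat.truncate C) b) = f"
    using * by (simp add: gsub_pre pre_def cat.truncate_def act_id_eq)
next
  fix as b g
  assume *: "short_ok 1 (length as)" "as \<in> lists (Obj (cat.truncate C))" "b \<in> Obj (cat.truncate C)" "g \<in> Mul C as b"
  then have "length as \<le> 4" by (auto simp: short_ok_simp)
  then show "gsub C [] b [] as b (Idm (cat.truncate C) b) g = g"
    using * by (simp add: gsub_post post_def cat.truncate_def act_id_eq idm_hom)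
qed (auto simp: cat.truncate_def mul_unary gsub_pre pre_unary idm_hom gsub_mul partial_nested partial_parallel)

end

section \<open>Multimaps as triples\<close>

type_synonym ('o, 'm) marrow = "'o list \<times> 'm \<times> 'o"

text \<open>The arrows of \<open>X\<close> are the unary multimaps; only the shape of the domain differs.\<close>

definition una :: "('o, 'm) arrow \<Rightarrow> ('o, 'm) marrow" where
  "una f = ([src f], raw f, trg f)"

lemma una_simps [simp]: "src (una f) = [src f]" "trg (una f) = trg f" "raw (una f) = raw f"
  by (simp_all add: una_def)

lemma una_inj [simp]: "una f = una g \<longleftrightarrow> f = g"
  by (auto simp: una_def prod_eq_iff)

declare arr_obj [simp]

context partial_multicategory begin

lemma ok_short: "short_ok n m \<Longrightarrow> ok n m"
  using ok_cases by auto

lemma ok_1 [simp]: "m \<le> 4 \<Longrightarrow> ok (Suc 0) m" "1 \<le> n \<Longrightarrow> n \<le> 4 \<Longrightarrow> ok n (Suc 0)"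
  by (auto intro!: ok_short simp: short_ok_simp)

lemma ok_2 [simp]: "m \<le> 3 \<Longrightarrow> ok (Suc (Suc 0)) m" "m \<le> 2 \<Longrightarrow> ok (Suc (Suc (Suc 0))) m"
proof -
  show "ok (Suc (Suc 0)) m" if "m \<le> 3"
    using that ok_short[of 2 m] by (auto simp: short_ok_simp le_Suc_eq numeral_eq_Suc)
  show "ok (Suc (Suc (Suc 0))) m" if "m \<le> 2"
    using that ok_short[of 3 m] by (auto simp: short_ok_simp le_Suc_eq numeral_eq_Suc)
qed

lemma ok_total: "ok n m \<Longrightarrow> 1 \<le> n \<Longrightarrow> ok (Suc 0) (n + m - 1)"
  using ok_cases short_ok_bounds[of n m] by (auto simp: short_ok_simp)

lemma ok_dom: "ok n m \<Longrightarrow> 1 \<le> n \<Longrightarrow> ok (Suc 0) n \<and> ok (Suc 0) m \<and> ok n (Suc 0)"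
  using ok_cases short_ok_bounds[of n m] by (auto simp: short_ok_simp)

lemma ok_unary: "ok (Suc 0) n \<Longrightarrow> 1 \<le> n \<Longrightarrow> ok n (Suc 0)"
  using ok_cases short_ok_bounds[of 1 n] by (auto simp: short_ok_simp)

lemma category_X: "category X"
proof
  show "Idm X a \<in> Hom X a a" if "a \<in> Obj X" for a
    using that by (simp add: hom_unary idm_unary)
next
  fix a b c f g assume o: "a \<in> Obj X" "b \<in> Obj X" "c \<in> Obj X" "f \<in> Hom X a b" "g \<in> Hom X b c"
  then show "Cmp X a b c g f \<in> Hom X a c"
    using sub_hom[of "[]" "[]" "[a]" b c g f] by (simp add: hom_unary cmp_unary)
next
  fix a b f assume o: "a \<in> Obj X" "b \<in> Obj X" "f \<in> Hom X a b"
  then show "Cmp X a b b (Idm X b) f = f" "Cmp X a a b f (Idm X a) = f"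
    using sub_id_left[of "[a]" b f] sub_id_right[of "[]" "[]" a b f] by (simp_all add: hom_unary cmp_unary idm_unary)
next
  fix a b c d f g h assume o: "a \<in> Obj X" "b \<in> Obj X" "c \<in> Obj X" "d \<in> Obj X"
    "f \<in> Hom X a b" "g \<in> Hom X b c" "h \<in> Hom X c d"
  then show "Cmp X a b d (Cmp X b c d h g) f = Cmp X a c d h (Cmp X a b c g f)"
    using sub_assoc_nested[of "[]" "[]" "[]" "[]" "[a]" c b d h g f] sub_hom[of "[]" "[]" "[a]" b c g f]
      sub_hom[of "[]" "[]" "[b]" c d h g]
    by (simp add: hom_unary cmp_unary)
qed

interpretation X: category X by (rule category_X)

text \<open>The condition \<open>ok 1 (length (src F))\<close> bounds the arity by 4 in the case of short multicategories.\<close>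

definition mar :: "('o, 'm) marrow set" where
  "mar = {F. src F \<in> lists (Obj X) \<and> trg F \<in> Obj X \<and> ok 1 (length (src F)) \<and> raw F \<in> MM (src F) (trg F)}"

definition msub :: "('o, 'm) marrow \<Rightarrow> nat \<Rightarrow> ('o, 'm) marrow \<Rightarrow> ('o, 'm) marrow"
    (\<open>(_/ \<odot>[_] _)\<close> [70, 0, 71] 70) where
  "F \<odot>[i] G = (take i (src F) @ src G @ drop (Suc i) (src F),
     S (take i (src F)) (src F ! i) (drop (Suc i) (src F)) (src G) (trg F) (raw F) (raw G), trg F)"

lemma msub_src_trg [simp]:
  "src (F \<odot>[i] G) = take i (src F) @ src G @ drop (Suc i) (src F)" "trg (F \<odot>[i] G) = trg F"
  by (simp_all add: msub_def)

lemma msub_eq: "src F = xs @ b # ys \<Longrightarrow> length xs = i \<Longrightarrow>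
  F \<odot>[i] G = (xs @ src G @ ys, S xs b ys (src G) (trg F) (raw F) (raw G), trg F)"
  by (auto simp: msub_def)

lemma mar_objs: "F \<in> mar \<Longrightarrow> src F \<in> lists (Obj X)" "F \<in> mar \<Longrightarrow> trg F \<in> Obj X"
  "F \<in> mar \<Longrightarrow> ok (Suc 0) (length (src F))" "F \<in> mar \<Longrightarrow> raw F \<in> MM (src F) (trg F)"
  by (auto simp: mar_def)

lemma mar_split:
  assumes "F \<in> mar" "i < length (src F)"
  obtains xs b ys where "src F = xs @ b # ys" "length xs = i" "xs \<in> lists (Obj X)" "b \<in> Obj X" "ys \<in> lists (Obj X)"
  using mar_objs(1)[OF assms(1)] id_take_nth_drop[OF assms(2)] assms(2)
  by (metis append_in_lists_conv Cons_in_lists_iff length_take min.absorb4)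

lemma msub_mar [simp]:
  assumes "F \<in> mar" "G \<in> mar" "i < length (src F)" "src F ! i = trg G" "ok (length (src F)) (length (src G))"
  shows "F \<odot>[i] G \<in> mar"
proof -
  obtain xs b ys where F: "src F = xs @ b # ys" "length xs = i" "xs \<in> lists (Obj X)" "b \<in> Obj X" "ys \<in> lists (Obj X)"
    using mar_split assms by metis
  have "S xs b ys (src G) (trg F) (raw F) (raw G) \<in> MM (xs @ src G @ ys) (trg F)"
    by (rule sub_hom) (use assms F mar_objs[of F] mar_objs[of G] in auto)
  moreover have "length xs + (length (src G) + length ys) = length (src F) + length (src G) - 1"
    using F(1) by simp
  then have "ok 1 (length xs + (length (src G) + length ys))"
    using ok_total[OF assms(5)] F(1) by (simp add: ac_simps)
  ultimately show ?thesis
    unfolding msub_eq[OF F(1,2)] mar_def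
    using F(3,5) mar_objs(2)[OF assms(1)] mar_objs(1)[OF assms(2)] by simp
qed

text \<open>
  As rewrite rules, \<open>nested\<close> and \<open>parallel\<close> bring composites into a normal form: bracketed to the left, with
  substitutions at earlier positions performed first. Positions count from 0.
\<close>

lemma nested:
  assumes "F \<in> mar" "G \<in> mar" "H \<in> mar" "i < length (src F)" "j < length (src G)"
    "src F ! i = trg G" "src G ! j = trg H"
    "ok (length (src F)) (length (src G))" "ok (length (src G)) (length (src H))"
    "ok (length (src F)) (length (src G) + length (src H) - 1)"
    "ok (length (src F) + length (src G) - 1) (length (src H))"
  shows "F \<odot>[i] (G \<odot>[j] H) = F \<odot>[i] G \<odot>[i + j] H"
proof -
  obtain xs b ys where F: "src F = xs @ b # ys" "length xs = i" "xs \<in> lists (Obj X)" "b \<in> Obj X" "ys \<in> lists (Obj X)"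
    using mar_split assms by metis
  obtain us c vs where G: "src G = us @ c # vs" "length us = j" "us \<in> lists (Obj X)" "c \<in> Obj X" "vs \<in> lists (Obj X)"
    using mar_split assms by metis
  have FG: "src (F \<odot>[i] G) = (xs @ us) @ c # (vs @ ys)" using F G by (simp add: msub_eq)
  have "S xs b ys (us @ src H @ vs) (trg F) (raw F) (S us c vs (src H) b (raw G) (raw H))
     = S (xs @ us) c (vs @ ys) (src H) (trg F) (S xs b ys (us @ c # vs) (trg F) (raw F) (raw G)) (raw H)"
    by (rule sub_assoc_nested)
       (use assms F G mar_objs[of F] mar_objs[of G] mar_objs[of H] in \<open>auto simp: algebra_simps\<close>)
  moreover have "b = trg G" "c = trg H" using F G assms(6,7) by (auto simp: nth_append)
  moreover have "F \<odot>[i] G \<odot>[i + j] H = ((xs @ us) @ src H @ (vs @ ys),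
      S (xs @ us) c (vs @ ys) (src H) (trg F) (raw (F \<odot>[i] G)) (raw H), trg F)"
    using F(2) G(2) by (subst msub_eq[OF FG]) auto
  ultimately show ?thesis
    using G by (simp add: msub_eq[OF F(1,2)] msub_eq[OF G(1,2)])
qed

lemma parallel:
  assumes "F \<in> mar" "G \<in> mar" "H \<in> mar" "i < j" "j < length (src F)"
    "src F ! i = trg G" "src F ! j = trg H"
    "ok (length (src F)) (length (src G))" "ok (length (src F)) (length (src H))"
    "ok (length (src F) + length (src G) - 1) (length (src H))"
    "ok (length (src F) + length (src H) - 1) (length (src G))"
    "length (src G) = 1 \<or> length (src H) = 1 \<or> length (src F) = 2"
  shows "F \<odot>[j] H \<odot>[i] G = F \<odot>[i] G \<odot>[j + length (src G) - 1] H"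
proof -
  obtain ws c zs where w: "src F = ws @ c # zs" "length ws = j" "ws \<in> lists (Obj X)" "c \<in> Obj X" "zs \<in> lists (Obj X)"
    using mar_split assms by metis
  have "i < length ws" using w assms by simp
  define xs b ys where "xs = take i ws" "b = ws ! i" "ys = drop (Suc i) ws"
  have ws: "ws = xs @ b # ys" "length xs = i"
    using id_take_nth_drop[OF \<open>i < length ws\<close>] \<open>i < length ws\<close> by (auto simp: xs_b_ys_def)
  have F: "src F = xs @ b # (ys @ c # zs)" "src F = (xs @ b # ys) @ c # zs"
    using w ws by auto
  have o: "xs \<in> lists (Obj X)" "b \<in> Obj X" "ys \<in> lists (Obj X)" using w(3) ws by auto
  have len: "length xs = i" "length (xs @ b # ys) = j" "i \<noteq> j" using w ws assms by auto
  have G: "b = trg G" "c = trg H" using assms F len by (auto simp: nth_append)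
  have 1: "src (F \<odot>[i] G) = (xs @ src G @ ys) @ c # zs" using F(1) len by (simp add: msub_eq)
  have 2: "src (F \<odot>[j] H) = xs @ b # (ys @ src H @ zs)" using msub_eq[OF F(2)] len by simp
  have "S (xs @ src G @ ys) c zs (src H) (trg F) (S xs b (ys @ c # zs) (src G) (trg F) (raw F) (raw G)) (raw H)
     = S xs b (ys @ src H @ zs) (src G) (trg F) (S (xs @ b # ys) c zs (src H) (trg F) (raw F) (raw H)) (raw G)"
    by (rule sub_assoc_parallel)
      (use assms F o w G mar_objs[of F] mar_objs[of G] mar_objs[of H] in \<open>auto simp: algebra_simps\<close>)
  then show ?thesis
    using len msub_eq[OF 1, of "j + length (src G) - 1" H] msub_eq[OF 2, of i G]
      msub_eq[OF F(1), of i G] msub_eq[OF F(2), of j H] by auto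
qed

lemma una_mar [simp]: "una f \<in> mar \<longleftrightarrow> f \<in> arr X"
  by (auto simp: mar_def arr_def hom_unary simp del: arr_obj)

lemma una_cmp: "f \<in> arr X \<Longrightarrow> g \<in> arr X \<Longrightarrow> src g = trg f \<Longrightarrow> una (cmpa X g f) = una g \<odot>[0] una f"
  by (auto simp: msub_def una_def cmpa_def arr_def cmp_unary hom_unary simp del: arr_obj)

lemma una_ex:
  assumes "F \<in> mar" "src F = [a]" obtains f where "f \<in> arr X" "F = una f" "src f = a" "trg f = trg F"
proof
  show "F = una (a, raw F, trg F)" using assms by (simp add: una_def prod_eq_iff)
  then show "(a, raw F, trg F) \<in> arr X" using assms(1) una_mar by metis
qed auto

lemma id_right [simp]:
  assumes "F \<in> mar" "i < length (src F)" "src F ! i = b" shows "F \<odot>[i] una (ida X b) = F"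
proof -
  obtain xs c ys where F: "src F = xs @ c # ys" "length xs = i" "xs \<in> lists (Obj X)" "c \<in> Obj X" "ys \<in> lists (Obj X)"
    using mar_split assms by metis
  have c: "c = b" using F assms by auto
  have "ok (length (src F)) 1" using ok_unary[OF mar_objs(3)[OF assms(1)]] assms(2) by simp
  then have "S xs b ys [b] (trg F) (raw F) (Idm X b) = raw F"
    using F c mar_objs[OF assms(1)] by (intro sub_id_right) auto
  then show ?thesis using F c by (simp add: msub_eq prod_eq_iff una_def ida_def)
qed

lemma id_left [simp]: "F \<in> mar \<Longrightarrow> trg F = b \<Longrightarrow> una (ida X b) \<odot>[0] F = F"
  using sub_id_left[of "src F" b "raw F"] mar_objs[of F] by (simp add: msub_def una_def ida_def prod_eq_iff)

text \<open>Laws for a multiarrow also hold below any other multiarrow.\<close>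

lemma below:
  assumes "G \<odot>[0] H = K" "F \<in> mar" "G \<in> mar" "H \<in> mar" "i < length (src F)" "src F ! i = trg G"
    "src G = [trg H]" "ok (length (src F)) (length (src H))"
  shows "F \<odot>[i] G \<odot>[i] H = F \<odot>[i] K"
proof -
  have "ok (length (src F)) (Suc 0)" "ok (Suc 0) (length (src H))"
    using ok_dom[OF assms(8)] assms(5) by auto
  then show ?thesis using nested[of F G H i 0] assms by simp
qed

end

section \<open>Left representability\<close>

text \<open>
  The bijections are required for the contexts \<open>xs\<close> into which the substitution of \<open>\<theta>\<close> and \<open>u\<close> is allowed. For
  \<open>short_ok\<close> these are the arities in \<open>left_classifiers\<close>.
\<close>

locale left_representable_pm = partial_multicategory X MM S ok
  for X :: "('o, 'm) cat" and MM S ok +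
  fixes t :: "('o, 'm) classifiers"
  assumes cl_ob: "a \<in> Obj X \<Longrightarrow> b \<in> Obj X \<Longrightarrow> clOb t a b \<in> Obj X"
    and cl_theta: "a \<in> Obj X \<Longrightarrow> b \<in> Obj X \<Longrightarrow> clTheta t a b \<in> MM [a, b] (clOb t a b)"
    and cl_unit: "clUnit t \<in> Obj X"
    and cl_u: "clU t \<in> MM [] (clUnit t)"
    and theta_bij: "\<lbrakk>a \<in> Obj X; b \<in> Obj X; xs \<in> lists (Obj X); d \<in> Obj X; ok (Suc (length xs)) 2\<rbrakk> \<Longrightarrow>
      bij_betw (\<lambda>f. S [] (clOb t a b) xs [a, b] d f (clTheta t a b)) (MM (clOb t a b # xs) d) (MM (a # b # xs) d)"
    and u_bij: "\<lbrakk>xs \<in> lists (Obj X); d \<in> Obj X; ok (Suc (length xs)) 0\<rbrakk> \<Longrightarrow>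
      bij_betw (\<lambda>f. S [] (clUnit t) xs [] d f (clU t)) (MM (clUnit t # xs) d) (MM xs d)"
begin

interpretation X: category X by (rule category_X)

definition th :: "'o \<Rightarrow> 'o \<Rightarrow> ('o, 'm) marrow" where "th a b = ([a, b], clTheta t a b, clOb t a b)"
definition uu :: "('o, 'm) marrow" where "uu = ([], clU t, clUnit t)"

lemma th_simps [simp]: "src (th a b) = [a, b]" "trg (th a b) = clOb t a b" "src uu = []" "trg uu = clUnit t"
  by (simp_all add: th_def uu_def)

lemma th_mar [simp]: "a \<in> Obj X \<Longrightarrow> b \<in> Obj X \<Longrightarrow> th a b \<in> mar" "uu \<in> mar"
  by (auto simp: mar_def th_def uu_def cl_ob cl_theta cl_unit cl_u)

declare cl_ob [simp] cl_unit [simp]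

lemma classifier_inj:
  assumes "bij_betw (\<lambda>f. S [] (trg K) xs (src K) d f (raw K)) (MM (trg K # xs) d) Z"
    and "F \<in> mar" "G \<in> mar" "src F = trg K # xs" "src G = trg K # xs" "trg F = d" "trg G = d"
    "F \<odot>[0] K = G \<odot>[0] K"
  shows "F = G"
proof -
  have "raw F = raw G"
    using assms mar_objs(4)[of F] mar_objs(4)[of G] unfolding bij_betw_def inj_on_def
    by (auto simp: msub_def)
  then show ?thesis using assms by (auto simp: prod_eq_iff)
qed

lemma classifier_ex:
  assumes "bij_betw (\<lambda>f. S [] (trg K) xs (src K) d f (raw K)) (MM (trg K # xs) d) (MM (src K @ xs) d)"
    and "H \<in> mar" "src H = src K @ xs" "trg H = d" "K \<in> mar" "ok (Suc (length xs)) (length (src K))"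
  obtains F where "F \<in> mar" "src F = trg K # xs" "trg F = d" "F \<odot>[0] K = H"
proof -
  have "raw H \<in> MM (src K @ xs) d" using assms mar_objs(4)[of H] by simp
  then have "raw H \<in> (\<lambda>f. S [] (trg K) xs (src K) d f (raw K)) ` MM (trg K # xs) d"
    using bij_betw_imp_surj_on[OF assms(1)] by simp
  then obtain f where "f \<in> MM (trg K # xs) d" "S [] (trg K) xs (src K) d f (raw K) = raw H"
    by auto
  note f = this
  have "ok (Suc 0) (length (trg K # xs))" using ok_dom[OF assms(6)] by simp
  then have "(trg K # xs, f, d) \<in> mar"
    unfolding mar_def using f mar_objs(1,2)[OF assms(2)] mar_objs(2)[OF assms(5)] assms(3,4) by simp
  moreover have "(trg K # xs, f, d) \<odot>[0] K = H" using f assms(3,4) by (simp add: msub_def prod_eq_iff)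
  ultimately show ?thesis using that by simp
qed

lemma theta_inj:
  assumes "F \<odot>[0] th a b = G \<odot>[0] th a b" "F \<in> mar" "G \<in> mar" "src F = clOb t a b # xs" "src G = clOb t a b # xs"
    "trg F = trg G" "a \<in> Obj X" "b \<in> Obj X" "ok (Suc (length xs)) 2"
  shows "F = G"
  by (rule classifier_inj[OF _ assms(2,3), of "th a b" xs "trg G"])
    (use assms theta_bij[of a b xs "trg G"] mar_objs[of G] in \<open>auto simp: th_def\<close>)

lemma uu_inj:
  assumes "F \<odot>[0] uu = G \<odot>[0] uu" "F \<in> mar" "G \<in> mar" "src F = clUnit t # xs" "src G = clUnit t # xs"
    "trg F = trg G" "ok (Suc (length xs)) 0"
  shows "F = G"
  by (rule classifier_inj[OF _ assms(2,3), of uu xs "trg G"])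
    (use assms u_bij[of xs "trg G"] mar_objs[of G] in \<open>auto simp: uu_def\<close>)

lemma theta_ex:
  assumes "H \<in> mar" "src H = a # b # xs" "ok (Suc (length xs)) 2"
  obtains F where "F \<in> mar" "src F = clOb t a b # xs" "trg F = trg H" "F \<odot>[0] th a b = H"
proof (rule classifier_ex[of "th a b" xs "trg H" H])
  have o: "a \<in> Obj X" "b \<in> Obj X" "xs \<in> lists (Obj X)" "trg H \<in> Obj X" using mar_objs[of H] assms by auto
  show "bij_betw (\<lambda>f. S [] (trg (th a b)) xs (src (th a b)) (trg H) f (raw (th a b)))
     (MM (trg (th a b) # xs) (trg H)) (MM (src (th a b) @ xs) (trg H))"
    using theta_bij[OF o assms(3)] by (simp add: th_def)
  show "th a b \<in> mar" using o by simp
qed (use assms that in \<open>auto simp: numeral_2_eq_2\<close>)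

lemma uu_ex:
  assumes "H \<in> mar" "ok (Suc (length (src H))) 0"
  obtains F where "F \<in> mar" "src F = clUnit t # src H" "trg F = trg H" "F \<odot>[0] uu = H"
proof (rule classifier_ex[of uu "src H" "trg H" H])
  show "bij_betw (\<lambda>f. S [] (trg uu) (src H) (src uu) (trg H) f (raw uu))
     (MM (trg uu # src H) (trg H)) (MM (src uu @ src H) (trg H))"
    using u_bij[of "src H" "trg H"] mar_objs[of H] assms by (simp add: uu_def)
qed (use assms that in auto)

text \<open>
  The definite descriptions in \<open>skew_of\<close> and \<open>lax_of\<close> are of this form or of the next one; universality
  makes them well defined.
\<close>

lemma the_theta:
  assumes "H \<in> mar" "src H = [a, b]"
    and h: "h = (THE h. h \<in> Hom X (clOb t a b) (trg H) \<and> S [] (clOb t a b) [] [a, b] (trg H) h (clTheta t a b) = raw H)"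
  shows "(clOb t a b, h, trg H) \<in> arr X" "una (clOb t a b, h, trg H) \<odot>[0] th a b = H"
proof -
  have o: "a \<in> Obj X" "b \<in> Obj X" using mar_objs[of H] assms by auto
  obtain F where F: "F \<in> mar" "src F = [clOb t a b]" "trg F = trg H" "F \<odot>[0] th a b = H"
    using theta_ex[of H a b "[]"] assms by auto
  then obtain f where f: "f \<in> arr X" "F = una f" "src f = clOb t a b" "trg f = trg H" using una_ex by metis
  have "h = raw f" unfolding h
  proof (rule the_equality)
    show "raw f \<in> Hom X (clOb t a b) (trg H) \<and> S [] (clOb t a b) [] [a, b] (trg H) (raw f) (clTheta t a b) = raw H"
      using f F by (auto simp: arr_def msub_def th_def prod_eq_iff simp del: arr_obj)
    fix k assume k: "k \<in> Hom X (clOb t a b) (trg H) \<and> S [] (clOb t a b) [] [a, b] (trg H) k (clTheta t a b) = raw H"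
    have k': "una (clOb t a b, k, trg H) \<in> mar"
      using k o mar_objs[of H] assms by (simp add: arr_def del: arr_obj)
    have "una (clOb t a b, k, trg H) = F"
      by (rule theta_inj[where a = a and b = b and xs = "[]"])
        (use k k' F o assms in \<open>simp_all add: msub_def th_def una_def prod_eq_iff\<close>)
    then show "k = raw f" using f by (auto simp: una_def)
  qed
  then have "una (clOb t a b, h, trg H) = F" using f by (simp add: una_def)
  then show "una (clOb t a b, h, trg H) \<odot>[0] th a b = H" "(clOb t a b, h, trg H) \<in> arr X"
    using F una_mar by metis+
qed

lemma the_uu:
  assumes "H \<in> mar" "src H = []"
    and h: "h = (THE h. h \<in> Hom X (clUnit t) (trg H) \<and> S [] (clUnit t) [] [] (trg H) h (clU t) = raw H)"
  shows "(clUnit t, h, trg H) \<in> arr X" "una (clUnit t, h, trg H) \<odot>[0] uu = H"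
proof -
  obtain F where F: "F \<in> mar" "src F = [clUnit t]" "trg F = trg H" "F \<odot>[0] uu = H"
    using uu_ex[of H] assms by auto
  then obtain f where f: "f \<in> arr X" "F = una f" "src f = clUnit t" "trg f = trg H" using una_ex by metis
  have "h = raw f" unfolding h
  proof (rule the_equality)
    show "raw f \<in> Hom X (clUnit t) (trg H) \<and> S [] (clUnit t) [] [] (trg H) (raw f) (clU t) = raw H"
      using f F by (auto simp: arr_def msub_def uu_def prod_eq_iff simp del: arr_obj)
    fix k assume k: "k \<in> Hom X (clUnit t) (trg H) \<and> S [] (clUnit t) [] [] (trg H) k (clU t) = raw H"
    have k': "una (clUnit t, k, trg H) \<in> mar"
      using k mar_objs[of H] assms by (simp add: arr_def del: arr_obj)
    have "una (clUnit t, k, trg H) = F"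
      by (rule uu_inj[where xs = "[]"])
        (use k k' F assms in \<open>simp_all add: msub_def uu_def una_def prod_eq_iff\<close>)
    then show "k = raw f" using f by (auto simp: una_def)
  qed
  then have "una (clUnit t, h, trg H) = F" using f by (simp add: una_def)
  then show "una (clUnit t, h, trg H) \<odot>[0] uu = H" "(clUnit t, h, trg H) \<in> arr X"
    using F una_mar by metis+
qed

abbreviation A :: "('o, 'm) skmon" where "A \<equiv> skew_of X S t"

lemma A_simps [simp]: "Obj A = Obj X" "Hom A = Hom X" "Idm A = Idm X" "Cmp A = Cmp X" "ten A = clOb t" "unt A = clUnit t"
  by (simp_all add: skew_of_def)

lemma A_arr [simp]: "arr A = arr X" "ida A = ida X" "cmpa A = cmpa X"
  by (auto simp: arr_def ida_def cmpa_def fun_eq_iff simp del: arr_obj)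

text \<open>
  The defining equations of tensor product, \<open>\<alpha>\<close>, \<open>\<lambda>\<close> and \<open>\<rho>\<close>. For \<open>\<alpha>\<close> and \<open>\<lambda>\<close> the equation involves two
  universal maps, so a map \<open>K\<close> between the two precompositions is obtained first.
\<close>

lemma tena_law:
  assumes "f \<in> arr X" "g \<in> arr X"
  shows "tena A f g \<in> arr X"
    "una (tena A f g) \<odot>[0] th (src f) (src g) = th (trg f) (trg g) \<odot>[0] una f \<odot>[Suc 0] una g"
proof -
  let ?H = "th (trg f) (trg g) \<odot>[0] una f \<odot>[Suc 0] una g"
  have H: "?H \<in> mar" "src ?H = [src f, src g]" using assms by auto
  have *: "raw (tena A f g) = (THE h. h \<in> Hom X (clOb t (src f) (src g)) (trg ?H) \<and>
     S [] (clOb t (src f) (src g)) [] [src f, src g] (trg ?H) h (clTheta t (src f) (src g)) = raw ?H)"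
    using assms by (simp add: tena_def skew_of_def skew_tenm_def arr_def msub_def th_def una_def del: arr_obj)
  have "tena A f g = (clOb t (src f) (src g), raw (tena A f g), trg ?H)"
    by (simp add: tena_def)
  then show "tena A f g \<in> arr X" "una (tena A f g) \<odot>[0] th (src f) (src g) = ?H"
    using the_theta[OF H *] by simp_all
qed

lemma alpa_law:
  assumes o: "a \<in> Obj X" "b \<in> Obj X" "c \<in> Obj X"
  shows "alpa A a b c \<in> arr X"
    "una (alpa A a b c) \<odot>[0] th (clOb t a b) c \<odot>[0] th a b = th a (clOb t b c) \<odot>[Suc 0] th b c"
proof -
  let ?H = "th a (clOb t b c) \<odot>[Suc 0] th b c"
  have H: "?H \<in> mar" "src ?H = [a, b, c]" using o by auto
  obtain K where K: "K \<in> mar" "src K = [clOb t a b, c]" "trg K = trg ?H" "K \<odot>[0] th a b = ?H"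
    using theta_ex[of ?H a b "[c]"] H by (auto simp: numeral_2_eq_2)
  have *: "raw (alpa A a b c) = (THE h. h \<in> Hom X (clOb t (clOb t a b) c) (trg K) \<and>
     S [] (clOb t (clOb t a b) c) [] [clOb t a b, c] (trg K) h (clTheta t (clOb t a b) c) = raw K)"
  proof -
    have "S [] (clOb t a b) [c] [a, b] (clOb t a (clOb t b c)) (S [] (clOb t (clOb t a b) c) [] [clOb t a b, c] (clOb t a (clOb t b c)) h (clTheta t (clOb t a b) c)) (clTheta t a b)
        = S [a] (clOb t b c) [] [b, c] (clOb t a (clOb t b c)) (clTheta t a (clOb t b c)) (clTheta t b c)
     \<longleftrightarrow> S [] (clOb t (clOb t a b) c) [] [clOb t a b, c] (trg K) h (clTheta t (clOb t a b) c) = raw K"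
      (is "?l = _ \<longleftrightarrow> ?r") if h: "h \<in> Hom X (clOb t (clOb t a b) c) (clOb t a (clOb t b c))" for h
    proof -
      let ?F = "una (clOb t (clOb t a b) c, h, clOb t a (clOb t b c))"
      have F: "?F \<in> mar" using h o by (simp add: arr_def del: arr_obj)
      have "?F \<odot>[0] th (clOb t a b) c \<in> mar" using F o by simp
      then have "?F \<odot>[0] th (clOb t a b) c \<odot>[0] th a b = K \<odot>[0] th a b \<longleftrightarrow> ?F \<odot>[0] th (clOb t a b) c = K"
        using theta_inj[of "?F \<odot>[0] th (clOb t a b) c" a b K "[c]"] K o by auto
      then show ?thesis using K by (auto simp: msub_def th_def una_def prod_eq_iff)
    qed
    then show ?thesis
      using o K by (simp add: alpa_def skew_of_def skew_alp_def Let_def cong: conj_cong)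
  qed
  have K': "src K = [clOb t a b, c]" using K by simp
  have "alpa A a b c = (clOb t (clOb t a b) c, raw (alpa A a b c), trg K)"
    using K by (simp add: alpa_def)
  then show "alpa A a b c \<in> arr X" "una (alpa A a b c) \<odot>[0] th (clOb t a b) c \<odot>[0] th a b = ?H"
    using the_theta[OF K(1) K' *] K(4) by simp_all
qed

lemma lama_law:
  assumes o: "a \<in> Obj X"
  shows "lama A a \<in> arr X" "una (lama A a) \<odot>[0] th (clUnit t) a \<odot>[0] uu = una (ida X a)"
proof -
  let ?i = "clUnit t"
  let ?H = "una (ida X a)"
  have H: "?H \<in> mar" "src ?H = [a]" using o by auto
  obtain K where K: "K \<in> mar" "src K = [?i, a]" "trg K = trg ?H" "K \<odot>[0] uu = ?H"
    using uu_ex[of ?H] H by auto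
  have *: "raw (lama A a) = (THE h. h \<in> Hom X (clOb t ?i a) (trg K) \<and>
     S [] (clOb t ?i a) [] [?i, a] (trg K) h (clTheta t ?i a) = raw K)"
  proof -
    have "S [] ?i [a] [] a (S [] (clOb t ?i a) [] [?i, a] a h (clTheta t ?i a)) (clU t) = Idm X a
     \<longleftrightarrow> S [] (clOb t ?i a) [] [?i, a] (trg K) h (clTheta t ?i a) = raw K"
      if h: "h \<in> Hom X (clOb t ?i a) a" for h
    proof -
      let ?F = "una (clOb t ?i a, h, a)"
      have F: "?F \<in> mar" using h o by (simp add: arr_def del: arr_obj)
      have "?F \<odot>[0] th ?i a \<in> mar" using F o by simp
      then have "?F \<odot>[0] th ?i a \<odot>[0] uu = K \<odot>[0] uu \<longleftrightarrow> ?F \<odot>[0] th ?i a = K"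
        using uu_inj[of "?F \<odot>[0] th ?i a" K "[a]"] K o by auto
      then show ?thesis using K by (auto simp: msub_def th_def uu_def una_def ida_def prod_eq_iff)
    qed
    then show ?thesis
      using o K by (simp add: lama_def skew_of_def skew_lam_def Let_def cong: conj_cong)
  qed
  have "lama A a = (clOb t ?i a, raw (lama A a), trg K)"
    using K by (simp add: lama_def)
  then show "lama A a \<in> arr X" "una (lama A a) \<odot>[0] th ?i a \<odot>[0] uu = ?H"
    using the_theta[OF K(1) K(2) *] K(4) by simp_all
qed

lemma rhoa_law:
  assumes o: "a \<in> Obj X"
  shows "rhoa A a \<in> arr X" "una (rhoa A a) = th a (clUnit t) \<odot>[Suc 0] uu"
proof -
  show *: "una (rhoa A a) = th a (clUnit t) \<odot>[Suc 0] uu"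
    using o by (simp add: rhoa_def una_def msub_def skew_of_def skew_rho_def th_def uu_def)
  have "una (rhoa A a) \<in> mar" unfolding * using o by simp
  then show "rhoa A a \<in> arr X" by simp
qed

end

section \<open>The skew monoidal category of a left representable multicategory\<close>

context left_representable_pm begin

interpretation X: category X by (rule category_X)

text \<open>The defining equations below an arbitrary multimap \<open>F\<close>, in which form they complete the rewrite rules for normal forms.\<close>

lemma tena_nf:
  assumes "f \<in> arr X" "g \<in> arr X" "a = src f" "c = src g" "F \<in> mar" "i < length (src F)"
    "src F ! i = clOb t (trg f) (trg g)" "ok (length (src F)) 2"
  shows "F \<odot>[i] una (tena A f g) \<odot>[i] th a c = F \<odot>[i] th (trg f) (trg g) \<odot>[i] una f \<odot>[Suc i] una g"
proof -
  have ok: "ok (length (src F)) (Suc (Suc 0))" "ok (Suc (length (src F))) (Suc 0)" "ok (length (src F)) (Suc 0)"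
    using assms(6,8) ok_dom[OF assms(8)] ok_unary[of "Suc (length (src F))"] ok_total[OF assms(8)]
    by (auto simp: numeral_2_eq_2)
  have "F \<odot>[i] una (tena A f g) \<odot>[i] th a c = F \<odot>[i] (th (trg f) (trg g) \<odot>[0] una f \<odot>[Suc 0] una g)"
    by (rule below) (use assms ok tena_law[of f g] in \<open>auto simp: tena_def\<close>)
  also have "\<dots> = F \<odot>[i] th (trg f) (trg g) \<odot>[i] una f \<odot>[Suc i] una g"
    using assms ok by (simp add: nested)
  finally show ?thesis .
qed

lemma alpa_nf:
  assumes "a \<in> Obj X" "b \<in> Obj X" "c \<in> Obj X" "ab = clOb t a b" "F \<in> mar" "i < length (src F)"
    "src F ! i = clOb t a (clOb t b c)" "length (src F) \<le> 2"
  shows "F \<odot>[i] una (alpa A a b c) \<odot>[i] th ab c \<odot>[i] th a b = F \<odot>[i] th a (clOb t b c) \<odot>[Suc i] th b c"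
proof -
  have n: "length (src F) = Suc 0 \<or> length (src F) = Suc (Suc 0)" using assms(6,8) by linarith
  have al: "alpa A a b c \<in> arr X" using assms alpa_law by auto
  have "F \<odot>[i] una (alpa A a b c) \<odot>[i] th ab c = F \<odot>[i] (una (alpa A a b c) \<odot>[0] th ab c)"
    using n assms al nested[of F "una (alpa A a b c)" "th ab c" i 0] by auto
  moreover have "F \<odot>[i] (una (alpa A a b c) \<odot>[0] th ab c) \<odot>[i] th a b
     = F \<odot>[i] (una (alpa A a b c) \<odot>[0] th ab c \<odot>[0] th a b)"
    using n assms al nested[of F "una (alpa A a b c) \<odot>[0] th ab c" "th a b" i 0] by auto
  moreover have "F \<odot>[i] (th a (clOb t b c) \<odot>[Suc 0] th b c) = F \<odot>[i] th a (clOb t b c) \<odot>[Suc i] th b c"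
    using n assms by (auto simp: nested)
  ultimately show ?thesis using assms alpa_law(2)[of a b c] by simp
qed

lemma lama_nf:
  assumes "a \<in> Obj X" "j = clUnit t" "F \<in> mar" "i < length (src F)" "src F ! i = a" "length (src F) \<le> 2"
  shows "F \<odot>[i] una (lama A a) \<odot>[i] th j a \<odot>[i] uu = F"
proof -
  have n: "length (src F) = Suc 0 \<or> length (src F) = Suc (Suc 0)" using assms(4,6) by linarith
  have al: "lama A a \<in> arr X" using assms lama_law by auto
  have "F \<odot>[i] una (lama A a) \<odot>[i] th j a = F \<odot>[i] (una (lama A a) \<odot>[0] th j a)"
    using n assms al nested[of F "una (lama A a)" "th j a" i 0] by auto
  moreover have "F \<odot>[i] (una (lama A a) \<odot>[0] th j a) \<odot>[i] uu = F \<odot>[i] (una (lama A a) \<odot>[0] th j a \<odot>[0] uu)"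
    using n assms al nested[of F "una (lama A a) \<odot>[0] th j a" uu i 0] by auto
  ultimately show ?thesis using assms lama_law(2)[of a] by simp
qed

lemma tena_law':
  assumes "f \<in> arr X" "g \<in> arr X" "a = src f" "c = src g"
  shows "una (tena A f g) \<odot>[0] th a c = th (trg f) (trg g) \<odot>[0] una f \<odot>[Suc 0] una g"
  using tena_law assms by simp

lemmas nf = una_cmp nested parallel tena_nf alpa_nf lama_nf tena_law(1) tena_law' alpa_law lama_law rhoa_law

text \<open>
  Each axiom is an equation of unary maps, hence can be tested after precomposition with universal maps.
  There both sides have the same normal form, a composite of universal maps.
\<close>

lemma skew_monoidal_A: "skew_monoidal A"
proof (rule skew_monoidalI, unfold A_arr A_simps)
  show "category A" using category_X unfolding category_def by simp
  fix f g f' g' assume fg: "f \<in> arr X" "g \<in> arr X" "f' \<in> arr X" "g' \<in> arr X" "src f' = trg f" "src g' = trg g"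
  have "una (tena A (cmpa X f' f) (cmpa X g' g)) = una (cmpa X (tena A f' g') (tena A f g))"
    by (rule theta_inj[where a = "src f" and b = "src g" and xs = "[]"]) (use fg in \<open>simp_all add: nf\<close>)
  then show "tena A (cmpa X f' f) (cmpa X g' g) = cmpa X (tena A f' g') (tena A f g)" by simp
next
  fix a b assume o: "a \<in> Obj X" "b \<in> Obj X"
  have "una (tena A (ida X a) (ida X b)) = una (ida X (clOb t a b))"
    by (rule theta_inj[where a = "a" and b = "b" and xs = "[]"]) (use o in \<open>simp_all add: nf\<close>)
  then show "tena A (ida X a) (ida X b) = ida X (clOb t a b)" by simp
next
  fix f g h assume fgh: "f \<in> arr X" "g \<in> arr X" "h \<in> arr X"
  let ?L = "una (cmpa X (alpa A (trg f) (trg g) (trg h)) (tena A (tena A f g) h))"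
  let ?R = "una (cmpa X (tena A f (tena A g h)) (alpa A (src f) (src g) (src h)))"
  have "?L \<odot>[0] th (clOb t (src f) (src g)) (src h) = ?R \<odot>[0] th (clOb t (src f) (src g)) (src h)"
    by (rule theta_inj[where xs = "[src h]" and a = "src f" and b = "src g"]) (use fgh in \<open>simp_all add: nf\<close>)
  then have "?L = ?R"
    by (rule theta_inj[where a = "clOb t (src f) (src g)" and b = "src h" and xs = "[]"]) (use fgh in \<open>simp_all add: nf\<close>)
  then show "cmpa X (alpa A (trg f) (trg g) (trg h)) (tena A (tena A f g) h)
     = cmpa X (tena A f (tena A g h)) (alpa A (src f) (src g) (src h))" by simp
next
  fix f assume f: "f \<in> arr X"
  let ?i = "clUnit t"
  let ?L = "una (cmpa X (lama A (trg f)) (tena A (ida X ?i) f))" and ?R = "una (cmpa X f (lama A (src f)))"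
  have "?L \<odot>[0] th ?i (src f) = ?R \<odot>[0] th ?i (src f)"
    by (rule uu_inj[where xs = "[src f]"]) (use f in \<open>simp_all add: nf\<close>)
  then have "?L = ?R"
    by (rule theta_inj[where a = "clUnit t" and b = "src f" and xs = "[]"]) (use f in \<open>simp_all add: nf\<close>)
  then show "cmpa X (lama A (trg f)) (tena A (ida X ?i) f) = cmpa X f (lama A (src f))" by simp
  have "una (cmpa X (rhoa A (trg f)) f) = una (cmpa X (tena A f (ida X ?i)) (rhoa A (src f)))"
    using f by (simp add: nf)
  then show "cmpa X (rhoa A (trg f)) f = cmpa X (tena A f (ida X ?i)) (rhoa A (src f))" by simp
next
  fix a b c d assume o: "a \<in> Obj X" "b \<in> Obj X" "c \<in> Obj X" "d \<in> Obj X"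
  let ?L = "una (cmpa X (alpa A a b (clOb t c d)) (alpa A (clOb t a b) c d))"
  let ?R = "una (cmpa X (tena A (ida X a) (alpa A b c d)) (cmpa X (alpa A a (clOb t b c) d) (tena A (alpa A a b c) (ida X d))))"
  let ?T = "th (clOb t (clOb t a b) c) d"
  have "?L \<odot>[0] ?T \<odot>[0] th (clOb t a b) c = ?R \<odot>[0] ?T \<odot>[0] th (clOb t a b) c"
    by (rule theta_inj[where xs = "[c, d]" and a = a and b = b]) (use o in \<open>simp_all add: nf\<close>)
  then have "?L \<odot>[0] ?T = ?R \<odot>[0] ?T"
    by (rule theta_inj[where a = "clOb t a b" and b = "c" and xs = "[d]"]) (use o in \<open>simp_all add: nf\<close>)
  then have "?L = ?R"
    by (rule theta_inj[where a = "clOb t (clOb t a b) c" and b = "d" and xs = "[]"]) (use o in \<open>simp_all add: nf\<close>)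
  then show "cmpa X (alpa A a b (clOb t c d)) (alpa A (clOb t a b) c d) =
     cmpa X (tena A (ida X a) (alpa A b c d)) (cmpa X (alpa A a (clOb t b c) d) (tena A (alpa A a b c) (ida X d)))" by simp
next
  fix a b assume o: "a \<in> Obj X" "b \<in> Obj X"
  let ?i = "clUnit t"
  let ?L = "una (cmpa X (lama A (clOb t a b)) (alpa A ?i a b))" and ?R = "una (tena A (lama A a) (ida X b))"
  have "?L \<odot>[0] th (clOb t ?i a) b \<odot>[0] th ?i a = ?R \<odot>[0] th (clOb t ?i a) b \<odot>[0] th ?i a"
    by (rule uu_inj[where xs = "[a, b]"]) (use o in \<open>simp_all add: nf\<close>)
  then have "?L \<odot>[0] th (clOb t ?i a) b = ?R \<odot>[0] th (clOb t ?i a) b"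
    by (rule theta_inj[where a = "clUnit t" and b = "a" and xs = "[b]"]) (use o in \<open>simp_all add: nf\<close>)
  then have "?L = ?R"
    by (rule theta_inj[where a = "clOb t (clUnit t) a" and b = "b" and xs = "[]"]) (use o in \<open>simp_all add: nf\<close>)
  then show "cmpa X (lama A (clOb t a b)) (alpa A ?i a b) = tena A (lama A a) (ida X b)" by simp
  have "una (cmpa X (alpa A a b ?i) (rhoa A (clOb t a b))) = una (tena A (ida X a) (rhoa A b))"
    by (rule theta_inj[where a = "a" and b = "b" and xs = "[]"]) (use o in \<open>simp_all add: nf\<close>)
  then show "cmpa X (alpa A a b ?i) (rhoa A (clOb t a b)) = tena A (ida X a) (rhoa A b)" by simp
  have "una (cmpa X (tena A (ida X a) (lama A b)) (cmpa X (alpa A a ?i b) (tena A (rhoa A a) (ida X b)))) = una (ida X (clOb t a b))"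
    by (rule theta_inj[where a = "a" and b = "b" and xs = "[]"]) (use o in \<open>simp_all add: nf\<close>)
  then show "cmpa X (tena A (ida X a) (lama A b)) (cmpa X (alpa A a ?i b) (tena A (rhoa A a) (ida X b))) = ida X (clOb t a b)" by simp
next
  let ?i = "clUnit t"
  have "una (cmpa X (lama A ?i) (rhoa A ?i)) = una (ida X ?i)"
    by (rule uu_inj[where xs = "[]"]) (simp_all add: nf)
  then show "cmpa X (lama A ?i) (rhoa A ?i) = ida X ?i" by simp
qed (simp_all add: nf)

text \<open>The map \<open>a \<rightarrow> \<i> a\<close> inverse to \<open>\<lambda>\<close>; it makes the skew monoidal category left normal.\<close>

definition kap :: "'o \<Rightarrow> ('o, 'm) marrow" where "kap a = th (clUnit t) a \<odot>[0] uu"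

lemma kap_mar [simp]: "a \<in> Obj X \<Longrightarrow> kap a \<in> mar" "src (kap a) = [a]" "trg (kap a) = clOb t (clUnit t) a"
  by (simp_all add: kap_def)

lemma kap_lama:
  assumes "a \<in> Obj X"
  shows "una (lama A a) \<odot>[0] kap a = una (ida X a)" "kap a \<odot>[0] una (lama A a) = una (ida X (clOb t (clUnit t) a))"
proof -
  show "una (lama A a) \<odot>[0] kap a = una (ida X a)"
    using assms by (simp add: kap_def nf)
  have "kap a \<odot>[0] una (lama A a) \<odot>[0] th (clUnit t) a = una (ida X (clOb t (clUnit t) a)) \<odot>[0] th (clUnit t) a"
    by (rule uu_inj[where xs = "[a]"]) (use assms in \<open>simp_all add: nf\<close>, simp add: kap_def)
  then show "kap a \<odot>[0] una (lama A a) = una (ida X (clOb t (clUnit t) a))"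
    by (rule theta_inj[where a = "clUnit t" and b = "a" and xs = "[]"]) (use assms in \<open>simp_all add: nf\<close>)
qed

lemma left_normal_A: "left_normal A"
  unfolding left_normal_def
proof
  fix a assume "a \<in> Obj A"
  then have a: "a \<in> Obj X" by simp
  obtain k where k: "k \<in> arr X" "kap a = una k" "src k = a" "trg k = clOb t (clUnit t) a"
    using una_ex[of "kap a" a] kap_mar a by metis
  have l: "lama A a \<in> arr X" using a by (simp add: nf)
  have "una (cmpa X (lama A a) k) = una (ida X a)" "una (cmpa X k (lama A a)) = una (ida X (clOb t (clUnit t) a))"
    using kap_lama[OF a] k l by (simp_all add: una_cmp)
  then show "iso_map A (ten A (unt A) a) a (lam A a)"
    using l k unfolding iso_map_def una_inj
    by (auto simp: arr_def lama_def cmpa_def ida_def simp del: arr_obj intro!: bexI[of _ "raw k"])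
qed

end

section \<open>Iterated universal maps\<close>

context partial_multicategory begin

text \<open>Closure properties of the allowed arities, for the inductions over lists of inputs below.\<close>

lemma ok_step:
  assumes "ok (Suc m) p" "1 \<le> m" shows "ok (Suc (Suc 0)) m" "ok m p" "ok (Suc (Suc 0)) (m + p - 1)"
    "ok (Suc (Suc 0)) p" "ok (Suc p) m"
  using ok_cases assms by (auto simp: short_ok_simp)

lemma ok_split:
  assumes "ok (Suc 0) (p + n)" "1 \<le> n" "1 \<le> p"
  shows "ok n (Suc (Suc 0))" "ok (Suc (Suc 0)) p" "ok n (Suc p)" "ok (Suc n) p"
proof -
  have "ok n (Suc (Suc 0)) \<and> ok (Suc (Suc 0)) p \<and> ok n (Suc p) \<and> ok (Suc n) p" if "ok = short_ok"
  proof -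
    have "p + n \<le> 4" using assms(1) short_ok_bounds[of "Suc 0" "p + n"] that by simp
    then have "n \<in> {1, 2, 3}" "p \<in> {1, 2, 3}" "p + n \<le> 4" using assms(2,3) by auto
    then show ?thesis unfolding that by (elim insertE emptyE) (auto simp: short_ok_simp)
  qed
  then show "ok n (Suc (Suc 0))" "ok (Suc (Suc 0)) p" "ok n (Suc p)" "ok (Suc n) p" using ok_cases by auto
qed

lemma ok_2_pre: "ok (Suc 0) (Suc n) \<Longrightarrow> ok (Suc (Suc 0)) n"
  using ok_cases by (auto simp: short_ok_simp le_Suc_eq numeral_eq_Suc)

lemma ok_2_Suc:
  "ok (Suc (Suc 0)) (Suc k) \<Longrightarrow> ok (Suc (Suc 0)) k" "ok (Suc (Suc 0)) (Suc k) \<Longrightarrow> ok (Suc (Suc (Suc 0))) k"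
  "ok (Suc (Suc 0)) k \<Longrightarrow> ok (Suc 0) k" "ok (Suc (Suc 0)) k \<Longrightarrow> ok (Suc 0) (Suc k)"
  using ok_cases by (auto simp: short_ok_simp)

lemma ok_mono_left:
  assumes "ok n m" "1 \<le> k" "k \<le> n" shows "ok k m"
proof -
  have "short_ok k m" if "short_ok n m"
  proof -
    have "n \<in> {1, 2, 3, 4}" "k \<in> {1, 2, 3, 4}" using that assms(2,3) short_ok_bounds[of n m] by auto
    then show ?thesis using assms(3) that by (elim insertE emptyE) (auto simp: short_ok_simp)
  qed
  then show ?thesis using ok_cases assms(1) by auto
qed

lemma ok_1_mono: "ok (Suc 0) n \<Longrightarrow> m \<le> n \<Longrightarrow> ok (Suc 0) m"
  using ok_cases by (auto simp: short_ok_simp)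

end

context left_representable_pm begin

interpretation X: category X by (rule category_X)

sublocale A: skew_monoidal "skew_of X S t"
  rewrites "Obj (skew_of X S t) = Obj X" and "ten (skew_of X S t) = clOb t" and "unt (skew_of X S t) = clUnit t"
    and "arr (skew_of X S t) = arr X" and "ida (skew_of X S t) = ida X" and "cmpa (skew_of X S t) = cmpa X"
    and "Hom (skew_of X S t) = Hom X"
  by (rule skew_monoidal_A) simp_all

abbreviation tns :: "'o \<Rightarrow> 'o list \<Rightarrow> 'o" where "tns \<equiv> foldl (clOb t)"

text \<open>In particular \<open>thl uu as : as \<rightarrow> \<i> as\<close> is the universal map for the list \<open>as\<close>.\<close>

primrec thl :: "('o, 'm) marrow \<Rightarrow> 'o list \<Rightarrow> ('o, 'm) marrow" where
  "thl F [] = F"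
| "thl F (a # as) = thl (th (trg F) a \<odot>[0] F) as"

lemma thl_append: "thl F (as @ bs) = thl (thl F as) bs"
  by (induction as arbitrary: F) auto

lemma thl_src_trg [simp]: "src (thl F as) = src F @ as" "trg (thl F as) = tns (trg F) as"
  by (induction as arbitrary: F) auto

lemma thl_mar [simp]:
  "F \<in> mar \<Longrightarrow> as \<in> lists (Obj X) \<Longrightarrow> ok (Suc 0) (length (src F) + length as) \<Longrightarrow> thl F as \<in> mar"
proof (induction as arbitrary: F)
  case (Cons a as)
  have "ok (Suc (Suc 0)) (length (src F))"
    by (rule ok_2_pre, rule ok_1_mono[OF Cons.prems(3)]) simp
  then show ?case using Cons.prems Cons.IH[of "th (trg F) a \<odot>[0] F"] mar_objs(2)[OF Cons.prems(1)] by simp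
qed simp

lemma thl_msub:
  assumes "F \<in> mar" "G \<in> mar" "i < length (src F)" "src F ! i = trg G" "as \<in> lists (Obj X)"
    "ok (length (src F) + length as) (length (src G))"
  shows "thl (F \<odot>[i] G) as = thl F as \<odot>[i] G"
  using assms(5,6)
proof (induction as rule: rev_induct)
  case (snoc a as)
  let ?m = "length (src F) + length as"
  have ok: "ok (Suc ?m) (length (src G))" "1 \<le> ?m" using snoc.prems assms(3) by auto
  note ok' = ok_step[OF ok] ok
  have a: "a \<in> Obj X" "as \<in> lists (Obj X)" using snoc.prems by auto
  have m: "thl F as \<in> mar"
    using assms a ok' ok_dom[of "Suc ?m" "length (src G)"] by (intro thl_mar) (auto intro: ok_1_mono)
  have "th (tns (trg F) as) a \<odot>[0] (thl F as \<odot>[i] G) = th (tns (trg F) as) a \<odot>[0] thl F as \<odot>[0 + i] G"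
    by (rule nested) (use assms a ok' m mar_objs(2)[of F] in \<open>auto simp: nth_append\<close>)
  then show ?case using a ok' snoc.IH by (simp add: thl_append)
qed simp

lemma thl_id:
  assumes "G \<in> mar" "trg G = x" "as \<in> lists (Obj X)" "ok (Suc (length as)) (length (src G))"
  shows "thl (una (ida X x)) as \<odot>[0] G = thl G as"
  using thl_msub[of "una (ida X x)" G 0 as] assms mar_objs(2)[of G] by simp

lemma thl_post:
  assumes "f \<in> arr X" "F \<in> mar" "trg F = src f" "as \<in> lists (Obj X)" "ok (Suc 0) (length (src F) + length as)"
  shows "thl (una f \<odot>[0] F) as = una (A.act f as) \<odot>[0] thl F as"
  using assms
proof (induction as arbitrary: f F)
  case (Cons a as)
  let ?n = "length (src F)"
  have ok2: "ok (Suc (Suc 0)) ?n" by (rule ok_2_pre, rule ok_1_mono[OF Cons.prems(5)]) simp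
  have ok1: "ok (Suc 0) ?n" "ok (Suc 0) (Suc ?n)"
    by (rule ok_1_mono[OF Cons.prems(5)], simp)+
  let ?g = "tena A f (ida X a)"
  have g: "?g \<in> arr X" using Cons.prems by (simp add: tena_law)
  have "th (trg f) a \<odot>[0] (una f \<odot>[0] F) = th (trg f) a \<odot>[0] una f \<odot>[0] F"
    using Cons.prems ok2 ok1 by (simp add: nested)
  also have "th (trg f) a \<odot>[0] una f = una ?g \<odot>[0] th (src f) a"
    using Cons.prems by (simp add: tena_law')
  also have "una ?g \<odot>[0] th (src f) a \<odot>[0] F = una ?g \<odot>[0] (th (src f) a \<odot>[0] F)"
    using Cons.prems ok2 ok1 g by (subst nested) auto
  finally show ?case using Cons.prems Cons.IH[of ?g "th (src f) a \<odot>[0] F"] g ok2 by simp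
qed simp

lemma una_cmp_msub:
  assumes "f \<in> arr X" "g \<in> arr X" "src g = trg f" "F \<in> mar" "trg F = src f"
  shows "una (cmpa X g f) \<odot>[0] F = una g \<odot>[0] (una f \<odot>[0] F)"
  using assms mar_objs(3)[of F] nested[of "una g" "una f" F 0 0] by (simp add: una_cmp)

text \<open>
  The shift of brackets mediates between multiplying \<open>x\<close> with \<open>as\<close> from the right and multiplying \<open>x\<close> with
  \<open>\<i> as\<close>. Each step of the induction is the defining equation of \<open>\<alpha>\<close>, and the start is that of \<open>\<rho>\<close>.
\<close>

lemma bet_law:
  assumes "x \<in> Obj X" "as \<in> lists (Obj X)" "ok (Suc (Suc 0)) (length as)"
  shows "una (A.bet x (clUnit t) (rhoa A x) as) \<odot>[0] thl (una (ida X x)) as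
    = th x (tns (clUnit t) as) \<odot>[Suc 0] thl uu as"
  using assms(2,3)
proof (induction as rule: rev_induct)
  case Nil
  then show ?case using assms(1) by (simp add: rhoa_law)
next
  case (snoc a as)
  let ?k = "length as" and ?I = "tns (clUnit t) as"
  let ?b = "A.bet x (clUnit t) (rhoa A x) as" and ?L = "thl (una (ida X x)) as" and ?T = "thl uu as"
  have a: "a \<in> Obj X" "as \<in> lists (Obj X)" using snoc.prems by auto
  have ok: "ok (Suc (Suc 0)) (Suc ?k)" "ok (Suc (Suc 0)) ?k" "ok (Suc (Suc (Suc 0))) ?k" "ok (Suc 0) ?k"
     "ok (Suc 0) (Suc ?k)" "ok (Suc 0) (Suc (Suc ?k))"
    using snoc.prems ok_2_Suc by auto
  have m: "?L \<in> mar" "?T \<in> mar" using a assms(1) ok by (auto intro!: thl_mar)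
  have I: "?I \<in> Obj X" "tns x as \<in> Obj X" using a assms(1) by (auto intro!: A.tens_obj)
  have b: "?b \<in> arr X" "src ?b = tns x as" "trg ?b = clOb t x ?I"
    using a assms(1) by (auto simp: lama_law rhoa_law)
  let ?c = "tena A ?b (ida X a)" and ?al = "alpa A x ?I a"
  have c: "?c \<in> arr X" "?al \<in> arr X" "src ?c = clOb t (tns x as) a" "trg ?c = clOb t (clOb t x ?I) a"
    using b a I assms(1) by (auto simp: tena_law alpa_law)
  have "una (cmpa X ?al ?c) \<odot>[0] (th (tns x as) a \<odot>[0] ?L) = una ?al \<odot>[0] (una ?c \<odot>[0] (th (tns x as) a \<odot>[0] ?L))"
    using c m ok I a by (intro una_cmp_msub) auto
  also have "una ?c \<odot>[0] (th (tns x as) a \<odot>[0] ?L) = una ?c \<odot>[0] th (tns x as) a \<odot>[0] ?L"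
    using c m ok I a by (simp add: nested)
  also have "una ?c \<odot>[0] th (tns x as) a = th (clOb t x ?I) a \<odot>[0] una ?b"
    using b a I assms(1) by (simp add: tena_law')
  also have "th (clOb t x ?I) a \<odot>[0] una ?b \<odot>[0] ?L = th (clOb t x ?I) a \<odot>[0] (una ?b \<odot>[0] ?L)"
    using b a I m ok assms(1) by (subst nested) auto
  also have "una ?b \<odot>[0] ?L = th x ?I \<odot>[Suc 0] ?T" using snoc.IH a ok by simp
  also have "una ?al \<odot>[0] (th (clOb t x ?I) a \<odot>[0] (th x ?I \<odot>[Suc 0] ?T))
     = una ?al \<odot>[0] th (clOb t x ?I) a \<odot>[0] th x ?I \<odot>[Suc 0] ?T"
    using c m ok I a assms(1) by (simp add: nested)
  also have "\<dots> = th x (clOb t ?I a) \<odot>[Suc 0] th ?I a \<odot>[Suc 0] ?T"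
    using I a assms(1) by (simp add: alpa_law)
  also have "\<dots> = th x (clOb t ?I a) \<odot>[Suc 0] (th ?I a \<odot>[0] ?T)"
    using m ok I a assms(1) by (subst nested) auto
  finally show ?case by (simp add: thl_append A.bet_append)
qed

text \<open>The passage from arrows \<open>\<i> as \<rightarrow> b\<close> to multimaps \<open>as \<rightarrow> b\<close>.\<close>

definition Phi :: "('o, 'm) arrow \<Rightarrow> 'o list \<Rightarrow> ('o, 'm) marrow" where
  "Phi f as = una f \<odot>[0] thl uu as"

lemma Phi_src_trg [simp]: "src (Phi f as) = as" "trg (Phi f as) = trg f"
  by (auto simp: Phi_def)

lemma Phi_mar [simp]:
  "f \<in> arr X \<Longrightarrow> src f = tns (clUnit t) as \<Longrightarrow> as \<in> lists (Obj X) \<Longrightarrow> ok (Suc 0) (length as) \<Longrightarrow> Phi f as \<in> mar"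
  by (simp add: Phi_def)

lemma wh_law:
  assumes "x \<in> Obj X" "g \<in> arr X" "src g = tns (clUnit t) as" "as \<in> lists (Obj X)" "ok (Suc (Suc 0)) (length as)"
  shows "una (A.wh x as g) \<odot>[0] thl (una (ida X x)) as = th x (trg g) \<odot>[Suc 0] Phi g as"
proof -
  let ?b = "A.bet x (clUnit t) (rhoa A x) as" and ?L = "thl (una (ida X x)) as" and ?T = "thl uu as"
  let ?I = "tns (clUnit t) as" and ?h = "tena A (ida X x) g"
  have ok: "ok (Suc 0) (length as)" "ok (Suc 0) (Suc (length as))" using assms ok_2_Suc by auto
  have m: "?L \<in> mar" "?T \<in> mar" using assms ok by (auto intro!: thl_mar)
  have I: "?I \<in> Obj X" using assms by (auto intro!: A.tens_obj)
  have b: "?b \<in> arr X" "src ?b = tns x as" "trg ?b = clOb t x ?I"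
    using assms by (auto simp: lama_law rhoa_law)
  have h: "?h \<in> arr X" "src ?h = clOb t x ?I" using assms by (auto simp: tena_law)
  have "una (A.wh x as g) \<odot>[0] ?L = una ?h \<odot>[0] (una ?b \<odot>[0] ?L)"
    unfolding A.wh_def using m b h by (intro una_cmp_msub) auto
  also have "\<dots> = una ?h \<odot>[0] (th x ?I \<odot>[Suc 0] ?T)" using assms by (simp add: bet_law)
  also have "\<dots> = th x (trg g) \<odot>[Suc 0] (una g \<odot>[0] ?T)"
    using m h I assms ok by (simp add: nested tena_law')
  finally show ?thesis by (simp add: Phi_def)
qed

text \<open>
  The case of \<open>Phi_subst\<close> in which \<open>f\<close> is an identity and \<open>ys\<close> is empty. For empty \<open>xs\<close> it holds because whiskering
  by \<open>\<i>\<close> is inverted by \<open>\<lambda>\<close>; otherwise it is \<open>wh_law\<close> precomposed with the universal map of \<open>xs\<close>.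
\<close>

lemma Phi_base:
  assumes "g \<in> arr X" "src g = tns (clUnit t) as" "as \<in> lists (Obj X)" "xs \<in> lists (Obj X)"
    "ok (Suc (length xs)) (length as)"
  shows "una (A.wh (tns (clUnit t) xs) as g) \<odot>[0] thl uu (xs @ as) = thl uu (xs @ [trg g]) \<odot>[length xs] Phi g as"
proof (cases "xs = []")
  case True
  let ?i = "clUnit t" and ?b = "trg g" and ?T = "thl uu as"
  let ?w = "A.wh ?i as g"
  have ok: "ok (Suc 0) (length as)" using assms True by simp
  have m: "?T \<in> mar" using assms ok by simp
  have w: "?w \<in> arr X" "src ?w = tns ?i as" "trg ?w = clOb t ?i ?b" using assms by auto
  have l: "lama A ?b \<in> arr X" using assms by (simp add: lama_law)
  have "kap ?b \<odot>[0] (una g \<odot>[0] ?T) = kap ?b \<odot>[0] (una (cmpa X (lama A ?b) ?w) \<odot>[0] ?T)"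
    using assms by (simp add: A.wh_unit)
  also have "\<dots> = kap ?b \<odot>[0] (una (lama A ?b) \<odot>[0] (una ?w \<odot>[0] ?T))"
    using una_cmp_msub[of ?w "lama A ?b" ?T] m w l by simp
  also have "\<dots> = kap ?b \<odot>[0] una (lama A ?b) \<odot>[0] (una ?w \<odot>[0] ?T)"
    using m w l assms ok nested[of "kap ?b" "una (lama A ?b)" "una ?w \<odot>[0] ?T" 0 0] by simp
  also have "\<dots> = una ?w \<odot>[0] ?T"
    using kap_lama(2)[of ?b] m w assms ok by simp
  finally show ?thesis using True by (simp add: Phi_def kap_def)
next
  case False
  let ?x = "tns (clUnit t) xs" and ?b = "trg g" and ?T = "thl uu xs"
  let ?w = "A.wh ?x as g" and ?L = "thl (una (ida X ?x)) as"
  have "1 \<le> length xs" using False by (cases xs) auto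
  note ok = ok_step[OF assms(5) this] assms(5) ok_dom[OF assms(5)]
  have ok': "ok (Suc 0) (length xs)" "ok (Suc 0) (length as)" "ok (Suc 0) (Suc (length as))"
    "ok (Suc 0) (length as + length xs)"
    using ok ok_2_Suc ok_total[OF ok(5)] by auto
  have x: "?x \<in> Obj X" "?b \<in> Obj X" using assms by auto
  have m: "?T \<in> mar" "?L \<in> mar" "Phi g as \<in> mar" using assms ok' by (auto intro!: thl_mar Phi_mar A.tens_obj)
  have w: "?w \<in> arr X" "src ?w = tns ?x as" "trg ?w = clOb t ?x ?b" using assms by auto
  have "una ?w \<odot>[0] thl uu (xs @ as) = una ?w \<odot>[0] (?L \<odot>[0] ?T)"
    using m assms ok by (simp add: thl_append thl_id)
  also have "\<dots> = una ?w \<odot>[0] ?L \<odot>[0] ?T"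
    using nested[of "una ?w" ?L ?T 0 0] m w ok ok' by simp
  also have "\<dots> = th ?x ?b \<odot>[Suc 0] Phi g as \<odot>[0] ?T"
    using wh_law[of ?x g as] assms x ok by simp
  also have "\<dots> = th ?x ?b \<odot>[0] ?T \<odot>[length xs] Phi g as"
    using parallel[of "th ?x ?b" ?T "Phi g as" 0 "Suc 0"] m x ok by simp
  finally show ?thesis by (simp add: thl_append)
qed

text \<open>
  \<open>Phi\<close> turns the substitution of \<open>multi_of\<close> into the given one. From \<open>Phi_base\<close> the factors \<open>ys\<close> are added by
  \<open>thl_msub\<close>, and \<open>f\<close> by associativity.
\<close>

theorem Phi_subst:
  assumes "f \<in> arr X" "g \<in> arr X" "src f = tns (clUnit t) (xs @ b # ys)" "src g = tns (clUnit t) as" "trg g = b"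
    "xs \<in> lists (Obj X)" "ys \<in> lists (Obj X)" "as \<in> lists (Obj X)" "ok (length xs + 1 + length ys) (length as)"
  shows "Phi (cmpa X f (A.act (A.wh (tns (clUnit t) xs) as g) ys)) (xs @ as @ ys)
    = Phi f (xs @ b # ys) \<odot>[length xs] Phi g as"
proof -
  let ?w = "A.wh (tns (clUnit t) xs) as g"
  have b: "b \<in> Obj X" using assms by auto
  have ok: "ok (Suc (length xs)) (length as)"
    by (rule ok_mono_left[OF assms(9)]) auto
  have ok1: "ok (Suc 0) (Suc (length xs + length ys))" "ok (Suc 0) (length as)" "ok (Suc 0) (length xs + length as + length ys)"
    using ok_dom[OF assms(9)] ok_total[OF assms(9)] by (auto simp: algebra_simps)
  have ok2: "ok (Suc 0) (length xs + length as)" "ok (Suc 0) (length xs)" "ok (Suc 0) (Suc (length xs))"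
    using ok_1_mono[OF ok1(3)] ok_1_mono[OF ok1(1)] by auto
  have w: "?w \<in> arr X" "src ?w = tns (tns (clUnit t) xs) as" "trg ?w = clOb t (tns (clUnit t) xs) b"
    using assms by auto
  have m: "thl uu (xs @ as) \<in> mar" "thl uu (xs @ [b]) \<in> mar" "Phi g as \<in> mar" "thl uu (xs @ b # ys) \<in> mar"
     "thl uu (xs @ as @ ys) \<in> mar"
    using assms b ok1 ok2 by (auto intro!: thl_mar Phi_mar simp: algebra_simps)
  have "una (A.act ?w ys) \<odot>[0] thl uu (xs @ as @ ys) = thl (una ?w \<odot>[0] thl uu (xs @ as)) ys"
    using thl_post[of ?w "thl uu (xs @ as)" ys] w m assms ok1 by (simp add: thl_append)
  also have "\<dots> = thl (thl uu (xs @ [b]) \<odot>[length xs] Phi g as) ys"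
    using Phi_base[of g as xs] assms ok by simp
  also have "\<dots> = thl uu (xs @ b # ys) \<odot>[length xs] Phi g as"
    using thl_msub[of "thl uu (xs @ [b])" "Phi g as" "length xs" ys] thl_append[of uu "xs @ [b]" ys] m assms(5-)
    by (simp add: nth_append)
  finally have *: "una (A.act ?w ys) \<odot>[0] thl uu (xs @ as @ ys) = thl uu (xs @ b # ys) \<odot>[length xs] Phi g as" .
  have "Phi (cmpa X f (A.act ?w ys)) (xs @ as @ ys) = una f \<odot>[0] (una (A.act ?w ys) \<odot>[0] thl uu (xs @ as @ ys))"
    unfolding Phi_def using assms w m by (intro una_cmp_msub) auto
  also have "\<dots> = una f \<odot>[0] thl uu (xs @ b # ys) \<odot>[length xs] Phi g as"
    unfolding * using nested[of "una f" "thl uu (xs @ b # ys)" "Phi g as" 0 "length xs"] assms m ok1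
    by (simp add: nth_append algebra_simps)
  finally show ?thesis by (simp add: Phi_def)
qed

text \<open>
  Iterated universal maps are universal: the last factor is split off by left representability, which
  leaves an additional input \<open>a\<close> in the context of the remaining factors.
\<close>

lemma thl_uu_bij:
  assumes "as \<noteq> []" "as \<in> lists (Obj X)" "ok (Suc 0) (length as + length ys)"
  shows "(\<forall>F \<in> mar. \<forall>G \<in> mar. src F = tns (clUnit t) as # ys \<longrightarrow> src G = src F \<longrightarrow> trg G = trg F
        \<longrightarrow> F \<odot>[0] thl uu as = G \<odot>[0] thl uu as \<longrightarrow> F = G)
    \<and> (\<forall>H \<in> mar. src H = as @ ys \<longrightarrow> (\<exists>F \<in> mar. src F = tns (clUnit t) as # ys \<and> trg F = trg H \<and> F \<odot>[0] thl uu as = H))"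
  using assms
proof (induction as arbitrary: ys rule: rev_nonempty_induct)
  \<comment> \<open>\<open>thl uu [a]\<close> is the inverse of \<open>\<lambda>\<close>\<close>
  case (single a)
  have a: "a \<in> Obj X" using single by simp
  have ok: "ok (Suc (length ys)) (Suc 0)" using ok_unary[of "Suc (length ys)"] single by simp
  have l: "una (lama A a) \<in> mar" using a by (simp add: lama_law)
  have k: "thl uu [a] = kap a" by (simp add: kap_def)
  have inv: "F \<odot>[0] kap a \<odot>[0] una (lama A a) = F" if "F \<in> mar" "src F = clOb t (clUnit t) a # ys" for F
    using that a l ok nested[of F "kap a" "una (lama A a)" 0 0] by (simp add: kap_lama)
  have inv': "H \<odot>[0] una (lama A a) \<odot>[0] kap a = H" if "H \<in> mar" "src H = a # ys" for H
    using that a l ok nested[of H "una (lama A a)" "kap a" 0 0] by (simp add: kap_lama)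
  show ?case
  proof (intro conjI ballI impI)
    fix H assume "H \<in> mar" "src H = [a] @ ys"
    then show "\<exists>F\<in>mar. src F = tns (clUnit t) [a] # ys \<and> trg F = trg H \<and> F \<odot>[0] thl uu [a] = H"
      using inv'[of H] l ok unfolding k by (intro bexI[of _ "H \<odot>[0] una (lama A a)"]) auto
  next
    fix F G assume *: "F \<in> mar" "G \<in> mar" "src F = tns (clUnit t) [a] # ys" "src G = src F" "trg G = trg F"
      "F \<odot>[0] thl uu [a] = G \<odot>[0] thl uu [a]"
    have "F = G \<odot>[0] kap a \<odot>[0] una (lama A a)" using inv[of F] * unfolding k by simp
    also have "\<dots> = G" using inv[of G] * by simp
    finally show "F = G" .
  qed
next
  case (snoc a as)
  let ?n = "Suc (length ys)" and ?p = "length as" and ?I = "tns (clUnit t) as" and ?T = "thl uu as"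
  have p: "1 \<le> ?p" using snoc.hyps by (cases as) auto
  have a: "a \<in> Obj X" "as \<in> lists (Obj X)" using snoc.prems by auto
  have I: "?I \<in> Obj X" using a by auto
  have okn: "ok (Suc 0) (?p + ?n)" using snoc.prems(2) by simp
  note ok = ok_split[OF okn _ p]
  have ok1: "ok (Suc 0) ?p" by (rule ok_1_mono[OF okn]) simp
  have T: "?T \<in> mar" "thl uu (as @ [a]) = th ?I a \<odot>[0] ?T" using a ok1 by (auto simp: thl_append)
  have eq: "F \<odot>[0] thl uu (as @ [a]) = F \<odot>[0] th ?I a \<odot>[0] ?T"
    if "F \<in> mar" "src F = clOb t ?I a # ys" for F
    unfolding T using nested[of F "th ?I a" ?T 0 0] that T a I ok by simp
  have IH1: "F = G" if "F \<in> mar" "G \<in> mar" "src F = ?I # a # ys" "src G = src F" "trg G = trg F" "F \<odot>[0] ?T = G \<odot>[0] ?T" for F G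
    using snoc.IH[of "a # ys"] a okn that by simp
  have IH2: "\<exists>F \<in> mar. src F = ?I # a # ys \<and> trg F = trg H \<and> F \<odot>[0] ?T = H" if "H \<in> mar" "src H = as @ a # ys" for H
    using snoc.IH[of "a # ys"] a okn that by simp
  show ?case
  proof (intro conjI ballI impI)
    fix F G assume *: "F \<in> mar" "G \<in> mar" "src F = tns (clUnit t) (as @ [a]) # ys" "src G = src F" "trg G = trg F"
      "F \<odot>[0] thl uu (as @ [a]) = G \<odot>[0] thl uu (as @ [a])"
    have "F \<odot>[0] th ?I a = G \<odot>[0] th ?I a"
      by (rule IH1) (use * eq[of F] eq[of G] a I ok in auto)
    then show "F = G"
      by (rule theta_inj[where xs = ys]) (use * a I ok in \<open>auto simp: numeral_2_eq_2\<close>)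
  next
    fix H assume H: "H \<in> mar" "src H = (as @ [a]) @ ys"
    then obtain K where K: "K \<in> mar" "src K = ?I # a # ys" "trg K = trg H" "K \<odot>[0] ?T = H"
      using IH2[of H] by auto
    then obtain F where "F \<in> mar" "src F = clOb t ?I a # ys" "trg F = trg K" "F \<odot>[0] th ?I a = K"
      using theta_ex[of K ?I a ys] ok by (auto simp: numeral_2_eq_2)
    then show "\<exists>F\<in>mar. src F = tns (clUnit t) (as @ [a]) # ys \<and> trg F = trg H \<and> F \<odot>[0] thl uu (as @ [a]) = H"
      using K eq[of F] by (intro bexI[of _ F]) auto
  qed
qed

theorem Phi_surj:
  assumes "G \<in> mar"
  obtains f where "f \<in> arr X" "src f = tns (clUnit t) (src G)" "trg f = trg G" "Phi f (src G) = G"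
proof (cases "src G = []")
  case True
  obtain F where "F \<in> mar" "src F = [clUnit t]" "trg F = trg G" "F \<odot>[0] uu = G"
    using uu_ex[of G] assms True by auto
  then show ?thesis using una_ex[of F "clUnit t"] that True unfolding Phi_def by (metis foldl_Nil thl.simps(1))
next
  case False
  obtain F where "F \<in> mar" "src F = [tns (clUnit t) (src G)]" "trg F = trg G" "F \<odot>[0] thl uu (src G) = G"
    using thl_uu_bij[of "src G" "[]"] False assms mar_objs[OF assms] by auto
  then show ?thesis using una_ex[of F "tns (clUnit t) (src G)"] that unfolding Phi_def by metis
qed

theorem Phi_inj:
  assumes "Phi f as = Phi g as" "f \<in> arr X" "g \<in> arr X" "src f = tns (clUnit t) as" "src g = src f" "trg g = trg f"
    "as \<in> lists (Obj X)" "ok (Suc 0) (length as)"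
  shows "f = g"
proof (cases "as = []")
  case True
  have "una f = una g"
    by (rule uu_inj[where xs = "[]"]) (use assms True in \<open>simp_all add: Phi_def\<close>)
  then show ?thesis by simp
next
  case False
  then have "una f = una g"
    using thl_uu_bij[of as "[]", THEN conjunct1, rule_format, of "una f" "una g"] assms by (simp add: Phi_def)
  then show ?thesis by simp
qed

end

section \<open>Lax monoidal functors from universal maps\<close>

context left_representable_pm begin

interpretation X: category X by (rule category_X)

text \<open>
  Maps \<open>q\<close> and \<open>v\<close> compatible with the structure of the domain make a functor into \<open>A\<close> lax monoidal, since the
  laws of a lax monoidal functor can be tested after precomposition with universal maps.
\<close>

lemma lax_monoidal_to_A:
  assumes E: "skew_monoidal E" and F: "is_functor E A F"
    and ext: "fOb F \<in> extensional (Obj E)" "\<And>a b. fMap F a b \<in> extensional (catMaps E a b)"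
      "\<And>a b. \<not> (a \<in> Obj E \<and> b \<in> Obj E) \<Longrightarrow> lax2 F a b = undefined"
    and q: "\<And>a b. a \<in> Obj E \<Longrightarrow> b \<in> Obj E \<Longrightarrow> q a b \<in> mar"
      "\<And>a b. a \<in> Obj E \<Longrightarrow> b \<in> Obj E \<Longrightarrow> src (q a b) = [fOb F a, fOb F b]"
      "\<And>a b. a \<in> Obj E \<Longrightarrow> b \<in> Obj E \<Longrightarrow> trg (q a b) = fOb F (ten E a b)"
    and v: "v \<in> mar" "src v = []" "trg v = fOb F (unt E)"
    and l2: "\<And>a b. a \<in> Obj E \<Longrightarrow> b \<in> Obj E \<Longrightarrow> lax2a E A F a b \<in> arr X"
      "\<And>a b. a \<in> Obj E \<Longrightarrow> b \<in> Obj E \<Longrightarrow> una (lax2a E A F a b) \<odot>[0] th (fOb F a) (fOb F b) = q a b"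
    and l0: "lax0a E A F \<in> arr X" "una (lax0a E A F) \<odot>[0] uu = v"
    and nat: "\<And>f g. f \<in> arr E \<Longrightarrow> g \<in> arr E \<Longrightarrow>
      q (trg f) (trg g) \<odot>[0] una (mapa F f) \<odot>[Suc 0] una (mapa F g) = una (mapa F (tena E f g)) \<odot>[0] q (src f) (src g)"
    and assoc: "\<And>a b c. a \<in> Obj E \<Longrightarrow> b \<in> Obj E \<Longrightarrow> c \<in> Obj E \<Longrightarrow>
      una (mapa F (alpa E a b c)) \<odot>[0] q (ten E a b) c \<odot>[0] q a b = q a (ten E b c) \<odot>[Suc 0] q b c"
    and lunit: "\<And>a. a \<in> Obj E \<Longrightarrow> una (mapa F (lama E a)) \<odot>[0] q (unt E) a \<odot>[0] v = una (ida X (fOb F a))"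
    and runit: "\<And>a. a \<in> Obj E \<Longrightarrow> q a (unt E) \<odot>[Suc 0] v = una (mapa F (rhoa E a))"
  shows "lax_monoidal E A F"
proof -
  interpret E: skew_monoidal E by (rule E)
  interpret F: is_functor E A F by (rule F)
  have ob [simp]: "fOb F a \<in> Obj X" if "a \<in> Obj E" for a using F.functor_obj that by simp
  have map [simp]: "mapa F f \<in> arr X" if "f \<in> arr E" for f using F.mapa_arr that by simp
  note [simp] = q v
  have l2': "una (lax2a E A F a b) \<odot>[0] th x y = q a b" if "a \<in> Obj E" "b \<in> Obj E" "x = fOb F a" "y = fOb F b" for a b x y
    using l2 that by simp
  have l2_nf: "G \<odot>[i] una (lax2a E A F a b) \<odot>[i] th x y = G \<odot>[i] q a b"
    if "a \<in> Obj E" "b \<in> Obj E" "x = fOb F a" "y = fOb F b" "G \<in> mar" "i < length (src G)"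
      "src G ! i = fOb F (ten E a b)" "ok (length (src G)) 2" for G i a b x y
    by (rule below) (use that l2 in \<open>auto simp: numeral_2_eq_2\<close>)
  have l0_nf: "G \<odot>[i] una (lax0a E A F) \<odot>[i] uu = G \<odot>[i] v"
    if "G \<in> mar" "i < length (src G)" "src G ! i = fOb F (unt E)" "ok (length (src G)) 0" for G i
    by (rule below) (use that l0 in auto)
  note nf' = nf l2(1) l2' l2_nf l0 l0_nf
  show ?thesis
  proof (rule lax_monoidalI[OF E skew_monoidal_A F ext], unfold A_arr A_simps)
    fix f g assume fg: "f \<in> arr E" "g \<in> arr E"
    have "una (cmpa X (lax2a E A F (trg f) (trg g)) (tena A (mapa F f) (mapa F g)))
       = una (cmpa X (mapa F (tena E f g)) (lax2a E A F (src f) (src g)))"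
      by (rule theta_inj[where a = "fOb F (src f)" and b = "fOb F (src g)" and xs = "[]"])
        (use fg nat[of f g] in \<open>simp_all add: nf'\<close>)
    then show "cmpa X (lax2a E A F (trg f) (trg g)) (tena A (mapa F f) (mapa F g))
       = cmpa X (mapa F (tena E f g)) (lax2a E A F (src f) (src g))" by simp
  next
    fix a b c assume o: "a \<in> Obj E" "b \<in> Obj E" "c \<in> Obj E"
    let ?a = "fOb F a" and ?b = "fOb F b" and ?c = "fOb F c"
    let ?L = "una (cmpa X (mapa F (alpa E a b c)) (cmpa X (lax2a E A F (ten E a b) c) (tena A (lax2a E A F a b) (ida X ?c))))"
    let ?R = "una (cmpa X (lax2a E A F a (ten E b c)) (cmpa X (tena A (ida X ?a) (lax2a E A F b c)) (alpa A ?a ?b ?c)))"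
    have "?L \<odot>[0] th (clOb t ?a ?b) ?c = ?R \<odot>[0] th (clOb t ?a ?b) ?c"
      by (rule theta_inj[where a = ?a and b = ?b and xs = "[?c]"])
        (use o assoc[of a b c] in \<open>simp_all add: nf'\<close>)
    then have "?L = ?R"
      by (rule theta_inj[where a = "clOb t ?a ?b" and b = ?c and xs = "[]"]) (use o in \<open>simp_all add: nf'\<close>)
    then show "cmpa X (mapa F (alpa E a b c)) (cmpa X (lax2a E A F (ten E a b) c) (tena A (lax2a E A F a b) (ida X ?c)))
      = cmpa X (lax2a E A F a (ten E b c)) (cmpa X (tena A (ida X ?a) (lax2a E A F b c)) (alpa A ?a ?b ?c))" by simp
  next
    fix a assume o: "a \<in> Obj E"
    let ?a = "fOb F a" and ?i = "clUnit t"
    let ?L = "una (cmpa X (mapa F (lama E a)) (cmpa X (lax2a E A F (unt E) a) (tena A (lax0a E A F) (ida X ?a))))"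
    have "?L \<odot>[0] th ?i ?a = una (lama A ?a) \<odot>[0] th ?i ?a"
      by (rule uu_inj[where xs = "[?a]"]) (use o lunit[of a] in \<open>simp_all add: nf'\<close>)
    then have "?L = una (lama A ?a)"
      by (rule theta_inj[where a = ?i and b = ?a and xs = "[]"]) (use o in \<open>simp_all add: nf'\<close>)
    then show "cmpa X (mapa F (lama E a)) (cmpa X (lax2a E A F (unt E) a) (tena A (lax0a E A F) (ida X ?a))) = lama A ?a" by simp
    have "una (cmpa X (lax2a E A F a (unt E)) (cmpa X (tena A (ida X ?a) (lax0a E A F)) (rhoa A ?a))) = una (mapa F (rhoa E a))"
      using o runit[of a] by (simp add: nf')
    then show "cmpa X (lax2a E A F a (unt E)) (cmpa X (tena A (ida X ?a) (lax0a E A F)) (rhoa A ?a)) = mapa F (rhoa E a)" by simp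
  qed (use l0 l2 in simp_all)
qed

end

section \<open>Morphisms of partial multicategories\<close>

definition mapm :: "('o, 'm) mmor \<Rightarrow> ('o, 'm) marrow \<Rightarrow> ('o, 'm) marrow" where
  "mapm F G = (map (morOb F) (src G), morMap F (src G) (trg G) (raw G), morOb F (trg G))"

lemma mapm_src_trg [simp]: "src (mapm F G) = map (morOb F) (src G)" "trg (mapm F G) = morOb F (trg G)"
  by (simp_all add: mapm_def)

definition (in partial_multicategory) mars :: "'o list \<Rightarrow> 'o \<Rightarrow> 'm set" where
  "mars as b = {m. (as, m, b) \<in> mar}"

locale pm_morphism = C: partial_multicategory X1 MM1 S1 ok + D: partial_multicategory X2 MM2 S2 ok
  for X1 :: "('o, 'm) cat" and MM1 S1 and X2 :: "('o, 'm) cat" and MM2 S2 ok +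
  fixes F :: "('o, 'm) mmor"
  assumes ext_ob: "morOb F \<in> extensional (Obj X1)"
    and ext_map: "morMap F as b \<in> extensional (C.mars as b)"
    and map_ob: "a \<in> Obj X1 \<Longrightarrow> morOb F a \<in> Obj X2"
    and map_mar: "G \<in> C.mar \<Longrightarrow> mapm F G \<in> D.mar"
    and map_idm: "a \<in> Obj X1 \<Longrightarrow> mapm F (una (ida X1 a)) = una (ida X2 (morOb F a))"
    and map_msub: "\<lbrakk>G \<in> C.mar; H \<in> C.mar; i < length (src G); src G ! i = trg H; ok (length (src G)) (length (src H))\<rbrakk>
      \<Longrightarrow> mapm F (C.msub G i H) = D.msub (mapm F G) i (mapm F H)"

lemma pm_morphism_eqI:
  assumes "pm_morphism X1 MM1 S1 X2 MM2 S2 ok F" "pm_morphism X1 MM1 S1 X2 MM2 S2 ok G"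
    "\<And>a. a \<in> Obj X1 \<Longrightarrow> morOb F a = morOb G a"
    "\<And>H. H \<in> partial_multicategory.mar X1 MM1 ok \<Longrightarrow> mapm F H = mapm G H"
  shows "F = G"
proof -
  interpret F: pm_morphism X1 MM1 S1 X2 MM2 S2 ok F by fact
  interpret G: pm_morphism X1 MM1 S1 X2 MM2 S2 ok G by fact
  have "morOb F = morOb G" using F.ext_ob G.ext_ob assms(3) by (rule extensionalityI)
  moreover have "morMap F as b = morMap G as b" for as b
  proof (rule extensionalityI[OF F.ext_map G.ext_map])
    fix m assume "m \<in> F.C.mars as b"
    then have "mapm F (as, m, b) = mapm G (as, m, b)" using assms(4) by (simp add: F.C.mars_def)
    then show "morMap F as b m = morMap G as b m" by (simp add: mapm_def)
  qed
  ultimately show ?thesis by (intro mmor.equality) (auto intro!: ext)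
qed

locale left_representable_pair = C: left_representable_pm X1 MM1 S1 ok t1 + D: left_representable_pm X2 MM2 S2 ok t2
  for X1 :: "('o, 'm) cat" and MM1 S1 t1 and X2 :: "('o, 'm) cat" and MM2 S2 t2 ok

locale left_representable_morphism = left_representable_pair X1 MM1 S1 t1 X2 MM2 S2 t2 ok +
    pm_morphism X1 MM1 S1 X2 MM2 S2 ok F
  for X1 :: "('o, 'm) cat" and MM1 S1 t1 and X2 :: "('o, 'm) cat" and MM2 S2 t2 ok F
begin

abbreviation L :: "('o, 'm) laxfun" where "L \<equiv> lax_of X1 X2 S2 t1 t2 F"

lemma L_simps [simp]: "fOb L = morOb F" "fMap L a b = morMap F [a] b"
  by (simp_all add: lax_of_def)

lemma una_mapa: "una (mapa L f) = mapm F (una f)"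
  by (simp add: una_def mapm_def mapa_def)

lemma L_lax0:
  "lax0a C.A D.A L \<in> arr X2" "D.msub (una (lax0a C.A D.A L)) 0 D.uu = mapm F C.uu"
proof -
  have H: "mapm F C.uu \<in> D.mar" "src (mapm F C.uu) = []" by (simp_all add: map_mar)
  have *: "lax0 L = (THE h. h \<in> Hom X2 (clUnit t2) (trg (mapm F C.uu)) \<and>
     S2 [] (clUnit t2) [] [] (trg (mapm F C.uu)) h (clU t2) = raw (mapm F C.uu))"
    by (simp add: lax_of_def mapm_def C.uu_def Let_def)
  have "lax0a C.A D.A L = (clUnit t2, lax0 L, trg (mapm F C.uu))" by (simp add: lax0a_def)
  then show "lax0a C.A D.A L \<in> arr X2" "D.msub (una (lax0a C.A D.A L)) 0 D.uu = mapm F C.uu"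
    using D.the_uu[OF H *] by simp_all
qed

lemma L_lax2:
  assumes "a \<in> Obj X1" "b \<in> Obj X1"
  shows "lax2a C.A D.A L a b \<in> arr X2"
    "D.msub (una (lax2a C.A D.A L a b)) 0 (D.th (morOb F a) (morOb F b)) = mapm F (C.th a b)"
proof -
  have H: "mapm F (C.th a b) \<in> D.mar" "src (mapm F (C.th a b)) = [morOb F a, morOb F b]"
    using assms by (simp_all add: map_mar)
  have *: "lax2 L a b = (THE h. h \<in> Hom X2 (clOb t2 (morOb F a) (morOb F b)) (trg (mapm F (C.th a b))) \<and>
     S2 [] (clOb t2 (morOb F a) (morOb F b)) [] [morOb F a, morOb F b] (trg (mapm F (C.th a b))) h
       (clTheta t2 (morOb F a) (morOb F b)) = raw (mapm F (C.th a b)))"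
    using assms by (simp add: lax_of_def mapm_def C.th_def Let_def)
  have "lax2a C.A D.A L a b = (clOb t2 (morOb F a) (morOb F b), lax2 L a b, trg (mapm F (C.th a b)))"
    by (simp add: lax2a_def)
  then show "lax2a C.A D.A L a b \<in> arr X2"
    "D.msub (una (lax2a C.A D.A L a b)) 0 (D.th (morOb F a) (morOb F b)) = mapm F (C.th a b)"
    using D.the_theta[OF H *] by simp_all
qed

lemma mapa_arr_F: "f \<in> arr X1 \<Longrightarrow> mapa L f \<in> arr X2"
  using map_mar[of "una f"] una_mapa[of f] by (metis C.una_mar D.una_mar)

lemma functor_X: "is_functor X1 X2 L"
proof -
  interpret X1: category X1 by (rule C.category_X)
  interpret X2: category X2 by (rule D.category_X)
  show ?thesis
  proof
    show "fOb L a \<in> Obj X2" if "a \<in> Obj X1" for a using that map_ob by simp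
    show "fMap L a b f \<in> Hom X2 (fOb L a) (fOb L b)" if "a \<in> Obj X1" "b \<in> Obj X1" "f \<in> Hom X1 a b" for a b f
      using mapa_arr_F[of "(a, f, b)"] that by (simp add: arr_def mapa_def del: arr_obj)
    show "fMap L a a (Idm X1 a) = Idm X2 (fOb L a)" if "a \<in> Obj X1" for a
      using map_idm[OF that] by (simp add: mapm_def una_def ida_def)
    fix a b c f g assume *: "a \<in> Obj X1" "b \<in> Obj X1" "c \<in> Obj X1" "f \<in> Hom X1 a b" "g \<in> Hom X1 b c"
    have fg: "(a, f, b) \<in> arr X1" "(b, g, c) \<in> arr X1" using * by (simp_all add: arr_def del: arr_obj)
    have "una (mapa L (cmpa X1 (b, g, c) (a, f, b))) = una (cmpa X2 (mapa L (b, g, c)) (mapa L (a, f, b)))"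
      using fg mapa_arr_F[OF fg(1)] mapa_arr_F[OF fg(2)] map_msub[of "una (b, g, c)" "una (a, f, b)" 0]
      by (simp add: C.una_cmp D.una_cmp una_mapa)
    then show "fMap L a c (Cmp X1 a b c g f) = Cmp X2 (fOb L a) (fOb L b) (fOb L c) (fMap L b c g) (fMap L a b f)"
      by (simp add: mapa_def cmpa_def)
  qed
qed

lemma functor_A: "is_functor C.A D.A L"
  using functor_X unfolding is_functor_def is_functor_axioms_def category_def by simp

lemma lax_monoidal_L: "lax_monoidal C.A D.A L"
proof (rule D.lax_monoidal_to_A[where q = "\<lambda>a b. mapm F (C.th a b)" and v = "mapm F C.uu",
      OF C.skew_monoidal_A functor_A], unfold C.A_simps C.A_arr)
  show "fOb L \<in> extensional (Obj X1)" using ext_ob by simp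
  show "fMap L a b \<in> extensional (catMaps C.A a b)" for a b
  proof -
    have "C.mars [a] b = catMaps C.A a b"
      using C.una_mar[of "(a, _, b)"] by (auto simp: C.mars_def catMaps_def una_def arr_def simp del: arr_obj)
    then show ?thesis using ext_map[of "[a]" b] by simp
  qed
  show "lax2 L a b = undefined" if "\<not> (a \<in> Obj X1 \<and> b \<in> Obj X1)" for a b
    using that by (auto simp: lax_of_def)
next
  fix f g assume fg: "f \<in> arr X1" "g \<in> arr X1"
  have "mapm F (C.msub (C.msub (C.th (trg f) (trg g)) 0 (una f)) (Suc 0) (una g))
     = mapm F (C.msub (una (tena C.A f g)) 0 (C.th (src f) (src g)))"
    using fg by (simp add: C.tena_law)
  then show "D.msub (D.msub (mapm F (C.th (trg f) (trg g))) 0 (una (mapa L f))) (Suc 0) (una (mapa L g)) =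
     D.msub (una (mapa L (tena C.A f g))) 0 (mapm F (C.th (src f) (src g)))"
    using fg by (simp add: map_msub una_mapa C.tena_law(1))
next
  fix a b c assume o: "a \<in> Obj X1" "b \<in> Obj X1" "c \<in> Obj X1"
  have "mapm F (C.msub (C.msub (una (alpa C.A a b c)) 0 (C.th (clOb t1 a b) c)) 0 (C.th a b))
    = mapm F (C.msub (C.th a (clOb t1 b c)) (Suc 0) (C.th b c))"
    using o by (simp add: C.alpa_law)
  then show "D.msub (D.msub (una (mapa L (alpa C.A a b c))) 0 (mapm F (C.th (clOb t1 a b) c))) 0 (mapm F (C.th a b))
     = D.msub (mapm F (C.th a (clOb t1 b c))) (Suc 0) (mapm F (C.th b c))"
    using o by (simp add: map_msub una_mapa C.alpa_law(1))
next
  fix a assume o: "a \<in> Obj X1"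
  have "mapm F (C.msub (C.msub (una (lama C.A a)) 0 (C.th (clUnit t1) a)) 0 C.uu) = mapm F (una (ida X1 a))"
    using o by (simp add: C.lama_law)
  then show "D.msub (D.msub (una (mapa L (lama C.A a))) 0 (mapm F (C.th (clUnit t1) a))) 0 (mapm F C.uu) = una (ida X2 (fOb L a))"
    using o by (simp add: map_msub una_mapa C.lama_law(1) map_idm)
  show "D.msub (mapm F (C.th a (clUnit t1))) (Suc 0) (mapm F C.uu) = una (mapa L (rhoa C.A a))"
    using o by (simp add: una_mapa C.rhoa_law(2) map_msub)
qed (simp_all add: map_mar L_lax0 L_lax2)

end

context left_representable_pair begin

text \<open>
  Every multimap is a unary map composed with iterated universal maps, so a morphism is determined by its
  values on unary maps and universal maps. These values can be read off from the lax monoidal functor.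
\<close>

lemma lax_of_inj:
  assumes F: "pm_morphism X1 MM1 S1 X2 MM2 S2 ok F" and G: "pm_morphism X1 MM1 S1 X2 MM2 S2 ok G"
    and eq: "lax_of X1 X2 S2 t1 t2 F = lax_of X1 X2 S2 t1 t2 G"
  shows "F = G"
proof -
  interpret F: left_representable_morphism X1 MM1 S1 t1 X2 MM2 S2 t2 ok F
    by (intro left_representable_morphism.intro left_representable_pair_axioms F)
  interpret G: left_representable_morphism X1 MM1 S1 t1 X2 MM2 S2 t2 ok G
    by (intro left_representable_morphism.intro left_representable_pair_axioms G)
  have ob: "morOb F = morOb G" using eq F.L_simps(1) G.L_simps(1) by metis
  have un: "mapm F (una f) = mapm G (una f)" for f
    using eq F.una_mapa G.una_mapa by metis
  have th: "mapm F (C.th a b) = mapm G (C.th a b)" if "a \<in> Obj X1" "b \<in> Obj X1" for a b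
    using F.L_lax2(2)[OF that] G.L_lax2(2)[OF that] ob eq by simp
  have uu: "mapm F C.uu = mapm G C.uu"
    using F.L_lax0(2) G.L_lax0(2) eq by simp
  have thl: "mapm F (C.thl C.uu as) = mapm G (C.thl C.uu as)" if "as \<in> lists (Obj X1)" "ok (Suc 0) (length as)" for as
    using that
  proof (induction as rule: rev_induct)
    case (snoc a as)
    have ok: "ok (Suc (Suc 0)) (length as)" "ok (Suc 0) (length as)"
      using snoc.prems C.ok_2_pre[of "length as"] C.ok_1_mono[of "length (as @ [a])" "length as"] by auto
    then show ?case using snoc uu
      by (simp add: C.thl_append F.map_msub G.map_msub th C.A.tens_obj)
  qed (simp add: uu)
  show ?thesis
  proof (rule pm_morphism_eqI[OF F G])
    fix H assume H: "H \<in> C.mar"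
    then obtain f where f: "f \<in> arr X1" "src f = C.tns (clUnit t1) (src H)" "C.Phi f (src H) = H"
      using C.Phi_surj by metis
    have o: "src H \<in> lists (Obj X1)" "ok (Suc 0) (length (src H))" using C.mar_objs[OF H] by auto
    have "mapm F (C.Phi f (src H)) = mapm G (C.Phi f (src H))"
      unfolding C.Phi_def using f o by (simp add: F.map_msub G.map_msub un thl)
    then show "mapm F H = mapm G H" using f by simp
  qed (simp add: ob)
qed

text \<open>
  The morphism sends \<open>Phi f as\<close> to \<open>Phi\<close> of the composite of \<open>H f\<close> with the canonical arrow
  \<open>\<i> (H as) \<rightarrow> H (\<i> as)\<close>. It preserves substitution by \<open>Phi_subst\<close> on both sides and \<open>laxs_subst\<close> between them.
\<close>

lemma lax_of_surj:
  assumes H: "lax_monoidal C.A D.A H"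
  shows "\<exists>F. pm_morphism X1 MM1 S1 X2 MM2 S2 ok F \<and> lax_of X1 X2 S2 t1 t2 F = H"
proof -
  interpret H: lax_monoidal C.A D.A H
    rewrites "Obj C.A = Obj X1" and "ten C.A = clOb t1" and "unt C.A = clUnit t1"
    and "arr C.A = arr X1" and "ida C.A = ida X1" and "cmpa C.A = cmpa X1" and "Hom C.A = Hom X1"
    and "Obj D.A = Obj X2" and "ten D.A = clOb t2" and "unt D.A = clUnit t2"
    and "arr D.A = arr X2" and "ida D.A = ida X2" and "cmpa D.A = cmpa X2" and "Hom D.A = Hom X2"
    by (rule H) simp_all
  interpret X1: category X1 by (rule C.category_X)
  interpret X2: category X2 by (rule D.category_X)
  let ?i = "clUnit t1" and ?l0 = "lax0a C.A D.A H" and ?ob = "fOb H"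
  let ?K = "H.laxs ?l0 ?i"
  have Phi_ex: "\<exists>f. G \<in> C.mar \<longrightarrow> f \<in> arr X1 \<and> src f = C.tns ?i (src G) \<and> trg f = trg G \<and> C.Phi f (src G) = G" for G
    using C.Phi_surj[of G] by metis
  then obtain inv where inv: "\<And>G. G \<in> C.mar \<Longrightarrow>
     inv G \<in> arr X1 \<and> src (inv G) = C.tns ?i (src G) \<and> trg (inv G) = trg G \<and> C.Phi (inv G) (src G) = G"
    by metis
  define F where "F = \<lparr>morOb = ?ob, morMap = (\<lambda>as b. restrict (\<lambda>m.
     raw (D.Phi (cmpa X2 (mapa H (inv (as, m, b))) (?K as)) (map ?ob as))) (C.mars as b))\<rparr>"
  have ob [simp]: "morOb F = ?ob" by (simp add: F_def)
  have mapF: "mapm F G = D.Phi (cmpa X2 (mapa H (inv G)) (?K (src G))) (map ?ob (src G))" if "G \<in> C.mar" for G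
    using that inv[OF that] by (simp add: mapm_def F_def C.mars_def prod_eq_iff)
  have mapPhi: "mapm F (C.Phi f as) = D.Phi (cmpa X2 (mapa H f) (?K as)) (map ?ob as)"
    if "f \<in> arr X1" "src f = C.tns ?i as" "as \<in> lists (Obj X1)" "ok (Suc 0) (length as)" for f as
  proof -
    have G: "C.Phi f as \<in> C.mar" using that by simp
    have "inv (C.Phi f as) = f"
      by (rule C.Phi_inj[of _ as]) (use inv[OF G] that in auto)
    then show ?thesis using mapF[OF G] by simp
  qed
  have K: "?K as \<in> arr X2" "src (?K as) = D.tns (clUnit t2) (map ?ob as)" "trg (?K as) = ?ob (C.tns ?i as)"
    if "as \<in> lists (Obj X1)" for as
    using that by (simp_all add: H.laxs_arr)
  have mar: "mapm F G \<in> D.mar" if "G \<in> C.mar" for G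
    unfolding mapF[OF that] using inv[OF that] C.mar_objs[OF that] K[of "src G"]
    by (intro D.Phi_mar) auto
  have K1: "cmpa X2 (mapa H (lama C.A a)) (?K [a]) = lama D.A (?ob a)" if "a \<in> Obj X1" for a
    using H.laxa_left_unit[OF that] by simp
  have una_C: "una f = C.Phi (cmpa X1 f (lama C.A (src f))) [src f]" if "f \<in> arr X1" for f
    using that C.una_cmp_msub[of "lama C.A (src f)" f "C.kap (src f)"]
    by (simp add: C.Phi_def C.kap_lama C.lama_law C.kap_def[symmetric])
  have una_D: "D.Phi (cmpa X2 f (lama D.A (src f))) [src f] = una f" if "f \<in> arr X2" for f
    using that D.una_cmp_msub[of "lama D.A (src f)" f "D.kap (src f)"]
    by (simp add: D.Phi_def D.kap_lama D.lama_law D.kap_def[symmetric])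
  have mapu: "mapm F (una f) = una (mapa H f)" if f: "f \<in> arr X1" for f
  proof -
    have "mapm F (una f) = D.Phi (cmpa X2 (mapa H (cmpa X1 f (lama C.A (src f)))) (?K [src f])) [?ob (src f)]"
      unfolding una_C[OF f] using f mapPhi[of "cmpa X1 f (lama C.A (src f))" "[src f]"] by (simp add: C.lama_law)
    also have "cmpa X2 (mapa H (cmpa X1 f (lama C.A (src f)))) (?K [src f]) = cmpa X2 (mapa H f) (lama D.A (?ob (src f)))"
      using f K1[of "src f"] K[of "[src f]"] by (simp add: H.mapa_cmp C.lama_law del: H.laxs.simps)
    finally show ?thesis using una_D[of "mapa H f"] f by simp
  qed
  have pm: "pm_morphism X1 MM1 S1 X2 MM2 S2 ok F"
  proof
    show "morOb F \<in> extensional (Obj X1)" using H.ext_obj by simp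
    show "morMap F as b \<in> extensional (C.mars as b)" for as b by (simp add: F_def)
    show "morOb F a \<in> Obj X2" if "a \<in> Obj X1" for a using that by simp
    show "mapm F (una (ida X1 a)) = una (ida X2 (morOb F a))" if "a \<in> Obj X1" for a
      using that by (simp add: mapu)
    fix G G' i assume G: "G \<in> C.mar" "G' \<in> C.mar" "i < length (src G)" "src G ! i = trg G'" "ok (length (src G)) (length (src G'))"
    obtain g where g: "g \<in> arr X1" "src g = C.tns ?i (src G)" "trg g = trg G" "C.Phi g (src G) = G"
      using C.Phi_surj[OF G(1)] by metis
    obtain h where h: "h \<in> arr X1" "src h = C.tns ?i (src G')" "trg h = trg G'" "C.Phi h (src G') = G'"
      using C.Phi_surj[OF G(2)] by metis
    obtain xs b ys where xs: "src G = xs @ b # ys" "length xs = i" "xs \<in> lists (Obj X1)" "b \<in> Obj X1" "ys \<in> lists (Obj X1)"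
      using C.mar_split G by metis
    define as where "as = src G'"
    have o: "as \<in> lists (Obj X1)" "b = trg h" "ok (length xs + 1 + length ys) (length as)" "ok (Suc 0) (length as)"
      "ok (Suc 0) (length xs + length as + length ys)" "ok (Suc 0) (Suc (length xs + length ys))"
      using C.mar_objs[OF G(2)] C.mar_objs[OF G(1)] xs G h C.ok_total[OF G(5)] by (auto simp: as_def nth_append algebra_simps)
    let ?w = "C.A.wh (C.tns ?i xs) as h"
    have w: "cmpa X1 g (C.A.act ?w ys) \<in> arr X1" "src (C.A.act ?w ys) = C.tns ?i (xs @ as @ ys)"
      using g h xs o by (auto simp: as_def)
    have "mapm F (C.msub G i G') = mapm F (C.Phi (cmpa X1 g (C.A.act ?w ys)) (xs @ as @ ys))"
      using C.Phi_subst[of g h xs b ys as] g h xs o by (simp add: as_def)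
    also have "\<dots> = D.Phi (cmpa X2 (mapa H (cmpa X1 g (C.A.act ?w ys))) (?K (xs @ as @ ys))) (map ?ob (xs @ as @ ys))"
      using w o xs by (intro mapPhi) (auto simp: algebra_simps)
    also have "cmpa X2 (mapa H (cmpa X1 g (C.A.act ?w ys))) (?K (xs @ as @ ys))
      = cmpa X2 (cmpa X2 (mapa H g) (?K (xs @ b # ys)))
         (D.A.act (D.A.wh (D.tns (clUnit t2) (map ?ob xs)) (map ?ob as) (cmpa X2 (mapa H h) (?K as))) (map ?ob ys))"
      using H.laxs_subst[of g h xs b ys as] g h xs o by (simp add: as_def)
    also have "D.Phi \<dots> (map ?ob (xs @ as @ ys)) =
       D.msub (D.Phi (cmpa X2 (mapa H g) (?K (xs @ b # ys))) (map ?ob (xs @ b # ys))) i (D.Phi (cmpa X2 (mapa H h) (?K as)) (map ?ob as))"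
    proof -
      have gh: "cmpa X2 (mapa H g) (?K (xs @ b # ys)) \<in> arr X2" "cmpa X2 (mapa H h) (?K as) \<in> arr X2"
        using g h xs o K[of "xs @ b # ys"] K[of as] by (auto simp: as_def)
      show ?thesis
        using D.Phi_subst[OF gh, of "map ?ob xs" "?ob b" "map ?ob ys" "map ?ob as"] g h xs o
          K[of "xs @ b # ys"] K[of as] by (simp add: as_def H.map_objs)
    qed
    also have "\<dots> = D.msub (mapm F (C.Phi g (xs @ b # ys))) i (mapm F (C.Phi h as))"
      using mapPhi[of g "xs @ b # ys"] mapPhi[of h as] g h xs o by (simp add: as_def)
    finally show "mapm F (C.msub G i G') = D.msub (mapm F G) i (mapm F G')" using g h xs by (simp add: as_def)
  qed (rule mar)
  interpret M: left_representable_morphism X1 MM1 S1 t1 X2 MM2 S2 t2 ok F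
    by (intro left_representable_morphism.intro left_representable_pair_axioms pm)
  have uuC: "C.uu = C.Phi (ida X1 ?i) []" by (simp add: C.Phi_def)
  have thC: "C.th a b = C.Phi (tena C.A (lama C.A a) (ida X1 b)) [a, b]" if "a \<in> Obj X1" "b \<in> Obj X1" for a b
    using that by (simp add: C.Phi_def C.nf)
  have thD: "D.th a b = D.Phi (tena D.A (lama D.A a) (ida X2 b)) [a, b]" if "a \<in> Obj X2" "b \<in> Obj X2" for a b
    using that by (simp add: D.Phi_def D.nf)
  have "una (lax0a C.A D.A M.L) = una ?l0"
  proof (rule D.uu_inj[where xs = "[]"])
    show "D.msub (una (lax0a C.A D.A M.L)) 0 D.uu = D.msub (una ?l0) 0 D.uu"
      unfolding M.L_lax0(2) uuC using mapPhi[of "ida X1 ?i" "[]"] H.lax_arr(1) by (simp add: D.Phi_def)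
  qed (use M.L_lax0(1) H.lax_arr(1) in simp_all)
  then have e0: "lax0 M.L = lax0 H" by (simp add: lax0a_def)
  have "una (lax2a C.A D.A M.L a b) = una (lax2a C.A D.A H a b)" if o: "a \<in> Obj X1" "b \<in> Obj X1" for a b
  proof (rule D.theta_inj[where a = "?ob a" and b = "?ob b" and xs = "[]"])
    let ?l2 = "lax2a C.A D.A H" and ?c = "tena C.A (lama C.A a) (ida X1 b)"
    have c: "lama C.A a \<in> arr X1" "?c \<in> arr X1" using o by (simp_all add: C.lama_law C.tena_law)
    have k: "?K [a] \<in> arr X2" "src (?K [a]) = clOb t2 (clUnit t2) (?ob a)" "trg (?K [a]) = ?ob (clOb t1 ?i a)"
      using K[of "[a]"] o by auto
    have "cmpa X2 (mapa H ?c) (?K [a, b])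
       = cmpa X2 (mapa H ?c) (cmpa X2 (?l2 (clOb t1 ?i a) b) (tena D.A (?K [a]) (ida X2 (?ob b))))"
      by simp
    also have "\<dots> = cmpa X2 (?l2 a b) (cmpa X2 (tena D.A (mapa H (lama C.A a)) (ida X2 (?ob b))) (tena D.A (?K [a]) (ida X2 (?ob b))))"
      using D.A.cmpa_reassoc[OF H.laxa_natural[of "lama C.A a" "ida X1 b"], of "tena D.A (?K [a]) (ida X2 (?ob b))"] o c k
      by (simp del: H.laxs.simps)
    also have "cmpa X2 (tena D.A (mapa H (lama C.A a)) (ida X2 (?ob b))) (tena D.A (?K [a]) (ida X2 (?ob b)))
       = tena D.A (lama D.A (?ob a)) (ida X2 (?ob b))"
      using o c k K1[of a] by (simp del: H.laxs.simps flip: D.A.tena_cmp_id)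
    finally have "mapm F (C.th a b) = D.Phi (cmpa X2 (?l2 a b) (tena D.A (lama D.A (?ob a)) (ida X2 (?ob b)))) [?ob a, ?ob b]"
      unfolding thC[OF o] using mapPhi[of ?c "[a, b]"] o c by (simp del: H.laxs.simps)
    also have "\<dots> = D.msub (una (?l2 a b)) 0 (D.th (?ob a) (?ob b))"
      unfolding thD[OF H.functor_obj'[OF o(1)] H.functor_obj'[OF o(2)]] unfolding D.Phi_def
      using o by (intro D.una_cmp_msub) (auto simp: D.lama_law D.tena_law)
    finally show "D.msub (una (lax2a C.A D.A M.L a b)) 0 (D.th (?ob a) (?ob b)) = D.msub (una (?l2 a b)) 0 (D.th (?ob a) (?ob b))"
      using M.L_lax2(2)[OF o] by simp
  qed (use o M.L_lax2(1)[OF o] in simp_all)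
  then have e2: "lax2 M.L a b = lax2 H a b" for a b
    using H.ext_lax2[of a b] by (cases "a \<in> Obj X1 \<and> b \<in> Obj X1") (auto simp: lax2a_def lax_of_def)
  have em: "fMap M.L a b f = fMap H a b f" for a b f
  proof (cases "f \<in> C.mars [a] b")
    case True
    then have "(a, f, b) \<in> arr X1" using C.una_mar[of "(a, f, b)"] by (simp add: C.mars_def una_def)
    then show ?thesis using M.una_mapa[of "(a, f, b)"] mapu[of "(a, f, b)"] by (simp add: mapa_def mapm_def una_def)
  next
    case False
    then have "(a, f, b) \<notin> arr X1" using C.una_mar[of "(a, f, b)"] by (simp add: C.mars_def una_def)
    then have "f \<notin> catMaps C.A a b" by (simp add: arr_def catMaps_def del: arr_obj)
    then show ?thesis using False H.ext_map[of a b] M.ext_map[of "[a]" b] by (simp add: extensional_def)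
  qed
  have "M.L = H" by (rule laxfun_eqI) (use e0 e2 em in auto)
  then show ?thesis using pm by blast
qed

end

section \<open>Substitution of lists of unary maps\<close>

context partial_multicategory begin

interpretation X: category X by (rule category_X)

text \<open>The action of lists of unary maps on multimaps will be expressed as a sequence of single substitutions.\<close>

primrec subs :: "('o, 'm) marrow \<Rightarrow> nat \<Rightarrow> ('o, 'm) arrow list \<Rightarrow> ('o, 'm) marrow" where
  "subs F i [] = F"
| "subs F i (p # ps) = subs (F \<odot>[i] una p) (Suc i) ps"

lemma subs_trg [simp]: "trg (subs F i ps) = trg F"
  by (induction ps arbitrary: F i) auto

lemma subs_src: "src F = xs @ map trg ps @ ys \<Longrightarrow> length xs = i \<Longrightarrow> src (subs F i ps) = xs @ map src ps @ ys"
proof (induction ps arbitrary: F i xs)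
  case (Cons p ps)
  then show ?case using Cons.IH[of "F \<odot>[i] una p" "xs @ [src p]" "Suc i"] by (simp add: msub_eq)
qed simp

lemma mar_unary_ok: "F \<in> mar \<Longrightarrow> i < length (src F) \<Longrightarrow> ok (length (src F)) (Suc 0)"
  using ok_unary[OF mar_objs(3)] by simp

lemma subs_mar:
  "F \<in> mar \<Longrightarrow> src F = xs @ map trg ps @ ys \<Longrightarrow> length xs = i \<Longrightarrow> set ps \<subseteq> arr X \<Longrightarrow> subs F i ps \<in> mar"
proof (induction ps arbitrary: F i xs)
  case (Cons p ps)
  have "F \<odot>[i] una p \<in> mar"
    using Cons.prems mar_unary_ok[of F i] by (intro msub_mar) auto
  then show ?case using Cons.prems Cons.IH[of "F \<odot>[i] una p" "xs @ [src p]" "Suc i"] by (simp add: msub_eq)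
qed simp

end

section \<open>Composition of morphisms\<close>

lemma una_mapa_mor: "una (mapa (mor_unary F) f) = mapm F (una f)"
  by (simp add: una_def mapm_def mapa_def mor_unary_def)

context pm_morphism begin

lemma map_arr: "f \<in> arr X1 \<Longrightarrow> mapa (mor_unary F) f \<in> arr X2"
  using map_mar[of "una f"] una_mapa_mor[of F f] by (metis C.una_mar D.una_mar)

lemma is_functor_mor: "is_functor X1 X2 (mor_unary F)"
proof -
  interpret X1: category X1 by (rule C.category_X)
  interpret X2: category X2 by (rule D.category_X)
  show ?thesis
  proof
    show "fOb (mor_unary F) a \<in> Obj X2" if "a \<in> Obj X1" for a using that map_ob by (simp add: mor_unary_def)
    show "fMap (mor_unary F) a b f \<in> Hom X2 (fOb (mor_unary F) a) (fOb (mor_unary F) b)"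
      if "a \<in> Obj X1" "b \<in> Obj X1" "f \<in> Hom X1 a b" for a b f
      using map_arr[of "(a, f, b)"] that by (simp add: arr_def mapa_def del: arr_obj)
    show "fMap (mor_unary F) a a (Idm X1 a) = Idm X2 (fOb (mor_unary F) a)" if "a \<in> Obj X1" for a
      using map_idm[OF that] by (simp add: mapm_def una_def ida_def mor_unary_def)
    fix a b c f g assume *: "a \<in> Obj X1" "b \<in> Obj X1" "c \<in> Obj X1" "f \<in> Hom X1 a b" "g \<in> Hom X1 b c"
    have fg: "(a, f, b) \<in> arr X1" "(b, g, c) \<in> arr X1" using * by (simp_all add: arr_def del: arr_obj)
    have "una (mapa (mor_unary F) (cmpa X1 (b, g, c) (a, f, b)))
        = una (cmpa X2 (mapa (mor_unary F) (b, g, c)) (mapa (mor_unary F) (a, f, b)))"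
      using fg map_arr[OF fg(1)] map_arr[OF fg(2)] map_msub[of "una (b, g, c)" "una (a, f, b)" 0]
      by (simp add: C.una_cmp D.una_cmp una_mapa_mor)
    then show "fMap (mor_unary F) a c (Cmp X1 a b c g f)
       = Cmp X2 (fOb (mor_unary F) a) (fOb (mor_unary F) b) (fOb (mor_unary F) c)
          (fMap (mor_unary F) b c g) (fMap (mor_unary F) a b f)"
      by (simp add: mapa_def cmpa_def)
  qed
qed

lemma map_subs:
  assumes "G \<in> C.mar" "src G = xs @ map trg ps @ ys" "length xs = i" "set ps \<subseteq> arr X1"
  shows "mapm F (C.subs G i ps) = D.subs (mapm F G) i (map (mapa (mor_unary F)) ps)"
  using assms
proof (induction ps arbitrary: G i xs)
  case (Cons p ps)
  have ok: "ok (length (src G)) (Suc 0)" using Cons.prems C.mar_unary_ok[of G i] by auto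
  have "C.msub G i (una p) \<in> C.mar" using Cons.prems ok by (intro C.msub_mar) auto
  moreover have "src (C.msub G i (una p)) = (xs @ [src p]) @ map trg ps @ ys" using Cons.prems by simp
  moreover have "mapm F (C.msub G i (una p)) = D.msub (mapm F G) i (una (mapa (mor_unary F) p))"
    using Cons.prems ok by (subst map_msub) (auto simp: una_mapa_mor)
  ultimately show ?case
    using Cons.prems Cons.IH[of "C.msub G i (una p)" "xs @ [src p]" "Suc i"] by simp
qed simp

end

lemma pm_morphism_comp:
  assumes "pm_morphism X1 MM1 S1 X2 MM2 S2 ok F" "pm_morphism X2 MM2 S2 X3 MM3 S3 ok G"
  shows "pm_morphism X1 MM1 S1 X3 MM3 S3 ok (mor_comp (Obj X1) (partial_multicategory.mars X1 MM1 ok) G F)"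
    "\<And>H. H \<in> partial_multicategory.mar X1 MM1 ok \<Longrightarrow>
      mapm (mor_comp (Obj X1) (partial_multicategory.mars X1 MM1 ok) G F) H = mapm G (mapm F H)"
proof -
  interpret F: pm_morphism X1 MM1 S1 X2 MM2 S2 ok F by fact
  interpret G: pm_morphism X2 MM2 S2 X3 MM3 S3 ok G by fact
  let ?K = "mor_comp (Obj X1) F.C.mars G F"
  have ob: "morOb ?K a = morOb G (morOb F a)" if "a \<in> Obj X1" for a using that by (simp add: mor_comp_def)
  show map: "mapm ?K H = mapm G (mapm F H)" if "H \<in> F.C.mar" for H
  proof -
    have "map (morOb ?K) as = map (morOb G) (map (morOb F) as)" if "as \<in> lists (Obj X1)" for as
      using that by (induction as) (auto simp: ob)
    then show ?thesis
      using that F.C.mar_objs[OF that] by (simp add: mapm_def ob) (simp add: mor_comp_def F.C.mars_def)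
  qed
  show "pm_morphism X1 MM1 S1 X3 MM3 S3 ok ?K"
  proof
    show "morOb ?K \<in> extensional (Obj X1)" "\<And>as b. morMap ?K as b \<in> extensional (F.C.mars as b)"
      by (simp_all add: mor_comp_def)
    show "morOb ?K a \<in> Obj X3" if "a \<in> Obj X1" for a using that by (simp add: ob F.map_ob G.map_ob)
    show "mapm ?K (una (ida X1 a)) = una (ida X3 (morOb ?K a))" if "a \<in> Obj X1" for a
    proof -
      interpret category X1 by (rule F.C.category_X)
      show ?thesis using that by (simp add: map ob F.map_idm G.map_idm F.map_ob)
    qed
  qed (simp_all add: map F.map_mar G.map_mar F.map_msub G.map_msub)
qed

lemma pm_morphism_id:
  assumes "partial_multicategory X MM S ok"
  shows "pm_morphism X MM S X MM S ok (mor_id (Obj X) (partial_multicategory.mars X MM ok))"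
    "\<And>H. H \<in> partial_multicategory.mar X MM ok \<Longrightarrow> mapm (mor_id (Obj X) (partial_multicategory.mars X MM ok)) H = H"
proof -
  interpret C: partial_multicategory X MM S ok by fact
  interpret category X by (rule C.category_X)
  let ?K = "mor_id (Obj X) C.mars"
  have ob: "morOb ?K a = a" if "a \<in> Obj X" for a using that by (simp add: mor_id_def)
  show map: "mapm ?K H = H" if "H \<in> C.mar" for H
  proof -
    have "map (morOb ?K) as = as" if "as \<in> lists (Obj X)" for as
      using that by (induction as) (auto simp: ob)
    then show ?thesis
      using that C.mar_objs[OF that] by (simp add: mapm_def ob) (simp add: mor_id_def C.mars_def prod_eq_iff)
  qed
  show "pm_morphism X MM S X MM S ok ?K"
  proof
    show "morOb ?K \<in> extensional (Obj X)" "\<And>as b. morMap ?K as b \<in> extensional (C.mars as b)"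
      by (simp_all add: mor_id_def)
  qed (simp_all add: map ob)
qed

lemma pm_comp_id:
  assumes "pm_morphism X1 MM1 S1 X2 MM2 S2 ok F"
  shows "mor_comp (Obj X1) (partial_multicategory.mars X1 MM1 ok) (mor_id (Obj X2) (partial_multicategory.mars X2 MM2 ok)) F = F"
    "mor_comp (Obj X1) (partial_multicategory.mars X1 MM1 ok) F (mor_id (Obj X1) (partial_multicategory.mars X1 MM1 ok)) = F"
proof -
  interpret F: pm_morphism X1 MM1 S1 X2 MM2 S2 ok F by fact
  note 1 = pm_morphism_id[OF F.C.partial_multicategory_axioms]
  note 2 = pm_morphism_id[OF F.D.partial_multicategory_axioms]
  note 3 = pm_morphism_comp[OF assms 2(1)] and 4 = pm_morphism_comp[OF 1(1) assms]
  show "mor_comp (Obj X1) F.C.mars (mor_id (Obj X2) F.D.mars) F = F"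
    by (rule pm_morphism_eqI[OF 3(1) assms]) (simp add: mor_comp_def mor_id_def F.map_ob, simp add: 3(2) 2(2) F.map_mar)
  show "mor_comp (Obj X1) F.C.mars F (mor_id (Obj X1) F.C.mars) = F"
    by (rule pm_morphism_eqI[OF 4(1) assms]) (simp add: mor_comp_def mor_id_def, simp add: 4(2) 1(2))
qed

lemma pm_comp_assoc:
  assumes F: "pm_morphism X1 MM1 S1 X2 MM2 S2 ok F" and G: "pm_morphism X2 MM2 S2 X3 MM3 S3 ok G"
    and H: "pm_morphism X3 MM3 S3 X4 MM4 S4 ok H"
  shows "mor_comp (Obj X1) (partial_multicategory.mars X1 MM1 ok)
      (mor_comp (Obj X2) (partial_multicategory.mars X2 MM2 ok) H G) F
    = mor_comp (Obj X1) (partial_multicategory.mars X1 MM1 ok) H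
      (mor_comp (Obj X1) (partial_multicategory.mars X1 MM1 ok) G F)"
proof -
  interpret F: pm_morphism X1 MM1 S1 X2 MM2 S2 ok F by fact
  interpret G: pm_morphism X2 MM2 S2 X3 MM3 S3 ok G by fact
  note 1 = pm_morphism_comp[OF F G] and 2 = pm_morphism_comp[OF G H]
  note 3 = pm_morphism_comp[OF F 2(1)] and 4 = pm_morphism_comp[OF 1(1) H]
  show ?thesis
    by (rule pm_morphism_eqI[OF 3(1) 4(1)]) (simp add: mor_comp_def F.map_ob, simp add: 1 2 3 4 F.map_mar)
qed

lemma lax_of_comp:
  assumes "left_representable_pm X1 MM1 S1 ok t1" "left_representable_pm X2 MM2 S2 ok t2"
    "left_representable_pm X3 MM3 S3 ok t3"
    and F: "pm_morphism X1 MM1 S1 X2 MM2 S2 ok F" and G: "pm_morphism X2 MM2 S2 X3 MM3 S3 ok G"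
  shows "lax_of X1 X3 S3 t1 t3 (mor_comp (Obj X1) (partial_multicategory.mars X1 MM1 ok) G F)
    = lax_comp (skew_of X1 S1 t1) (skew_of X2 S2 t2) (skew_of X3 S3 t3) (lax_of X2 X3 S3 t2 t3 G) (lax_of X1 X2 S2 t1 t2 F)"
proof -
  interpret C: left_representable_pm X1 MM1 S1 ok t1 by fact
  interpret D: left_representable_pm X2 MM2 S2 ok t2 by fact
  interpret E: left_representable_pm X3 MM3 S3 ok t3 by fact
  interpret F: left_representable_morphism X1 MM1 S1 t1 X2 MM2 S2 t2 ok F
    by (intro left_representable_morphism.intro left_representable_pair.intro) fact+
  interpret G: left_representable_morphism X2 MM2 S2 t2 X3 MM3 S3 t3 ok G
    by (intro left_representable_morphism.intro left_representable_pair.intro) fact+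
  let ?K = "mor_comp (Obj X1) C.mars G F"
  note K = pm_morphism_comp[OF F G]
  interpret K: left_representable_morphism X1 MM1 S1 t1 X3 MM3 S3 t3 ok ?K
    by (intro left_representable_morphism.intro left_representable_pair.intro K(1)) fact+
  let ?L = "lax_comp C.A D.A E.A G.L F.L"
  interpret L: lax_monoidal C.A E.A ?L by (rule lax_monoidal_comp[OF F.lax_monoidal_L G.lax_monoidal_L])
  have ob: "morOb ?K a = morOb G (morOb F a)" if "a \<in> Obj X1" for a using that by (simp add: mor_comp_def)
  have obL: "fOb ?L a = morOb G (morOb F a)" if "a \<in> Obj X1" for a using that by (simp add: lax_comp_def)
  have l0: "lax0a C.A E.A ?L = cmpa X3 (mapa G.L (lax0a C.A D.A F.L)) (lax0a D.A E.A G.L)"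
    by (simp add: lax0a_def mapa_def cmpa_def lax_comp_def)
  have l2: "lax2a C.A E.A ?L a b = cmpa X3 (mapa G.L (lax2a C.A D.A F.L a b)) (lax2a D.A E.A G.L (morOb F a) (morOb F b))"
    if "a \<in> Obj X1" "b \<in> Obj X1" for a b
    using that by (simp add: lax2a_def mapa_def cmpa_def lax_comp_def)
  have "una (lax0a C.A E.A K.L) = una (lax0a C.A E.A ?L)"
  proof (rule E.uu_inj[where xs = "[]"])
    have "E.msub (una (lax0a C.A E.A ?L)) 0 E.uu = E.msub (una (mapa G.L (lax0a C.A D.A F.L))) 0 (mapm G D.uu)"
      unfolding l0 using F.L_lax0 G.L_lax0 G.mapa_arr_F by (subst E.una_cmp_msub) auto
    also have "\<dots> = mapm G (mapm F C.uu)"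
      using F.L_lax0 G.map_msub[of "una (lax0a C.A D.A F.L)" D.uu 0] by (simp add: G.una_mapa)
    finally show "E.msub (una (lax0a C.A E.A K.L)) 0 E.uu = E.msub (una (lax0a C.A E.A ?L)) 0 E.uu"
      using K.L_lax0(2) K(2)[of C.uu] by simp
  qed (use K.L_lax0(1) L.lax_arr(1) in \<open>simp_all add: ob obL\<close>)
  then have e0: "lax0 K.L = lax0 ?L" by (simp add: lax0a_def)
  have "una (lax2a C.A E.A K.L a b) = una (lax2a C.A E.A ?L a b)" if o: "a \<in> Obj X1" "b \<in> Obj X1" for a b
  proof (rule E.theta_inj[where a = "morOb ?K a" and b = "morOb ?K b" and xs = "[]"])
    have "E.msub (una (lax2a C.A E.A ?L a b)) 0 (E.th (morOb ?K a) (morOb ?K b))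
       = E.msub (una (mapa G.L (lax2a C.A D.A F.L a b))) 0 (mapm G (D.th (morOb F a) (morOb F b)))"
      unfolding l2[OF o] using o F.L_lax2 G.L_lax2 G.mapa_arr_F by (subst E.una_cmp_msub) (auto simp: F.map_ob G.map_ob ob)
    also have "\<dots> = mapm G (mapm F (C.th a b))"
      using o F.L_lax2[OF o] G.map_msub[of "una (lax2a C.A D.A F.L a b)" "D.th (morOb F a) (morOb F b)" 0]
      by (simp add: G.una_mapa F.map_ob)
    finally show "E.msub (una (lax2a C.A E.A K.L a b)) 0 (E.th (morOb ?K a) (morOb ?K b))
       = E.msub (una (lax2a C.A E.A ?L a b)) 0 (E.th (morOb ?K a) (morOb ?K b))"
      using o K.L_lax2(2)[OF o] K(2)[of "C.th a b"] by simp
  qed (use o K.L_lax2(1)[OF o] L.lax_arr(2)[of a b] in \<open>simp_all add: K.map_ob ob obL F.map_ob G.map_ob\<close>)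
  then have "lax2 K.L a b = lax2 ?L a b" if "a \<in> Obj X1" "b \<in> Obj X1" for a b
    using that by (simp only: lax2a_def una_inj prod.inject)
  moreover have "lax2 K.L a b = lax2 ?L a b" if "\<not> (a \<in> Obj X1 \<and> b \<in> Obj X1)" for a b
  proof -
    have "lax2 K.L a b = undefined" using that by (auto simp: lax_of_def)
    then show ?thesis using L.ext_lax2[of a b] that by simp
  qed
  ultimately have e2: "lax2 K.L a b = lax2 ?L a b" for a b by blast
  have "C.mars [a] b = catMaps C.A a b" for a b
    using C.una_mar[of "(a, _, b)"] by (auto simp: C.mars_def catMaps_def una_def arr_def simp del: arr_obj)
  then have em: "fMap K.L a b f = fMap ?L a b f" for a b f
    by (auto simp: mor_comp_def lax_comp_def restrict_def lax_of_def)
  show ?thesis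
    by (rule laxfun_eqI) (use e0 e2 em in \<open>auto simp: lax_of_def mor_comp_def lax_comp_def\<close>)
qed

lemma lax_of_id:
  assumes "left_representable_pm X MM S ok t"
  shows "lax_of X X S t t (mor_id (Obj X) (partial_multicategory.mars X MM ok)) = lax_id (skew_of X S t)"
proof -
  interpret C: left_representable_pm X MM S ok t by fact
  interpret X: category X by (rule C.category_X)
  let ?K = "mor_id (Obj X) C.mars"
  note K = pm_morphism_id[OF C.partial_multicategory_axioms]
  interpret K: left_representable_morphism X MM S t X MM S t ok ?K
    by (intro left_representable_morphism.intro left_representable_pair.intro K(1)) fact+
  have ob: "morOb ?K a = a" if "a \<in> Obj X" for a using that by (simp add: mor_id_def)
  have "una (lax0a C.A C.A K.L) = una (ida X (clUnit t))"
    by (rule C.uu_inj[where xs = "[]"]) (use K.L_lax0 K(2)[of C.uu] ob in simp_all)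
  then have e0: "lax0 K.L = Idm X (clUnit t)" by (simp add: lax0a_def ida_def)
  have "una (lax2a C.A C.A K.L a b) = una (ida X (clOb t a b))" if o: "a \<in> Obj X" "b \<in> Obj X" for a b
    by (rule C.theta_inj[where a = a and b = b and xs = "[]"])
      (use o K.L_lax2[OF o] K(2)[of "C.th a b"] ob in simp_all)
  then have e2: "lax2 K.L a b = Idm X (clOb t a b)" if "a \<in> Obj X" "b \<in> Obj X" for a b
    using that by (simp add: lax2a_def ida_def)
  have "C.mars [a] b = catMaps C.A a b" for a b
    using C.una_mar[of "(a, _, b)"] by (auto simp: C.mars_def catMaps_def una_def arr_def simp del: arr_obj)
  then have em: "fMap K.L a b f = fMap (lax_id C.A) a b f" for a b f
    by (auto simp: mor_id_def lax_id_def restrict_def lax_of_def)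
  have e2': "lax2 K.L a b = lax2 (lax_id C.A) a b" for a b
    using e2[of a b] by (auto simp: lax_id_def lax_of_def)
  show ?thesis
    by (rule laxfun_eqI) (use e0 e2' em in \<open>auto simp: lax_of_def mor_id_def lax_id_def\<close>)
qed

section \<open>Lists of unary maps\<close>

lemma short_ok_1 [simp]: "short_ok (Suc 0) n \<longleftrightarrow> n \<le> 4"
  by (auto simp: short_ok_simp)

lemma truncate_simps [simp]: "Obj (cat.truncate C) = Obj C" "Hom (cat.truncate C) = Hom C"
  "Idm (cat.truncate C) = Idm C" "Cmp (cat.truncate C) = Cmp C"
  by (simp_all add: cat.truncate_def)

lemma unary_cat_simps [simp]: "Obj (unary_cat M) = mObj M" "Hom (unary_cat M) a b = mHom M [a] b"
  "Idm (unary_cat M) = mIdm M" "Cmp (unary_cat M) a b c g f = mSub M [] b [] [a] c g f"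
  by (simp_all add: unary_cat_def)

text \<open>A map \<open>ps : as \<rightarrow> bs\<close> in a power of a category becomes a list of triples.\<close>

abbreviation arrows :: "'o list \<Rightarrow> 'o list \<Rightarrow> 'm list \<Rightarrow> ('o, 'm) arrow list" where
  "arrows as bs ps \<equiv> zip as (zip ps bs)"

lemma arrows_src_trg:
  assumes "ps \<in> Homs C as bs"
  shows "map src (arrows as bs ps) = as" "map trg (arrows as bs ps) = bs" "length (arrows as bs ps) = length as"
  using Homs_length[OF assms] by (simp_all add: map_zip_map flip: map_map[of fst snd, unfolded comp_def] map_map[of snd snd, unfolded comp_def])

lemma arrows_arr:
  assumes "ps \<in> Homs C as bs" "as \<in> lists (Obj C)" "bs \<in> lists (Obj C)"
  shows "set (arrows as bs ps) \<subseteq> arr C"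
proof -
  have "length as = length ps" "length bs = length ps" using Homs_length[OF assms(1)] by auto
  then show ?thesis using assms
  proof (induction ps arbitrary: as bs)
    case (Cons p ps)
    then show ?case by (cases as; cases bs) (auto simp: arr_def simp del: arr_obj)
  qed auto
qed

section \<open>Morphisms of short multicategories\<close>

lemma partial_short: "short_multicategory C \<Longrightarrow> partial_multicategory (cat.truncate C) (Mul C) (gsub C) short_ok"
  by (rule short_multicategory.partial_multicategory_short)

lemma short_mars:
  assumes "short_multicategory C"
  shows "partial_multicategory.mars (cat.truncate C) (Mul C) short_ok = shMaps C"
proof -
  interpret partial_multicategory "cat.truncate C" "Mul C" "gsub C" short_ok by (rule partial_short) fact
  show ?thesis by (intro ext) (auto simp: mars_def mar_def shMaps_def)
qed

context short_multicategory begin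

interpretation P: partial_multicategory "cat.truncate C" "Mul C" "gsub C" short_ok
  by (rule partial_multicategory_short)

lemma act_subs:
  assumes "xs \<in> lists (Obj C)" "as \<in> lists (Obj C)" "as' \<in> lists (Obj C)" "b \<in> Obj C" "ps \<in> Homs C as' as"
    "f \<in> Mul C (xs @ as) b" "length xs + length as \<le> 4"
  shows "(xs @ as', Act C (xs @ as) b (xs @ as') b (Idms C xs @ ps) (Idm C b) f, b)
    = P.subs (xs @ as, f, b) (length xs) (arrows as' as ps)"
  using assms
proof (induction as arbitrary: xs as' ps f)
  case Nil
  then have "ps = []" "as' = []" by (auto simp: Homs_def)
  then show ?case using Nil act_id[of xs b f] by simp
next
  case (Cons a as)
  have l: "length as' = Suc (length as)" "length ps = Suc (length as)" using Homs_length[OF Cons.prems(5)] by auto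
  obtain a' as1 where as': "as' = a' # as1" using l by (cases as') auto
  obtain p ps1 where ps: "ps = p # ps1" using l by (cases ps) auto
  have o: "a \<in> Obj C" "as \<in> lists (Obj C)" "a' \<in> Obj C" "as1 \<in> lists (Obj C)" "p \<in> Hom C a' a" "ps1 \<in> Homs C as1 as"
    using Cons.prems as' ps by auto
  let ?f = "pre xs a as a' b f p"
  have f: "?f \<in> Mul C ((xs @ [a']) @ as) b"
    using pre_mul[of xs as a' a b f p] o Cons.prems by simp
  have len: "length ps1 = length as" "length as1 = length as" using Homs_length[OF o(6)] by auto
  have "Act C ((xs @ [a']) @ as) b ((xs @ [a']) @ as1) b (Idms C (xs @ [a']) @ ps1) (Idm C b) ?f
     = Act C (xs @ a # as) b (xs @ a' # as1) b (Idms C xs @ p # ps1) (Idm C b) f"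
    unfolding pre_def append.assoc append.simps Idms_simps
    using Cons.prems o len
    by (subst act_cmp[symmetric]) (auto simp: Cmps_append Cmps_Idms cmp_id_right cmp_id_left idm_hom)
  moreover have "P.msub (xs @ a # as, f, b) (length xs) (una (a', p, a)) = ((xs @ [a']) @ as, ?f, b)"
    by (simp add: P.msub_def gsub_pre)
  ultimately show ?case
    using Cons.IH[of "xs @ [a']" as1 ps1 ?f] Cons.prems(1,4,7) o f by (simp add: as' ps)
qed

text \<open>
  So the action in a short multicategory is determined by substitutions with unary maps, and naturality of a
  morphism amounts to the preservation of such substitutions.
\<close>

lemma act_eq_subs:
  assumes "as \<in> lists (Obj C)" "as' \<in> lists (Obj C)" "b \<in> Obj C" "b' \<in> Obj C" "ps \<in> Homs C as' as"
    "f \<in> Mul C as b" "length as \<le> 4" "q \<in> Hom C b b'"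
  shows "(as', Act C as b as' b' ps q f, b') = P.msub (una (b, q, b')) 0 (P.subs (as, f, b) 0 (arrows as' as ps))"
proof -
  let ?g = "Act C as b as' b ps (Idm C b) f"
  have l: "length as' = length as" using Homs_length[OF assms(5)] by simp
  have g: "?g \<in> Mul C as' b" using assms by (intro act_mul) (auto simp: idm_hom)
  have "Act C as b as' b' ps q f = post as' b b' q ?g"
    unfolding post_def using assms l
    by (subst act_cmp[symmetric]) (auto simp: Cmps_Idms cmp_id_right idm_hom)
  also have "\<dots> = gsub C [] b [] as' b' q ?g" using assms g by (simp add: gsub_post)
  finally have "(as', Act C as b as' b' ps q f, b') = P.msub (una (b, q, b')) 0 (as', ?g, b)"
    by (simp add: P.msub_def una_def)
  then show ?thesis using act_subs[of "[]" as as' b ps f] assms by simp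
qed

end

lemma morMaps_simps [simp]: "morMaps F as bs [] = []"
  "morMaps F (a # as) (b # bs) (p # ps) = morMap F [a] b p # morMaps F as bs ps"
  by (auto simp: morMaps_def simp del: upt_Suc simp add: upt_conv_Cons map_Suc_upt[symmetric])

lemma morMaps_append:
  "length as = length ps \<Longrightarrow> length bs = length ps \<Longrightarrow> morMaps F (as @ as') (bs @ bs') (ps @ ps') = morMaps F as bs ps @ morMaps F as' bs' ps'"
proof (induction ps arbitrary: as bs)
  case (Cons p ps)
  then show ?case by (cases as; cases bs) auto
qed auto

lemma arrows_morMaps:
  assumes "length as = length ps" "length bs = length ps"
  shows "map (mapa (mor_unary F)) (arrows as bs ps) = arrows (map (morOb F) as) (map (morOb F) bs) (morMaps F as bs ps)"
  using assms
proof (induction ps arbitrary: as bs)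
  case (Cons p ps)
  then show ?case by (cases as; cases bs) (auto simp: mapa_def mor_unary_def)
qed auto

context short_morphism begin

lemma morMaps_Idms: "as \<in> lists (Obj C) \<Longrightarrow> morMaps F as as (Idms C as) = Idms D (map (morOb F) as)"
proof (induction as)
  case (Cons a as)
  then show ?case using functor_id[of a] by (simp add: mor_unary_def)
qed simp

lemma ob_in [simp]: "a \<in> Obj C \<Longrightarrow> morOb F a \<in> Obj D"
  using functor_obj[of a] by (simp add: mor_unary_def)

lemma obs_in [simp]: "as \<in> lists (Obj C) \<Longrightarrow> map (morOb F) as \<in> lists (Obj D)"
  by (induction as) auto

lemma map_gsub:
  assumes "short_ok (length xs + 1 + length ys) (length as)"
    "xs \<in> lists (Obj C)" "b \<in> Obj C" "ys \<in> lists (Obj C)" "as \<in> lists (Obj C)" "c \<in> Obj C"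
    "f \<in> Mul C (xs @ b # ys) c" "g \<in> Mul C as b"
  shows "morMap F (xs @ as @ ys) c (gsub C xs b ys as c f g)
    = gsub D (map (morOb F) xs) (morOb F b) (map (morOb F) ys) (map (morOb F) as) (morOb F c)
        (morMap F (xs @ b # ys) c f) (morMap F as b g)"
proof -
  have id: "morMap F [c] c (Idm C c) = Idm D (morOb F c)" if "c \<in> Obj C" for c
    using functor_id[OF that] by (simp add: mor_unary_def)
  consider a where "as = [a]" | "length as \<noteq> 1" "xs = []" "ys = []" | "length as \<noteq> 1" "xs \<noteq> [] \<or> ys \<noteq> []"
    by (cases as) auto
  then show ?thesis
  proof cases
    case 1
    have len: "length xs + length ys \<le> 3" using short_ok_bounds[OF assms(1)] by auto
    have g: "a \<in> Obj C" "g \<in> Hom C a b" using assms 1 C.mul_unary by auto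
    have m: "morMaps F (xs @ a # ys) (xs @ b # ys) (Idms C xs @ g # Idms C ys)
       = Idms D (map (morOb F) xs) @ morMap F [a] b g # Idms D (map (morOb F) ys)"
      using assms by (simp add: morMaps_append morMaps_Idms)
    show ?thesis
      unfolding 1 C.gsub_pre D.gsub_pre list.map C.pre_def D.pre_def append.simps
      using assms g len m by (subst map_natural) (auto simp: id C.idm_hom)
  next
    case 2
    have len: "length as \<le> 4" using short_ok_bounds[OF assms(1)] by auto
    have "f \<in> Hom C b c" "morMap F [b] c f \<in> Hom D (morOb F b) (morOb F c)"
      using assms 2 C.mul_unary functor_hom[of b c f] by (auto simp: mor_unary_def)
    then show ?thesis using assms 2 len map_mul[of as b g]
      by (simp add: C.gsub_post D.gsub_post C.post_def D.post_def map_natural morMaps_Idms)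
  next
    case 3
    have "(length xs + 1 + length ys, length as) \<in> sub_arities"
      using short_ok_sub[OF assms(1)] 3 by auto
    then show ?thesis using 3 map_sub[of xs ys as b c f g] assms by (simp add: C.gsub_sub D.gsub_sub)
  qed
qed

end

lemma pm_morphism_short:
  assumes "short_morphism C D F"
  shows "pm_morphism (cat.truncate C) (Mul C) (gsub C) (cat.truncate D) (Mul D) (gsub D) short_ok F"
proof -
  interpret F: short_morphism C D F by fact
  interpret P: partial_multicategory "cat.truncate C" "Mul C" "gsub C" short_ok by (rule partial_short) unfold_locales
  interpret Q: partial_multicategory "cat.truncate D" "Mul D" "gsub D" short_ok by (rule partial_short) unfold_locales
  show ?thesis
  proof
    show "morOb F \<in> extensional (Obj (cat.truncate C))" using F.ext_obj by simp
    show "morMap F as b \<in> extensional (P.mars as b)" for as b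
      using F.ext_map[of as b] short_mars[of C] F.C.short_multicategory_axioms by simp
    show "morOb F a \<in> Obj (cat.truncate D)" if "a \<in> Obj (cat.truncate C)" for a using that by simp
    show "mapm F G \<in> Q.mar" if "G \<in> P.mar" for G
      using that F.map_mul[of "src G" "trg G" "raw G"] F.obs_in[of "src G"] unfolding P.mar_def Q.mar_def
      by (auto simp: mapm_def)
    show "mapm F (una (ida (cat.truncate C) a)) = una (ida (cat.truncate D) (morOb F a))" if "a \<in> Obj (cat.truncate C)" for a
      using that F.functor_id[of a] by (simp add: mapm_def una_def ida_def mor_unary_def)
    fix G H i assume *: "G \<in> P.mar" "H \<in> P.mar" "i < length (src G)" "src G ! i = trg H"
      "short_ok (length (src G)) (length (src H))"
    obtain xs b ys where G: "src G = xs @ b # ys" "length xs = i" "xs \<in> lists (Obj C)" "b \<in> Obj C" "ys \<in> lists (Obj C)"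
      using P.mar_split[OF *(1,3)] by auto
    have b: "b = trg H" using G * by auto
    have "raw G \<in> Mul C (xs @ b # ys) (trg G)" "raw H \<in> Mul C (src H) b"
      using P.mar_objs[OF *(1)] P.mar_objs[OF *(2)] G b by auto
    then have "morMap F (xs @ src H @ ys) (trg G) (gsub C xs b ys (src H) (trg G) (raw G) (raw H))
      = gsub D (map (morOb F) xs) (morOb F b) (map (morOb F) ys) (map (morOb F) (src H)) (morOb F (trg G))
        (morMap F (xs @ b # ys) (trg G) (raw G)) (morMap F (src H) b (raw H))"
      using * G P.mar_objs[OF *(1)] P.mar_objs[OF *(2)] by (intro F.map_gsub) auto
    moreover have "P.msub G i H = (xs @ src H @ ys, gsub C xs b ys (src H) (trg G) (raw G) (raw H), trg G)"
      by (rule P.msub_eq) (use G in auto)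
    moreover have "Q.msub (mapm F G) i (mapm F H) = (map (morOb F) xs @ map (morOb F) (src H) @ map (morOb F) ys,
       gsub D (map (morOb F) xs) (morOb F b) (map (morOb F) ys) (map (morOb F) (src H)) (morOb F (trg G))
        (morMap F (xs @ b # ys) (trg G) (raw G)) (morMap F (src H) b (raw H)), morOb F (trg G))"
      using Q.msub_eq[of "mapm F G" "map (morOb F) xs" "morOb F b" "map (morOb F) ys" i "mapm F H"] G b
      by (simp add: mapm_def)
    ultimately show "mapm F (P.msub G i H) = Q.msub (mapm F G) i (mapm F H)"
      by (simp add: mapm_def)
  qed
qed

lemma short_morphism_pm:
  assumes C: "short_multicategory C" and D: "short_multicategory D"
    and F: "pm_morphism (cat.truncate C) (Mul C) (gsub C) (cat.truncate D) (Mul D) (gsub D) short_ok F"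
  shows "short_morphism C D F"
proof -
  interpret C: short_multicategory C by fact
  interpret D: short_multicategory D by fact
  interpret F: pm_morphism "cat.truncate C" "Mul C" "gsub C" "cat.truncate D" "Mul D" "gsub D" short_ok F by fact
  have fu: "is_functor C D (mor_unary F)"
    using F.is_functor_mor unfolding is_functor_def is_functor_axioms_def category_def by simp
  interpret U: is_functor C D "mor_unary F" by (rule fu)
  have mar: "(as, f, b) \<in> F.C.mar \<longleftrightarrow> as \<in> lists (Obj C) \<and> b \<in> Obj C \<and> length as \<le> 4 \<and> f \<in> Mul C as b" for as b f
    by (auto simp: F.C.mar_def)
  have mar': "(as, f, b) \<in> F.D.mar \<longleftrightarrow> as \<in> lists (Obj D) \<and> b \<in> Obj D \<and> length as \<le> 4 \<and> f \<in> Mul D as b" for as b f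
    by (auto simp: F.D.mar_def)
  have obs: "map (morOb F) as \<in> lists (Obj D)" if "as \<in> lists (Obj C)" for as
    using that F.map_ob by (induction as) auto
  have mul: "morMap F as b f \<in> Mul D (map (morOb F) as) (morOb F b)"
    if "as \<in> lists (Obj C)" "b \<in> Obj C" "length as \<le> 4" "f \<in> Mul C as b" for as b f
    using F.map_mar[of "(as, f, b)"] that mar mar' by (simp add: mapm_def)
  show ?thesis
  proof (intro short_morphism.intro C D fu short_morphism_axioms.intro)
    show "morOb F \<in> extensional (Obj C)" using F.ext_ob by simp
    show "morMap F as b \<in> extensional (shMaps C as b)" for as b
      using F.ext_map[of as b] short_mars[OF C] by simp
  next
    fix as as' b b' ps q f
    assume *: "as \<in> lists (Obj C)" "as' \<in> lists (Obj C)" "b \<in> Obj C" "b' \<in> Obj C" "length as \<le> 4"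
        "ps \<in> Homs C as' as" "q \<in> Hom C b b'" "f \<in> Mul C as b"
    let ?a = "arrows as' as ps"
    have len: "length as' = length ps" "length as = length ps" using Homs_length[OF *(6)] by auto
    note a = arrows_src_trg[OF *(6)] arrows_arr[OF *(6,2,1)]
    have a': "set ?a \<subseteq> arr (cat.truncate C)" using a(4) by (simp add: arr_def del: arr_obj)
    have q: "(b, q, b') \<in> arr (cat.truncate C)" using * by (simp add: arr_def del: arr_obj)
    have s: "F.C.subs (as, f, b) 0 ?a \<in> F.C.mar" "src (F.C.subs (as, f, b) 0 ?a) = as'"
      using F.C.subs_mar[of "(as, f, b)" "[]" ?a "[]" 0] F.C.subs_src[of "(as, f, b)" "[]" ?a "[]" 0] a a' * mar by auto
    have mp: "morMaps F as' as ps \<in> Homs D (map (morOb F) as') (map (morOb F) as)"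
      using len * U.functor_hom by (auto simp: Homs_def morMaps_def mor_unary_def in_lists_conv_set)
    have "mapm F (as', Act C as b as' b' ps q f, b') = mapm F (F.C.msub (una (b, q, b')) 0 (F.C.subs (as, f, b) 0 ?a))"
      using * by (simp add: C.act_eq_subs)
    also have "\<dots> = F.D.msub (mapm F (una (b, q, b'))) 0 (mapm F (F.C.subs (as, f, b) 0 ?a))"
      using s q len * by (intro F.map_msub) auto
    also have "mapm F (F.C.subs (as, f, b) 0 ?a) = F.D.subs (mapm F (as, f, b)) 0 (map (mapa (mor_unary F)) ?a)"
      by (rule F.map_subs[of _ "[]" _ "[]"]) (use a a' * mar in auto)
    also have "map (mapa (mor_unary F)) ?a = arrows (map (morOb F) as') (map (morOb F) as) (morMaps F as' as ps)"
      using len by (intro arrows_morMaps) auto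
    also have "F.D.msub (mapm F (una (b, q, b'))) 0 (F.D.subs (mapm F (as, f, b)) 0
          (arrows (map (morOb F) as') (map (morOb F) as) (morMaps F as' as ps)))
       = (map (morOb F) as', Act D (map (morOb F) as) (morOb F b) (map (morOb F) as') (morOb F b')
            (morMaps F as' as ps) (morMap F [b] b' q) (morMap F as b f), morOb F b')"
      using * mp obs mul[of as b f] F.map_ob U.functor_hom[of b b' q]
      by (subst D.act_eq_subs) (auto simp: mapm_def una_def mor_unary_def)
    finally show "morMap F as' b' (Act C as b as' b' ps q f)
        = Act D (map (morOb F) as) (morOb F b) (map (morOb F) as') (morOb F b')
            (morMaps F as' as ps) (morMap F [b] b' q) (morMap F as b f)"
      by (simp add: mapm_def)
  next
    fix xs b ys as c f g
    assume *: "(length xs + 1 + length ys, length as) \<in> sub_arities"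
        "xs \<in> lists (Obj C)" "b \<in> Obj C" "ys \<in> lists (Obj C)" "as \<in> lists (Obj C)" "c \<in> Obj C"
        "f \<in> Mul C (xs @ b # ys) c" "g \<in> Mul C as b"
    have n: "length as \<noteq> 1" "xs \<noteq> [] \<or> ys \<noteq> []" "length as \<le> 4" "length xs + length ys \<le> 3"
      using *(1) by (auto simp: sub_arities_def)
    have ok: "short_ok (length xs + 1 + length ys) (length as)" using *(1) by (simp add: short_ok_def)
    have "mapm F (F.C.msub (xs @ b # ys, f, c) (length xs) (as, g, b))
       = F.D.msub (mapm F (xs @ b # ys, f, c)) (length xs) (mapm F (as, g, b))"
      by (rule F.map_msub) (use * n mar ok in auto)
    moreover have "F.C.msub (xs @ b # ys, f, c) (length xs) (as, g, b) = (xs @ as @ ys, Sub C xs b ys as c f g, c)"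
      using n by (subst F.C.msub_eq) (auto simp: C.gsub_sub)
    moreover have "F.D.msub (mapm F (xs @ b # ys, f, c)) (length xs) (mapm F (as, g, b)) =
      (map (morOb F) (xs @ as @ ys), Sub D (map (morOb F) xs) (morOb F b) (map (morOb F) ys) (map (morOb F) as) (morOb F c)
            (morMap F (xs @ b # ys) c f) (morMap F as b g), morOb F c)"
      using n by (subst F.D.msub_eq[of _ "map (morOb F) xs" "morOb F b" "map (morOb F) ys"]) (auto simp: D.gsub_sub mapm_def)
    ultimately show "morMap F (xs @ as @ ys) c (Sub C xs b ys as c f g)
        = Sub D (map (morOb F) xs) (morOb F b) (map (morOb F) ys) (map (morOb F) as) (morOb F c)
            (morMap F (xs @ b # ys) c f) (morMap F as b g)"
      by (simp add: mapm_def)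
  qed (use mul in auto)
qed

section \<open>Multifunctors\<close>

lemma multi_mars:
  assumes "multicategory M"
  shows "partial_multicategory.mars (unary_cat M) (mHom M) (\<lambda>n m. True) = mMaps M"
proof -
  interpret partial_multicategory "unary_cat M" "mHom M" "mSub M" "\<lambda>n m. True"
    by (rule partial_multicategory_multi) fact
  show ?thesis by (intro ext) (auto simp: mars_def mar_def mMaps_def)
qed

lemma pm_morphism_multifunctor:
  "multifunctor M N F \<longleftrightarrow> multicategory M \<and> multicategory N \<and>
     pm_morphism (unary_cat M) (mHom M) (mSub M) (unary_cat N) (mHom N) (mSub N) (\<lambda>n m. True) F"
  (is "?l \<longleftrightarrow> ?M \<and> ?N \<and> ?r")
proof (intro iffI conjI; (elim conjE)?)
  assume ?l
  then interpret F: multifunctor M N F .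
  show ?M ?N by unfold_locales
  interpret P: partial_multicategory "unary_cat M" "mHom M" "mSub M" "\<lambda>n m. True"
    by (rule partial_multicategory_multi) unfold_locales
  interpret Q: partial_multicategory "unary_cat N" "mHom N" "mSub N" "\<lambda>n m. True"
    by (rule partial_multicategory_multi) unfold_locales
  have obs: "map (morOb F) as \<in> lists (mObj N)" if "as \<in> lists (mObj M)" for as
    using that F.map_obj by (induction as) auto
  show ?r
  proof
    show "morOb F \<in> extensional (Obj (unary_cat M))" using F.ext_obj by simp
    show "morMap F as b \<in> extensional (P.mars as b)" for as b
      using F.ext_map[of as b] multi_mars[OF \<open>?M\<close>] by simp
    show "morOb F a \<in> Obj (unary_cat N)" if "a \<in> Obj (unary_cat M)" for a using that F.map_obj by simp
    show "mapm F G \<in> Q.mar" if "G \<in> P.mar" for G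
      using that F.map_hom[of "src G" "trg G" "raw G"] obs[of "src G"] F.map_obj[of "trg G"] unfolding P.mar_def Q.mar_def
      by (auto simp: mapm_def)
    show "mapm F (una (ida (unary_cat M) a)) = una (ida (unary_cat N) (morOb F a))" if "a \<in> Obj (unary_cat M)" for a
      using that F.map_id[of a] by (simp add: mapm_def una_def ida_def)
    fix G H i assume *: "G \<in> P.mar" "H \<in> P.mar" "i < length (src G)" "src G ! i = trg H"
    obtain xs b ys where G: "src G = xs @ b # ys" "length xs = i" "xs \<in> lists (mObj M)" "b \<in> mObj M" "ys \<in> lists (mObj M)"
      using P.mar_split[OF *(1,3)] by auto
    have b: "b = trg H" using G * by auto
    have "raw G \<in> mHom M (xs @ b # ys) (trg G)" "raw H \<in> mHom M (src H) b"
      using P.mar_objs[OF *(1)] P.mar_objs[OF *(2)] G b by auto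
    then have "morMap F (xs @ src H @ ys) (trg G) (mSub M xs b ys (src H) (trg G) (raw G) (raw H))
      = mSub N (map (morOb F) xs) (morOb F b) (map (morOb F) ys) (map (morOb F) (src H)) (morOb F (trg G))
        (morMap F (xs @ b # ys) (trg G) (raw G)) (morMap F (src H) b (raw H))"
      using * G P.mar_objs[OF *(1)] P.mar_objs[OF *(2)] by (intro F.map_sub) auto
    moreover have "P.msub G i H = (xs @ src H @ ys, mSub M xs b ys (src H) (trg G) (raw G) (raw H), trg G)"
      by (rule P.msub_eq) (use G in auto)
    moreover have "Q.msub (mapm F G) i (mapm F H) = (map (morOb F) xs @ map (morOb F) (src H) @ map (morOb F) ys,
       mSub N (map (morOb F) xs) (morOb F b) (map (morOb F) ys) (map (morOb F) (src H)) (morOb F (trg G))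
        (morMap F (xs @ b # ys) (trg G) (raw G)) (morMap F (src H) b (raw H)), morOb F (trg G))"
      using Q.msub_eq[of "mapm F G" "map (morOb F) xs" "morOb F b" "map (morOb F) ys" i "mapm F H"] G b
      by (simp add: mapm_def)
    ultimately show "mapm F (P.msub G i H) = Q.msub (mapm F G) i (mapm F H)"
      by (simp add: mapm_def)
  qed
next
  assume M: ?M and N: ?N and ?r
  then interpret F: pm_morphism "unary_cat M" "mHom M" "mSub M" "unary_cat N" "mHom N" "mSub N" "\<lambda>n m. True" F by simp
  show ?l
  proof (intro multifunctor.intro M N multifunctor_axioms.intro)
    show "morOb F \<in> extensional (mObj M)" using F.ext_ob by simp
    show "morMap F as b \<in> extensional (mMaps M as b)" for as b
      using F.ext_map[of as b] multi_mars[OF M] by simp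
    show "morOb F a \<in> mObj N" if "a \<in> mObj M" for a using F.map_ob that by simp
    show "morMap F as b f \<in> mHom N (map (morOb F) as) (morOb F b)"
      if "as \<in> lists (mObj M)" "b \<in> mObj M" "f \<in> mHom M as b" for as b f
      using F.map_mar[of "(as, f, b)"] that by (simp add: mapm_def F.C.mar_def F.D.mar_def)
    show "morMap F [a] a (mIdm M a) = mIdm N (morOb F a)" if "a \<in> mObj M" for a
      using F.map_idm[of a] that by (simp add: mapm_def una_def ida_def)
    fix xs b ys as c f g
    assume *: "xs \<in> lists (mObj M)" "b \<in> mObj M" "ys \<in> lists (mObj M)" "as \<in> lists (mObj M)" "c \<in> mObj M"
        "f \<in> mHom M (xs @ b # ys) c" "g \<in> mHom M as b"
    have "mapm F (F.C.msub (xs @ b # ys, f, c) (length xs) (as, g, b))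
       = F.D.msub (mapm F (xs @ b # ys, f, c)) (length xs) (mapm F (as, g, b))"
      by (rule F.map_msub) (use * in \<open>auto simp: F.C.mar_def\<close>)
    moreover have "F.C.msub (xs @ b # ys, f, c) (length xs) (as, g, b) = (xs @ as @ ys, mSub M xs b ys as c f g, c)"
      by (subst F.C.msub_eq) auto
    moreover have "F.D.msub (mapm F (xs @ b # ys, f, c)) (length xs) (mapm F (as, g, b)) =
      (map (morOb F) (xs @ as @ ys), mSub N (map (morOb F) xs) (morOb F b) (map (morOb F) ys) (map (morOb F) as) (morOb F c)
            (morMap F (xs @ b # ys) c f) (morMap F as b g), morOb F c)"
      by (subst F.D.msub_eq[of _ "map (morOb F) xs" "morOb F b" "map (morOb F) ys"]) (auto simp: mapm_def)
    ultimately show "morMap F (xs @ as @ ys) c (mSub M xs b ys as c f g)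
        = mSub N (map (morOb F) xs) (morOb F b) (map (morOb F) ys) (map (morOb F) as) (morOb F c)
            (morMap F (xs @ b # ys) c f) (morMap F as b g)"
      by (simp add: mapm_def)
  qed
qed

section \<open>The categories of short multicategories and of multicategories\<close>

lemma category_ShMulti: "category ShMulti"
proof
  fix C :: "('o, 'm) shmulti" assume "C \<in> Obj ShMulti"
  then have C: "short_multicategory C" by (simp add: ShMulti_def)
  show "Idm ShMulti C \<in> Hom ShMulti C C"
    using short_morphism_pm[OF C C] pm_morphism_id(1)[OF partial_short[OF C]] short_mars[OF C] by (simp add: ShMulti_def)
next
  fix C D E :: "('o, 'm) shmulti" and F G
  assume "C \<in> Obj ShMulti" "D \<in> Obj ShMulti" "E \<in> Obj ShMulti" "F \<in> Hom ShMulti C D" "G \<in> Hom ShMulti D E"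
  then have C: "short_multicategory C" "short_multicategory E" and F: "short_morphism C D F" "short_morphism D E G"
    by (simp_all add: ShMulti_def)
  show "Cmp ShMulti C D E G F \<in> Hom ShMulti C E"
    using short_morphism_pm[OF C pm_morphism_comp(1)[OF F[THEN pm_morphism_short], unfolded truncate_simps short_mars[OF C(1)]]]
    by (simp add: ShMulti_def)
next
  fix C D :: "('o, 'm) shmulti" and F
  assume "C \<in> Obj ShMulti" "D \<in> Obj ShMulti" "F \<in> Hom ShMulti C D"
  then have C: "short_multicategory C" "short_multicategory D" and F: "short_morphism C D F"
    by (simp_all add: ShMulti_def)
  show "Cmp ShMulti C D D (Idm ShMulti D) F = F" "Cmp ShMulti C C D F (Idm ShMulti C) = F"
    using pm_comp_id[OF pm_morphism_short[OF F]] by (simp_all add: ShMulti_def short_mars C)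
next
  fix C D E K :: "('o, 'm) shmulti" and F G H
  assume "C \<in> Obj ShMulti" "D \<in> Obj ShMulti" "F \<in> Hom ShMulti C D" "G \<in> Hom ShMulti D E" "H \<in> Hom ShMulti E K"
  then have C: "short_multicategory C" "short_multicategory D"
    and F: "short_morphism C D F" and G: "short_morphism D E G" and H: "short_morphism E K H"
    by (simp_all add: ShMulti_def)
  show "Cmp ShMulti C D K (Cmp ShMulti D E K H G) F = Cmp ShMulti C E K H (Cmp ShMulti C D E G F)"
    using pm_comp_assoc[OF pm_morphism_short[OF F] pm_morphism_short[OF G] pm_morphism_short[OF H]]
    by (simp add: ShMulti_def short_mars C)
qed

lemma category_Multi: "category Multi"
proof
  fix C :: "('o, 'm) multi" assume "C \<in> Obj Multi"
  then have C: "multicategory C" by (simp add: Multi_def)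
  show "Idm Multi C \<in> Hom Multi C C"
    using pm_morphism_id(1)[OF partial_multicategory_multi[OF C]] C multi_mars[OF C]
    by (simp add: Multi_def pm_morphism_multifunctor)
next
  fix C D E :: "('o, 'm) multi" and F G
  assume "C \<in> Obj Multi" "D \<in> Obj Multi" "E \<in> Obj Multi" "F \<in> Hom Multi C D" "G \<in> Hom Multi D E"
  then have C: "multicategory C" "multicategory E" and F:
    "pm_morphism (unary_cat C) (mHom C) (mSub C) (unary_cat D) (mHom D) (mSub D) (\<lambda>n m. True) F"
    "pm_morphism (unary_cat D) (mHom D) (mSub D) (unary_cat E) (mHom E) (mSub E) (\<lambda>n m. True) G"
    by (simp_all add: Multi_def pm_morphism_multifunctor)
  show "Cmp Multi C D E G F \<in> Hom Multi C E"
    using pm_morphism_comp(1)[OF F] C multi_mars[OF C(1)]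
    by (simp add: Multi_def pm_morphism_multifunctor)
next
  fix C D :: "('o, 'm) multi" and F
  assume "C \<in> Obj Multi" "D \<in> Obj Multi" "F \<in> Hom Multi C D"
  then have C: "multicategory C" "multicategory D" and F:
    "pm_morphism (unary_cat C) (mHom C) (mSub C) (unary_cat D) (mHom D) (mSub D) (\<lambda>n m. True) F"
    by (simp_all add: Multi_def pm_morphism_multifunctor)
  show "Cmp Multi C D D (Idm Multi D) F = F" "Cmp Multi C C D F (Idm Multi C) = F"
    using pm_comp_id[OF F] by (simp_all add: Multi_def multi_mars C)
next
  fix C D E K :: "('o, 'm) multi" and F G H
  assume "C \<in> Obj Multi" "D \<in> Obj Multi" "F \<in> Hom Multi C D" "G \<in> Hom Multi D E" "H \<in> Hom Multi E K"
  then have C: "multicategory C" "multicategory D"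
    and F: "pm_morphism (unary_cat C) (mHom C) (mSub C) (unary_cat D) (mHom D) (mSub D) (\<lambda>n m. True) F"
    "pm_morphism (unary_cat D) (mHom D) (mSub D) (unary_cat E) (mHom E) (mSub E) (\<lambda>n m. True) G"
    "pm_morphism (unary_cat E) (mHom E) (mSub E) (unary_cat K) (mHom K) (mSub K) (\<lambda>n m. True) H"
    by (simp_all add: Multi_def pm_morphism_multifunctor)
  show "Cmp Multi C D K (Cmp Multi D E K H G) F = Cmp Multi C E K H (Cmp Multi C D E G F)"
    using pm_comp_assoc[OF F] by (simp add: Multi_def multi_mars C)
qed

section \<open>The short multicategory of a multicategory\<close>

context multicategory begin

interpretation P: partial_multicategory "unary_cat M" "mHom M" "mSub M" "\<lambda>n m. True"
  by (rule partial_multicategory_multi) unfold_locales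

interpretation X: category "unary_cat M" by (rule P.category_X)

lemma mar_iff: "(as, f, b) \<in> P.mar \<longleftrightarrow> as \<in> lists (mObj M) \<and> b \<in> mObj M \<and> f \<in> mHom M as b"
  by (auto simp: P.mar_def)

lemma una_arr: "(a, f, b) \<in> arr (unary_cat M) \<longleftrightarrow> a \<in> mObj M \<and> b \<in> mObj M \<and> f \<in> mHom M [a] b"
  by (simp add: arr_def del: arr_obj)

lemma subs_append: "P.subs F i (ps @ qs) = P.subs (P.subs F i ps) (i + length ps) qs"
  by (induction ps arbitrary: F i) auto

lemma subs_ids:
  assumes "F \<in> P.mar" "src F = xs @ as @ ys" "i = length xs" "as \<in> lists (mObj M)"
  shows "P.subs F i (map (ida (unary_cat M)) as) = F"
  using assms
proof (induction as arbitrary: i xs)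
  case (Cons a as)
  then show ?case using Cons.IH[of "xs @ [a]" "Suc i"] P.id_right[of F i a] by (simp add: nth_append)
qed simp

lemma arrows_Idms: "arrows as as (Idms (unary_cat M) as) = map (ida (unary_cat M)) as"
  by (induction as) (auto simp: ida_def)

text \<open>
  Substitution of consecutive unary maps commutes with the substitution of a multimap at an earlier
  position, at a later one, and inside another multimap.
\<close>

lemma subs_msub_before:
  assumes "F \<in> P.mar" "G \<in> P.mar" "k < i" "src F = xs @ map trg ps @ zs" "length xs = i" "src F ! k = trg G"
    "set ps \<subseteq> arr (unary_cat M)"
  shows "P.msub (P.subs F i ps) k G = P.subs (P.msub F k G) (i + length (src G) - 1) ps"
  using assms
proof (induction ps arbitrary: F i xs)
  case (Cons p ps)
  have p: "una p \<in> P.mar" "P.msub F i (una p) \<in> P.mar" using Cons.prems by (auto intro!: P.msub_mar)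
  have s: "src (P.msub F i (una p)) = (xs @ [src p]) @ map trg ps @ zs" using Cons.prems by (simp add: P.msub_eq)
  have k: "src (P.msub F i (una p)) ! k = trg G" using Cons.prems(3-6) unfolding s by (simp add: nth_append)
  have "P.msub (P.subs F i (p # ps)) k G = P.subs (P.msub (P.msub F i (una p)) k G) (Suc i + length (src G) - 1) ps"
    using Cons.IH[OF p(2) Cons.prems(2) _ s, of "Suc i"] k Cons.prems by simp
  also have "P.msub (P.msub F i (una p)) k G = P.msub (P.msub F k G) (i + length (src G) - 1) (una p)"
    using P.parallel[of F G "una p" k i] p Cons.prems by (simp add: nth_append)
  also have "Suc i + length (src G) - 1 = Suc (i + length (src G) - 1)" using Cons.prems(3) by simp
  finally show ?case by simp
qed simp

lemma subs_msub_after: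
  assumes "F \<in> P.mar" "G \<in> P.mar" "i + length ps \<le> k" "src F = xs @ map trg ps @ zs" "length xs = i"
    "k < length (src F)" "src F ! k = trg G" "set ps \<subseteq> arr (unary_cat M)"
  shows "P.msub (P.subs F i ps) k G = P.subs (P.msub F k G) i ps"
  using assms
proof (induction ps arbitrary: F i xs)
  case (Cons p ps)
  have p: "una p \<in> P.mar" "P.msub F i (una p) \<in> P.mar" using Cons.prems by (auto intro!: P.msub_mar)
  have s: "src (P.msub F i (una p)) = (xs @ [src p]) @ map trg ps @ zs" using Cons.prems by (simp add: P.msub_eq)
  have k: "src (P.msub F i (una p)) ! k = trg G" using Cons.prems(3-7) unfolding s by (simp add: nth_append nth_Cons')
  have l: "length (src (P.msub F i (una p))) = length (src F)" unfolding s Cons.prems(4) by simp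
  have "P.msub (P.subs F i (p # ps)) k G = P.subs (P.msub (P.msub F i (una p)) k G) (Suc i) ps"
    using Cons.IH[OF p(2) Cons.prems(2) _ s, of "Suc i"] k l Cons.prems by simp
  also have "P.msub (P.msub F i (una p)) k G = P.msub (P.msub F k G) i (una p)"
    using P.parallel[of F "una p" G i k] p Cons.prems by (simp add: nth_append)
  finally show ?case by simp
qed simp

lemma subs_msub_inside:
  assumes "F \<in> P.mar" "G \<in> P.mar" "k < length (src F)" "src F ! k = trg G" "src G = xs @ map trg ps @ zs"
    "length xs = i" "set ps \<subseteq> arr (unary_cat M)"
  shows "P.msub F k (P.subs G i ps) = P.subs (P.msub F k G) (k + i) ps"
  using assms
proof (induction ps arbitrary: G i xs)
  case (Cons p ps)
  have p: "una p \<in> P.mar" "P.msub G i (una p) \<in> P.mar" using Cons.prems by (auto intro!: P.msub_mar)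
  have s: "src (P.msub G i (una p)) = (xs @ [src p]) @ map trg ps @ zs" using Cons.prems by (simp add: P.msub_eq)
  have "P.msub F k (P.msub G i (una p)) = P.msub (P.msub F k G) (k + i) (una p)"
    using P.nested[of F G "una p" k i] p Cons.prems by (simp add: nth_append)
  then show ?case
    using Cons.IH[OF Cons.prems(1) p(2) Cons.prems(3) _ s, of "Suc i"] Cons.prems by simp
qed simp

lemma subs_cmp:
  assumes "F \<in> P.mar" "src F = xs @ map trg ps @ zs" "length xs = i" "map src ps = map trg qs"
    "set ps \<subseteq> arr (unary_cat M)" "set qs \<subseteq> arr (unary_cat M)"
  shows "P.subs (P.subs F i ps) i qs = P.subs F i (map2 (cmpa (unary_cat M)) ps qs)"
  using assms
proof (induction ps arbitrary: F i xs qs)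
  case (Cons p ps)
  obtain q qs1 where qs: "qs = q # qs1" "trg q = src p" "map src ps = map trg qs1" using Cons.prems(4) by (cases qs) auto
  have p: "una p \<in> P.mar" "una q \<in> P.mar" "P.msub F i (una p) \<in> P.mar" using Cons.prems qs by (auto intro!: P.msub_mar)
  have s: "src (P.msub F i (una p)) = (xs @ [src p]) @ map trg ps @ zs" using Cons.prems by (simp add: P.msub_eq)
  have pq: "P.msub (P.msub F i (una p)) i (una q) = P.msub F i (una (cmpa (unary_cat M) p q))"
    using P.nested[of F "una p" "una q" i 0] p qs Cons.prems by (simp add: P.una_cmp nth_append)
  have m: "P.msub F i (una (cmpa (unary_cat M) p q)) \<in> P.mar" using Cons.prems qs by (auto intro!: P.msub_mar)
  have "P.subs (P.subs F i (p # ps)) i qs = P.subs (P.msub (P.subs (P.msub F i (una p)) (Suc i) ps) i (una q)) (Suc i) qs1"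
    by (simp add: qs)
  also have "P.msub (P.subs (P.msub F i (una p)) (Suc i) ps) i (una q) = P.subs (P.msub F i (una (cmpa (unary_cat M) p q))) (Suc i) ps"
    using subs_msub_before[OF p(3,2) _ s, of i "Suc i"] Cons.prems qs s by (simp add: pq nth_append)
  also have "P.subs \<dots> (Suc i) qs1 = P.subs (P.msub F i (una (cmpa (unary_cat M) p q))) (Suc i) (map2 (cmpa (unary_cat M)) ps qs1)"
    by (rule Cons.IH[OF m, of "xs @ [src q]"]) (use Cons.prems qs in \<open>auto simp: P.msub_eq\<close>)
  finally show ?case by (simp add: qs)
qed simp

lemma sub_unaries_subs:
  assumes "xs \<in> lists (mObj M)" "as \<in> lists (mObj M)" "as' \<in> lists (mObj M)" "ps \<in> Homs (unary_cat M) as' as"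
  shows "(xs @ as', sub_unaries M xs as as' ps c f, c) = P.subs (xs @ as, f, c) (length xs) (arrows as' as ps)"
  using assms
proof (induction as arbitrary: xs as' ps f)
  case Nil
  then have "ps = []" "as' = []" by (auto simp: Homs_def)
  then show ?case by simp
next
  case (Cons a as)
  have l: "length as' = Suc (length as)" "length ps = Suc (length as)" using Homs_length[OF Cons.prems(4)] by auto
  obtain a' as1 where as': "as' = a' # as1" using l by (cases as') auto
  obtain p ps1 where ps: "ps = p # ps1" using l by (cases ps) auto
  have "P.msub (xs @ a # as, f, c) (length xs) (una (a', p, a)) = ((xs @ [a']) @ as, mSub M xs a as [a'] c f p, c)"
    by (simp add: P.msub_def)
  then show ?case
    using Cons.IH[of "xs @ [a']" as1 ps1 "mSub M xs a as [a'] c f p"] Cons.prems by (simp add: as' ps)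
qed

lemma U_simps [simp]: "Obj (U_ob M) = mObj M" "Hom (U_ob M) a b = mHom M [a] b" "Idm (U_ob M) = mIdm M"
  "Cmp (U_ob M) a b c g f = mSub M [] b [] [a] c g f"
  "Mul (U_ob M) as b = (if length as \<le> 4 then mHom M as b else {})"
  by (simp_all add: U_ob_def)

lemma U_Homs: "Homs (U_ob M) = Homs (unary_cat M)" "Idms (U_ob M) = Idms (unary_cat M)" "Cmps (U_ob M) = Cmps (unary_cat M)"
  by (auto simp: Homs_def Idms_def Cmps_def fun_eq_iff)

lemma U_Act:
  assumes "length as \<le> 4" "as \<in> lists (mObj M)" "as' \<in> lists (mObj M)" "ps \<in> Homs (unary_cat M) as' as"
  shows "(as', Act (U_ob M) as b as' b' ps q f, b') = P.msub (una (b, q, b')) 0 (P.subs (as, f, b) 0 (arrows as' as ps))"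
proof -
  have "P.subs (as, f, b) 0 (arrows as' as ps) = (as', sub_unaries M [] as as' ps b f, b)"
    using sub_unaries_subs[of "[]" as as' ps b f] assms by simp
  then show ?thesis using assms(1) by (simp add: P.msub_def una_def U_ob_def)
qed

lemma U_Act_pre:
  assumes "xs \<in> lists (mObj M)" "ys \<in> lists (mObj M)" "a \<in> mObj M" "b \<in> mObj M" "c \<in> mObj M"
    "length xs + length ys \<le> 3" "f \<in> mHom M (xs @ b # ys) c" "p \<in> mHom M [a] b"
  shows "(xs @ a # ys, Act (U_ob M) (xs @ b # ys) c (xs @ a # ys) c (Idms (U_ob M) xs @ p # Idms (U_ob M) ys) (mIdm M c) f, c)
    = P.msub (xs @ b # ys, f, c) (length xs) (una (a, p, b))"
proof -
  have F: "(xs @ b # ys, f, c) \<in> P.mar" using assms by (simp add: mar_iff)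
  have p: "una (a, p, b) \<in> P.mar" using assms by (simp add: una_arr)
  have idh: "Idms (unary_cat M) as \<in> Homs (unary_cat M) as as" if "as \<in> lists (mObj M)" for as
    using that by (induction as) (auto simp: id_hom)
  have h: "Idms (unary_cat M) xs @ p # Idms (unary_cat M) ys \<in> Homs (unary_cat M) (xs @ a # ys) (xs @ b # ys)"
    using assms idh by (intro Homs_append) auto
  have "P.subs (xs @ b # ys, f, c) 0 (map (ida (unary_cat M)) xs @ (a, p, b) # map (ida (unary_cat M)) ys)
     = P.msub (xs @ b # ys, f, c) (length xs) (una (a, p, b))"
  proof -
    let ?G = "P.msub (xs @ b # ys, f, c) (length xs) (una (a, p, b))"
    have "P.subs (xs @ b # ys, f, c) 0 (map (ida (unary_cat M)) xs) = (xs @ b # ys, f, c)"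
      by (rule subs_ids[OF F, of "[]"]) (use assms in auto)
    moreover have "?G \<in> P.mar" using F p by (intro P.msub_mar) auto
    then have "P.subs ?G (Suc (length xs)) (map (ida (unary_cat M)) ys) = ?G"
      by (rule subs_ids[where xs = "xs @ [a]" and ys = "[]"]) (use assms in auto)
    ultimately show ?thesis by (simp only: subs_append P.subs.simps length_map add_0)
  qed
  moreover have "una (c, mIdm M c, c) = una (ida (unary_cat M) c)" by (simp add: ida_def)
  moreover have "P.msub (xs @ b # ys, f, c) (length xs) (una (a, p, b)) \<in> P.mar"
    using F p by (intro P.msub_mar) auto
  ultimately show ?thesis
    using U_Act[OF _ _ _ h, of c c "mIdm M c" f] F p assms by (simp add: U_Homs arrows_Idms)
qed

lemma U_Act_post:
  assumes "as \<in> lists (mObj M)" "b \<in> mObj M" "c \<in> mObj M" "length as \<le> 4" "g \<in> mHom M as b"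
  shows "(as, Act (U_ob M) as b as c (Idms (U_ob M) as) f g, c) = P.msub (una (b, f, c)) 0 (as, g, b)"
proof -
  have G: "(as, g, b) \<in> P.mar" using assms by (simp add: mar_iff)
  have h: "Idms (unary_cat M) as \<in> Homs (unary_cat M) as as"
    using assms(1) by (induction as) (auto simp: id_hom)
  show ?thesis using U_Act[OF assms(4,1,1) h] subs_ids[OF G, of "[]" as "[]" 0] assms by (simp add: U_Homs arrows_Idms)
qed

lemma U_gsub:
  assumes "short_ok (length xs + 1 + length ys) (length as)"
    "xs \<in> lists (mObj M)" "b \<in> mObj M" "ys \<in> lists (mObj M)" "as \<in> lists (mObj M)" "c \<in> mObj M"
    "f \<in> mHom M (xs @ b # ys) c" "g \<in> mHom M as b"
  shows "gsub (U_ob M) xs b ys as c f g = mSub M xs b ys as c f g"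
proof -
  consider a where "as = [a]" | "length as \<noteq> 1" "xs = []" "ys = []" | "length as \<noteq> 1" "xs \<noteq> [] \<or> ys \<noteq> []"
    by (cases as) auto
  then show ?thesis
  proof cases
    case 1
    have "length xs + length ys \<le> 3" using short_ok_bounds[OF assms(1)] by auto
    then show ?thesis
      using U_Act_pre[of xs ys a b c f g] assms unfolding 1 gsub_def by (simp add: P.msub_def una_def)
  next
    case 2
    have "length as \<le> 4" using short_ok_bounds[OF assms(1)] by auto
    then show ?thesis
      using U_Act_post[of as b c g f] assms 2 unfolding gsub_def by (simp add: P.msub_def una_def)
  next
    case 3
    then have "(length xs + 1 + length ys, length as) \<in> sub_arities"
      using short_ok_sub[OF assms(1)] by auto
    then show ?thesis using 3 unfolding gsub_def by (auto simp: U_ob_def)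
  qed
qed

lemma arrows_Cmps:
  assumes "ps \<in> Homs (unary_cat M) as' as" "ps' \<in> Homs (unary_cat M) as'' as'"
  shows "arrows as'' as (Cmps (unary_cat M) as'' as' as ps ps') = map2 (cmpa (unary_cat M)) (arrows as' as ps) (arrows as'' as' ps')"
proof -
  have "length as = length ps" "length as' = length ps" "length as'' = length ps" "length ps' = length ps"
    using Homs_length[OF assms(1)] Homs_length[OF assms(2)] by simp_all
  then show ?thesis
  proof (induction ps arbitrary: as as' as'' ps')
    case (Cons p ps)
    then show ?case by (cases as; cases as'; cases as''; cases ps') (auto simp: cmpa_def)
  qed simp
qed

lemma subs_post:
  assumes "F \<in> P.mar" "una q \<in> P.mar" "src q = trg F" "src F = map trg ps" "set ps \<subseteq> arr (unary_cat M)"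
  shows "P.subs (P.msub (una q) 0 F) 0 ps = P.msub (una q) 0 (P.subs F 0 ps)"
  using subs_msub_inside[of "una q" F 0 "[]" ps "[]" 0] assms by simp

text \<open>
  With the actions written as sequences of substitutions, functoriality, naturality and dinaturality
  become instances of the associativity laws of the multicategory.
\<close>

lemma short_U: "short_multicategory (U_ob M)"
proof (intro short_multicategory.intro short_multicategory_axioms.intro, unfold U_simps U_Homs)
  show "category (U_ob M)"
    using P.category_X unfolding category_def by simp
  show "(if length [a] \<le> 4 then mHom M [a] b else {}) = mHom M [a] b" for a b by simp
  show "Act (U_ob M) [a] b [a'] b' [p] q f = mSub M [] b [] [a'] b' q (mSub M [] a [] [a'] b f p)"
    for a a' b b' p q f by (simp add: U_ob_def)
next
  fix as as' b b' ps q f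
  assume "as \<in> lists (mObj M)" "as' \<in> lists (mObj M)" "b \<in> mObj M" "b' \<in> mObj M" "length as \<le> 4"
    "ps \<in> Homs (unary_cat M) as' as" "q \<in> mHom M [b] b'" "f \<in> (if length as \<le> 4 then mHom M as b else {})"
  note a = this arrows_src_trg[OF this(6)] arrows_arr[OF this(6)]
  have F: "(as, f, b) \<in> P.mar" "una (b, q, b') \<in> P.mar" using a by (simp_all add: mar_iff una_arr)
  have s: "P.subs (as, f, b) 0 (arrows as' as ps) \<in> P.mar" "src (P.subs (as, f, b) 0 (arrows as' as ps)) = as'"
    using P.subs_mar[OF F(1), of "[]" "arrows as' as ps" "[]"] P.subs_src[of "(as, f, b)" "[]" "arrows as' as ps" "[]" 0] a by auto
  have "(as', Act (U_ob M) as b as' b' ps q f, b') \<in> P.mar"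
    unfolding U_Act[OF a(5,1,2,6)] using F s by (intro P.msub_mar) auto
  then show "Act (U_ob M) as b as' b' ps q f \<in> (if length as' \<le> 4 then mHom M as' b' else {})"
    using a Homs_length[OF a(6)] by (simp add: mar_iff)
next
  fix as b f
  assume *: "as \<in> lists (mObj M)" "b \<in> mObj M" "length as \<le> 4" "f \<in> (if length as \<le> 4 then mHom M as b else {})"
  then have "(as, f, b) \<in> P.mar" by (simp add: mar_iff)
  then show "Act (U_ob M) as b as b (Idms (unary_cat M) as) (mIdm M b) f = f"
    using U_Act_post[of as b b f "mIdm M b"] P.id_left[of "(as, f, b)" b] * by (simp add: U_Homs ida_def)
next
  fix as as' as'' b b' b'' ps ps' q q' f
  assume "as \<in> lists (mObj M)" "as' \<in> lists (mObj M)" "as'' \<in> lists (mObj M)" "b \<in> mObj M" "b' \<in> mObj M" "b'' \<in> mObj M"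
    "length as \<le> 4" "ps \<in> Homs (unary_cat M) as' as" "ps' \<in> Homs (unary_cat M) as'' as'" "q \<in> mHom M [b] b'"
    "q' \<in> mHom M [b'] b''" "f \<in> (if length as \<le> 4 then mHom M as b else {})"
  note a = this
  let ?p = "arrows as' as ps" and ?p' = "arrows as'' as' ps'"
  note p = arrows_src_trg[OF a(8)] arrows_arr[OF a(8)] and p' = arrows_src_trg[OF a(9)] arrows_arr[OF a(9)]
  have F: "(as, f, b) \<in> P.mar" "una (b, q, b') \<in> P.mar" "una (b', q', b'') \<in> P.mar"
    "(b, q, b') \<in> arr (unary_cat M)" "(b', q', b'') \<in> arr (unary_cat M)" using a by (simp_all add: mar_iff una_arr)
  have s: "P.subs (as, f, b) 0 ?p \<in> P.mar" "src (P.subs (as, f, b) 0 ?p) = as'"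
    using P.subs_mar[OF F(1), of "[]" ?p "[]"] P.subs_src[of "(as, f, b)" "[]" ?p "[]" 0] a p by auto
  have s': "P.subs (P.subs (as, f, b) 0 ?p) 0 ?p' \<in> P.mar"
    using P.subs_mar[OF s(1), of "[]" ?p' "[]"] s a p' by auto
  have l: "length as' = length as" using Homs_length[OF a(8)] by simp
  have c: "Cmps (unary_cat M) as'' as' as ps ps' \<in> Homs (unary_cat M) as'' as"
    using a(1-3,8,9) X.cmp_hom by (auto simp: Homs_def Cmps_def in_lists_conv_set)
  have "(as'', Act (U_ob M) as' b' as'' b'' ps' q' (Act (U_ob M) as b as' b' ps q f), b'')
     = P.msub (una (b', q', b'')) 0 (P.subs (P.msub (una (b, q, b')) 0 (P.subs (as, f, b) 0 ?p)) 0 ?p')"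
    using U_Act[of as' as'' ps' b' b'' q'] U_Act[of as as' ps b b' q f] a l by simp
  also have "\<dots> = P.msub (una (b', q', b'')) 0 (P.msub (una (b, q, b')) 0 (P.subs (P.subs (as, f, b) 0 ?p) 0 ?p'))"
    using subs_post[OF s(1) F(2), of ?p'] s(2) p' a by simp
  also have "\<dots> = P.msub (una (cmpa (unary_cat M) (b', q', b'') (b, q, b'))) 0 (P.subs (P.subs (as, f, b) 0 ?p) 0 ?p')"
    using P.nested[OF F(3,2) s', of 0 0] F by (simp add: P.una_cmp)
  also have "P.subs (P.subs (as, f, b) 0 ?p) 0 ?p' = P.subs (as, f, b) 0 (arrows as'' as (Cmps (unary_cat M) as'' as' as ps ps'))"
    unfolding arrows_Cmps[OF a(8,9)] by (rule subs_cmp[OF F(1), of "[]" _ "[]"]) (use p p' a in auto)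
  also have "P.msub (una (cmpa (unary_cat M) (b', q', b'') (b, q, b'))) 0 \<dots>
     = (as'', Act (U_ob M) as b as'' b'' (Cmps (unary_cat M) as'' as' as ps ps') (mSub M [] b' [] [b] b'' q' q) f, b'')"
    using U_Act[OF a(7,1,3) c, of b b''] by (simp add: cmpa_def)
  finally show "Act (U_ob M) as b as'' b'' (Cmps (unary_cat M) as'' as' as ps ps') (mSub M [] b' [] [b] b'' q' q) f
    = Act (U_ob M) as' b' as'' b'' ps' q' (Act (U_ob M) as b as' b' ps q f)" by simp
next
  fix xs b ys as c f g
  assume "(length xs + 1 + length ys, length as) \<in> sub_arities"
    "xs \<in> lists (mObj M)" "b \<in> mObj M" "ys \<in> lists (mObj M)" "as \<in> lists (mObj M)" "c \<in> mObj M"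
    "f \<in> (if length (xs @ b # ys) \<le> 4 then mHom M (xs @ b # ys) c else {})" "g \<in> (if length as \<le> 4 then mHom M as b else {})"
  then show "Sub (U_ob M) xs b ys as c f g \<in> (if length (xs @ as @ ys) \<le> 4 then mHom M (xs @ as @ ys) c else {})"
    using sub_hom[of xs b ys as c f g] by (auto simp: U_ob_def sub_arities_def split: if_splits)
next
  fix xs b ys as c xs' ys' as' c' f g ps qs rs s
  assume a: "(length xs + 1 + length ys, length as) \<in> sub_arities"
    "xs \<in> lists (mObj M)" "b \<in> mObj M" "ys \<in> lists (mObj M)" "as \<in> lists (mObj M)" "c \<in> mObj M"
    "xs' \<in> lists (mObj M)" "ys' \<in> lists (mObj M)" "as' \<in> lists (mObj M)" "c' \<in> mObj M"
    "f \<in> (if length (xs @ b # ys) \<le> 4 then mHom M (xs @ b # ys) c else {})" "g \<in> (if length as \<le> 4 then mHom M as b else {})"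
    "ps \<in> Homs (unary_cat M) xs' xs" "qs \<in> Homs (unary_cat M) ys' ys" "rs \<in> Homs (unary_cat M) as' as" "s \<in> mHom M [c] c'"
  have len: "length xs + length ys \<le> 3" "length as \<le> 4" "length xs + length as + length ys \<le> 4" using a(1) by (auto simp: sub_arities_def)
  have l: "length xs' = length xs" "length ys' = length ys" "length as' = length as" "length ps = length xs" "length rs = length as"
    using Homs_length a by metis+
  let ?F = "(xs @ b # ys, f, c)" and ?G = "(as, g, b)" and ?s = "una (c, s, c')" and ?k = "length xs"
  let ?p = "arrows xs' xs ps" and ?q = "arrows ys' ys qs" and ?r = "arrows as' as rs"
  have F: "?F \<in> P.mar" "?G \<in> P.mar" "?s \<in> P.mar" using a len by (simp_all add: mar_iff una_arr)
  note p = arrows_src_trg[OF a(13)] arrows_arr[OF a(13)] and q = arrows_src_trg[OF a(14)] arrows_arr[OF a(14)]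
    and r = arrows_src_trg[OF a(15)] arrows_arr[OF a(15)]
  have h: "ps @ mIdm M b # qs \<in> Homs (unary_cat M) (xs' @ b # ys') (xs @ b # ys)"
     "ps @ rs @ qs \<in> Homs (unary_cat M) (xs' @ as' @ ys') (xs @ as @ ys)"
    using a by (auto intro!: Homs_append simp: id_hom)
  have z: "arrows (xs' @ b # ys') (xs @ b # ys) (ps @ mIdm M b # qs) = ?p @ ida (unary_cat M) b # ?q"
     "arrows (xs' @ as' @ ys') (xs @ as @ ys) (ps @ rs @ qs) = ?p @ ?r @ ?q"
    using l by (simp_all add: ida_def)
  have p1: "P.subs ?F 0 ?p \<in> P.mar" "src (P.subs ?F 0 ?p) = xs' @ b # ys"
    using P.subs_mar[OF F(1), of "[]" ?p "b # ys"] P.subs_src[of ?F "[]" ?p "b # ys" 0] p a by auto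
  have p2: "P.subs (P.subs ?F 0 ?p) (Suc ?k) ?q \<in> P.mar" "src (P.subs (P.subs ?F 0 ?p) (Suc ?k) ?q) = xs' @ b # ys'"
    using P.subs_mar[OF p1(1), of "xs' @ [b]" ?q "[]"] P.subs_src[of "P.subs ?F 0 ?p" "xs' @ [b]" ?q "[]"] p1(2) q a l by auto
  have r1: "P.subs ?G 0 ?r \<in> P.mar" "src (P.subs ?G 0 ?r) = as'"
    using P.subs_mar[OF F(2), of "[]" ?r "[]"] P.subs_src[of ?G "[]" ?r "[]" 0] r a by auto
  have FG: "P.msub ?F ?k ?G \<in> P.mar" using F by (intro P.msub_mar) auto
  have "P.subs ?F 0 (?p @ ida (unary_cat M) b # ?q) = P.subs (P.subs ?F 0 ?p) (Suc ?k) ?q"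
    using p1 l P.id_right[OF p1(1), of ?k b] by (simp add: subs_append p(3) nth_append)
  then have Fa: "(xs' @ b # ys', Act (U_ob M) (xs @ b # ys) c (xs' @ b # ys') c' (ps @ mIdm M b # qs) s f, c')
     = P.msub ?s 0 (P.subs (P.subs ?F 0 ?p) (Suc ?k) ?q)"
    using U_Act[OF _ _ _ h(1), of c c' s f] a len z by simp
  have Ga: "(as', Act (U_ob M) as b as' b rs (mIdm M b) g, b) = P.subs ?G 0 ?r"
    using U_Act[OF len(2) a(5,9,15), of b b "mIdm M b" g] r1 P.id_left[OF r1(1), of b] by (simp add: ida_def)
  have "(xs' @ as' @ ys', Sub (U_ob M) xs' b ys' as' c'
      (Act (U_ob M) (xs @ b # ys) c (xs' @ b # ys') c' (ps @ mIdm M b # qs) s f) (Act (U_ob M) as b as' b rs (mIdm M b) g), c')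
     = P.msub (xs' @ b # ys', Act (U_ob M) (xs @ b # ys) c (xs' @ b # ys') c' (ps @ mIdm M b # qs) s f, c') ?k
         (as', Act (U_ob M) as b as' b rs (mIdm M b) g, b)"
    using a(1) l by (subst P.msub_eq[of _ xs' b ys']) (auto simp: U_ob_def)
  also have "\<dots> = P.msub (P.msub ?s 0 (P.subs (P.subs ?F 0 ?p) (Suc ?k) ?q)) ?k (P.subs ?G 0 ?r)"
    unfolding Fa Ga ..
  also have "\<dots> = P.msub ?s 0 (P.msub (P.subs (P.subs ?F 0 ?p) (Suc ?k) ?q) ?k (P.subs ?G 0 ?r))"
    using P.nested[OF F(3) p2(1) r1(1), of 0 ?k] p2 l by (simp add: nth_append)
  also have "P.msub (P.subs (P.subs ?F 0 ?p) (Suc ?k) ?q) ?k (P.subs ?G 0 ?r)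
     = P.subs (P.msub (P.subs ?F 0 ?p) ?k (P.subs ?G 0 ?r)) (?k + length as) ?q"
    using subs_msub_before[OF p1(1) r1(1), of ?k "Suc ?k" "xs' @ [b]" ?q "[]"] p1(2) r1(2) q a l by (simp add: nth_append)
  also have "P.msub (P.subs ?F 0 ?p) ?k (P.subs ?G 0 ?r) = P.subs (P.msub (P.subs ?F 0 ?p) ?k ?G) ?k ?r"
    using subs_msub_inside[OF p1(1) F(2), of ?k "[]" ?r "[]" 0] p1(2) r a l by (simp add: nth_append)
  also have "P.msub (P.subs ?F 0 ?p) ?k ?G = P.subs (P.msub ?F ?k ?G) 0 ?p"
    using subs_msub_after[OF F(1,2), of 0 ?p ?k "[]" "b # ys"] p a l by (simp add: nth_append)
  also have "P.subs (P.subs (P.subs (P.msub ?F ?k ?G) 0 ?p) ?k ?r) (?k + length as) ?q = P.subs (P.msub ?F ?k ?G) 0 (?p @ ?r @ ?q)"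
    using l by (simp add: subs_append p(3) r(3))
  also have "P.msub ?F ?k ?G = (xs @ as @ ys, Sub (U_ob M) xs b ys as c f g, c)"
    using a(1) by (subst P.msub_eq[of _ xs b ys]) (auto simp: U_ob_def)
  also have "P.msub ?s 0 (P.subs (xs @ as @ ys, Sub (U_ob M) xs b ys as c f g, c) 0 (?p @ ?r @ ?q))
     = (xs' @ as' @ ys', Act (U_ob M) (xs @ as @ ys) c (xs' @ as' @ ys') c' (ps @ rs @ qs) s (Sub (U_ob M) xs b ys as c f g), c')"
    using U_Act[OF _ _ _ h(2), of c c' s "Sub (U_ob M) xs b ys as c f g"] a len z by simp
  finally show "Sub (U_ob M) xs' b ys' as' c'
      (Act (U_ob M) (xs @ b # ys) c (xs' @ b # ys') c' (ps @ mIdm M b # qs) s f) (Act (U_ob M) as b as' b rs (mIdm M b) g)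
    = Act (U_ob M) (xs @ as @ ys) c (xs' @ as' @ ys') c' (ps @ rs @ qs) s (Sub (U_ob M) xs b ys as c f g)" by simp
next
  fix xs b b' ys as c f g p
  assume a: "(length xs + 1 + length ys, length as) \<in> sub_arities"
    "xs \<in> lists (mObj M)" "b \<in> mObj M" "b' \<in> mObj M" "ys \<in> lists (mObj M)" "as \<in> lists (mObj M)" "c \<in> mObj M"
    "f \<in> (if length (xs @ b' # ys) \<le> 4 then mHom M (xs @ b' # ys) c else {})" "g \<in> (if length as \<le> 4 then mHom M as b else {})"
    "p \<in> mHom M [b] b'"
  have len: "length xs + length ys \<le> 3" "length as \<le> 4" using a(1) by (auto simp: sub_arities_def)
  let ?F = "(xs @ b' # ys, f, c)" and ?G = "(as, g, b)" and ?k = "length xs"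
  have F: "?F \<in> P.mar" "?G \<in> P.mar" "una (b, p, b') \<in> P.mar" using a len by (simp_all add: mar_iff una_arr)
  have f: "f \<in> mHom M (xs @ b' # ys) c" "g \<in> mHom M as b" using a len by auto
  have "(xs @ as @ ys, Sub (U_ob M) xs b ys as c
         (Act (U_ob M) (xs @ b' # ys) c (xs @ b # ys) c (Idms (unary_cat M) xs @ p # Idms (unary_cat M) ys) (mIdm M c) f) g, c)
     = P.msub (xs @ b # ys, Act (U_ob M) (xs @ b' # ys) c (xs @ b # ys) c (Idms (unary_cat M) xs @ p # Idms (unary_cat M) ys) (mIdm M c) f, c) ?k ?G"
    using a(1) by (subst P.msub_eq[of _ xs b ys]) (auto simp: U_ob_def)
  also have "\<dots> = P.msub (P.msub ?F ?k (una (b, p, b'))) ?k ?G"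
    using U_Act_pre[of xs ys b b' c f p] a len f by (simp add: U_Homs)
  also have "\<dots> = P.msub ?F ?k (P.msub (una (b, p, b')) 0 ?G)"
    using P.nested[OF F(1,3,2), of ?k 0] by simp
  also have "P.msub (una (b, p, b')) 0 ?G = (as, Act (U_ob M) as b as b' (Idms (unary_cat M) as) p g, b')"
    using U_Act_post[of as b b' g p] a len f by (simp add: U_Homs)
  also have "P.msub ?F ?k \<dots> = (xs @ as @ ys, Sub (U_ob M) xs b' ys as c f (Act (U_ob M) as b as b' (Idms (unary_cat M) as) p g), c)"
    using a(1) by (subst P.msub_eq[of _ xs b' ys]) (auto simp: U_ob_def)
  finally show "Sub (U_ob M) xs b ys as c
         (Act (U_ob M) (xs @ b' # ys) c (xs @ b # ys) c (Idms (unary_cat M) xs @ p # Idms (unary_cat M) ys) (mIdm M c) f) g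
    = Sub (U_ob M) xs b' ys as c f (Act (U_ob M) as b as b' (Idms (unary_cat M) as) p g)" by simp
next
  fix xs b ys us c vs as d f g h
  assume a: "length xs + 1 + length ys = 2" "(length us + 1 + length vs, length as) \<in> {(2,2), (2,0)}"
        "xs \<in> lists (mObj M)" "b \<in> mObj M" "ys \<in> lists (mObj M)" "us \<in> lists (mObj M)" "c \<in> mObj M"
        "vs \<in> lists (mObj M)" "as \<in> lists (mObj M)" "d \<in> mObj M"
        "f \<in> (if length (xs @ b # ys) \<le> 4 then mHom M (xs @ b # ys) d else {})"
        "g \<in> (if length (us @ c # vs) \<le> 4 then mHom M (us @ c # vs) b else {})"
        "h \<in> (if length as \<le> 4 then mHom M as c else {})"
  have m: "f \<in> mHom M (xs @ b # ys) d" "g \<in> mHom M (us @ c # vs) b" "h \<in> mHom M as c" using a by auto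
  have ok: "short_ok (length xs + 1 + length ys) (length us + 1 + length vs)" "short_ok (length us + 1 + length vs) (length as)"
    "short_ok (length xs + 1 + length ys) (length us + length as + length vs)"
    "short_ok (length xs + length us + 1 + length vs + length ys) (length as)"
    using a(1,2) by (auto simp: short_ok_simp)
  show "gsub (U_ob M) xs b ys (us @ as @ vs) d f (gsub (U_ob M) us c vs as b g h)
    = gsub (U_ob M) (xs @ us) c (vs @ ys) as d (gsub (U_ob M) xs b ys (us @ c # vs) d f g) h"
    using ok a m sub_hom[of us c vs as b g h] sub_hom[of xs b ys "us @ c # vs" d f g]
    by (simp add: U_gsub sub_assoc_nested algebra_simps)
next
  fix as as' b c d f g h
  assume a: "(length as, length as') \<in> {(2,2), (2,0), (0,2), (0,0)}" "b \<in> mObj M" "c \<in> mObj M" "d \<in> mObj M"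
        "as \<in> lists (mObj M)" "as' \<in> lists (mObj M)" "f \<in> (if length [b, c] \<le> 4 then mHom M [b, c] d else {})"
        "g \<in> (if length as \<le> 4 then mHom M as b else {})" "h \<in> (if length as' \<le> 4 then mHom M as' c else {})"
  have m: "f \<in> mHom M [b, c] d" "g \<in> mHom M as b" "h \<in> mHom M as' c" using a by auto
  have ok: "short_ok 2 (length as)" "short_ok 2 (length as')" "short_ok (length as + 1) (length as')" "short_ok (1 + length as') (length as)"
    using a(1) by (auto simp: short_ok_simp)
  have "gsub (U_ob M) as c [] as' d (gsub (U_ob M) [] b [c] as d f g) h = mSub M as c [] as' d (mSub M [] b [c] as d f g) h"
    using ok a m sub_hom[of "[]" b "[c]" as d f g] by (simp add: U_gsub numeral_2_eq_2)
  moreover have "gsub (U_ob M) [] b as' as d (gsub (U_ob M) [b] c [] as' d f h) g = mSub M [] b as' as d (mSub M [b] c [] as' d f h) g"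
    using ok a m sub_hom[of "[b]" c "[]" as' d f h] by (simp add: U_gsub numeral_2_eq_2)
  ultimately show "gsub (U_ob M) as c [] as' d (gsub (U_ob M) [] b [c] as d f g) h
    = gsub (U_ob M) [] b as' as d (gsub (U_ob M) [b] c [] as' d f h) g"
    using sub_assoc_parallel[of "[]" b "[]" c "[]" as as' d f g h] a m by simp
qed

end

section \<open>The forgetful functor\<close>

lemma U_mars: "shMaps (U_ob M) as b = (if length as \<le> 4 then mMaps M as b else {})"
  by (simp add: shMaps_def mMaps_def U_ob_def)

lemma short_morphism_U:
  assumes "multifunctor M N F"
  shows "short_morphism (U_ob M) (U_ob N) (U_mor F)"
proof -
  interpret F: multifunctor M N F by fact
  note M = F.M.multicategory_axioms and N = F.N.multicategory_axioms
  interpret A: pm_morphism "unary_cat M" "mHom M" "mSub M" "unary_cat N" "mHom N" "mSub N" "\<lambda>n m. True" F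
    using assms pm_morphism_multifunctor by blast
  interpret C: partial_multicategory "cat.truncate (U_ob M)" "Mul (U_ob M)" "gsub (U_ob M)" short_ok
    by (rule partial_short[OF F.M.short_U])
  interpret D: partial_multicategory "cat.truncate (U_ob N)" "Mul (U_ob N)" "gsub (U_ob N)" short_ok
    by (rule partial_short[OF F.N.short_U])
  have mar: "G \<in> C.mar \<longleftrightarrow> G \<in> A.C.mar \<and> length (src G) \<le> 4" for G
    by (auto simp: C.mar_def A.C.mar_def F.M.U_simps)
  have mar': "G \<in> D.mar \<longleftrightarrow> G \<in> A.D.mar \<and> length (src G) \<le> 4" for G
    by (auto simp: D.mar_def A.D.mar_def F.N.U_simps)
  have sub: "C.msub G i H = A.C.msub G i H"
    if GH: "G \<in> C.mar" "H \<in> C.mar" "i < length (src G)" "src G ! i = trg H" "short_ok (length (src G)) (length (src H))" for G H i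
  proof -
    obtain xs b ys where G: "src G = xs @ b # ys" "length xs = i" "xs \<in> lists (mObj M)" "b \<in> mObj M" "ys \<in> lists (mObj M)"
      using C.mar_split[OF GH(1,3)] by (auto simp: F.M.U_simps)
    have "raw G \<in> mHom M (xs @ b # ys) (trg G)" "raw H \<in> mHom M (src H) b" "trg G \<in> mObj M" "src H \<in> lists (mObj M)"
      using A.C.mar_objs[of G] A.C.mar_objs[of H] GH G mar by (auto simp: nth_append)
    then show ?thesis
      unfolding C.msub_eq[OF G(1,2)] A.C.msub_eq[OF G(1,2)] using GH(5) G
      by (subst F.M.U_gsub) auto
  qed
  have sub': "D.msub G i H = A.D.msub G i H"
    if GH: "G \<in> D.mar" "H \<in> D.mar" "i < length (src G)" "src G ! i = trg H" "short_ok (length (src G)) (length (src H))" for G H i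
  proof -
    obtain xs b ys where G: "src G = xs @ b # ys" "length xs = i" "xs \<in> lists (mObj N)" "b \<in> mObj N" "ys \<in> lists (mObj N)"
      using D.mar_split[OF GH(1,3)] by (auto simp: F.N.U_simps)
    have "raw G \<in> mHom N (xs @ b # ys) (trg G)" "raw H \<in> mHom N (src H) b" "trg G \<in> mObj N" "src H \<in> lists (mObj N)"
      using A.D.mar_objs[of G] A.D.mar_objs[of H] GH G mar' by (auto simp: nth_append)
    then show ?thesis
      unfolding D.msub_eq[OF G(1,2)] A.D.msub_eq[OF G(1,2)] using GH(5) G
      by (subst F.N.U_gsub) auto
  qed
  have map: "mapm (U_mor F) G = mapm F G" if "length (src G) \<le> 4" for G
    using that by (simp add: mapm_def U_mor_def)
  show ?thesis
  proof (rule short_morphism_pm[OF F.M.short_U F.N.short_U], unfold_locales)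
    show "morOb (U_mor F) \<in> extensional (Obj (cat.truncate (U_ob M)))"
      using F.ext_obj by (simp add: U_mor_def F.M.U_simps)
    show "morMap (U_mor F) as b \<in> extensional (C.mars as b)" for as b
      using F.ext_map[of as b] by (auto simp: short_mars F.M.short_U U_mars U_mor_def extensional_def)
    show "morOb (U_mor F) a \<in> Obj (cat.truncate (U_ob N))" if "a \<in> Obj (cat.truncate (U_ob M))" for a
      using that F.map_obj by (simp add: U_mor_def F.M.U_simps F.N.U_simps)
    show "mapm (U_mor F) G \<in> D.mar" if "G \<in> C.mar" for G
      using that A.map_mar[of G] by (simp add: mar mar' map)
    show "mapm (U_mor F) (una (ida (cat.truncate (U_ob M)) a)) = una (ida (cat.truncate (U_ob N)) (morOb (U_mor F) a))"
      if "a \<in> Obj (cat.truncate (U_ob M))" for a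
      using that A.map_idm[of a] by (simp add: map ida_def F.M.U_simps F.N.U_simps) (simp add: U_mor_def)
    fix G H i assume *: "G \<in> C.mar" "H \<in> C.mar" "i < length (src G)" "src G ! i = trg H" "short_ok (length (src G)) (length (src H))"
    have "C.msub G i H \<in> C.mar" using * by (rule C.msub_mar)
    then have l: "length (src (A.C.msub G i H)) \<le> 4" using mar sub[OF *] by simp
    have "mapm F G \<in> D.mar" "mapm F H \<in> D.mar" using * A.map_mar by (auto simp: mar mar')
    then show "mapm (U_mor F) (C.msub G i H) = D.msub (mapm (U_mor F) G) i (mapm (U_mor F) H)"
      using * sub[OF *] sub'[of "mapm F G" "mapm F H" i] A.map_msub[of G H i] l by (simp add: map mar)
  qed
qed

lemma is_functor_U: "is_functor Multi ShMulti U_functor"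
proof (intro is_functor.intro is_functor_axioms.intro category_Multi category_ShMulti)
  show "fOb U_functor M \<in> Obj ShMulti" if "M \<in> Obj Multi" for M :: "('o, 'm) multi"
    using that multicategory.short_U[of M] by (simp add: U_functor_def Multi_def ShMulti_def)
  show "fMap U_functor M N F \<in> Hom ShMulti (fOb U_functor M) (fOb U_functor N)"
    if "F \<in> Hom Multi M N" for M N :: "('o, 'm) multi" and F
    using that short_morphism_U by (simp add: U_functor_def Multi_def ShMulti_def)
next
  fix M :: "('o, 'm) multi" assume "M \<in> Obj Multi"
  then interpret multicategory M by (simp add: Multi_def)
  show "fMap U_functor M M (Idm Multi M) = Idm ShMulti (fOb U_functor M)"
    unfolding U_functor_def Multi_def ShMulti_def U_mor_def mor_id_def
    by (auto simp: U_mars fun_eq_iff restrict_def)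
next
  fix M N P :: "('o, 'm) multi" and F G
  assume "M \<in> Obj Multi" "N \<in> Obj Multi"
  then interpret multicategory M by (simp add: Multi_def)
  show "fMap U_functor M P (Cmp Multi M N P G F)
    = Cmp ShMulti (fOb U_functor M) (fOb U_functor N) (fOb U_functor P) (fMap U_functor N P G) (fMap U_functor M N F)"
    unfolding U_functor_def Multi_def ShMulti_def U_mor_def mor_comp_def
    by (auto simp: U_mars fun_eq_iff restrict_def)
qed

section \<open>Classifying maps\<close>

lemma left_representable_short:
  assumes "short_multicategory C" "left_classifiers C t"
  shows "left_representable_pm (cat.truncate C) (Mul C) (gsub C) short_ok t"
proof -
  interpret partial_multicategory "cat.truncate C" "Mul C" "gsub C" short_ok by (rule partial_short) fact
  show ?thesis
  proof
    fix a b xs d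
    assume *: "a \<in> Obj (cat.truncate C)" "b \<in> Obj (cat.truncate C)" "xs \<in> lists (Obj (cat.truncate C))"
      "d \<in> Obj (cat.truncate C)" "short_ok (Suc (length xs)) 2"
    then have "length xs + 1 \<in> {1, 2, 3}" by (auto simp: short_ok_simp)
    then show "bij_betw (\<lambda>f. gsub C [] (clOb t a b) xs [a, b] d f (clTheta t a b))
      (Mul C (clOb t a b # xs) d) (Mul C (a # b # xs) d)"
      using assms(2) * unfolding left_classifiers_def truncate_simps by blast
  next
    fix xs d
    assume *: "xs \<in> lists (Obj (cat.truncate C))" "d \<in> Obj (cat.truncate C)" "short_ok (Suc (length xs)) 0"
    then have "length xs \<in> {0, 1, 2}" by (auto simp: short_ok_simp)
    then show "bij_betw (\<lambda>f. gsub C [] (clUnit t) xs [] d f (clU t)) (Mul C (clUnit t # xs) d) (Mul C xs d)"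
      using assms(2) * unfolding left_classifiers_def truncate_simps by blast
  qed (use assms(2) in \<open>auto simp: left_classifiers_def classifier_data_def\<close>)
qed

context partial_multicategory begin

interpretation X: category X by (rule category_X)

text \<open>Universality of \<open>K\<close> in the context \<open>xs, ys\<close>.\<close>

definition precomp_bij :: "('o, 'm) marrow \<Rightarrow> 'o list \<Rightarrow> 'o list \<Rightarrow> 'o \<Rightarrow> bool" where
  "precomp_bij K xs ys d \<longleftrightarrow> bij_betw (\<lambda>h. S xs (trg K) ys (src K) d h (raw K)) (MM (xs @ trg K # ys) d) (MM (xs @ src K @ ys) d)"

lemma precomp_bijD:
  assumes "precomp_bij K xs ys d" "K \<in> mar" "xs \<in> lists (Obj X)" "ys \<in> lists (Obj X)" "d \<in> Obj X"
    "ok (length xs + 1 + length ys) (length (src K))"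
  shows "\<And>F G. F \<in> mar \<Longrightarrow> G \<in> mar \<Longrightarrow> src F = xs @ trg K # ys \<Longrightarrow> src G = src F \<Longrightarrow> trg F = d \<Longrightarrow> trg G = d \<Longrightarrow>
      F \<odot>[length xs] K = G \<odot>[length xs] K \<Longrightarrow> F = G"
    "\<And>H. H \<in> mar \<Longrightarrow> src H = xs @ src K @ ys \<Longrightarrow> trg H = d \<Longrightarrow>
      \<exists>F \<in> mar. src F = xs @ trg K # ys \<and> trg F = d \<and> F \<odot>[length xs] K = H"
proof -
  fix F G assume *: "F \<in> mar" "G \<in> mar" "src F = xs @ trg K # ys" "src G = src F" "trg F = d" "trg G = d"
      "F \<odot>[length xs] K = G \<odot>[length xs] K"
  have "raw F \<in> MM (xs @ trg K # ys) d" "raw G \<in> MM (xs @ trg K # ys) d" using mar_objs(4) * by metis+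
  moreover have "S xs (trg K) ys (src K) d (raw F) (raw K) = S xs (trg K) ys (src K) d (raw G) (raw K)"
    using * msub_eq[of F xs "trg K" ys "length xs" K] msub_eq[of G xs "trg K" ys "length xs" K] by simp
  ultimately have "raw F = raw G" using assms(1) unfolding precomp_bij_def bij_betw_def by (auto dest: inj_onD)
  then show "F = G" using * by (simp add: prod_eq_iff)
next
  fix H assume *: "H \<in> mar" "src H = xs @ src K @ ys" "trg H = d"
  then have "raw H \<in> MM (xs @ src K @ ys) d" using mar_objs(4) by metis
  then have "raw H \<in> (\<lambda>h. S xs (trg K) ys (src K) d h (raw K)) ` MM (xs @ trg K # ys) d"
    using assms(1) unfolding precomp_bij_def by (simp add: bij_betw_imp_surj_on)
  then obtain h where h: "h \<in> MM (xs @ trg K # ys) d" "S xs (trg K) ys (src K) d h (raw K) = raw H" by auto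
  have F: "(xs @ trg K # ys, h, d) \<in> mar"
    unfolding mar_def using h assms(3-5) mar_objs(2)[OF assms(2)] ok_dom[OF assms(6)] by simp
  moreover have "(xs @ trg K # ys, h, d) \<odot>[length xs] K = H"
    using h * by (subst msub_eq) (auto simp: prod_eq_iff)
  ultimately show "\<exists>F \<in> mar. src F = xs @ trg K # ys \<and> trg F = d \<and> F \<odot>[length xs] K = H"
    by (intro bexI[of _ "(xs @ trg K # ys, h, d)"]) auto
qed

lemma precomp_bijI:
  assumes inj: "\<And>F G. F \<in> mar \<Longrightarrow> G \<in> mar \<Longrightarrow> src F = xs @ trg K # ys \<Longrightarrow> src G = src F \<Longrightarrow> trg F = d \<Longrightarrow> trg G = d \<Longrightarrow>
      F \<odot>[length xs] K = G \<odot>[length xs] K \<Longrightarrow> F = G"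
    and surj: "\<And>H. H \<in> mar \<Longrightarrow> src H = xs @ src K @ ys \<Longrightarrow> trg H = d \<Longrightarrow>
      \<exists>F \<in> mar. src F = xs @ trg K # ys \<and> trg F = d \<and> F \<odot>[length xs] K = H"
    and K: "K \<in> mar" "xs \<in> lists (Obj X)" "ys \<in> lists (Obj X)" "d \<in> Obj X"
    "ok (length xs + 1 + length ys) (length (src K))"
  shows "precomp_bij K xs ys d"
proof -
  have mar: "(xs @ trg K # ys, h, d) \<in> mar \<longleftrightarrow> h \<in> MM (xs @ trg K # ys) d" for h
    unfolding mar_def using K(2-4) mar_objs(2)[OF K(1)] ok_dom[OF K(5)] by simp
  have ok: "ok (Suc 0) (length xs + (length (src K) + length ys))"
    using ok_total[OF K(5)] by (simp add: ac_simps)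
  have mar': "(xs @ src K @ ys, h, d) \<in> mar \<longleftrightarrow> h \<in> MM (xs @ src K @ ys) d" for h
    unfolding mar_def using K(2-4) mar_objs(1)[OF K(1)] ok by simp
  have sub: "(xs @ trg K # ys, h, d) \<odot>[length xs] K = (xs @ src K @ ys, S xs (trg K) ys (src K) d h (raw K), d)" for h
    by (subst msub_eq) auto
  show ?thesis
    unfolding precomp_bij_def bij_betw_def
  proof
    show "inj_on (\<lambda>h. S xs (trg K) ys (src K) d h (raw K)) (MM (xs @ trg K # ys) d)"
    proof (rule inj_onI)
      fix h k assume "h \<in> MM (xs @ trg K # ys) d" "k \<in> MM (xs @ trg K # ys) d"
        "S xs (trg K) ys (src K) d h (raw K) = S xs (trg K) ys (src K) d k (raw K)"
      then have *: "(xs @ trg K # ys, h, d) \<in> mar" "(xs @ trg K # ys, k, d) \<in> mar"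
        "(xs @ trg K # ys, h, d) \<odot>[length xs] K = (xs @ trg K # ys, k, d) \<odot>[length xs] K"
        unfolding sub mar by simp_all
      have "(xs @ trg K # ys, h, d) = (xs @ trg K # ys, k, d)"
        by (rule inj[OF *(1,2) _ _ _ _ *(3)]) simp_all
      then show "h = k" by simp
    qed
    show "(\<lambda>h. S xs (trg K) ys (src K) d h (raw K)) ` MM (xs @ trg K # ys) d = MM (xs @ src K @ ys) d"
    proof (intro equalityI subsetI)
      fix h assume "h \<in> MM (xs @ src K @ ys) d"
      then obtain F where F: "F \<in> mar" "src F = xs @ trg K # ys" "trg F = d" "F \<odot>[length xs] K = (xs @ src K @ ys, h, d)"
        using surj[of "(xs @ src K @ ys, h, d)"] mar' by (metis fst_conv snd_conv)
      then have "raw F \<in> MM (xs @ trg K # ys) d" using mar_objs(4) by metis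
      moreover have "S xs (trg K) ys (src K) d (raw F) (raw K) = h"
        using F msub_eq[of F xs "trg K" ys "length xs" K] by simp
      ultimately show "h \<in> (\<lambda>h. S xs (trg K) ys (src K) d h (raw K)) ` MM (xs @ trg K # ys) d" by auto
    next
      fix h assume "h \<in> (\<lambda>h. S xs (trg K) ys (src K) d h (raw K)) ` MM (xs @ trg K # ys) d"
      then obtain k where k: "k \<in> MM (xs @ trg K # ys) d" "h = S xs (trg K) ys (src K) d k (raw K)" by auto
      have "(xs @ trg K # ys, k, d) \<odot>[length xs] K \<in> mar"
        by (rule msub_mar) (use k(1) mar K in \<open>simp_all add: nth_append\<close>)
      then show "h \<in> MM (xs @ src K @ ys) d" by (simp only: sub k mar')
    qed
  qed
qed

text \<open>
  Two maps with the same inputs that classify unary maps differ by an isomorphism of their codomains,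
  so one of them classifies maps in a context if the other does.
\<close>

lemma precomp_bij_transfer:
  assumes K: "K \<in> mar" "K' \<in> mar" "src K' = src K"
    and u: "\<And>d. d \<in> Obj X \<Longrightarrow> precomp_bij K [] [] d" "\<And>d. d \<in> Obj X \<Longrightarrow> precomp_bij K' [] [] d"
    and K': "precomp_bij K' xs ys d"
    and o: "xs \<in> lists (Obj X)" "ys \<in> lists (Obj X)" "d \<in> Obj X" "ok (length xs + 1 + length ys) (length (src K))"
  shows "precomp_bij K xs ys d"
proof -
  have ok: "ok (Suc 0) (length (src K))" "ok (Suc (length xs + length ys)) (Suc 0)" "ok (Suc (length xs + length ys)) (length (src K))"
    using ok_dom[OF o(4)] o(4) by auto
  have t: "trg K \<in> Obj X" "trg K' \<in> Obj X" using K mar_objs by auto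
  have "\<exists>F \<in> mar. src F = [] @ trg K' # [] \<and> trg F = trg K \<and> F \<odot>[length ([] :: 'o list)] K' = K"
    by (rule precomp_bijD(2)[OF u(2)[OF t(1)] K(2)]) (use K t ok in simp_all)
  then obtain F where F: "F \<in> mar" "src F = [trg K']" "trg F = trg K" "F \<odot>[0] K' = K" by auto
  have "\<exists>G \<in> mar. src G = [] @ trg K # [] \<and> trg G = trg K' \<and> G \<odot>[length ([] :: 'o list)] K = K'"
    by (rule precomp_bijD(2)[OF u(1)[OF t(2)] K(1)]) (use K t ok in simp_all)
  then obtain G where G: "G \<in> mar" "src G = [trg K]" "trg G = trg K'" "G \<odot>[0] K = K'" by auto
  have GF: "G \<odot>[0] F = una (ida X (trg K'))"
    by (rule precomp_bijD(1)[OF u(2)[OF t(2)] K(2)])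
      (use F G t K ok nested[of G F K' 0 0] in simp_all)
  have FG: "F \<odot>[0] G = una (ida X (trg K))"
    by (rule precomp_bijD(1)[OF u(1)[OF t(1)] K(1)])
      (use F G t K ok nested[of F G K 0 0] in simp_all)
  have HF: "H \<odot>[length xs] F \<odot>[length xs] K' = H \<odot>[length xs] K" if "H \<in> mar" "src H = xs @ trg K # ys" for H
    using nested[of H F K' "length xs" 0] that F K ok by (simp add: nth_append)
  have HG: "H \<odot>[length xs] G \<odot>[length xs] K = H \<odot>[length xs] K'" if "H \<in> mar" "src H = xs @ trg K' # ys" for H
    using nested[of H G K "length xs" 0] that G K ok by (simp add: nth_append)
  have HFG: "H \<odot>[length xs] F \<odot>[length xs] G = H" if "H \<in> mar" "src H = xs @ trg K # ys" for H
    using nested[of H F G "length xs" 0] that F G FG ok by (simp add: nth_append)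
  show ?thesis
  proof (rule precomp_bijI[OF _ _ K(1) o])
    fix H L assume *: "H \<in> mar" "L \<in> mar" "src H = xs @ trg K # ys" "src L = src H" "trg H = d" "trg L = d"
      "H \<odot>[length xs] K = L \<odot>[length xs] K"
    have "H \<odot>[length xs] F = L \<odot>[length xs] F"
      by (rule precomp_bijD(1)[OF K' K(2) o(1-3)]) (use * F K ok HF[of H] HF[of L] in \<open>simp_all add: nth_append\<close>)
    moreover have "H \<odot>[length xs] F \<odot>[length xs] G = H" by (rule HFG[OF *(1,3)])
    moreover have "L \<odot>[length xs] F \<odot>[length xs] G = L" by (rule HFG[OF *(2)]) (use *(3,4) in simp)
    ultimately show "H = L" by metis
  next
    fix H assume *: "H \<in> mar" "src H = xs @ src K @ ys" "trg H = d"
    have "\<exists>L \<in> mar. src L = xs @ trg K' # ys \<and> trg L = d \<and> L \<odot>[length xs] K' = H"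
      by (rule precomp_bijD(2)[OF K' K(2) o(1-3)]) (use * K ok in simp_all)
    then obtain L where L: "L \<in> mar" "src L = xs @ trg K' # ys" "trg L = d" "L \<odot>[length xs] K' = H" by auto
    then show "\<exists>F \<in> mar. src F = xs @ trg K # ys \<and> trg F = d \<and> F \<odot>[length xs] K = H"
      using HG[of L] G ok by (intro bexI[of _ "L \<odot>[length xs] G"]) (simp_all add: nth_append)
  qed
qed

end

context left_representable_pm begin

lemma precomp_bij_th:
  assumes "a \<in> Obj X" "b \<in> Obj X" "xs \<in> lists (Obj X)" "d \<in> Obj X" "ok (Suc (length xs)) 2"
  shows "precomp_bij (th a b) [] xs d"
  using theta_bij[OF assms] by (simp add: precomp_bij_def th_def)

lemma precomp_bij_uu:
  assumes "xs \<in> lists (Obj X)" "d \<in> Obj X" "ok (Suc (length xs)) 0"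
  shows "precomp_bij uu [] xs d"
  using u_bij[OF assms] by (simp add: precomp_bij_def uu_def)

end

text \<open>
  The maps chosen for the underlying short multicategory are isomorphic to those that witness
  representability, hence classify maps of all arities.
\<close>

lemma left_representable_multi:
  assumes "multicategory M" "representable_multi M" "left_classifiers (U_ob M) t"
  shows "left_representable_pm (unary_cat M) (mHom M) (mSub M) (\<lambda>n m. True) t"
proof -
  interpret M: multicategory M by fact
  interpret P: partial_multicategory "unary_cat M" "mHom M" "mSub M" "\<lambda>n m. True"
    by (rule partial_multicategory_multi) fact
  have cls: "\<exists>K. K \<in> P.mar \<and> src K = as \<and> (\<forall>xs \<in> lists (mObj M). \<forall>ys \<in> lists (mObj M). \<forall>d \<in> mObj M. P.precomp_bij K xs ys d)"
    if as: "as \<in> lists (mObj M)" for as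
  proof -
    obtain m q where m: "m \<in> mObj M" "q \<in> mHom M as m" "\<forall>xs \<in> lists (mObj M). \<forall>ys \<in> lists (mObj M). \<forall>b \<in> mObj M.
       bij_betw (\<lambda>f. mSub M xs m ys as b f q) (mHom M (xs @ m # ys) b) (mHom M (xs @ as @ ys) b)"
      using assms(2) as unfolding representable_multi_def by blast
    then show ?thesis using as by (intro exI[of _ "(as, q, m)"]) (auto simp: P.mar_def P.precomp_bij_def)
  qed
  have d: "clOb t a b \<in> mObj M" "clTheta t a b \<in> mHom M [a, b] (clOb t a b)" if "a \<in> mObj M" "b \<in> mObj M" for a b
    using assms(3) that unfolding left_classifiers_def classifier_data_def by (simp_all add: M.U_simps)
  have u: "clUnit t \<in> mObj M" "clU t \<in> mHom M [] (clUnit t)"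
    using assms(3) unfolding left_classifiers_def classifier_data_def by (simp_all add: M.U_simps)
  have tr: "P.precomp_bij K xs ys d"
    if K: "K \<in> P.mar" "\<And>d. d \<in> mObj M \<Longrightarrow> P.precomp_bij K [] [] d" "xs \<in> lists (mObj M)" "ys \<in> lists (mObj M)" "d \<in> mObj M"
    for K xs ys d
  proof -
    obtain K' where K': "K' \<in> P.mar" "src K' = src K"
      "\<forall>xs \<in> lists (mObj M). \<forall>ys \<in> lists (mObj M). \<forall>d \<in> mObj M. P.precomp_bij K' xs ys d"
      using cls[of "src K"] P.mar_objs(1)[OF K(1)] by auto
    have u: "P.precomp_bij K' [] [] d" if "d \<in> mObj M" for d using K'(3) that by blast
    have "P.precomp_bij K' xs ys d" using K'(3) K(3-5) by blast
    then show ?thesis using P.precomp_bij_transfer[OF K(1) K'(1,2) K(2) u] K(3-5) by simp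
  qed
  have th: "P.precomp_bij ([a, b], clTheta t a b, clOb t a b) [] xs d"
    if o: "a \<in> mObj M" "b \<in> mObj M" "xs \<in> lists (mObj M)" "d \<in> mObj M" for a b xs d
  proof (rule tr)
    fix d assume dd: "d \<in> mObj M"
    have "bij_betw (\<lambda>f. gsub (U_ob M) [] (clOb t a b) [] [a, b] d f (clTheta t a b)) (mHom M [clOb t a b] d) (mHom M [a, b] d)"
      using assms(3) o dd unfolding left_classifiers_def by (auto simp: M.U_simps dest!: bspec[of _ _ "[]"])
    moreover have "gsub (U_ob M) [] (clOb t a b) [] [a, b] d f (clTheta t a b) = mSub M [] (clOb t a b) [] [a, b] d f (clTheta t a b)"
      if "f \<in> mHom M [clOb t a b] d" for f
      using that o dd d by (intro M.U_gsub) (auto simp: short_ok_simp)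
    ultimately have "bij_betw (\<lambda>f. mSub M [] (clOb t a b) [] [a, b] d f (clTheta t a b)) (mHom M [clOb t a b] d) (mHom M [a, b] d)"
      by (simp cong: bij_betw_cong)
    then show "P.precomp_bij ([a, b], clTheta t a b, clOb t a b) [] [] d" by (simp add: P.precomp_bij_def)
  qed (use o d in \<open>auto simp: P.mar_def\<close>)
  have uu: "P.precomp_bij ([], clU t, clUnit t) [] xs d" if o: "xs \<in> lists (mObj M)" "d \<in> mObj M" for xs d
  proof (rule tr)
    fix d assume dd: "d \<in> mObj M"
    have "bij_betw (\<lambda>f. gsub (U_ob M) [] (clUnit t) [] [] d f (clU t)) (mHom M [clUnit t] d) (mHom M [] d)"
      using assms(3) dd unfolding left_classifiers_def by (auto simp: M.U_simps dest!: bspec[of _ _ "[]"])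
    moreover have "gsub (U_ob M) [] (clUnit t) [] [] d f (clU t) = mSub M [] (clUnit t) [] [] d f (clU t)"
      if "f \<in> mHom M [clUnit t] d" for f
      using that dd u by (intro M.U_gsub) (auto simp: short_ok_simp)
    ultimately have "bij_betw (\<lambda>f. mSub M [] (clUnit t) [] [] d f (clU t)) (mHom M [clUnit t] d) (mHom M [] d)"
      by (simp cong: bij_betw_cong)
    then show "P.precomp_bij ([], clU t, clUnit t) [] [] d" by (simp add: P.precomp_bij_def)
  qed (use o u in \<open>auto simp: P.mar_def\<close>)
  show ?thesis
    by unfold_locales (use d u th uu in \<open>auto simp: P.precomp_bij_def\<close>)
qed

lemma representable_U:
  assumes "multicategory M" "representable_multi M"
  shows "representable (U_ob M)"
proof -
  interpret M: multicategory M by fact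
  have "\<exists>m q. as \<in> lists (mObj M) \<longrightarrow> m \<in> mObj M \<and> q \<in> mHom M as m \<and> (\<forall>xs \<in> lists (mObj M). \<forall>ys \<in> lists (mObj M). \<forall>b \<in> mObj M.
       bij_betw (\<lambda>f. mSub M xs m ys as b f q) (mHom M (xs @ m # ys) b) (mHom M (xs @ as @ ys) b))" for as
    using assms(2) unfolding representable_multi_def by blast
  then obtain m q where mq: "\<And>as. as \<in> lists (mObj M) \<Longrightarrow> m as \<in> mObj M \<and> q as \<in> mHom M as (m as) \<and>
      (\<forall>xs \<in> lists (mObj M). \<forall>ys \<in> lists (mObj M). \<forall>b \<in> mObj M.
       bij_betw (\<lambda>f. mSub M xs (m as) ys as b f (q as)) (mHom M (xs @ m as # ys) b) (mHom M (xs @ as @ ys) b))"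
    by metis
  let ?t = "\<lparr>clOb = (\<lambda>a b. m [a, b]), clTheta = (\<lambda>a b. q [a, b]), clUnit = m [], clU = q []\<rparr>"
  have bij: "bij_betw (\<lambda>f. gsub (U_ob M) xs (m as) ys as d f (q as)) (Mul (U_ob M) (xs @ m as # ys) d) (Mul (U_ob M) (xs @ as @ ys) d)"
    if "short_ok (length xs + 1 + length ys) (length as)" "as \<in> lists (mObj M)"
      "xs \<in> lists (mObj M)" "ys \<in> lists (mObj M)" "d \<in> mObj M" for as xs ys d
  proof -
    have "bij_betw (\<lambda>f. mSub M xs (m as) ys as d f (q as)) (mHom M (xs @ m as # ys) d) (mHom M (xs @ as @ ys) d)"
      using mq that by blast
    moreover have "gsub (U_ob M) xs (m as) ys as d f (q as) = mSub M xs (m as) ys as d f (q as)"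
      if "f \<in> mHom M (xs @ m as # ys) d" for f
      using that \<open>short_ok _ _\<close> \<open>as \<in> _\<close> \<open>xs \<in> _\<close> \<open>ys \<in> _\<close> \<open>d \<in> _\<close> mq by (intro M.U_gsub) auto
    ultimately have "bij_betw (\<lambda>f. gsub (U_ob M) xs (m as) ys as d f (q as)) (mHom M (xs @ m as # ys) d) (mHom M (xs @ as @ ys) d)"
      by (simp cong: bij_betw_cong)
    moreover have "length xs + length ys \<le> 3" "length xs + (length as + length ys) \<le> 4"
      using short_ok_bounds[OF that(1)] by auto
    ultimately show ?thesis by simp
  qed
  show ?thesis
    unfolding representable_def
  proof (intro exI[of _ ?t] conjI ballI impI)
    show "classifier_data (U_ob M) ?t" using mq by (auto simp: classifier_data_def M.U_simps)
  next
    fix xs ys d assume *: "xs \<in> lists (Obj (U_ob M))" "ys \<in> lists (Obj (U_ob M))" "d \<in> Obj (U_ob M)" "length xs + 1 + length ys \<in> {1, 2, 3}"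
    have ok: "short_ok (length xs + 1 + length ys) 0" "short_ok (length xs + 1 + length ys) 2"
      using *(4) by (auto simp: short_ok_simp)
    show "bij_betw (\<lambda>f. gsub (U_ob M) xs (clUnit ?t) ys [] d f (clU ?t)) (Mul (U_ob M) (xs @ clUnit ?t # ys) d) (Mul (U_ob M) (xs @ ys) d)"
      using bij[of xs ys "[]" d] * ok by (simp add: M.U_simps(1))
    fix a b assume "a \<in> Obj (U_ob M)" "b \<in> Obj (U_ob M)"
    then show "bij_betw (\<lambda>f. gsub (U_ob M) xs (clOb ?t a b) ys [a, b] d f (clTheta ?t a b)) (Mul (U_ob M) (xs @ clOb ?t a b # ys) d) (Mul (U_ob M) (xs @ a # b # ys) d)"
      using bij[of xs ys "[a, b]" d] * ok by (simp add: M.U_simps(1) numeral_2_eq_2)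
  qed
qed

lemma closed_U:
  assumes "multicategory M" "closed_multi M"
  shows "closed_short (U_ob M)"
  unfolding closed_short_def
proof (intro ballI)
  interpret M: multicategory M by fact
  fix b c assume "b \<in> Obj (U_ob M)" "c \<in> Obj (U_ob M)"
  then have bc: "b \<in> mObj M" "c \<in> mObj M" by (simp_all add: M.U_simps)
  then obtain h e where h: "h \<in> mObj M" "e \<in> mHom M [h, b] c"
    "\<forall>xs \<in> lists (mObj M). bij_betw (\<lambda>f. mSub M [] h [b] xs c e f) (mHom M xs h) (mHom M (xs @ [b]) c)"
    using assms(2) unfolding closed_multi_def by blast
  have "bij_betw (\<lambda>f. gsub (U_ob M) [] h [b] xs c e f) (Mul (U_ob M) xs h) (Mul (U_ob M) (xs @ [b]) c)"
    if xs: "xs \<in> lists (mObj M)" "length xs \<in> {0, 1, 2, 3}" for xs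
  proof -
    have "gsub (U_ob M) [] h [b] xs c e f = mSub M [] h [b] xs c e f" if "f \<in> mHom M xs h" for f
      using that xs h bc by (intro M.U_gsub) (auto simp: short_ok_simp)
    then have "bij_betw (\<lambda>f. gsub (U_ob M) [] h [b] xs c e f) (mHom M xs h) (mHom M (xs @ [b]) c)"
      using h xs by (simp cong: bij_betw_cong)
    moreover have "length xs \<le> 3" using xs(2) by auto
    ultimately show ?thesis by simp
  qed
  then show "\<exists>h \<in> Obj (U_ob M). \<exists>e \<in> Mul (U_ob M) [h, b] c. \<forall>xs \<in> lists (Obj (U_ob M)). length xs \<in> {0, 1, 2, 3} \<longrightarrow>
       bij_betw (\<lambda>f. gsub (U_ob M) [] h [b] xs c e f) (Mul (U_ob M) xs h) (Mul (U_ob M) (xs @ [b]) c)"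
    using h by (intro bexI[of _ h] bexI[of _ e]) (auto simp: M.U_simps(1,5))
qed

section \<open>Invertible arrows and internal homs\<close>

definition isoa :: "('o, 'm, 'x) cat_scheme \<Rightarrow> ('o, 'm) arrow \<Rightarrow> bool" where
  "isoa C f \<longleftrightarrow> f \<in> arr C \<and> (\<exists>g \<in> arr C. src g = trg f \<and> trg g = src f \<and> cmpa C g f = ida C (src f) \<and> cmpa C f g = ida C (trg f))"

lemma iso_map_isoa:
  assumes "a \<in> Obj C" "b \<in> Obj C" shows "iso_map C a b f \<longleftrightarrow> isoa C (a, f, b)"
proof
  assume "iso_map C a b f"
  then obtain g where "f \<in> Hom C a b" "g \<in> Hom C b a" "Cmp C a b a g f = Idm C a" "Cmp C b a b f g = Idm C b"
    by (auto simp: iso_map_def)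
  then show "isoa C (a, f, b)"
    using assms by (auto simp: isoa_def arr_def cmpa_def ida_def simp del: arr_obj intro!: bexI[of _ "(b, g, a)"])
next
  assume "isoa C (a, f, b)"
  then show "iso_map C a b f"
    by (auto simp: isoa_def arr_def cmpa_def ida_def iso_map_def simp del: arr_obj)
qed

context category begin

lemma isoa_obtain:
  assumes "isoa C f"
  obtains g where "g \<in> arr C" "src g = trg f" "trg g = src f" "cmpa C g f = ida C (src f)" "cmpa C f g = ida C (trg f)"
  using assms unfolding isoa_def by blast

lemma isoa_arr: "isoa C f \<Longrightarrow> f \<in> arr C"
  by (simp add: isoa_def)

lemma isoa_ida: "a \<in> Obj C \<Longrightarrow> isoa C (ida C a)"
  unfolding isoa_def by (auto intro!: bexI[of _ "ida C a"])

lemma isoa_cmp: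
  assumes f: "isoa C f" and g: "isoa C g" and t: "src g = trg f"
  shows "isoa C (cmpa C g f)"
proof -
  obtain f' where f': "f' \<in> arr C" "src f' = trg f" "trg f' = src f" "cmpa C f' f = ida C (src f)" "cmpa C f f' = ida C (trg f)"
    using isoa_obtain[OF f] .
  obtain g' where g': "g' \<in> arr C" "src g' = trg g" "trg g' = src g" "cmpa C g' g = ida C (src g)" "cmpa C g g' = ida C (trg g)"
    using isoa_obtain[OF g] .
  have a: "f \<in> arr C" "g \<in> arr C" using f g isoa_arr by auto
  have "cmpa C g' (cmpa C g f) = f" using cmpa_assoc[of f g g'] a g' t by simp
  moreover have "cmpa C f (cmpa C f' g') = g'" using cmpa_assoc[of g' f' f] a f' g' t by simp
  ultimately show ?thesis
    unfolding isoa_def using a f' g' t by (intro conjI bexI[of _ "cmpa C f' g'"]) simp_all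
qed

end

context skew_monoidal begin

text \<open>\<open>[b, c]\<close> with its evaluation map, by its universal property.\<close>

definition internal_hom :: "'o \<Rightarrow> 'o \<Rightarrow> 'o \<Rightarrow> ('o, 'm) arrow \<Rightarrow> bool" where
  "internal_hom b c h ev \<longleftrightarrow> h \<in> Obj C \<and> ev \<in> arr C \<and> src ev = h \<otimes> b \<and> trg ev = c \<and>
     (\<forall>a \<in> Obj C. \<forall>g \<in> arr C. src g = a \<otimes> b \<longrightarrow> trg g = c \<longrightarrow>
        (\<exists>!f. f \<in> arr C \<and> src f = a \<and> trg f = h \<and> ev \<cdot> (f \<boxtimes> ida C b) = g))"

lemma tensor_right_functor:
  assumes b: "b \<in> Obj C" shows "is_functor C C (tensor_right C b)"
proof
  show "fOb (tensor_right C b) a \<in> Obj C" if "a \<in> Obj C" for a using that b by (simp add: tensor_right_def)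
  show "fMap (tensor_right C b) a a' f \<in> Hom C (fOb (tensor_right C b) a) (fOb (tensor_right C b) a')"
    if "a \<in> Obj C" "a' \<in> Obj C" "f \<in> Hom C a a'" for a a' f
    using tena_arr[of "(a, f, a')" "ida C b"] that b idm_hom[OF b]
    by (simp add: tensor_right_def arr_def tena_def ida_def del: arr_obj)
  show "fMap (tensor_right C b) a a (Idm C a) = Idm C (fOb (tensor_right C b) a)" if "a \<in> Obj C" for a
    using tena_id[OF that b] by (simp add: tensor_right_def tena_def ida_def)
  show "fMap (tensor_right C b) a c (Cmp C a a' c g f) =
      Cmp C (fOb (tensor_right C b) a) (fOb (tensor_right C b) a') (fOb (tensor_right C b) c)
       (fMap (tensor_right C b) a' c g) (fMap (tensor_right C b) a a' f)"
    if "a \<in> Obj C" "a' \<in> Obj C" "c \<in> Obj C" "f \<in> Hom C a a'" "g \<in> Hom C a' c" for a a' c f g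
    using tena_cmp_id[of "(a, f, a')" "(a', g, c)" b] that b
    by (simp add: tensor_right_def tena_def ida_def cmpa_def arr_def del: arr_obj)
qed

text \<open>
  The adjoint sends \<open>q : c \<rightarrow> c'\<close> to the map \<open>[b, c] \<rightarrow> [b, c']\<close> that corresponds to \<open>q\<close> after the evaluation, and
  uniqueness in the universal property gives functoriality and the natural bijection.
\<close>

lemma right_adjoint_if_internal_hom:
  assumes b: "b \<in> Obj C" and ih: "\<And>c. c \<in> Obj C \<Longrightarrow> \<exists>h ev. internal_hom b c h ev"
  shows "\<exists>G. right_adjoint C C (tensor_right C b) G"
proof -
  obtain hh ev where he: "\<And>c. c \<in> Obj C \<Longrightarrow> internal_hom b c (hh c) (ev c)" using ih by metis
  have h: "\<And>c. c \<in> Obj C \<Longrightarrow> hh c \<in> Obj C"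
    and ev: "\<And>c. c \<in> Obj C \<Longrightarrow> ev c \<in> arr C" "\<And>c. c \<in> Obj C \<Longrightarrow> src (ev c) = hh c \<otimes> b" "\<And>c. c \<in> Obj C \<Longrightarrow> trg (ev c) = c"
    using he unfolding internal_hom_def by auto
  define tr where "tr a g = (THE f. f \<in> arr C \<and> src f = a \<and> trg f = hh (trg g) \<and> ev (trg g) \<cdot> (f \<boxtimes> ida C b) = g)" for a g
  have tr: "tr a g \<in> arr C \<and> src (tr a g) = a \<and> trg (tr a g) = hh (trg g) \<and> ev (trg g) \<cdot> (tr a g \<boxtimes> ida C b) = g"
    if "a \<in> Obj C" "g \<in> arr C" "src g = a \<otimes> b" for a g
    unfolding tr_def by (rule theI') (use he[of "trg g"] that in \<open>auto simp: internal_hom_def\<close>)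
  have tr_eq: "tr a g = f" if "a \<in> Obj C" "f \<in> arr C" "src f = a" "trg f = hh (trg g)" "g \<in> arr C"
    "ev (trg g) \<cdot> (f \<boxtimes> ida C b) = g" for a f g
  proof -
    have "src g = a \<otimes> b" using that b by (metis src_trg(1,3,5))
    then have "\<exists>!f. f \<in> arr C \<and> src f = a \<and> trg f = hh (trg g) \<and> ev (trg g) \<cdot> (f \<boxtimes> ida C b) = g"
      using he[of "trg g"] that by (auto simp: internal_hom_def)
    then show ?thesis using tr[OF that(1,5) \<open>src g = _\<close>] that by blast
  qed
  define G where "G = \<lparr>fOb = hh, fMap = (\<lambda>c c' q. raw (tr (hh c) ((c, q, c') \<cdot> ev c)))\<rparr>"
  have q: "(c, q, c') \<in> arr C" if "c \<in> Obj C" "c' \<in> Obj C" "q \<in> Hom C c c'" for c c' q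
    using that by (simp add: arr_def del: arr_obj)
  have Gq: "(hh c, fMap G c c' q, hh c') = tr (hh c) ((c, q, c') \<cdot> ev c)" if "c \<in> Obj C" "c' \<in> Obj C" "q \<in> Hom C c c'" for c c' q
    using tr[of "hh c" "(c, q, c') \<cdot> ev c"] q[OF that] that ev h by (simp add: G_def prod_eq_iff)
  have Gq_ev: "ev c' \<cdot> ((hh c, fMap G c c' q, hh c') \<boxtimes> ida C b) = (c, q, c') \<cdot> ev c"
    "(hh c, fMap G c c' q, hh c') \<in> arr C"
    if "c \<in> Obj C" "c' \<in> Obj C" "q \<in> Hom C c c'" for c c' q
    unfolding Gq[OF that] using tr[of "hh c" "(c, q, c') \<cdot> ev c"] q[OF that] that ev h by simp_all
  have hom: "f \<in> Hom C a c" if "(a, f, c) \<in> arr C" for a f c using that by (simp add: arr_def del: arr_obj)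
  have G: "is_functor C C G"
  proof
    show "fOb G a \<in> Obj C" if "a \<in> Obj C" for a using that h by (simp add: G_def)
    show "fMap G a a' f \<in> Hom C (fOb G a) (fOb G a')" if "a \<in> Obj C" "a' \<in> Obj C" "f \<in> Hom C a a'" for a a' f
      using hom[OF Gq_ev(2)[OF that]] by (simp add: G_def)
    show "fMap G a a (Idm C a) = Idm C (fOb G a)" if a: "a \<in> Obj C" for a
    proof -
      have "(hh a, fMap G a a (Idm C a), hh a) = ida C (hh a)"
        unfolding Gq[OF a a idm_hom[OF a]] using a h ev b
        by (intro tr_eq) (simp_all flip: ida_def)
      then show ?thesis by (simp add: ida_def G_def)
    qed
    fix a a' c f g assume o: "a \<in> Obj C" "a' \<in> Obj C" "c \<in> Obj C" "f \<in> Hom C a a'" "g \<in> Hom C a' c"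
    let ?f = "(a, f, a')" and ?g = "(a', g, c)" and ?Gf = "(hh a, fMap G a a' f, hh a')" and ?Gg = "(hh a', fMap G a' c g, hh c)"
    have fg: "?f \<in> arr C" "?g \<in> arr C" using o q by auto
    note Gf = Gq_ev[OF o(1,2,4)] and Gg = Gq_ev[OF o(2,3,5)]
    have "ev c \<cdot> ((?Gg \<cdot> ?Gf) \<boxtimes> ida C b) = ev c \<cdot> (?Gg \<boxtimes> ida C b) \<cdot> (?Gf \<boxtimes> ida C b)"
      using Gf Gg b o by (simp add: tena_cmp_id)
    also have "\<dots> = ?g \<cdot> ev a' \<cdot> (?Gf \<boxtimes> ida C b)"
      using cmpa_reassoc[OF Gg(1), of "?Gf \<boxtimes> ida C b"] Gf(2) Gg(2) b o ev h fg by simp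
    also have "\<dots> = (?g \<cdot> ?f) \<cdot> ev a"
      using Gf(1) fg o ev by simp
    finally have "tr (hh a) ((?g \<cdot> ?f) \<cdot> ev a) = ?Gg \<cdot> ?Gf"
      using o h ev fg Gf(2) Gg(2) by (intro tr_eq) auto
    moreover have "(hh a, fMap G a c (Cmp C a a' c g f), hh c) = tr (hh a) ((?g \<cdot> ?f) \<cdot> ev a)"
      using Gq[OF o(1,3) cmp_hom[OF o]] by (simp add: cmpa_def)
    ultimately show "fMap G a c (Cmp C a a' c g f) = Cmp C (fOb G a) (fOb G a') (fOb G c) (fMap G a' c g) (fMap G a a' f)"
      by (simp add: cmpa_def G_def)
  qed
  define \<phi> where "\<phi> a c f = raw (tr a (a \<otimes> b, f, c))" for a c f
  have phi: "(a, \<phi> a c f, hh c) = tr a (a \<otimes> b, f, c)" "(a, \<phi> a c f, hh c) \<in> arr C"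
    "ev c \<cdot> ((a, \<phi> a c f, hh c) \<boxtimes> ida C b) = (a \<otimes> b, f, c)"
    if "a \<in> Obj C" "c \<in> Obj C" "f \<in> Hom C (a \<otimes> b) c" for a c f
  proof -
    have f: "(a \<otimes> b, f, c) \<in> arr C" using that b by (intro q) auto
    then show "(a, \<phi> a c f, hh c) = tr a (a \<otimes> b, f, c)"
      using tr[OF that(1) f] by (simp add: \<phi>_def prod_eq_iff)
    then show "(a, \<phi> a c f, hh c) \<in> arr C" "ev c \<cdot> ((a, \<phi> a c f, hh c) \<boxtimes> ida C b) = (a \<otimes> b, f, c)"
      using tr[OF that(1) f] by simp_all
  qed
  have "right_adjoint C C (tensor_right C b) G"
    unfolding right_adjoint_def
  proof (intro conjI tensor_right_functor[OF b] G exI[of _ \<phi>] ballI)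
    fix a c assume o: "a \<in> Obj C" "c \<in> Obj C"
    have "bij_betw (\<phi> a c) (Hom C (a \<otimes> b) c) (Hom C a (hh c))"
    proof (rule bij_betw_imageI)
      show "inj_on (\<phi> a c) (Hom C (a \<otimes> b) c)"
        by (rule inj_onI) (metis phi(3)[OF o] prod.inject)
      show "\<phi> a c ` Hom C (a \<otimes> b) c = Hom C a (hh c)"
      proof (intro equalityI subsetI)
        fix k assume "k \<in> \<phi> a c ` Hom C (a \<otimes> b) c"
        then show "k \<in> Hom C a (hh c)" using phi(2)[OF o] hom by auto
      next
        fix k assume "k \<in> Hom C a (hh c)"
        then have k: "(a, k, hh c) \<in> arr C" using o h by (intro q) auto
        let ?g = "ev c \<cdot> ((a, k, hh c) \<boxtimes> ida C b)"
        have g: "?g \<in> arr C" "?g = (a \<otimes> b, raw ?g, c)" using k o ev h b by (simp_all add: prod_eq_iff)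
        then have "raw ?g \<in> Hom C (a \<otimes> b) c" using hom by metis
        moreover have "tr a ?g = (a, k, hh c)" using k o ev h b by (intro tr_eq) simp_all
        then have "\<phi> a c (raw ?g) = k" using g(2) by (metis \<phi>_def fst_conv snd_conv)
        ultimately show "k \<in> \<phi> a c ` Hom C (a \<otimes> b) c" by (metis imageI)
      qed
    qed
    then show "bij_betw (\<phi> a c) (Hom C (fOb (tensor_right C b) a) c) (Hom C a (fOb G c))"
      by (simp add: tensor_right_def G_def)
  next
    fix a a' c c' p r f
    assume "a \<in> Obj C" "a' \<in> Obj C" "c \<in> Obj C" "c' \<in> Obj C" "p \<in> Hom C a' a" "r \<in> Hom C c c'"
      "f \<in> Hom C (fOb (tensor_right C b) a) c"
    then have o: "a \<in> Obj C" "a' \<in> Obj C" "c \<in> Obj C" "c' \<in> Obj C" "p \<in> Hom C a' a" "r \<in> Hom C c c'" "f \<in> Hom C (a \<otimes> b) c"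
      by (simp_all add: tensor_right_def)
    let ?p = "(a', p, a)" and ?r = "(c, r, c')" and ?f = "(a \<otimes> b, f, c)" and ?Gr = "(hh c, fMap G c c' r, hh c')"
    let ?k = "(a, \<phi> a c f, hh c)"
    have m: "?p \<in> arr C" "?r \<in> arr C" "?f \<in> arr C" using o b q by auto
    note k = phi(2,3)[OF o(1,3,7)] and Gr = Gq_ev[OF o(3,4,6)]
    let ?g = "?r \<cdot> ?f \<cdot> (?p \<boxtimes> ida C b)"
    have "ev c' \<cdot> ((?Gr \<cdot> ?k \<cdot> ?p) \<boxtimes> ida C b) = ev c' \<cdot> (?Gr \<boxtimes> ida C b) \<cdot> (?k \<boxtimes> ida C b) \<cdot> (?p \<boxtimes> ida C b)"
      using Gr(2) k(1) m b by (simp add: tena_cmp_id)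
    also have "\<dots> = ?r \<cdot> ev c \<cdot> (?k \<boxtimes> ida C b) \<cdot> (?p \<boxtimes> ida C b)"
      using cmpa_reassoc[OF Gr(1), of "(?k \<boxtimes> ida C b) \<cdot> (?p \<boxtimes> ida C b)"] Gr(2) k(1) m b o ev h by simp
    also have "\<dots> = ?g"
      using cmpa_reassoc[OF k(2), of "?p \<boxtimes> ida C b"] k(1) m b o ev h by simp
    finally have "tr a' ?g = ?Gr \<cdot> ?k \<cdot> ?p"
      using o h ev m k(1) Gr(2) b by (intro tr_eq) auto
    moreover have "?g = (a' \<otimes> b, Cmp C (a' \<otimes> b) c c' r (Cmp C (a' \<otimes> b) (a \<otimes> b) c f (tenm C a' a b b p (Idm C b))), c')"
      by (simp add: cmpa_def tena_def ida_def)
    ultimately have "raw (tr a' (a' \<otimes> b, Cmp C (a' \<otimes> b) c c' r (Cmp C (a' \<otimes> b) (a \<otimes> b) c f (tenm C a' a b b p (Idm C b))), c'))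
      = raw (?Gr \<cdot> ?k \<cdot> ?p)" by simp
    then have "\<phi> a' c' (Cmp C (a' \<otimes> b) c c' r (Cmp C (a' \<otimes> b) (a \<otimes> b) c f (tenm C a' a b b p (Idm C b))))
      = Cmp C a' (hh c) (hh c') (fMap G c c' r) (Cmp C a' a (hh c) (\<phi> a c f) p)"
      unfolding \<phi>_def[of a'] by (simp add: cmpa_def)
    then show "\<phi> a' c' (Cmp C (fOb (tensor_right C b) a') c c' r
          (Cmp C (fOb (tensor_right C b) a') (fOb (tensor_right C b) a) c f (fMap (tensor_right C b) a' a p)))
       = Cmp C a' (fOb G c) (fOb G c') (fMap G c c' r) (Cmp C a' a (fOb G c) (\<phi> a c f) p)"
      by (simp add: tensor_right_def G_def)
  qed
  then show ?thesis by blast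
qed

text \<open>The evaluation is the map that corresponds to the identity of \<open>G c\<close>.\<close>

lemma internal_hom_if_right_adjoint:
  assumes b: "b \<in> Obj C" and c: "c \<in> Obj C" and ra: "right_adjoint C C (tensor_right C b) G"
  shows "\<exists>h ev. internal_hom b c h ev"
proof -
  interpret G: is_functor C C G using ra by (simp add: right_adjoint_def)
  obtain \<phi> where bij: "\<And>a c. a \<in> Obj C \<Longrightarrow> c \<in> Obj C \<Longrightarrow> bij_betw (\<phi> a c) (Hom C (a \<otimes> b) c) (Hom C a (fOb G c))"
    and nat: "\<And>a a' c c' p q f. a \<in> Obj C \<Longrightarrow> a' \<in> Obj C \<Longrightarrow> c \<in> Obj C \<Longrightarrow> c' \<in> Obj C \<Longrightarrow> p \<in> Hom C a' a \<Longrightarrow>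
      q \<in> Hom C c c' \<Longrightarrow> f \<in> Hom C (a \<otimes> b) c \<Longrightarrow>
      \<phi> a' c' (Cmp C (a' \<otimes> b) c c' q (Cmp C (a' \<otimes> b) (a \<otimes> b) c f (tenm C a' a b b p (Idm C b))))
            = Cmp C a' (fOb G c) (fOb G c') (fMap G c c' q) (Cmp C a' a (fOb G c) (\<phi> a c f) p)"
    using ra unfolding right_adjoint_def tensor_right_def func.simps by blast
  let ?h = "fOb G c"
  have h: "?h \<in> Obj C" using c G.functor_obj by simp
  have "Idm C ?h \<in> \<phi> ?h c ` Hom C (?h \<otimes> b) c"
    using bij_betw_imp_surj_on[OF bij[OF h c]] idm_hom[OF h] by simp
  then obtain e where e: "e \<in> Hom C (?h \<otimes> b) c" "\<phi> ?h c e = Idm C ?h" by auto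
  let ?ev = "(?h \<otimes> b, e, c)"
  have ev: "?ev \<in> arr C" using e h b c by (simp add: arr_def del: arr_obj)
  have key: "raw (?ev \<cdot> (f \<boxtimes> ida C b)) \<in> Hom C (src f \<otimes> b) c \<and> \<phi> (src f) c (raw (?ev \<cdot> (f \<boxtimes> ida C b))) = raw f"
    if f: "f \<in> arr C" "trg f = ?h" for f
  proof -
    have m: "raw f \<in> Hom C (src f) ?h" "src f \<in> Obj C" using f by (auto simp: arr_def simp del: arr_obj)
    have "?ev \<cdot> (f \<boxtimes> ida C b) \<in> arr C" using f ev b by simp
    then have 1: "raw (?ev \<cdot> (f \<boxtimes> ida C b)) \<in> Hom C (src f \<otimes> b) c" by (simp add: arr_def del: arr_obj)
    have "raw (?ev \<cdot> (f \<boxtimes> ida C b)) = Cmp C (src f \<otimes> b) (?h \<otimes> b) c e (tenm C (src f) ?h b b (raw f) (Idm C b))"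
      using f by (simp add: cmpa_def tena_def ida_def)
    then have "\<phi> (src f) c (raw (?ev \<cdot> (f \<boxtimes> ida C b)))
      = \<phi> (src f) c (Cmp C (src f \<otimes> b) c c (Idm C c) (Cmp C (src f \<otimes> b) (?h \<otimes> b) c e (tenm C (src f) ?h b b (raw f) (Idm C b))))"
      using 1 m b c by (simp add: cmp_id_left)
    also have "\<dots> = raw f"
      using nat[OF h m(2) c c m(1) idm_hom[OF c] e(1)] e(2) m h c by (simp add: G.functor_id cmp_id_left)
    finally show ?thesis using 1 by simp
  qed
  have "internal_hom b c ?h ?ev"
    unfolding internal_hom_def
  proof (intro conjI ballI impI h ev)
    fix a g assume g: "a \<in> Obj C" "g \<in> arr C" "src g = a \<otimes> b" "trg g = c"
    have gr: "raw g \<in> Hom C (a \<otimes> b) c" using g by (auto simp: arr_def simp del: arr_obj)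
    let ?f = "(a, \<phi> a c (raw g), ?h)"
    have "\<phi> a c (raw g) \<in> Hom C a ?h" using bij_betw_apply[OF bij[OF g(1) c] gr] .
    then have f: "?f \<in> arr C" using g(1) h by (simp add: arr_def del: arr_obj)
    have "raw (?ev \<cdot> (?f \<boxtimes> ida C b)) = raw g"
      using key[OF f] gr bij_betw_imp_inj_on[OF bij[OF g(1) c]] by (auto dest: inj_onD)
    then have fg: "?ev \<cdot> (?f \<boxtimes> ida C b) = g" using g by (simp add: prod_eq_iff)
    show "\<exists>!f. f \<in> arr C \<and> src f = a \<and> trg f = ?h \<and> ?ev \<cdot> (f \<boxtimes> ida C b) = g"
    proof (rule ex1I[of _ ?f])
      show "?f \<in> arr C \<and> src ?f = a \<and> trg ?f = ?h \<and> ?ev \<cdot> (?f \<boxtimes> ida C b) = g" using f fg by simp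
      fix k assume k: "k \<in> arr C \<and> src k = a \<and> trg k = ?h \<and> ?ev \<cdot> (k \<boxtimes> ida C b) = g"
      then have "raw k = \<phi> a c (raw g)" using key[of k] by auto
      then show "k = ?f" using k by (simp add: prod_eq_iff)
    qed
  qed simp_all
  then show ?thesis by blast
qed

lemma closed_iff: "closed_skmon C \<longleftrightarrow> (\<forall>b \<in> Obj C. \<forall>c \<in> Obj C. \<exists>h ev. internal_hom b c h ev)"
  unfolding closed_skmon_def using right_adjoint_if_internal_hom internal_hom_if_right_adjoint by blast

end

section \<open>Representable closed short multicategories give closed monoidal categories\<close>

context left_representable_pm begin

interpretation X: category X by (rule category_X)

lemma isoa_A: "isoa A f \<longleftrightarrow> isoa X f"
  by (simp add: isoa_def)

text \<open>
  If \<open>\<theta>\<^sub>b\<^sub>,\<^sub>c\<close> classifies also in the second input, after \<open>a\<close>, then \<open>\<theta>\<^sub>a\<^sub>,\<^sub>b\<^sub>c\<close> and \<open>\<theta>\<^sub>b\<^sub>,\<^sub>c\<close> together are universal for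
  \<open>a, b, c\<close>, as are \<open>\<theta>\<^sub>a\<^sub>b\<^sub>,\<^sub>c\<close> and \<open>\<theta>\<^sub>a\<^sub>,\<^sub>b\<close>; \<open>\<alpha>\<close> compares them. Likewise \<open>\<rho>\<close> compares \<open>\<theta>\<^sub>a\<^sub>,\<^sub>\<i>\<close> and \<open>u\<close> with the identity of \<open>a\<close>.
\<close>

lemma monoidal_A:
  assumes th: "\<And>a b c d. a \<in> Obj X \<Longrightarrow> b \<in> Obj X \<Longrightarrow> c \<in> Obj X \<Longrightarrow> d \<in> Obj X \<Longrightarrow> precomp_bij (th b c) [a] [] d"
    and uu: "\<And>a d. a \<in> Obj X \<Longrightarrow> d \<in> Obj X \<Longrightarrow> precomp_bij uu [a] [] d"
  shows "monoidal A"
proof -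
  have "isoa X (alpa A a b c)" if o: "a \<in> Obj X" "b \<in> Obj X" "c \<in> Obj X" for a b c
  proof -
    let ?ab = "clOb t a b" and ?bc = "clOb t b c"
    have "\<exists>F \<in> mar. src F = [a] @ trg (th b c) # [] \<and> trg F = clOb t ?ab c \<and>
       F \<odot>[length [a]] th b c = th ?ab c \<odot>[0] th a b"
      by (rule precomp_bijD(2)[OF th]) (use o in simp_all)
    then obtain F where F: "F \<in> mar" "src F = [a, ?bc]" "trg F = clOb t ?ab c" "F \<odot>[Suc 0] th b c = th ?ab c \<odot>[0] th a b"
      by auto
    obtain K where "K \<in> mar" "src K = [clOb t a ?bc]" "trg K = clOb t ?ab c" "K \<odot>[0] th a ?bc = F"
      using theta_ex[of F a ?bc "[]"] F by auto
    then obtain k where k: "k \<in> arr X" "src k = clOb t a ?bc" "trg k = clOb t ?ab c" "una k \<odot>[0] th a ?bc = F"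
      using una_ex[of K] by metis
    have al: "alpa A a b c \<in> arr X" using o by (simp add: alpa_law)
    have "una (cmpa X k (alpa A a b c)) \<odot>[0] th ?ab c = una (ida X (clOb t ?ab c)) \<odot>[0] th ?ab c"
      by (rule theta_inj[where a = a and b = b and xs = "[c]"]) (use o k F in \<open>simp_all add: nf\<close>)
    then have 1: "una (cmpa X k (alpa A a b c)) = una (ida X (clOb t ?ab c))"
      by (rule theta_inj[where a = ?ab and b = c and xs = "[]"]) (use o k in \<open>simp_all add: nf\<close>)
    have "una (cmpa X (alpa A a b c) k) \<odot>[0] th a ?bc = una (alpa A a b c) \<odot>[0] F"
      using k al o una_cmp_msub[of k "alpa A a b c" "th a ?bc"] by simp
    moreover have "una (alpa A a b c) \<odot>[0] F = th a ?bc"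
    proof (rule precomp_bijD(1)[OF th])
      have "una (alpa A a b c) \<odot>[0] F \<odot>[Suc 0] th b c = una (alpa A a b c) \<odot>[0] (F \<odot>[Suc 0] th b c)"
        using o F al nested[of "una (alpa A a b c)" F "th b c" 0 "Suc 0"] by simp
      also have "\<dots> = th a ?bc \<odot>[Suc 0] th b c" unfolding F(4) using o by (simp add: nf)
      finally show "una (alpa A a b c) \<odot>[0] F \<odot>[length [a]] th b c = th a ?bc \<odot>[length [a]] th b c" by simp
    qed (use o F al in simp_all)
    ultimately have "una (cmpa X (alpa A a b c) k) \<odot>[0] th a ?bc = una (ida X (clOb t a ?bc)) \<odot>[0] th a ?bc"
      using o by simp
    then have 2: "una (cmpa X (alpa A a b c) k) = una (ida X (clOb t a ?bc))"
      by (rule theta_inj[where a = a and b = ?bc and xs = "[]"]) (use o k in \<open>simp_all add: nf\<close>)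
    show ?thesis unfolding isoa_def using 1 2 k al by (auto intro!: bexI[of _ k])
  qed
  moreover have "isoa X (rhoa A a)" if o: "a \<in> Obj X" for a
  proof -
    let ?i = "clUnit t"
    have "\<exists>F \<in> mar. src F = [a] @ trg uu # [] \<and> trg F = a \<and> F \<odot>[length [a]] uu = una (ida X a)"
      by (rule precomp_bijD(2)[OF uu]) (use o in simp_all)
    then obtain F where F: "F \<in> mar" "src F = [a, ?i]" "trg F = a" "F \<odot>[Suc 0] uu = una (ida X a)" by auto
    obtain K where "K \<in> mar" "src K = [clOb t a ?i]" "trg K = a" "K \<odot>[0] th a ?i = F"
      using theta_ex[of F a ?i "[]"] F by auto
    then obtain k where k: "k \<in> arr X" "src k = clOb t a ?i" "trg k = a" "una k \<odot>[0] th a ?i = F"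
      using una_ex[of K] by metis
    have rh: "rhoa A a \<in> arr X" using o by (simp add: rhoa_law)
    have 1: "una (cmpa X k (rhoa A a)) = una (ida X a)" using o k F by (simp add: nf)
    have "una (cmpa X (rhoa A a) k) \<odot>[0] th a ?i = una (rhoa A a) \<odot>[0] F"
      using k rh o una_cmp_msub[of k "rhoa A a" "th a ?i"] by simp
    moreover have "una (rhoa A a) \<odot>[0] F = th a ?i"
    proof (rule precomp_bijD(1)[OF uu])
      have "una (rhoa A a) \<odot>[0] F \<odot>[Suc 0] uu = una (rhoa A a) \<odot>[0] (F \<odot>[Suc 0] uu)"
        using o F rh nested[of "una (rhoa A a)" F uu 0 "Suc 0"] by simp
      also have "\<dots> = th a ?i \<odot>[Suc 0] uu" unfolding F(4) using o rh by (simp add: rhoa_law(2))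
      finally show "una (rhoa A a) \<odot>[0] F \<odot>[length [a]] uu = th a ?i \<odot>[length [a]] uu" by simp
    qed (use o F rh in simp_all)
    ultimately have "una (cmpa X (rhoa A a) k) \<odot>[0] th a ?i = una (ida X (clOb t a ?i)) \<odot>[0] th a ?i"
      using o by simp
    then have 2: "una (cmpa X (rhoa A a) k) = una (ida X (clOb t a ?i))"
      by (rule theta_inj[where a = a and b = ?i and xs = "[]"]) (use o k in \<open>simp_all add: nf\<close>)
    show ?thesis unfolding isoa_def using 1 2 k rh by (auto intro!: bexI[of _ k])
  qed
  ultimately show ?thesis
    using left_normal_A skew_monoidal_A unfolding monoidal_def left_normal_def
    by (simp add: iso_map_isoa isoa_A alpa_def rhoa_def)
qed

text \<open>The universal map \<open>E : h, b \<rightarrow> c\<close> factors through \<open>\<theta>\<close> as an evaluation \<open>h b \<rightarrow> c\<close>.\<close>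

lemma closed_A:
  assumes "\<And>b c. b \<in> Obj X \<Longrightarrow> c \<in> Obj X \<Longrightarrow> \<exists>E \<in> mar. \<exists>h. src E = [h, b] \<and> trg E = c \<and>
     (\<forall>a \<in> Obj X. \<forall>H \<in> mar. src H = [a, b] \<longrightarrow> trg H = c \<longrightarrow>
       (\<exists>!f. f \<in> arr X \<and> src f = a \<and> trg f = h \<and> E \<odot>[0] una f = H))"
  shows "closed_skmon A"
proof -
  show ?thesis
    unfolding skew_monoidal.closed_iff[OF skew_monoidal_A] A_simps
  proof (intro ballI)
    fix b c assume o: "b \<in> Obj X" "c \<in> Obj X"
    then obtain E h where E: "E \<in> mar" "src E = [h, b]" "trg E = c"
      and u: "\<forall>a \<in> Obj X. \<forall>H \<in> mar. src H = [a, b] \<longrightarrow> trg H = c \<longrightarrow>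
       (\<exists>!f. f \<in> arr X \<and> src f = a \<and> trg f = h \<and> E \<odot>[0] una f = H)"
      using assms[of b c] by blast
    have h: "h \<in> Obj X" using mar_objs(1)[OF E(1)] E(2) by simp
    obtain V where "V \<in> mar" "src V = [clOb t h b]" "trg V = c" "V \<odot>[0] th h b = E"
      using theta_ex[of E h b "[]"] E by auto
    then obtain ev where ev: "ev \<in> arr X" "src ev = clOb t h b" "trg ev = c" "una ev \<odot>[0] th h b = E"
      using una_ex[of V] by metis
    have eq: "cmpa X ev (tena A f (ida X b)) = g \<longleftrightarrow> E \<odot>[0] una f = una g \<odot>[0] th a b"
      if f: "f \<in> arr X" "src f = a" "trg f = h" "g \<in> arr X" "src g = clOb t a b" "trg g = c" for f a g
    proof -
      have a: "a \<in> Obj X" using f by auto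
      have t: "tena A f (ida X b) \<in> arr X" "src (tena A f (ida X b)) = clOb t a b" "trg (tena A f (ida X b)) = clOb t h b"
        using f o by (auto simp: tena_law)
      have "una (cmpa X ev (tena A f (ida X b))) \<odot>[0] th a b = una ev \<odot>[0] (una (tena A f (ida X b)) \<odot>[0] th a b)"
        using t ev a o by (intro una_cmp_msub) auto
      also have "\<dots> = una ev \<odot>[0] th h b \<odot>[0] una f"
        using f o a h ev by (simp add: tena_law' nested)
      finally have 1: "una (cmpa X ev (tena A f (ida X b))) \<odot>[0] th a b = E \<odot>[0] una f" using ev by simp
      have "una (cmpa X ev (tena A f (ida X b))) \<odot>[0] th a b = una g \<odot>[0] th a b \<Longrightarrow> una (cmpa X ev (tena A f (ida X b))) = una g"
        by (rule theta_inj[where a = a and b = b and xs = "[]"]) (use f t ev a o in simp_all)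
      then show ?thesis using 1 by auto
    qed
    have "A.internal_hom b c h ev"
      unfolding skew_monoidal.internal_hom_def[OF skew_monoidal_A] A_simps A_arr
    proof (intro conjI ballI impI h ev)
      fix a g assume g: "a \<in> Obj X" "g \<in> arr X" "src g = clOb t a b" "trg g = c"
      have H: "una g \<odot>[0] th a b \<in> mar" using g o by simp
      then have "\<exists>!f. f \<in> arr X \<and> src f = a \<and> trg f = h \<and> E \<odot>[0] una f = una g \<odot>[0] th a b"
        using u g by simp
      moreover have "(f \<in> arr X \<and> src f = a \<and> trg f = h \<and> E \<odot>[0] una f = una g \<odot>[0] th a b)
         = (f \<in> arr X \<and> src f = a \<and> trg f = h \<and> cmpa X ev (tena A f (ida X b)) = g)" for f
        using eq[of f a g] g by blast
      ultimately show "\<exists>!f. f \<in> arr X \<and> src f = a \<and> trg f = h \<and> cmpa X ev (tena A f (ida X b)) = g" by simp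
    qed
    then show "\<exists>h ev. A.internal_hom b c h ev" by blast
  qed
qed

end

lemma monoidal_closed_short:
  assumes C: "short_multicategory C" and t: "left_classifiers C t" and rep: "representable C" and cl: "closed_short C"
  shows "monoidal (skew_of (cat.truncate C) (gsub C) t)" "closed_skmon (skew_of (cat.truncate C) (gsub C) t)"
proof -
  interpret short_multicategory C by (rule C)
  interpret L: left_representable_pm "cat.truncate C" "Mul C" "gsub C" short_ok t
    by (rule left_representable_short[OF C t])
  \<comment> \<open>the maps that witness representability may differ from the chosen ones, so universality is transferred\<close>
  obtain s where s: "classifier_data C s"
    and bij: "\<And>xs ys d. xs \<in> lists (Obj C) \<Longrightarrow> ys \<in> lists (Obj C) \<Longrightarrow> d \<in> Obj C \<Longrightarrow> length xs + 1 + length ys \<in> {1, 2, 3} \<Longrightarrow>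
            bij_betw (\<lambda>f. gsub C xs (clUnit s) ys [] d f (clU s)) (Mul C (xs @ clUnit s # ys) d) (Mul C (xs @ ys) d)
            \<and> (\<forall>a \<in> Obj C. \<forall>b \<in> Obj C.
                bij_betw (\<lambda>f. gsub C xs (clOb s a b) ys [a, b] d f (clTheta s a b))
                  (Mul C (xs @ clOb s a b # ys) d) (Mul C (xs @ a # b # ys) d))"
    using rep unfolding representable_def by blast
  let ?th = "\<lambda>a b. ([a, b], clTheta s a b, clOb s a b)" and ?u = "([], clU s, clUnit s)"
  have sm: "?th a b \<in> L.mar" if "a \<in> Obj C" "b \<in> Obj C" for a b
    using s that by (simp add: classifier_data_def L.mar_def)
  have um: "?u \<in> L.mar" using s by (simp add: classifier_data_def L.mar_def)
  have b1: "L.precomp_bij (?th a b) xs ys d"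
    if "a \<in> Obj C" "b \<in> Obj C" "xs \<in> lists (Obj C)" "ys \<in> lists (Obj C)" "d \<in> Obj C" "length xs + 1 + length ys \<in> {1, 2, 3}" for a b xs ys d
    using bij[OF that(3-6)] that(1,2) by (simp add: L.precomp_bij_def)
  have b2: "L.precomp_bij ?u xs ys d"
    if "xs \<in> lists (Obj C)" "ys \<in> lists (Obj C)" "d \<in> Obj C" "length xs + 1 + length ys \<in> {1, 2, 3}" for xs ys d
    using bij[OF that] by (simp add: L.precomp_bij_def)
  show "monoidal (skew_of (cat.truncate C) (gsub C) t)"
  proof (rule L.monoidal_A)
    fix a b c d assume o: "a \<in> Obj (cat.truncate C)" "b \<in> Obj (cat.truncate C)" "c \<in> Obj (cat.truncate C)" "d \<in> Obj (cat.truncate C)"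
    show "L.precomp_bij (L.th b c) [a] [] d"
      by (rule L.precomp_bij_transfer[of _ "?th b c"])
        (use o sm b1[of b c "[]" "[]"] b1[of b c "[a]" "[]" d] L.precomp_bij_th[of b c "[]"] in simp_all)
  next
    fix a d assume o: "a \<in> Obj (cat.truncate C)" "d \<in> Obj (cat.truncate C)"
    show "L.precomp_bij L.uu [a] [] d"
      by (rule L.precomp_bij_transfer[of _ ?u])
        (use o um b2[of "[]" "[]"] b2[of "[a]" "[]" d] L.precomp_bij_uu[of "[]"] in simp_all)
  qed
  show "closed_skmon (skew_of (cat.truncate C) (gsub C) t)"
  proof (rule L.closed_A)
    fix b c assume o: "b \<in> Obj (cat.truncate C)" "c \<in> Obj (cat.truncate C)"
    obtain h e where h: "h \<in> Obj C" "e \<in> Mul C [h, b] c"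
      and bij': "\<forall>xs \<in> lists (Obj C). length xs \<in> {0, 1, 2, 3} \<longrightarrow>
       bij_betw (\<lambda>f. gsub C [] h [b] xs c e f) (Mul C xs h) (Mul C (xs @ [b]) c)"
      using cl o unfolding closed_short_def truncate_simps by blast
    let ?E = "([h, b], e, c)"
    have E: "?E \<in> L.mar" using h o by (simp add: L.mar_def)
    have "\<exists>!f. f \<in> arr (cat.truncate C) \<and> src f = a \<and> trg f = h \<and> L.msub ?E 0 (una f) = H"
      if a: "a \<in> Obj C" "H \<in> L.mar" "src H = [a, b]" "trg H = c" for a H
    proof -
      have bij1: "bij_betw (\<lambda>f. gsub C [] h [b] [a] c e f) (Mul C [a] h) (Mul C [a, b] c)"
        using bij'[rule_format, of "[a]"] a(1) by simp
      have sub: "L.msub ?E 0 (una f) = ([src f, b], gsub C [] h [b] [src f] c e (raw f), c)" for f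
        by (simp add: L.msub_def)
      have arr: "f \<in> arr (cat.truncate C) \<longleftrightarrow> raw f \<in> Mul C [a] h" if "src f = a" "trg f = h" for f
        using that a(1) h(1) by (simp add: arr_def mul_unary del: arr_obj)
      have "raw H \<in> Mul C [a, b] c" using L.mar_objs(4)[OF a(2)] a by simp
      then have "raw H \<in> (\<lambda>f. gsub C [] h [b] [a] c e f) ` Mul C [a] h" using bij_betw_imp_surj_on[OF bij1] by simp
      then obtain f where f: "f \<in> Mul C [a] h" "gsub C [] h [b] [a] c e f = raw H" by auto
      show ?thesis
      proof (rule ex1I[of _ "(a, f, h)"])
        show "(a, f, h) \<in> arr (cat.truncate C) \<and> src (a, f, h) = a \<and> trg (a, f, h) = h \<and> L.msub ?E 0 (una (a, f, h)) = H"
          using f a arr[of "(a, f, h)"] by (simp add: sub prod_eq_iff)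
        fix k assume k: "k \<in> arr (cat.truncate C) \<and> src k = a \<and> trg k = h \<and> L.msub ?E 0 (una k) = H"
        then have "raw k \<in> Mul C [a] h" "gsub C [] h [b] [a] c e (raw k) = raw H"
          using arr[of k] sub[of k] by (auto simp: prod_eq_iff)
        then have "raw k = f" using f bij_betw_imp_inj_on[OF bij1] by (metis inj_onD)
        then show "k = (a, f, h)" using k by (simp add: prod_eq_iff)
      qed
    qed
    then show "\<exists>E \<in> L.mar. \<exists>h. src E = [h, b] \<and> trg E = c \<and>
     (\<forall>a \<in> Obj (cat.truncate C). \<forall>H \<in> L.mar. src H = [a, b] \<longrightarrow> trg H = c \<longrightarrow>
       (\<exists>!f. f \<in> arr (cat.truncate C) \<and> src f = a \<and> trg f = h \<and> L.msub E 0 (una f) = H))"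
      using E by (intro bexI[of _ ?E] exI[of _ h]) simp_all
  qed
qed

section \<open>Universal multimaps in the multicategory of a skew monoidal category\<close>

context category begin

lemma isoa_inverse:
  assumes "isoa C l"
  obtains l' where "isoa C l'" "src l' = trg l" "trg l' = src l" "cmpa C l' l = ida C (src l)" "cmpa C l l' = ida C (trg l)"
proof -
  obtain g where g: "g \<in> arr C" "src g = trg l" "trg g = src l" "cmpa C g l = ida C (src l)" "cmpa C l g = ida C (trg l)"
    using isoa_obtain[OF assms] .
  then have "isoa C g" unfolding isoa_def using isoa_arr[OF assms] by auto
  then show ?thesis using that g by blast
qed

lemma isoa_precomp_bij:
  assumes w: "isoa C w" "src w = s" "trg w = s'" and b: "b \<in> Obj C"
  shows "bij_betw (\<lambda>f. raw (cmpa C (s', f, b) w)) (Hom C s' b) (Hom C s b)"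
proof -
  obtain v where v: "isoa C v" "src v = s'" "trg v = s" "cmpa C v w = ida C s" "cmpa C w v = ida C s'"
    using isoa_inverse[OF w(1)] w by metis
  have a: "w \<in> arr C" "v \<in> arr C" using w v isoa_arr by auto
  have o: "s \<in> Obj C" "s' \<in> Obj C" using a w by auto
  have t: "(x, f, b) \<in> arr C \<longleftrightarrow> f \<in> Hom C x b" if "x \<in> Obj C" for x f
    using that b by (simp add: arr_def del: arr_obj)
  have e: "cmpa C (x, f, b) k = (src k, raw (cmpa C (x, f, b) k), b)" for x f k
    by (simp add: prod_eq_iff)
  have c: "raw (cmpa C (trg k, f, b) k) \<in> Hom C (src k) b" if "k \<in> arr C" "f \<in> Hom C (trg k) b" for k f
    using cmpa_arr[of k "(trg k, f, b)"] that t[of "trg k" f] t[of "src k"] e[of "trg k" f k] by (metis arr_obj fst_conv)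
  show ?thesis
  proof (rule bij_betw_byWitness[where f' = "\<lambda>f. raw (cmpa C (s, f, b) v)"])
    show "\<forall>f \<in> Hom C s' b. raw (cmpa C (s, raw (cmpa C (s', f, b) w), b) v) = f"
    proof
      fix f assume f: "f \<in> Hom C s' b"
      have "cmpa C (cmpa C (s', f, b) w) v = (s', f, b)" using f a w v t[OF o(2)] by simp
      then show "raw (cmpa C (s, raw (cmpa C (s', f, b) w), b) v) = f" using e[of s' f w] w by simp
    qed
    show "\<forall>f \<in> Hom C s b. raw (cmpa C (s', raw (cmpa C (s, f, b) v), b) w) = f"
    proof
      fix f assume f: "f \<in> Hom C s b"
      have "cmpa C (cmpa C (s, f, b) v) w = (s, f, b)" using f a w v t[OF o(1)] by simp
      then show "raw (cmpa C (s', raw (cmpa C (s, f, b) v), b) w) = f" using e[of s f v] v by simp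
    qed
  qed (use c[of w] c[of v] a w v in auto)
qed

end

context skew_monoidal begin

lemma isoa_tena:
  assumes "isoa C f" "isoa C g" shows "isoa C (f \<boxtimes> g)"
proof -
  obtain f' where f': "isoa C f'" "src f' = trg f" "trg f' = src f" "f' \<cdot> f = ida C (src f)" "f \<cdot> f' = ida C (trg f)"
    using isoa_inverse[OF assms(1)] .
  obtain g' where g': "isoa C g'" "src g' = trg g" "trg g' = src g" "g' \<cdot> g = ida C (src g)" "g \<cdot> g' = ida C (trg g)"
    using isoa_inverse[OF assms(2)] .
  have a: "f \<in> arr C" "g \<in> arr C" "f' \<in> arr C" "g' \<in> arr C" using assms f' g' isoa_arr by auto
  show ?thesis
    unfolding isoa_def using a f' g' tena_cmp[of f g f' g'] tena_cmp[of f' g' f g]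
    by (intro conjI bexI[of _ "f' \<boxtimes> g'"]) simp_all
qed

lemma isoa_act: "isoa C f \<Longrightarrow> as \<in> lists (Obj C) \<Longrightarrow> isoa C (act f as)"
proof (induction as arbitrary: f)
  case (Cons a as)
  have "isoa C (f \<boxtimes> ida C a)" using Cons.prems by (intro isoa_tena isoa_ida) simp_all
  then show ?case using Cons by simp
qed simp

lemma left_normal_isoa: "left_normal C \<longleftrightarrow> (\<forall>a \<in> Obj C. isoa C (lama C a))"
  by (simp add: left_normal_def iso_map_isoa lama_def)

text \<open>
  By \<open>wh_unit\<close> this whiskering is \<open>g\<close> composed with the inverse of \<open>\<lambda>\<close>. Left normality therefore suffices for
  universality in the first input.
\<close>

lemma isoa_wh_unit:
  assumes ln: "left_normal C" and g: "isoa C g" "src g = tens \<i> as" "as \<in> lists (Obj C)"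
  shows "isoa C (wh \<i> as g)"
proof -
  have ga: "g \<in> arr C" using g isoa_arr by auto
  then have l: "isoa C (lama C (trg g))" using ln left_normal_isoa by auto
  obtain l' where l': "isoa C l'" "src l' = trg g" "trg l' = \<i> \<otimes> trg g" "l' \<cdot> lama C (trg g) = ida C (\<i> \<otimes> trg g)"
    using isoa_inverse[OF l] by (metis fst_conv snd_conv lama_def)
  have "l' \<cdot> g = l' \<cdot> lama C (trg g) \<cdot> wh \<i> as g" using wh_unit[OF ga g(2,3)] by simp
  also have "\<dots> = wh \<i> as g"
    using cmpa_reassoc[OF l'(4), of "wh \<i> as g"] isoa_arr[OF l'(1)] isoa_arr[OF l] l' ga g by simp
  finally show ?thesis using isoa_cmp[OF g(1) l'(1)] l' by simp
qed

lemma monoidal_isoa: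
  "monoidal C \<longleftrightarrow> left_normal C \<and> (\<forall>a \<in> Obj C. \<forall>b \<in> Obj C. \<forall>c \<in> Obj C. isoa C (alpa C a b c)) \<and> (\<forall>a \<in> Obj C. isoa C (rhoa C a))"
  using skew_monoidal_axioms by (auto simp: monoidal_def left_normal_def iso_map_isoa alpa_def rhoa_def)

lemma isoa_bet:
  assumes "monoidal C" "isoa C f" "trg f = x \<otimes> y" "x \<in> Obj C" "y \<in> Obj C" "as \<in> lists (Obj C)"
  shows "isoa C (bet x y f as)"
  using assms(2-6)
proof (induction as arbitrary: f y)
  case (Cons a as)
  have "isoa C (alpa C x y a \<cdot> (f \<boxtimes> ida C a))"
    using Cons.prems assms(1) by (intro isoa_cmp isoa_tena isoa_ida) (auto simp: monoidal_isoa)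
  then show ?case using Cons by simp
qed simp

lemma isoa_wh:
  assumes "monoidal C" "isoa C g" "src g = tens \<i> as" "x \<in> Obj C" "as \<in> lists (Obj C)"
  shows "isoa C (wh x as g)"
  unfolding wh_def using assms by (intro isoa_cmp isoa_tena isoa_ida isoa_bet) (auto simp: monoidal_isoa)

text \<open>Substitution of \<open>q\<close> is precomposition with its whiskering tensored by \<open>ys\<close>, so it is bijective when the whiskering is invertible.\<close>

lemma multi_of_precomp_bij:
  assumes w: "isoa C (wh (tens \<i> xs) as (tens \<i> as, q, m))"
    and o: "xs \<in> lists (Obj C)" "m \<in> Obj C" "ys \<in> lists (Obj C)" "as \<in> lists (Obj C)" "b \<in> Obj C" "q \<in> Hom C (tens \<i> as) m"
  shows "bij_betw (\<lambda>f. mSub multi_of xs m ys as b f q) (mHom multi_of (xs @ m # ys) b) (mHom multi_of (xs @ as @ ys) b)"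
proof -
  let ?w = "act (wh (tens \<i> xs) as (tens \<i> as, q, m)) ys"
  have "bij_betw (\<lambda>f. raw ((tens \<i> (xs @ m # ys), f, b) \<cdot> ?w)) (Hom C (tens \<i> (xs @ m # ys)) b) (Hom C (tens \<i> (xs @ as @ ys)) b)"
    using w o by (intro isoa_precomp_bij isoa_act) auto
  moreover have "mSub multi_of xs m ys as b f q = raw ((tens \<i> (xs @ m # ys), f, b) \<cdot> ?w)"
    if "f \<in> Hom C (tens \<i> (xs @ m # ys)) b" for f
    using multi_of_sub[OF o(1-5) that o(6)] by (simp only: prod_eq_iff fst_conv snd_conv)
  ultimately show ?thesis unfolding multi_of_simps by (rule iffD2[OF bij_betw_cong, rotated])
qed

lemma representable_multi_of:
  assumes "monoidal C" shows "representable_multi multi_of"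
  unfolding representable_multi_def
proof (intro ballI bexI)
  fix as xs ys b assume "as \<in> lists (mObj multi_of)" "xs \<in> lists (mObj multi_of)" "ys \<in> lists (mObj multi_of)" "b \<in> mObj multi_of"
  then have o: "as \<in> lists (Obj C)" "xs \<in> lists (Obj C)" "ys \<in> lists (Obj C)" "b \<in> Obj C" by simp_all
  have "(tens \<i> as, Idm C (tens \<i> as), tens \<i> as) = ida C (tens \<i> as)" by (simp add: ida_def)
  then have "isoa C (wh (tens \<i> xs) as (tens \<i> as, Idm C (tens \<i> as), tens \<i> as))"
    using o assms by (simp add: isoa_wh isoa_ida)
  then show "bij_betw (\<lambda>f. mSub multi_of xs (tens \<i> as) ys as b f (Idm C (tens \<i> as)))
     (mHom multi_of (xs @ tens \<i> as # ys) b) (mHom multi_of (xs @ as @ ys) b)"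
    by (rule multi_of_precomp_bij) (use o in \<open>simp_all add: idm_hom\<close>)
qed (simp_all add: idm_hom)

text \<open>The classifying multimap \<open>a, b \<rightarrow> a \<otimes> b\<close> has to be an arrow \<open>\<i> \<otimes> a \<otimes> b \<rightarrow> a \<otimes> b\<close>, whence the factor \<open>\<lambda>\<^sub>a\<close>.\<close>

definition ten_classifiers :: "('o, 'm) classifiers" where
  "ten_classifiers = \<lparr>clOb = ten C, clTheta = (\<lambda>a b. raw (lama C a \<boxtimes> ida C b)), clUnit = \<i>, clU = Idm C \<i>\<rparr>"

lemma ten_classifiers_simps [simp]: "clOb ten_classifiers = ten C" "clUnit ten_classifiers = \<i>" "clU ten_classifiers = Idm C \<i>"
  by (simp_all add: ten_classifiers_def)

lemma ten_classifiers_theta: "(tens \<i> [a, b], clTheta ten_classifiers a b, a \<otimes> b) = lama C a \<boxtimes> ida C b"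
  by (simp add: ten_classifiers_def prod_eq_iff)

lemma ten_classifiers_hom: "a \<in> Obj C \<Longrightarrow> b \<in> Obj C \<Longrightarrow> clTheta ten_classifiers a b \<in> Hom C (tens \<i> [a, b]) (a \<otimes> b)"
  by (rule triple_hom) (simp only: ten_classifiers_theta tena_arr struct_arr ida_arr)

lemma left_classifiers_multi_of:
  assumes ln: "left_normal C" shows "left_classifiers (U_ob multi_of) ten_classifiers"
proof -
  interpret M: multicategory multi_of by (rule multicategory_multi_of)
  have cls: "bij_betw (\<lambda>f. gsub (U_ob multi_of) [] m xs as d f q) (Mul (U_ob multi_of) (m # xs) d) (Mul (U_ob multi_of) (as @ xs) d)"
    if g: "isoa C (tens \<i> as, q, m)" and o: "as \<in> lists (Obj C)" "m \<in> Obj C" "xs \<in> lists (Obj C)" "d \<in> Obj C"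
      and ok: "short_ok (Suc (length xs)) (length as)" for as q m xs d
  proof -
    have q: "q \<in> Hom C (tens \<i> as) m" by (rule triple_hom[OF isoa_arr[OF g]])
    have "isoa C (wh (tens \<i> []) as (tens \<i> as, q, m))" using isoa_wh_unit[OF ln g] o by simp
    then have "bij_betw (\<lambda>f. mSub multi_of [] m xs as d f q) (mHom multi_of ([] @ m # xs) d) (mHom multi_of ([] @ as @ xs) d)"
      by (rule multi_of_precomp_bij) (use o q in simp_all)
    moreover have "gsub (U_ob multi_of) [] m xs as d f q = mSub multi_of [] m xs as d f q" if "f \<in> mHom multi_of ([] @ m # xs) d" for f
      using that q o ok by (intro M.U_gsub) auto
    ultimately have "bij_betw (\<lambda>f. gsub (U_ob multi_of) [] m xs as d f q) (mHom multi_of ([] @ m # xs) d) (mHom multi_of ([] @ as @ xs) d)"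
      by (simp only: cong: bij_betw_cong)
    moreover have "length xs \<le> 3" "length as + length xs \<le> 4" using short_ok_bounds[OF ok] by auto
    ultimately show ?thesis by simp
  qed
  have l: "isoa C (lama C a)" if "a \<in> Obj C" for a using ln that left_normal_isoa by auto
  have th: "isoa C (tens \<i> [a, b], clTheta ten_classifiers a b, a \<otimes> b)" if "a \<in> Obj C" "b \<in> Obj C" for a b
    unfolding ten_classifiers_theta using that l by (intro isoa_tena isoa_ida) auto
  have u: "isoa C (tens \<i> [], Idm C \<i>, \<i>)" using isoa_ida[of \<i>] by (simp add: ida_def)
  show ?thesis
    unfolding left_classifiers_def
  proof (intro conjI ballI impI)
    show "classifier_data (U_ob multi_of) ten_classifiers"
      using ten_classifiers_hom by (auto simp: classifier_data_def idm_hom)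
  next
    fix a b xs d assume "a \<in> Obj (U_ob multi_of)" "b \<in> Obj (U_ob multi_of)" "xs \<in> lists (Obj (U_ob multi_of))"
      "d \<in> Obj (U_ob multi_of)" and n: "length xs + 1 \<in> {1, 2, 3}"
    then have o: "a \<in> Obj C" "b \<in> Obj C" "xs \<in> lists (Obj C)" "d \<in> Obj C" by simp_all
    have "short_ok (Suc (length xs)) (length [a, b])" using n by (auto simp: short_ok_simp)
    then show "bij_betw (\<lambda>f. gsub (U_ob multi_of) [] (clOb ten_classifiers a b) xs [a, b] d f (clTheta ten_classifiers a b))
      (Mul (U_ob multi_of) (clOb ten_classifiers a b # xs) d) (Mul (U_ob multi_of) (a # b # xs) d)"
      using cls[OF th[OF o(1,2)], of xs d] o by simp
  next
    fix xs d assume "xs \<in> lists (Obj (U_ob multi_of))" "d \<in> Obj (U_ob multi_of)" and n: "length xs \<in> {0, 1, 2}"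
    then have o: "xs \<in> lists (Obj C)" "d \<in> Obj C" by simp_all
    have "short_ok (Suc (length xs)) (length ([] :: 'o list))" using n by (auto simp: short_ok_simp)
    then show "bij_betw (\<lambda>f. gsub (U_ob multi_of) [] (clUnit ten_classifiers) xs [] d f (clU ten_classifiers))
      (Mul (U_ob multi_of) (clUnit ten_classifiers # xs) d) (Mul (U_ob multi_of) xs d)"
      using cls[OF u, of xs d] o by simp
  qed
qed

text \<open>As multimaps \<open>xs \<rightarrow> h\<close> are arrows \<open>\<i> xs \<rightarrow> h\<close>, this is the universal property of the internal hom at the object \<open>\<i> xs\<close>.\<close>

lemma closed_multi_of:
  assumes "closed_skmon C" shows "closed_multi multi_of"
  unfolding closed_multi_def
proof (intro ballI)
  fix b c assume "b \<in> mObj multi_of" "c \<in> mObj multi_of"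
  then have o: "b \<in> Obj C" "c \<in> Obj C" by simp_all
  then obtain h ev where ih: "internal_hom b c h ev" using assms closed_iff by blast
  have h: "h \<in> Obj C" and ev: "ev \<in> arr C" "src ev = h \<otimes> b" "trg ev = c" using ih by (auto simp: internal_hom_def)
  let ?e = "ev \<cdot> (lama C h \<boxtimes> ida C b)"
  have e: "(tens \<i> [h, b], raw ?e, c) = ?e" using ev by (simp add: prod_eq_iff)
  have ea: "?e \<in> arr C" using ev h o by simp
  have eh: "raw ?e \<in> Hom C (tens \<i> [h, b]) c" by (rule triple_hom) (simp only: e ea)
  have bij: "bij_betw (\<lambda>f. mSub multi_of [] h [b] xs c (raw ?e) f) (Hom C (tens \<i> xs) h) (Hom C (tens \<i> (xs @ [b])) c)"
    if xs: "xs \<in> lists (Obj C)" for xs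
  proof -
    let ?a = "tens \<i> xs"
    have a: "?a \<in> Obj C" using xs by simp
    have sub: "(tens \<i> (xs @ [b]), mSub multi_of [] h [b] xs c (raw ?e) f, c) = ev \<cdot> ((?a, f, h) \<boxtimes> ida C b)"
      if f: "f \<in> Hom C ?a h" for f
    proof -
      have fa: "(?a, f, h) \<in> arr C" using f a h by (simp add: triple_arr)
      have "(tens \<i> ([] @ xs @ [b]), mSub multi_of [] h [b] xs c (raw ?e) f, c)
         = (tens \<i> ([] @ h # [b]), raw ?e, c) \<cdot> act (wh (tens \<i> []) xs (?a, f, h)) [b]"
        by (rule multi_of_sub) (use f o xs h eh in simp_all)
      also have "\<dots> = ev \<cdot> (lama C h \<boxtimes> ida C b) \<cdot> (wh \<i> xs (?a, f, h) \<boxtimes> ida C b)"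
        using e fa ev h o xs by simp
      also have "(lama C h \<boxtimes> ida C b) \<cdot> (wh \<i> xs (?a, f, h) \<boxtimes> ida C b) = (?a, f, h) \<boxtimes> ida C b"
        using wh_unit[OF fa] fa xs o h by (simp flip: tena_cmp_id)
      finally show ?thesis by simp
    qed
    have ex1: "\<exists>!f. f \<in> arr C \<and> src f = ?a \<and> trg f = h \<and> ev \<cdot> (f \<boxtimes> ida C b) = g"
      if "g \<in> arr C" "src g = ?a \<otimes> b" "trg g = c" for g
      using ih that a unfolding internal_hom_def by blast
    show ?thesis
    proof (rule bij_betw_imageI)
      show "inj_on (\<lambda>f. mSub multi_of [] h [b] xs c (raw ?e) f) (Hom C ?a h)"
      proof (rule inj_onI)
        fix f k assume fk: "f \<in> Hom C ?a h" "k \<in> Hom C ?a h" "mSub multi_of [] h [b] xs c (raw ?e) f = mSub multi_of [] h [b] xs c (raw ?e) k"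
        have arrs: "(?a, f, h) \<in> arr C" "(?a, k, h) \<in> arr C" using fk a h by (auto simp: triple_arr)
        have dom: "ev \<cdot> ((?a, k, h) \<boxtimes> ida C b) \<in> arr C" "src (ev \<cdot> ((?a, k, h) \<boxtimes> ida C b)) = ?a \<otimes> b"
            "trg (ev \<cdot> ((?a, k, h) \<boxtimes> ida C b)) = c"
          using arrs ev o h by simp_all
        have "ev \<cdot> ((?a, f, h) \<boxtimes> ida C b) = ev \<cdot> ((?a, k, h) \<boxtimes> ida C b)"
          using sub[OF fk(1)] sub[OF fk(2)] fk(3) by simp
        then have "(?a, f, h) = (?a, k, h)"
          using ex1[of "ev \<cdot> ((?a, k, h) \<boxtimes> ida C b)"] arrs ev o h by (metis fst_conv snd_conv dom)
        then show "f = k" by simp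
      qed
      show "(\<lambda>f. mSub multi_of [] h [b] xs c (raw ?e) f) ` Hom C ?a h = Hom C (tens \<i> (xs @ [b])) c"
      proof (intro equalityI subsetI)
        fix g assume "g \<in> (\<lambda>f. mSub multi_of [] h [b] xs c (raw ?e) f) ` Hom C ?a h"
        then obtain f where "f \<in> Hom C ?a h" "g = mSub multi_of [] h [b] xs c (raw ?e) f" by blast
        then show "g \<in> Hom C (tens \<i> (xs @ [b])) c"
          using multi_of_sub_hom[of "[]" h "[b]" xs c "raw ?e" f] xs o h eh by simp
      next
        fix g assume g: "g \<in> Hom C (tens \<i> (xs @ [b])) c"
        then have "(tens \<i> (xs @ [b]), g, c) \<in> arr C" using xs o by (intro triple_arr) simp_all
        then obtain f where f: "f \<in> arr C" "src f = ?a" "trg f = h" "ev \<cdot> (f \<boxtimes> ida C b) = (tens \<i> (xs @ [b]), g, c)"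
          using ex1[of "(tens \<i> (xs @ [b]), g, c)"] by auto
        have f': "f = (?a, raw f, h)" using f by (simp add: prod_eq_iff)
        then have "raw f \<in> Hom C ?a h" using f(1) triple_hom by metis
        moreover have "mSub multi_of [] h [b] xs c (raw ?e) (raw f) = g"
          using sub[OF \<open>raw f \<in> _\<close>] f f' by (metis prod.inject)
        ultimately show "g \<in> (\<lambda>f. mSub multi_of [] h [b] xs c (raw ?e) f) ` Hom C ?a h" by blast
      qed
    qed
  qed
  show "\<exists>h \<in> mObj multi_of. \<exists>e \<in> mHom multi_of [h, b] c. \<forall>xs \<in> lists (mObj multi_of).
       bij_betw (\<lambda>f. mSub multi_of [] h [b] xs c e f) (mHom multi_of xs h) (mHom multi_of (xs @ [b]) c)"
    using h eh bij by (intro bexI[of _ h] bexI[of _ "raw ?e"]) auto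
qed

end

section \<open>Isomorphisms of skew monoidal categories\<close>

lemma is_functorI:
  assumes "category A" "category B" "\<And>a. a \<in> Obj A \<Longrightarrow> fOb F a \<in> Obj B"
    and map: "\<And>f. f \<in> arr A \<Longrightarrow> mapa F f \<in> arr B"
    and id: "\<And>a. a \<in> Obj A \<Longrightarrow> mapa F (ida A a) = ida B (fOb F a)"
    and cmp: "\<And>f g. f \<in> arr A \<Longrightarrow> g \<in> arr A \<Longrightarrow> src g = trg f \<Longrightarrow> mapa F (cmpa A g f) = cmpa B (mapa F g) (mapa F f)"
  shows "is_functor A B F"
proof (intro is_functor.intro is_functor_axioms.intro assms(1-3))
  show "fMap F a b f \<in> Hom B (fOb F a) (fOb F b)" if "a \<in> Obj A" "b \<in> Obj A" "f \<in> Hom A a b" for a b f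
    using map[of "(a, f, b)"] that by (simp add: arr_def mapa_def del: arr_obj)
  show "fMap F a a (Idm A a) = Idm B (fOb F a)" if "a \<in> Obj A" for a
    using id[OF that] by (simp add: mapa_def ida_def)
  show "fMap F a c (Cmp A a b c g f) = Cmp B (fOb F a) (fOb F b) (fOb F c) (fMap F b c g) (fMap F a b f)"
    if "a \<in> Obj A" "b \<in> Obj A" "c \<in> Obj A" "f \<in> Hom A a b" "g \<in> Hom A b c" for a b c f g
    using cmp[of "(a, f, b)" "(b, g, c)"] that by (simp add: arr_def mapa_def cmpa_def del: arr_obj)
qed

text \<open>
  Since all constraints of \<open>J\<close> are identities, \<open>J\<close> preserves the structure strictly. Then so do the inverse
  functions, and identities serve as their constraints.
\<close>

lemma strict_iso_SkMon:
  assumes J: "lax_monoidal A B J"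
    and ob: "Obj B = Obj A" "\<And>a. a \<in> Obj A \<Longrightarrow> fOb J a = a"
    and unt: "unt B = unt A" and ten: "\<And>a b. a \<in> Obj A \<Longrightarrow> b \<in> Obj A \<Longrightarrow> ten B a b = ten A a b"
    and l0: "lax0 J = Idm B (unt B)" and l2: "\<And>a b. a \<in> Obj A \<Longrightarrow> b \<in> Obj A \<Longrightarrow> lax2 J a b = Idm B (ten B a b)"
    and bij: "\<And>a b. a \<in> Obj A \<Longrightarrow> b \<in> Obj A \<Longrightarrow> bij_betw (fMap J a b) (Hom A a b) (Hom B a b)"
  shows "iso_map SkMon A B J"
proof -
  interpret J: lax_monoidal A B J by (rule J)
  define K :: "('a, 'b) laxfun" where "K = \<lparr>fOb = restrict (\<lambda>a. a) (Obj B),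
     fMap = (\<lambda>a b. restrict (inv_into (Hom A a b) (fMap J a b)) (catMaps B a b)),
     lax0 = Idm A (unt A), lax2 = (\<lambda>a b. if a \<in> Obj B \<and> b \<in> Obj B then Idm A (ten A a b) else undefined)\<rparr>"
  have Kob: "fOb K a = a" if "a \<in> Obj A" for a using that ob by (simp add: K_def)
  have JK: "mapa J (mapa K g) = g" "mapa K g \<in> arr A" if g: "g \<in> arr B" for g
  proof -
    have o: "src g \<in> Obj A" "trg g \<in> Obj A" "raw g \<in> Hom B (src g) (trg g)"
      using g ob(1) by (auto simp: arr_def simp del: arr_obj)
    have K: "fMap K (src g) (trg g) (raw g) = inv_into (Hom A (src g) (trg g)) (fMap J (src g) (trg g)) (raw g)"
      using o ob(1) by (simp add: K_def catMaps_def)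
    have "fMap J (src g) (trg g) (fMap K (src g) (trg g) (raw g)) = raw g" "fMap K (src g) (trg g) (raw g) \<in> Hom A (src g) (trg g)"
      unfolding K using bij[OF o(1,2)] o(3) by (auto simp: bij_betw_inv_into_right intro: bij_betw_apply[OF bij_betw_inv_into])
    then show "mapa J (mapa K g) = g" "mapa K g \<in> arr A"
      using o Kob ob by (simp_all add: mapa_def arr_def prod_eq_iff del: arr_obj)
  qed
  have KJ: "mapa K (mapa J f) = f" if f: "f \<in> arr A" for f
  proof -
    have o: "src f \<in> Obj A" "trg f \<in> Obj A" "raw f \<in> Hom A (src f) (trg f)" using f by (auto simp: arr_def simp del: arr_obj)
    have "fMap J (src f) (trg f) (raw f) \<in> Hom B (src f) (trg f)" using bij[OF o(1,2)] o(3) bij_betw_apply by metis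
    then have "fMap K (src f) (trg f) (fMap J (src f) (trg f) (raw f)) = raw f"
      using o ob(1) bij_betw_inv_into_left[OF bij[OF o(1,2)] o(3)] by (simp add: K_def catMaps_def)
    then show ?thesis using o Kob ob(2) by (simp add: mapa_def prod_eq_iff)
  qed
  have JL0: "lax0a A B J = ida B (unt A)" using l0 unt ob(2) by (simp add: lax0a_def ida_def)
  have JL2: "lax2a A B J a b = ida B (ten A a b)" if "a \<in> Obj A" "b \<in> Obj A" for a b
    using that l2 ten ob(2) by (simp add: lax2a_def ida_def)
  have Jarr: "mapa J f \<in> arr B" "src (mapa J f) = src f" "trg (mapa J f) = trg f" if "f \<in> arr A" for f
    using that ob(2) by auto
  have Jten: "mapa J (tena A f g) = tena B (mapa J f) (mapa J g)" if "f \<in> arr A" "g \<in> arr A" for f g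
    using J.laxa_natural[OF that] that Jarr ten ob by (simp add: JL2)
  have Jid: "mapa J (ida A a) = ida B a" if "a \<in> Obj A" for a using that ob(2) by simp
  have Jal: "mapa J (alpa A a b c) = alpa B a b c" if "a \<in> Obj A" "b \<in> Obj A" "c \<in> Obj A" for a b c
    using J.laxa_assoc[OF that] that ob ten by (simp add: JL2)
  have Jla: "mapa J (lama A a) = lama B a" if "a \<in> Obj A" for a
    using J.laxa_left_unit[OF that] that ob ten unt by (simp add: JL2 JL0)
  have Jrh: "mapa J (rhoa A a) = rhoa B a" if "a \<in> Obj A" for a
    using J.laxa_right_unit[OF that] that ob ten unt by (simp add: JL2 JL0)
  have K: "mapa K (tena B f g) = tena A (mapa K f) (mapa K g)" if "f \<in> arr B" "g \<in> arr B" for f g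
    using KJ[of "tena A (mapa K f) (mapa K g)"] Jten[of "mapa K f" "mapa K g"] that JK by simp
  have Kid: "mapa K (ida B a) = ida A a" if "a \<in> Obj A" for a using KJ[of "ida A a"] Jid that by simp
  have Kst: "mapa K (alpa B a b c) = alpa A a b c" "mapa K (lama B a) = lama A a" "mapa K (rhoa B a) = rhoa A a"
    if "a \<in> Obj A" "b \<in> Obj A" "c \<in> Obj A" for a b c
    using KJ[of "alpa A a b c"] KJ[of "lama A a"] KJ[of "rhoa A a"] Jal Jla Jrh that by simp_all
  have Kf: "is_functor B A K"
  proof (rule is_functorI)
    fix f g assume fg: "f \<in> arr B" "g \<in> arr B" "src g = trg f"
    have "mapa J (cmpa A (mapa K g) (mapa K f)) = cmpa B g f"
      using JK fg Kob ob by (simp add: J.mapa_cmp)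
    then show "mapa K (cmpa B g f) = cmpa A (mapa K g) (mapa K f)"
      using KJ[of "cmpa A (mapa K g) (mapa K f)"] JK fg Kob ob by simp
  qed (use Kob Kid ob JK in \<open>auto intro: J.A.category_axioms J.B.category_axioms\<close>)
  have KL0: "lax0a B A K = ida A (unt A)" using Kob unt by (simp add: lax0a_def ida_def K_def)
  have KL2: "lax2a B A K a b = ida A (ten A a b)" if "a \<in> Obj A" "b \<in> Obj A" for a b
    using that Kob ten ob(1) by (simp add: lax2a_def ida_def K_def)
  have Kl: "lax_monoidal B A K"
  proof (rule lax_monoidalI[OF J.B.skew_monoidal_axioms J.A.skew_monoidal_axioms Kf])
    fix f g assume fg: "f \<in> arr B" "g \<in> arr B"
    then show "lax2a B A K (trg f) (trg g) \<cdot>\<^bsub>A\<^esub> (mapa K f \<boxtimes>\<^bsub>A\<^esub> mapa K g) = mapa K (f \<boxtimes>\<^bsub>B\<^esub> g) \<cdot>\<^bsub>A\<^esub> lax2a B A K (src f) (src g)"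
      using JK K ob Kob arr_obj[OF fg(1)] arr_obj[OF fg(2)] by (simp add: KL2)
  qed (use ob Kob ten unt Kst in \<open>simp_all add: KL0 KL2\<close>, auto simp: K_def)
  have l0K: "lax0 K = Idm A (unt A)" by (simp add: K_def)
  have l02: "lax2 K a b = Idm A (ten A a b)" if "a \<in> Obj A" "b \<in> Obj A" for a b
    using that ob(1) by (simp_all add: K_def)
  have raws: "fMap J a b (fMap K a b f) = f" if "a \<in> Obj A" "b \<in> Obj A" "f \<in> Hom B a b" for a b f
    using JK(1)[of "(a, f, b)"] that ob Kob by (simp add: mapa_def arr_def del: arr_obj)
  have raws': "fMap K a b (fMap J a b f) = f" if "a \<in> Obj A" "b \<in> Obj A" "f \<in> Hom A a b" for a b f
    using KJ[of "(a, f, b)"] that ob Kob by (simp add: mapa_def arr_def del: arr_obj)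
  have Kid': "fMap K a a (Idm B a) = Idm A a" "fMap J a a (Idm A a) = Idm B a" if "a \<in> Obj A" for a
    using Kid[OF that] Jid[OF that] that ob Kob by (simp_all add: mapa_def ida_def)
  have "lax_comp A B A K J = lax_id A"
  proof (rule laxfun_eqI)
    show "fOb (lax_comp A B A K J) = fOb (lax_id A)"
      by (rule ext) (simp add: lax_comp_def lax_id_def restrict_def ob Kob)
    show "fMap (lax_comp A B A K J) a b f = fMap (lax_id A) a b f" for a b f
      by (auto simp: lax_comp_def lax_id_def restrict_def catMaps_def ob Kob raws')
    show "lax0 (lax_comp A B A K J) = lax0 (lax_id A)"
      using l0 l0K Kid'(1)[of "unt A"] unt ob Kob J.A.unit_obj by (simp add: lax_comp_def lax_id_def J.A.cmp_id_left J.A.idm_hom)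
    show "lax2 (lax_comp A B A K J) a b = lax2 (lax_id A) a b" for a b
      using l2 l02 Kid'(1)[of "ten A a b"] ten ob Kob by (simp add: lax_comp_def lax_id_def J.A.cmp_id_left J.A.idm_hom)
  qed
  moreover have "lax_comp B A B J K = lax_id B"
  proof (rule laxfun_eqI)
    show "fOb (lax_comp B A B J K) = fOb (lax_id B)"
      by (rule ext) (simp add: lax_comp_def lax_id_def restrict_def ob Kob)
    show "fMap (lax_comp B A B J K) a b f = fMap (lax_id B) a b f" for a b f
      by (auto simp: lax_comp_def lax_id_def restrict_def catMaps_def ob Kob raws)
    show "lax0 (lax_comp B A B J K) = lax0 (lax_id B)"
      using l0 l0K Kid'(2)[of "unt A"] unt ob Kob J.A.unit_obj J.B.unit_obj
      by (simp add: lax_comp_def lax_id_def J.B.cmp_id_left J.B.idm_hom)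
    show "lax2 (lax_comp B A B J K) a b = lax2 (lax_id B) a b" for a b
      using l2 l02 Kid'(2)[of "ten A a b"] ten ob Kob J.A.ten_obj[of a b]
      by (simp add: lax_comp_def lax_id_def J.B.cmp_id_left J.B.idm_hom)
  qed
  ultimately show ?thesis using J Kl by (auto simp: iso_map_def SkMon_def)
qed

section \<open>Every left normal skew monoidal category comes from a multicategory\<close>

context skew_monoidal begin

lemma wh_post:
  assumes "g \<in> arr C" "src g = tens \<i> as" "h \<in> arr C" "src h = trg g" "x \<in> Obj C" "as \<in> lists (Obj C)"
  shows "wh x as (h \<cdot> g) = (ida C x \<boxtimes> h) \<cdot> wh x as g"
  using assms tena_id_cmp[of g h x] by (simp add: wh_def)

lemma wh_lama_right:
  assumes "g \<in> arr C" "src g = b" "x \<in> Obj C" shows "wh x [b] (g \<cdot> lama C b) = ida C x \<boxtimes> g"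
  using assms wh_post[of "lama C b" "[b]" g x] wh_lama[of x b] by auto

text \<open>
  Substituting \<open>\<lambda>\<^sub>b \<otimes> c\<close>, the classifier of \<open>b, c\<close> in \<open>multi_of\<close>, behind \<open>x\<close> gives \<open>\<alpha>\<close>. This is why \<open>lam_functor\<close>
  is compatible with \<open>\<alpha>\<close>.
\<close>

lemma wh_lama_tensor:
  assumes "x \<in> Obj C" "b \<in> Obj C" "c \<in> Obj C" shows "wh x [b, c] (lama C b \<boxtimes> ida C c) = alpa C x b c"
proof -
  let ?m = "alpa C x \<i> b \<cdot> (rhoa C x \<boxtimes> ida C b)"
  have "wh x [b, c] (lama C b \<boxtimes> ida C c) = (ida C x \<boxtimes> (lama C b \<boxtimes> ida C c)) \<cdot> alpa C x (\<i> \<otimes> b) c \<cdot> (?m \<boxtimes> ida C c)"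
    by (simp add: wh_def)
  also have "\<dots> = alpa C x b c \<cdot> (ida C x \<boxtimes> lama C b \<boxtimes> ida C c) \<cdot> (?m \<boxtimes> ida C c)"
    using assms cmpa_reassoc[OF alpa_natural[of "ida C x" "lama C b" "ida C c"], of "?m \<boxtimes> ida C c"] by simp
  also have "(ida C x \<boxtimes> lama C b \<boxtimes> ida C c) \<cdot> (?m \<boxtimes> ida C c) = ida C (x \<otimes> b \<otimes> c)"
    using assms middle_unita[of x b] by (subst tena_cmp_id[symmetric]) (simp_all add: tena_id)
  finally show ?thesis using assms by simp
qed

text \<open>
  The unary maps \<open>a \<rightarrow> b\<close> of \<open>multi_of\<close> are the arrows \<open>\<i> \<otimes> a \<rightarrow> b\<close>, which \<open>\<lambda>\<close> compares with the arrows \<open>a \<rightarrow> b\<close>. The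
  constraints are the identities of \<open>multi_of\<close>.
\<close>

definition lam_functor :: "('o, 'm) laxfun" where
  "lam_functor = \<lparr>fOb = restrict (\<lambda>a. a) (Obj C),
     fMap = (\<lambda>a b. restrict (\<lambda>f. raw ((a, f, b) \<cdot> lama C a)) (catMaps C a b)),
     lax0 = lam C \<i>, lax2 = (\<lambda>a b. if a \<in> Obj C \<and> b \<in> Obj C then lam C (a \<otimes> b) else undefined)\<rparr>"

lemma lam_functor_iso:
  assumes ln: "left_normal C"
  shows "iso_map SkMon C (skew_of (cat.truncate (U_ob multi_of)) (gsub (U_ob multi_of)) ten_classifiers) lam_functor"
proof -
  let ?U = "U_ob multi_of" and ?J = lam_functor
  interpret M: multicategory multi_of by (rule multicategory_multi_of)
  interpret L: left_representable_pm "cat.truncate ?U" "Mul ?U" "gsub ?U" short_ok ten_classifiers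
    by (intro left_representable_short M.short_U left_classifiers_multi_of ln)
  let ?X = "cat.truncate ?U"
  have lists_in: "as \<in> lists (Obj ?X) \<longleftrightarrow> as \<in> lists (Obj C)" for as by simp
  \<comment> \<open>\<open>tr\<close> reads multimaps of \<open>multi_of\<close> as arrows; this reduces each law to a computation in the given category\<close>
  define tr :: "('o, 'm) marrow \<Rightarrow> ('o, 'm) arrow" where "tr F = (tens \<i> (src F), raw F, trg F)" for F
  have tr_src_trg [simp]: "src (tr F) = tens \<i> (src F)" "trg (tr F) = trg F" for F by (simp_all add: tr_def)
  have tens_in: "tens \<i> as \<in> Obj C" if "\<forall>a \<in> set as. a \<in> Obj C" for as
    by (rule tens_obj) (use that unit_obj in auto)
  have mar: "F \<in> L.mar \<longleftrightarrow> src F \<in> lists (Obj C) \<and> length (src F) \<le> 4 \<and> tr F \<in> arr C" for F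
    using tens_in by (auto simp: L.mar_def tr_def arr_def simp del: arr_obj)
  have tr_arr: "tr F \<in> arr C" if "F \<in> L.mar" for F using that mar by blast
  have tr_eq: "F = G" if "tr F = tr G" "src F = src G" for F G
    using that by (simp add: tr_def prod_eq_iff)
  have tr_sub: "tr (L.msub F i G) = tr F \<cdot> act (wh (tens \<i> (take i (src F))) (src G) (tr G)) (drop (Suc i) (src F))"
    if F: "F \<in> L.mar" and G: "G \<in> L.mar" and i: "i < length (src F)" "src F ! i = trg G"
      and ok: "short_ok (length (src F)) (length (src G))" for F i G
  proof -
    obtain xs b ys where s: "src F = xs @ b # ys" "length xs = i" "xs \<in> lists (Obj ?X)" "b \<in> Obj ?X" "ys \<in> lists (Obj ?X)"
      using L.mar_split[OF F i(1)] .
    have b: "b = trg G" using s i by auto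
    note o = s(3-5)[unfolded lists_in truncate_simps M.U_simps multi_of_simps]
    have g: "src G \<in> lists (Obj C)" "trg F \<in> Obj C" using F G mar arr_obj(2)[of "tr F"] by auto
    have h: "raw F \<in> Hom C (tens \<i> (xs @ b # ys)) (trg F)" "raw G \<in> Hom C (tens \<i> (src G)) b"
      using tr_arr[OF F] tr_arr[OF G] s(1) b by (auto simp: tr_def arr_def simp del: arr_obj)
    have "gsub ?U xs b ys (src G) (trg F) (raw F) (raw G) = mSub multi_of xs b ys (src G) (trg F) (raw F) (raw G)"
      by (rule M.U_gsub) (use ok s(1) o g h in simp_all)
    then show ?thesis
      using multi_of_sub[OF o g h] s(1,2) b by (simp add: L.msub_eq[OF s(1,2)] tr_def)
  qed
  have th [simp]: "tr (L.th a b) = lama C a \<boxtimes> ida C b" for a b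
    using ten_classifiers_theta[of a b] by (simp add: tr_def L.th_def)
  have uu [simp]: "tr L.uu = ida C \<i>" by (simp add: tr_def L.uu_def ida_def)
  have ob [simp]: "fOb ?J a = a" if "a \<in> Obj C" for a using that by (simp add: lam_functor_def)
  have J: "tr (una (mapa ?J f)) = f \<cdot> lama C (src f)" if f: "f \<in> arr C" for f
    using f arr_obj[OF f] by (simp add: tr_def mapa_def lam_functor_def catMaps_def cmpa_def arr_def del: arr_obj)
  have Jst: "src (mapa ?J f) = src f" "trg (mapa ?J f) = trg f" if "f \<in> arr C" for f
    using that by (simp_all add: mapa_def)
  have Jarr: "mapa ?J f \<in> arr ?X" if f: "f \<in> arr C" for f
    using mar[of "una (mapa ?J f)"] f J[OF f] Jst[OF f] by simp
  have tr_id: "tr (una (ida ?X a)) = lama C a" for a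
    by (simp add: tr_def ida_def lama_def)
  have wh_unit': "lama C a \<cdot> wh \<i> as g \<cdot> k = g \<cdot> k"
    if "g \<in> arr C" "src g = tens \<i> as" "as \<in> lists (Obj C)" "trg g = a" "k \<in> arr C" "trg k = src g" for g as a k
    using that cmpa_reassoc[OF wh_unit[of g as], of k] by auto
  have funJ: "is_functor C L.A ?J"
  proof (rule is_functorI)
    show "category C" by unfold_locales
    show "category L.A" by (rule L.A.category_axioms)
    show "mapa ?J (ida C a) = ida L.A (fOb ?J a)" if "a \<in> Obj C" for a
    proof -
      have "una (mapa ?J (ida C a)) = una (ida ?X a)"
        by (rule tr_eq) (use that J[of "ida C a"] Jst[of "ida C a"] in \<open>simp_all add: tr_id\<close>)
      then show ?thesis using that by simp
    qed
    show "mapa ?J (g \<cdot> f) = cmpa L.A (mapa ?J g) (mapa ?J f)" if "f \<in> arr C" "g \<in> arr C" "src g = trg f" for f g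
    proof -
      have "una (mapa ?J (g \<cdot> f)) = L.msub (una (mapa ?J g)) 0 (una (mapa ?J f))"
        by (rule tr_eq) (use that J Jst Jarr wh_unit[of "f \<cdot> lama C (src f)" "[src f]"] in \<open>simp_all add: tr_sub\<close>)
      then show ?thesis
        using that L.una_cmp[OF Jarr[OF that(1)] Jarr[OF that(2)]] Jst una_inj by (metis L.A_arr(3))
    qed
  qed (use Jarr in simp_all)
  have lax0: "lax0a C L.A ?J = ida ?X \<i>" by (simp add: lax0a_def ida_def lam_functor_def)
  have lax2: "lax2a C L.A ?J a b = ida ?X (a \<otimes> b)" if "a \<in> Obj C" "b \<in> Obj C" for a b
    using that by (simp add: lax2a_def ida_def lam_functor_def)
  have lax: "lax_monoidal C L.A ?J"
  proof (rule L.lax_monoidal_to_A[where q = L.th and v = L.uu, OF skew_monoidal_axioms funJ])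
    fix f g assume fg: "f \<in> arr C" "g \<in> arr C"
    show "L.msub (L.msub (L.th (trg f) (trg g)) 0 (una (mapa ?J f))) (Suc 0) (una (mapa ?J g))
      = L.msub (una (mapa ?J (f \<boxtimes> g))) 0 (L.th (src f) (src g))" (is "?l = ?r")
    proof (rule tr_eq)
      have "tr ?l = (lama C (trg f) \<boxtimes> ida C (trg g)) \<cdot> (wh \<i> [src f] (f \<cdot> lama C (src f)) \<boxtimes> ida C (trg g)) \<cdot> (ida C (\<i> \<otimes> src f) \<boxtimes> g)"
        using fg J[OF fg(1)] J[OF fg(2)] Jst[OF fg(1)] Jst[OF fg(2)] Jarr[OF fg(1)] Jarr[OF fg(2)]
        by (simp add: tr_sub wh_lama_right)
      also have "\<dots> = (f \<cdot> lama C (src f)) \<boxtimes> g"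
        using fg wh_unit[of "f \<cdot> lama C (src f)" "[src f]"] by (simp flip: tena_cmp)
      also have "\<dots> = (f \<boxtimes> g) \<cdot> (lama C (src f) \<boxtimes> ida C (src g))"
        using fg by (simp flip: tena_cmp)
      also have "\<dots> = tr ?r"
        using fg J[of "f \<boxtimes> g"] Jst[of "f \<boxtimes> g"] Jarr[of "f \<boxtimes> g"] wh_unit[of "lama C (src f) \<boxtimes> ida C (src g)" "[src f, src g]"]
        by (simp add: tr_sub)
      finally show "tr ?l = tr ?r" .
    qed (use fg Jst[OF fg(1)] Jst[OF fg(2)] in simp)
  next
    fix a b c assume o: "a \<in> Obj C" "b \<in> Obj C" "c \<in> Obj C"
    show "L.msub (L.msub (una (mapa ?J (alpa C a b c))) 0 (L.th (a \<otimes> b) c)) 0 (L.th a b)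
      = L.msub (L.th a (b \<otimes> c)) (Suc 0) (L.th b c)" (is "?l = ?r")
    proof (rule tr_eq)
      have "tr ?l = alpa C a b c \<cdot> (lama C (a \<otimes> b) \<boxtimes> ida C c) \<cdot> (wh \<i> [a, b] (lama C a \<boxtimes> ida C b) \<boxtimes> ida C c)"
        using o J[of "alpa C a b c"] Jst[of "alpa C a b c"] Jarr[of "alpa C a b c"]
          wh_unit'[of "lama C (a \<otimes> b) \<boxtimes> ida C c" "[a \<otimes> b, c]"]
        by (simp add: tr_sub)
      also have "\<dots> = alpa C a b c \<cdot> (lama C a \<boxtimes> ida C b \<boxtimes> ida C c)"
        using o wh_unit[of "lama C a \<boxtimes> ida C b" "[a, b]"] by (simp flip: tena_cmp_id)
      also have "\<dots> = (lama C a \<boxtimes> ida C (b \<otimes> c)) \<cdot> alpa C (\<i> \<otimes> a) b c"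
        using o alpa_natural[of "lama C a" "ida C b" "ida C c"] by simp
      also have "\<dots> = tr ?r" using o by (simp add: tr_sub wh_lama_tensor)
      finally show "tr ?l = tr ?r" .
    qed (use o Jst[of "alpa C a b c"] in simp)
  next
    fix a assume o: "a \<in> Obj C"
    show "L.msub (L.msub (una (mapa ?J (lama C a))) 0 (L.th \<i> a)) 0 L.uu = una (ida ?X (fOb ?J a))" (is "?l = ?r")
    proof (rule tr_eq)
      have "tr ?l = lama C a \<cdot> (lama C \<i> \<boxtimes> ida C a) \<cdot> (wh \<i> [] (ida C \<i>) \<boxtimes> ida C a)"
        using o J[of "lama C a"] Jst[of "lama C a"] Jarr[of "lama C a"] wh_unit'[of "lama C \<i> \<boxtimes> ida C a" "[\<i>, a]"]
        by (simp add: tr_sub)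
      also have "\<dots> = tr ?r"
        using o wh_unit[of "ida C \<i>" "[]"] by (simp add: tr_id flip: tena_cmp_id)
      finally show "tr ?l = tr ?r" .
    qed (use o Jst[of "lama C a"] in simp)
    show "L.msub (L.th a \<i>) (Suc 0) L.uu = una (mapa ?J (rhoa C a))"
      by (rule tr_eq) (use o J[of "rhoa C a"] Jst[of "rhoa C a"] rhoa_natural[of "lama C a"] in \<open>simp_all add: tr_sub wh_def\<close>)
  qed (simp_all add: lax0 lax2, auto simp: lam_functor_def)
  have bij: "bij_betw (fMap ?J a b) (Hom C a b) (Hom L.A a b)" if o: "a \<in> Obj C" "b \<in> Obj C" for a b
  proof -
    have "isoa C (lama C a)" using ln o left_normal_isoa by blast
    then have "bij_betw (\<lambda>f. raw ((a, f, b) \<cdot> lama C a)) (Hom C a b) (Hom C (\<i> \<otimes> a) b)"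
      by (rule isoa_precomp_bij) (use o in simp_all)
    then have "bij_betw (fMap ?J a b) (Hom C a b) (Hom C (\<i> \<otimes> a) b)"
      by (rule iffD1[OF bij_betw_cong, rotated]) (use o in \<open>simp add: lam_functor_def catMaps_def\<close>)
    then show ?thesis by simp
  qed
  show ?thesis
    by (rule strict_iso_SkMon[OF lax]) (use bij in \<open>auto simp: lam_functor_def\<close>)
qed

end

section \<open>Independence of the chosen classifiers\<close>

lemma iso_map_trans:
  assumes "category A" "a \<in> Obj A" "b \<in> Obj A" "c \<in> Obj A" "iso_map A a b f" "iso_map A b c g"
  shows "\<exists>h. iso_map A a c h"
proof -
  interpret category A by fact
  have "isoa A (cmpa A (b, g, c) (a, f, b))"
    using assms by (intro isoa_cmp) (simp_all add: iso_map_isoa)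
  then have "iso_map A a c (raw (cmpa A (b, g, c) (a, f, b)))"
    using assms by (simp add: iso_map_isoa cmpa_def)
  then show ?thesis by blast
qed

lemma iso_map_sym: "iso_map A a b f \<Longrightarrow> \<exists>g. iso_map A b a g"
  unfolding iso_map_def by blast

text \<open>The identity morphism induces lax monoidal functors in both directions, and functoriality of \<open>lax_of\<close> makes them inverse to each other.\<close>

lemma skew_of_iso:
  assumes t: "left_representable_pm X MM S ok t" and s: "left_representable_pm X MM S ok s"
  shows "\<exists>f. iso_map SkMon (skew_of X S t) (skew_of X S s) f"
proof -
  interpret P: left_representable_pm X MM S ok t by fact
  let ?I = "mor_id (Obj X) P.mars"
  note I = pm_morphism_id(1)[OF P.partial_multicategory_axioms]
  note II = pm_comp_id(1)[OF I]
  have lax: "lax_monoidal (skew_of X S t) (skew_of X S s) (lax_of X X S t s ?I)"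
    if "left_representable_pm X MM S ok t" "left_representable_pm X MM S ok s" for t s
    by (rule left_representable_morphism.lax_monoidal_L[OF left_representable_morphism.intro[OF left_representable_pair.intro[OF that] I]])
  have inv: "lax_comp (skew_of X S t) (skew_of X S s) (skew_of X S t) (lax_of X X S s t ?I) (lax_of X X S t s ?I) = lax_id (skew_of X S t)"
    if "left_representable_pm X MM S ok t" "left_representable_pm X MM S ok s" for t s
    using lax_of_comp[OF that that(1) I I] lax_of_id[OF that(1)] by (simp add: II)
  show ?thesis
    using lax[OF t s] lax[OF s t] inv[OF t s] inv[OF s t] by (auto simp: iso_map_def SkMon_def)
qed

section \<open>The formulas of the two functors compared\<close>

lemma left_representable_if_representable: "representable C \<Longrightarrow> left_representable C"
  unfolding representable_def left_representable_def left_classifiers_def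
proof (elim exE conjE, intro exI conjI ballI impI)
  fix t
  assume t: "classifier_data C t" and bij: "\<forall>xs \<in> lists (Obj C). \<forall>ys \<in> lists (Obj C). \<forall>d \<in> Obj C.
      length xs + 1 + length ys \<in> {1, 2, 3} \<longrightarrow>
        bij_betw (\<lambda>f. gsub C xs (clUnit t) ys [] d f (clU t)) (Mul C (xs @ clUnit t # ys) d) (Mul C (xs @ ys) d)
        \<and> (\<forall>a \<in> Obj C. \<forall>b \<in> Obj C.
            bij_betw (\<lambda>f. gsub C xs (clOb t a b) ys [a, b] d f (clTheta t a b))
              (Mul C (xs @ clOb t a b # ys) d) (Mul C (xs @ a # b # ys) d))"
  note b = bij[THEN bspec, OF lists.Nil, THEN bspec, THEN bspec, THEN mp]
  show "classifier_data C t" by (rule t)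
  show "bij_betw (\<lambda>f. gsub C [] (clOb t a b) xs [a, b] d f (clTheta t a b)) (Mul C (clOb t a b # xs) d) (Mul C (a # b # xs) d)"
    if "a \<in> Obj C" "b \<in> Obj C" "xs \<in> lists (Obj C)" "d \<in> Obj C" "length xs + 1 \<in> {1, 2, 3}" for a b xs d
    using b[OF that(3,4)] that(1,2,5) by simp
  show "bij_betw (\<lambda>f. gsub C [] (clUnit t) xs [] d f (clU t)) (Mul C (clUnit t # xs) d) (Mul C xs d)"
    if "xs \<in> lists (Obj C)" "d \<in> Obj C" "length xs \<in> {0, 1, 2}" for xs d
    using b[OF that(1,2)] that(3) by simp
qed

lemma cat_truncate_U: "cat.truncate (U_ob M) = unary_cat M"
  by (simp add: cat.truncate_def U_ob_def unary_cat_def)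

context multicategory begin

text \<open>In the substitutions that occur in the formulas, all arities are small enough for \<open>gsub\<close> to agree with the substitution of \<open>M\<close>.\<close>

lemma skew_of_U:
  assumes t: "classifier_data (U_ob M) t"
  shows "skew_of (unary_cat M) (mSub M) t = skew_of (cat.truncate (U_ob M)) (gsub (U_ob M)) t"
proof -
  have ob: "clOb t a b \<in> mObj M" "clTheta t a b \<in> mHom M [a, b] (clOb t a b)" if "a \<in> mObj M" "b \<in> mObj M" for a b
    using t that by (auto simp: classifier_data_def)
  have u: "clUnit t \<in> mObj M" "clU t \<in> mHom M [] (clUnit t)" using t by (auto simp: classifier_data_def)
  have sub1: "mSub M [] b [c] as d f g \<in> mHom M (as @ [c]) d"
    if "b \<in> mObj M" "c \<in> mObj M" "as \<in> lists (mObj M)" "d \<in> mObj M" "f \<in> mHom M [b, c] d" "g \<in> mHom M as b" for b c as d f g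
    using sub_hom[of "[]" b "[c]" as d f g] that by simp
  have sub0: "mSub M [] b [] as d f g \<in> mHom M as d"
    if "b \<in> mObj M" "as \<in> lists (mObj M)" "d \<in> mObj M" "f \<in> mHom M [b] d" "g \<in> mHom M as b" for b as d f g
    using sub_hom[of "[]" b "[]" as d f g] that by simp
  note sub1' = sub1[of _ _ "[]", simplified] sub1[of _ _ "[a]" for a, simplified] sub1[of _ _ "[a, b]" for a b, simplified]
  note [simp] = ob u sub0 sub1' U_gsub short_ok_simp
  show ?thesis
    by (simp add: cat_truncate_U skew_of_def skew_tenm_def skew_alp_def skew_lam_def skew_rho_def Let_def fun_eq_iff cong: conj_cong if_cong)
qed

end

lemma lax_of_U:
  assumes F: "multifunctor M N F" and t: "classifier_data (U_ob M) t" and s: "classifier_data (U_ob N) s"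
  shows "lax_of (unary_cat M) (unary_cat N) (mSub N) t s F
    = lax_of (cat.truncate (U_ob M)) (cat.truncate (U_ob N)) (gsub (U_ob N)) t s (U_mor F)"
proof -
  interpret multifunctor M N F by (rule F)
  have ob: "clOb t a b \<in> mObj M" if "a \<in> mObj M" "b \<in> mObj M" for a b
    using t that by (auto simp: classifier_data_def M.U_simps)
  have ob': "clOb s a b \<in> mObj N" "clTheta s a b \<in> mHom N [a, b] (clOb s a b)" if "a \<in> mObj N" "b \<in> mObj N" for a b
    using s that by (auto simp: classifier_data_def N.U_simps)
  have u: "clUnit t \<in> mObj M" "clUnit s \<in> mObj N" "clU s \<in> mHom N [] (clUnit s)"
    using s t by (auto simp: classifier_data_def N.U_simps M.U_simps)
  note [simp] = ob ob' u map_obj N.U_gsub short_ok_simp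
  show ?thesis
    by (simp add: cat_truncate_U lax_of_def U_mor_def Let_def fun_eq_iff cong: conj_cong if_cong)
qed

section \<open>The equivalences\<close>

text \<open>The choice of universal maps on which \<open>K\<close> and \<open>T\<close> depend.\<close>

locale chosen_classifiers =
  fixes ch :: "('o, 'm) shmulti \<Rightarrow> ('o, 'm) classifiers"
  assumes ch: "C \<in> Obj ShMulti_lr \<Longrightarrow> left_classifiers C (ch C)"
begin

lemma Obj_ShMulti_lr: "C \<in> Obj ShMulti_lr \<longleftrightarrow> short_multicategory C \<and> left_representable C"
  by (simp add: ShMulti_lr_def full_sub_def ShMulti_def)

lemma Hom_ShMulti_lr: "Hom ShMulti_lr C D = {F. short_morphism C D F}"
  by (simp add: ShMulti_lr_def full_sub_def ShMulti_def)

lemma left_representable_ch: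
  "C \<in> Obj ShMulti_lr \<Longrightarrow> left_representable_pm (cat.truncate C) (Mul C) (gsub C) short_ok (ch C)"
  using ch by (intro left_representable_short) (simp_all add: Obj_ShMulti_lr)

lemma left_representable_pair_ch:
  "C \<in> Obj ShMulti_lr \<Longrightarrow> D \<in> Obj ShMulti_lr \<Longrightarrow> left_representable_pair (cat.truncate C) (Mul C) (gsub C) (ch C)
     (cat.truncate D) (Mul D) (gsub D) (ch D) short_ok"
  by (intro left_representable_pair.intro left_representable_ch)

lemma is_functor_K: "is_functor ShMulti_lr SkMon_ln (K_functor ch)"
proof (intro is_functor.intro is_functor_axioms.intro)
  show "category (ShMulti_lr :: (('o, 'm) shmulti, ('o, 'm) mmor) cat)"
    unfolding ShMulti_lr_def by (intro category_full_sub category_ShMulti)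
  show "category (SkMon_ln :: (('o, 'm) skmon, ('o, 'm) laxfun) cat)"
    unfolding SkMon_ln_def by (intro category_full_sub category_SkMon)
next
  fix C :: "('o, 'm) shmulti" assume C: "C \<in> Obj ShMulti_lr"
  interpret C: left_representable_pm "cat.truncate C" "Mul C" "gsub C" short_ok "ch C" by (rule left_representable_ch[OF C])
  have sC: "short_multicategory C" using C by (simp add: Obj_ShMulti_lr)
  show "fOb (K_functor ch) C \<in> Obj SkMon_ln"
    using C.skew_monoidal_A C.left_normal_A by (simp add: K_functor_def SkMon_ln_def full_sub_simps SkMon_def)
  show "fMap (K_functor ch) C C (Idm ShMulti_lr C) = Idm SkMon_ln (fOb (K_functor ch) C)"
    using lax_of_id[OF left_representable_ch[OF C]] short_mars[OF sC]
    by (simp add: K_functor_def ShMulti_lr_def SkMon_ln_def full_sub_simps ShMulti_def SkMon_def)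
next
  fix C D :: "('o, 'm) shmulti" and F assume C: "C \<in> Obj ShMulti_lr" and D: "D \<in> Obj ShMulti_lr" and F: "F \<in> Hom ShMulti_lr C D"
  have "short_morphism C D F" using F by (simp add: Hom_ShMulti_lr)
  then show "fMap (K_functor ch) C D F \<in> Hom SkMon_ln (fOb (K_functor ch) C) (fOb (K_functor ch) D)"
    using left_representable_morphism.lax_monoidal_L[OF left_representable_morphism.intro[OF left_representable_pair_ch[OF C D] pm_morphism_short]]
    by (simp add: K_functor_def SkMon_ln_def full_sub_simps SkMon_def)
next
  fix C D E :: "('o, 'm) shmulti" and F G assume o: "C \<in> Obj ShMulti_lr" "D \<in> Obj ShMulti_lr" "E \<in> Obj ShMulti_lr"
    and F: "F \<in> Hom ShMulti_lr C D" and G: "G \<in> Hom ShMulti_lr D E"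
  have FG: "short_morphism C D F" "short_morphism D E G" using F G by (simp_all add: Hom_ShMulti_lr)
  have sC: "short_multicategory C" using o by (simp add: Obj_ShMulti_lr)
  show "fMap (K_functor ch) C E (Cmp ShMulti_lr C D E G F) = Cmp SkMon_ln (fOb (K_functor ch) C) (fOb (K_functor ch) D)
     (fOb (K_functor ch) E) (fMap (K_functor ch) D E G) (fMap (K_functor ch) C D F)"
    using lax_of_comp[OF left_representable_ch[OF o(1)] left_representable_ch[OF o(2)] left_representable_ch[OF o(3)]
        pm_morphism_short[OF FG(1)] pm_morphism_short[OF FG(2)]] short_mars[OF sC]
    by (simp add: K_functor_def ShMulti_lr_def SkMon_ln_def full_sub_simps ShMulti_def SkMon_def)
qed

lemma fully_faithful_K: "fully_faithful ShMulti_lr SkMon_ln (K_functor ch)"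
  unfolding fully_faithful_def
proof (intro ballI bij_betw_imageI)
  fix C D :: "('o, 'm) shmulti" assume o: "C \<in> Obj ShMulti_lr" "D \<in> Obj ShMulti_lr"
  interpret left_representable_pair "cat.truncate C" "Mul C" "gsub C" "ch C" "cat.truncate D" "Mul D" "gsub D" "ch D" short_ok
    by (rule left_representable_pair_ch[OF o])
  have s: "short_multicategory C" "short_multicategory D" using o by (simp_all add: Obj_ShMulti_lr)
  show "inj_on (fMap (K_functor ch) C D) (Hom ShMulti_lr C D)"
    by (rule inj_onI) (auto simp: Hom_ShMulti_lr K_functor_def intro: lax_of_inj pm_morphism_short)
  show "fMap (K_functor ch) C D ` Hom ShMulti_lr C D = Hom SkMon_ln (fOb (K_functor ch) C) (fOb (K_functor ch) D)"
  proof (intro equalityI subsetI)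
    show "H \<in> Hom SkMon_ln (fOb (K_functor ch) C) (fOb (K_functor ch) D)" if "H \<in> fMap (K_functor ch) C D ` Hom ShMulti_lr C D" for H
      using that is_functor.functor_hom[OF is_functor_K o] by auto
    fix H assume "H \<in> Hom SkMon_ln (fOb (K_functor ch) C) (fOb (K_functor ch) D)"
    then have "lax_monoidal C.A D.A H" by (simp add: K_functor_def SkMon_ln_def full_sub_simps SkMon_def)
    then obtain F where "short_morphism C D F" "fMap (K_functor ch) C D F = H"
      using lax_of_surj[of H] short_morphism_pm[OF s] by (auto simp: K_functor_def)
    then show "H \<in> fMap (K_functor ch) C D ` Hom ShMulti_lr C D" by (auto simp: Hom_ShMulti_lr)
  qed
qed

text \<open>
  For the classifiers \<open>ten_classifiers\<close> the comparison is \<open>lam_functor\<close>; the chosen ones give an isomorphic skew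
  monoidal category.
\<close>

lemma K_multi_of:
  assumes A: "skew_monoidal A" and ln: "left_normal A"
  defines "C \<equiv> U_ob (skew_monoidal.multi_of A)"
  shows "C \<in> Obj ShMulti_lr" "\<exists>f. iso_map SkMon (fOb (K_functor ch) C) A f"
proof -
  interpret A: skew_monoidal A by (rule A)
  have sC: "short_multicategory C" unfolding C_def by (rule multicategory.short_U[OF A.multicategory_multi_of])
  have t: "left_classifiers C A.ten_classifiers" unfolding C_def by (rule A.left_classifiers_multi_of[OF ln])
  show C: "C \<in> Obj ShMulti_lr" using sC t by (auto simp: Obj_ShMulti_lr left_representable_def)
  let ?S = "skew_of (cat.truncate C) (gsub C)"
  note L = left_representable_short[OF sC t] and L' = left_representable_ch[OF C]
  obtain g where g: "iso_map SkMon (?S A.ten_classifiers) A g"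
    using iso_map_sym[OF A.lam_functor_iso[OF ln]] unfolding C_def by blast
  obtain f where f: "iso_map SkMon (?S (ch C)) (?S A.ten_classifiers) f"
    using skew_of_iso[OF L' L] by blast
  have "?S (ch C) \<in> Obj SkMon" "?S A.ten_classifiers \<in> Obj SkMon" "A \<in> Obj SkMon"
    using left_representable_pm.skew_monoidal_A[OF L] left_representable_pm.skew_monoidal_A[OF L'] A by (simp_all add: SkMon_def)
  then show "\<exists>f. iso_map SkMon (fOb (K_functor ch) C) A f"
    using iso_map_trans[OF category_SkMon _ _ _ f g] by (simp add: K_functor_def)
qed

lemma equivalence_K: "equivalence ShMulti_lr SkMon_ln (K_functor ch)"
proof (rule equivalence_if_fully_faithful_essentially_surjective[OF is_functor_K fully_faithful_K])
  show "essentially_surjective ShMulti_lr SkMon_ln (K_functor ch)"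
    unfolding essentially_surjective_def
  proof
    fix A :: "('o, 'm) skmon" assume "A \<in> Obj SkMon_ln"
    then have "skew_monoidal A" "left_normal A" by (simp_all add: SkMon_ln_def full_sub_simps SkMon_def)
    from K_multi_of[OF this] show "\<exists>C \<in> Obj ShMulti_lr. \<exists>f. iso_map SkMon_ln (fOb (K_functor ch) C) A f"
      by (auto simp: SkMon_ln_def iso_map_full_sub)
  qed
qed

lemma rep_cl_sub: "{C. representable C \<and> closed_short C} \<subseteq> {C. left_representable C}"
  "{A. monoidal A \<and> closed_skmon A} \<subseteq> {A. left_normal A}"
  by (auto simp: left_representable_if_representable monoidal_def left_normal_def)

lemma ShMulti_rep_cl_eq: "ShMulti_rep_cl = full_sub ShMulti_lr {C. representable C \<and> closed_short C}"
  unfolding ShMulti_rep_cl_def ShMulti_lr_def by (rule full_sub_sub[OF rep_cl_sub(1), symmetric])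

lemma Mon_cl_eq: "Mon_cl = full_sub SkMon_ln {A. monoidal A \<and> closed_skmon A}"
  unfolding Mon_cl_def SkMon_ln_def by (rule full_sub_sub[OF rep_cl_sub(2), symmetric])

lemma is_functor_K_cl: "is_functor ShMulti_rep_cl Mon_cl (K_functor ch)"
  unfolding ShMulti_rep_cl_eq Mon_cl_eq
  by (rule is_functor_full_sub[OF is_functor_K])
    (use ch in \<open>simp add: Obj_ShMulti_lr K_functor_def monoidal_closed_short\<close>)

lemma fully_faithful_K_cl: "fully_faithful ShMulti_rep_cl Mon_cl (K_functor ch)"
  unfolding ShMulti_rep_cl_eq Mon_cl_eq by (rule fully_faithful_full_sub[OF fully_faithful_K])

lemma is_functor_U_cl: "is_functor Multi_rep_cl ShMulti_rep_cl (U_functor :: (('o, 'm) multi, ('o, 'm) mmor, ('o, 'm) shmulti, ('o, 'm) mmor) func)"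
  unfolding Multi_rep_cl_def ShMulti_rep_cl_def
  by (rule is_functor_full_sub[OF is_functor_U]) (auto simp: U_functor_def Multi_def representable_U closed_U)

lemma K_multi_of_cl:
  assumes "A \<in> Obj Mon_cl"
  obtains M f where "M \<in> Obj Multi_rep_cl" "iso_map Mon_cl (fOb (K_functor ch) (U_ob M)) A f"
proof -
  have A: "skew_monoidal A" "monoidal A" "closed_skmon A" "left_normal A"
    using assms rep_cl_sub(2) by (auto simp: Mon_cl_def full_sub_simps SkMon_def)
  interpret A: skew_monoidal A by (rule A)
  have "A.multi_of \<in> Obj Multi_rep_cl"
    using A.multicategory_multi_of A.representable_multi_of A.closed_multi_of A by (simp add: Multi_rep_cl_def full_sub_simps Multi_def)
  then show ?thesis
    using K_multi_of(2)[OF A(1,4)] that by (auto simp: Mon_cl_def iso_map_full_sub)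
qed

lemma U_Obj: "(M :: ('o, 'm) multi) \<in> Obj Multi_rep_cl \<Longrightarrow> U_ob M \<in> Obj ShMulti_rep_cl"
  using is_functor.functor_obj[OF is_functor_U_cl] by (simp add: U_functor_def)

lemma equivalence_K_cl: "equivalence ShMulti_rep_cl Mon_cl (K_functor ch)"
proof (rule equivalence_if_fully_faithful_essentially_surjective[OF is_functor_K_cl fully_faithful_K_cl])
  show "essentially_surjective ShMulti_rep_cl Mon_cl (K_functor ch)"
    unfolding essentially_surjective_def using K_multi_of_cl U_Obj by metis
qed

lemma left_classifiers_U: "M \<in> Obj Multi_rep_cl \<Longrightarrow> left_classifiers (U_ob M) (ch (U_ob M))"
  using U_Obj ch by (simp add: ShMulti_rep_cl_eq full_sub_simps)

lemma T_eq: "func_eq Multi_rep_cl (T_functor ch) (func_comp (K_functor ch) U_functor)"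
  unfolding func_eq_def
proof (intro conjI ballI)
  have c: "multicategory M" "classifier_data (U_ob M) (ch (U_ob M))" if "M \<in> Obj Multi_rep_cl" for M
    using that left_classifiers_U[OF that] by (auto simp: Multi_rep_cl_def full_sub_simps Multi_def left_classifiers_def)
  show "fOb (T_functor ch) M = fOb (func_comp (K_functor ch) U_functor) M" if "M \<in> Obj Multi_rep_cl" for M
    using multicategory.skew_of_U[OF c[OF that]] by (simp add: T_functor_def K_functor_def func_comp_def U_functor_def)
  show "fMap (T_functor ch) M N F = fMap (func_comp (K_functor ch) U_functor) M N F"
    if "M \<in> Obj Multi_rep_cl" "N \<in> Obj Multi_rep_cl" "F \<in> Hom Multi_rep_cl M N" for M N F
    using lax_of_U[OF _ c(2)[OF that(1)] c(2)[OF that(2)], of F] that(3)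
    by (simp add: T_functor_def K_functor_def func_comp_def U_functor_def Multi_rep_cl_def full_sub_simps Multi_def)
qed

lemma is_functor_T: "is_functor Multi_rep_cl Mon_cl (T_functor ch)"
  by (rule is_functor_func_eq[OF is_functor_comp[OF is_functor_U_cl is_functor_K_cl] T_eq])

lemma fully_faithful_T: "fully_faithful Multi_rep_cl Mon_cl (T_functor ch)"
  unfolding fully_faithful_def
proof (intro ballI bij_betw_imageI)
  fix M N :: "('o, 'm) multi" assume o: "M \<in> Obj Multi_rep_cl" "N \<in> Obj Multi_rep_cl"
  then have m: "multicategory M" "representable_multi M" "multicategory N" "representable_multi N"
    by (simp_all add: Multi_rep_cl_def full_sub_simps Multi_def)
  interpret left_representable_pair "unary_cat M" "mHom M" "mSub M" "ch (U_ob M)" "unary_cat N" "mHom N" "mSub N" "ch (U_ob N)" "\<lambda>n m. True"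
    using m o left_classifiers_U by (intro left_representable_pair.intro left_representable_multi)
  have Hom: "F \<in> Hom Multi_rep_cl M N \<longleftrightarrow> multifunctor M N F" for F
    by (simp add: Multi_rep_cl_def full_sub_simps Multi_def)
  show "inj_on (fMap (T_functor ch) M N) (Hom Multi_rep_cl M N)"
    using lax_of_inj by (auto intro!: inj_onI simp: Hom T_functor_def pm_morphism_multifunctor)
  show "fMap (T_functor ch) M N ` Hom Multi_rep_cl M N = Hom Mon_cl (fOb (T_functor ch) M) (fOb (T_functor ch) N)"
  proof (intro equalityI subsetI)
    show "H \<in> Hom Mon_cl (fOb (T_functor ch) M) (fOb (T_functor ch) N)" if "H \<in> fMap (T_functor ch) M N ` Hom Multi_rep_cl M N" for H
      using that is_functor.functor_hom[OF is_functor_T o] by auto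
    fix H assume "H \<in> Hom Mon_cl (fOb (T_functor ch) M) (fOb (T_functor ch) N)"
    then have "lax_monoidal C.A D.A H" by (simp add: T_functor_def Mon_cl_def full_sub_simps SkMon_def)
    then obtain F where "multifunctor M N F" "fMap (T_functor ch) M N F = H"
      using lax_of_surj[of H] m by (auto simp: T_functor_def pm_morphism_multifunctor)
    then show "H \<in> fMap (T_functor ch) M N ` Hom Multi_rep_cl M N" using Hom by auto
  qed
qed

lemma equivalence_T: "equivalence Multi_rep_cl Mon_cl (T_functor ch)"
proof (rule equivalence_if_fully_faithful_essentially_surjective[OF is_functor_T fully_faithful_T])
  have "fOb (T_functor ch) M = fOb (K_functor ch) (U_ob M)" if "M \<in> Obj Multi_rep_cl" for M
    using T_eq that by (simp add: func_eq_def func_comp_def U_functor_def)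
  then show "essentially_surjective Multi_rep_cl Mon_cl (T_functor ch)"
    unfolding essentially_surjective_def using K_multi_of_cl by metis
qed

lemma equivalence_U:
  "equivalence Multi_rep_cl ShMulti_rep_cl (U_functor :: (('o, 'm) multi, ('o, 'm) mmor, ('o, 'm) shmulti, ('o, 'm) mmor) func)"
proof (rule equivalence_if_fully_faithful_essentially_surjective[OF is_functor_U_cl])
  show "fully_faithful Multi_rep_cl ShMulti_rep_cl (U_functor :: (('o, 'm) multi, ('o, 'm) mmor, ('o, 'm) shmulti, ('o, 'm) mmor) func)"
    by (rule fully_faithful_cancel[OF T_eq fully_faithful_T fully_faithful_K_cl is_functor_U_cl])
  show "essentially_surjective Multi_rep_cl ShMulti_rep_cl (U_functor :: (('o, 'm) multi, ('o, 'm) mmor, ('o, 'm) shmulti, ('o, 'm) mmor) func)"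
    unfolding essentially_surjective_def
  proof
    fix C :: "('o, 'm) shmulti" assume C: "C \<in> Obj ShMulti_rep_cl"
    obtain M f where M: "M \<in> Obj Multi_rep_cl" "iso_map Mon_cl (fOb (K_functor ch) (U_ob M)) (fOb (K_functor ch) C) f"
      using K_multi_of_cl is_functor.functor_obj[OF is_functor_K_cl C] by metis
    then have "\<exists>g. iso_map ShMulti_rep_cl (U_ob M) C g"
      using fully_faithful_reflects_iso[OF is_functor_K_cl fully_faithful_K_cl U_Obj C] by metis
    then show "\<exists>M \<in> Obj Multi_rep_cl. \<exists>g. iso_map ShMulti_rep_cl (fOb U_functor M) C g"
      using M(1) by (auto simp: U_functor_def)
  qed
qed

end

theorem theorem4p8:
  fixes ch :: "('o, 'm) shmulti \<Rightarrow> ('o, 'm) classifiers"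
  assumes "\<And>C. C \<in> Obj ShMulti_lr \<Longrightarrow> left_classifiers C (ch C)"
  shows "equivalence ShMulti_lr SkMon_ln (K_functor ch)
    \<and> full_subcategory ShMulti_rep_cl (ShMulti_lr :: (('o, 'm) shmulti, ('o, 'm) mmor) cat)
    \<and> full_subcategory Mon_cl (SkMon_ln :: (('o, 'm) skmon, ('o, 'm) laxfun) cat)
    \<and> equivalence ShMulti_rep_cl Mon_cl (K_functor ch)
    \<and> equivalence Multi_rep_cl ShMulti_rep_cl
        (U_functor :: (('o, 'm) multi, ('o, 'm) mmor, ('o, 'm) shmulti, ('o, 'm) mmor) func)
    \<and> equivalence Multi_rep_cl Mon_cl (T_functor ch)
    \<and> func_eq Multi_rep_cl (T_functor ch) (func_comp (K_functor ch) U_functor)"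
proof -
  interpret chosen_classifiers ch by unfold_locales (rule assms)
  have "full_subcategory ShMulti_rep_cl (ShMulti_lr :: (('o, 'm) shmulti, ('o, 'm) mmor) cat)"
    unfolding ShMulti_rep_cl_def ShMulti_lr_def by (rule full_subcategory_full_sub[OF rep_cl_sub(1)])
  moreover have "full_subcategory Mon_cl (SkMon_ln :: (('o, 'm) skmon, ('o, 'm) laxfun) cat)"
    unfolding Mon_cl_def SkMon_ln_def by (rule full_subcategory_full_sub[OF rep_cl_sub(2)])
  ultimately show ?thesis
    using equivalence_K equivalence_K_cl equivalence_U equivalence_T T_eq by blast
qed

end
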